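(* Let $\mathcal L$ be a $k$-local Lindblad generator on $n$ qubits with bounded weighted interaction strength $\alpha$. Fix a decision threshold $\lambda>0$ and a margin $0<\gamma<\lambda$, and let $D_-:=D_{\lambda-\gamma}$, $\rho_+:=\rho_{\lambda+\gamma}$. Assume $$D_-\rho_+\le\frac\gamma2 ,$$ and assume access to PTM estimates of accuracy $\varepsilon_L\le\gamma(2D_-)^{-1}$, i.e. numbers $\widehat L_{\mathbf A_S\otimes I_{\overline S},\mathbf B_S\otimes I_{\overline S}}$ within $\varepsilon_L$ of $L_{\mathbf A_S\otimes I_{\overline S},\mathbf B_S\otimes I_{\overline S}}$ for every nonempty $S\subseteq[n]$ with $|S|\le k$ and all $\mathbf A_S,\mathbf B_S\in\mathcal P_S$. Then the guarded sparse recovery algorithm, run with decision threshold $\lambda$, outputs a set $\widehat\Omega_\lambda\subseteq\mathcal I_k$ which is correct up to a $\gamma$-margin: for $(\mathbf P,\mathbf Q)\in\mathcal I_k^\circ$, $$|\chi_{\mathbf P,\mathbf Q}|>\lambda+\gamma\ \Longrightarrow\ (\mathbf P,\mathbf Q)\in\widehat\Omega_\lambda,\qquad |\chi_{\mathbf P,\mathbf Q}|<\lambda-\gamma\ \Longrightarrow\ (\mathbf P,\mathbf Q)\notin\widehat\Omega_\lambda .$$ The classical postprocessing time is $\mathcal O_k(n^k)$. Using the process-shadow derivative-estimation routine to obtain the required PTM estimates (with success probability at least $1-\delta$), the number of samples is $$\widetilde{\mathcal O}_k\Bigl(\frac{D_-^2}{\gamma^2}\log\frac n\delta\Bigr),$$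 where the hidden factors are polylogarithmic in $D_-/\gamma$ and $n$ and depend on $k$ and the bound on $\alpha$. In the exact threshold case (every coefficient outside $\Omega_{\lambda+\gamma}$ is zero) one has $\rho_+=0$, so the condition $D_-\rho_+\le\gamma/2$ is automatic. If, in addition, the diagonal-extension degree is bounded so that $D_-=\mathcal O_k(1)$, the number of samples becomes $\widetilde{\mathcal O}_k\bigl(\gamma^{-2}\log\frac n\delta\bigr)$.
   Context: Pauli notation. $\mathcal P_n=\{I,X,Y,Z\}^{\otimes n}$; $\operatorname{supp}(\mathbf P)$ is the set of qubits of nontrivial action, $\operatorname{wt}$ its size. For $S\subseteq[n]$, $\overline S=[n]\setminus S$, $\mathcal P_S$ is the set of Pauli strings on $S$, $\mathbf P_S$ the restriction of $\mathbf P$ to $S$. $X\bullet Y$ denotes $M\mapsto XMY$. Generator. A $k$-local Lindblad generator is $\mathcal L=\sum_{e\subseteq[n],|e|\le k}\mathcal L_e=-i[H,\bullet]+\sum_{e}\sum_{a}\bigl(L_{e,a}\bullet L_{e,a}^\dagger-\tfrac12\{L_{e,a}^\dagger L_{e,a},\bullet\}\bigr)$, with $H$ Hermitian, traceless, a combination of Pauli strings of weight $\le k$, $L_{e,a}$ traceless supported on $e$, and $\mathcal L_e$ the full contribution supported on $e$. $\alpha=\max_{u}\sum_{e\ni u}\|\mathcal L_e^\dagger\|_{2\to2}$ (norm induced by the Hilbert--Schmidt norm). PTM entries: $L_{\mathbf P,\mathbf Q}=2^{-n}\operatorname{Tr}(\mathbf P\mathcal L(\mathbf Q))$. $\chi$-coefficients: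 $\mathcal L=\sum_{\mathbf P,\mathbf Q}\chi_{\mathbf P,\mathbf Q}\mathbf P\bullet\mathbf Q$. Diagonal extensions. $\mathcal I_k=\{(\mathbf P,\mathbf Q):|\operatorname{supp}(\mathbf P)\cup\operatorname{supp}(\mathbf Q)|\le k\}$, $\mathcal I_k^\circ=\mathcal I_k\setminus\{(I,I)\}$. For $\tau>0$, $\Omega_\tau=\{(\mathbf P,\mathbf Q)\in\mathcal I_k^\circ:|\chi_{\mathbf P,\mathbf Q}|>\tau\}$; $\mathfrak d_\tau$ is the maximum over $S\subseteq[n]$, $\mathbf P_S,\mathbf Q_S\in\mathcal P_S$ of the number of $\mathbf A\in\mathcal P_{\overline S}\setminus\{I\}$ with $(\mathbf P_S\otimes\mathbf A,\mathbf Q_S\otimes\mathbf A)\in\Omega_\tau$; $D_\tau=\sum_{\ell=0}^k\mathfrak d_\tau^\ell$; $\rho_\tau$ is the maximum over $S,\mathbf P_S,\mathbf Q_S$ of $\sum|\chi_{\mathbf P_S\otimes\mathbf A,\mathbf Q_S\otimes\mathbf A}|$ over $\mathbf A\in\mathcal P_{\overline S}\setminus\{I\}$ with $(\mathbf P_S\otimes\mathbf A,\mathbf Q_S\otimes\mathbf A)\notin\Omega_\tau$. Guarded sparse recovery algorithm (threshold $\lambda$). For all nonempty $S$, $|S|\le k$, and $\mathbf P_S,\mathbf Q_S\in\mathcal P_S$, compute $\widehat\chi^{(S)}_{\mathbf P_S,\mathbf Q_S}=2^{-3|S|}\sum_{\mathbf A_S,\mathbf B_S\in\mathcal P_S}\widehat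 L_{\mathbf A_S\otimes I_{\overline S},\mathbf B_S\otimes I_{\overline S}}\operatorname{Tr}(\mathbf A_S\mathbf Q_S\mathbf B_S\mathbf P_S)$. Set $\widehat\Omega_\lambda=\varnothing$ and all registers $\mathsf R(S,\mathbf P_S,\mathbf Q_S)=0$. For $s=k,k-1,\dots,1$ and every $(\mathbf P,\mathbf Q)\in\mathcal I_k$ whose support union $S$ has size $s$: set $\widetilde\chi_{\mathbf P,\mathbf Q}=\widehat\chi^{(S)}_{\mathbf P_S,\mathbf Q_S}-\mathsf R(S,\mathbf P_S,\mathbf Q_S)$; if $|\widetilde\chi_{\mathbf P,\mathbf Q}|>\lambda$, add $(\mathbf P,\mathbf Q)$ to $\widehat\Omega_\lambda$, set $\widehat\chi_{\mathbf P,\mathbf Q}=\widetilde\chi_{\mathbf P,\mathbf Q}$, and for every $\varnothing\ne T\subsetneq S$ with $\mathbf P_{S\setminus T}=\mathbf Q_{S\setminus T}$ add $\widehat\chi_{\mathbf P,\mathbf Q}$ to $\mathsf R(T,\mathbf P_T,\mathbf Q_T)$. Return $\widehat\Omega_\lambda$ and the accepted estimates. Process-shadow derivative-estimation routine. One sample prepares a random product of single-qubit Pauli eigenstates, evolves it by $e^{t\mathcal L}$ with $t\in[0,T]$, $T=(4\alpha k)^{-1}$, and measures each qubit in a random Pauli basis; samples are independent. The overlaps $2^{-n}\operatorname{Tr}(\mathbf Pe^{t\mathcal L}(\mathbf Q))$ are estimated in parallel by median-of-means at $\mathcal O(d\log d)$ times $t$; a degree-$d$ polynomial in $t$ is fitted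 by robust polynomial regression, with $d$ logarithmic in the inverse precision; $\widehat L_{\mathbf P,\mathbf Q}$ is its derivative at $0$. *)

theory Defs
  imports "HOL-Probability.Probability" "Jordan_Normal_Form.Schur_Decomposition"
begin

section \<open>Operators and Pauli strings\<close>

definition mtrace :: "complex mat \<Rightarrow> complex" where
  "mtrace A = (\<Sum>i<dim_row A. A $$ (i, i))"

text \<open>JNF matrices carry their dimension as data, so \<open>sum\<close> is not available for them.\<close>

definition msum :: "nat \<Rightarrow> ('a \<Rightarrow> complex mat) \<Rightarrow> 'a set \<Rightarrow> complex mat" where
  "msum d f A = Matrix.mat d d (\<lambda>(i, j). \<Sum>x\<in>A. f x $$ (i, j))"

definition hs_norm :: "complex mat \<Rightarrow> real" where
  "hs_norm A = sqrt (Re (mtrace (mat_adjoint A * A)))"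

text \<open>\<open>M u\<close> is a \<open>2 \<times> 2\<close> matrix acting on qubit \<open>u\<close>; the result is the tensor product over the
  (distinct) qubits listed in \<open>us\<close>, binary digit \<open>r\<close> of a row or column index being the basis
  state of qubit \<open>us ! r\<close>.\<close>

definition tensor :: "nat list \<Rightarrow> (nat \<Rightarrow> complex mat) \<Rightarrow> complex mat" where
  "tensor us M = Matrix.mat (2 ^ length us) (2 ^ length us)
     (\<lambda>(i, j). \<Prod>r<length us. M (us ! r) $$ (i div 2 ^ r mod 2, j div 2 ^ r mod 2))"

datatype pauli = PI | PX | PY | PZ

fun sigma :: "pauli \<Rightarrow> complex mat" where
  "sigma PI = mat_of_rows_list 2 [[1, 0], [0, 1]]"
| "sigma PX = mat_of_rows_list 2 [[0, 1], [1, 0]]"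
| "sigma PY = mat_of_rows_list 2 [[0, - \<i>], [\<i>, 0]]"
| "sigma PZ = mat_of_rows_list 2 [[1, 0], [0, - 1]]"

text \<open>A Pauli string on \<open>S\<close> is a function equal to \<open>PI\<close> outside \<open>S\<close>, so that a string on \<open>S\<close>
  and its extension by the identity to a larger set of qubits are the same object.\<close>

type_synonym pstring = "nat \<Rightarrow> pauli"

abbreviation id_string :: pstring where
  "id_string \<equiv> (\<lambda>_. PI)"

definition supp :: "pstring \<Rightarrow> nat set" where
  "supp P = {u. P u \<noteq> PI}"

definition strings_on :: "nat set \<Rightarrow> pstring set" where
  "strings_on S = {P. supp P \<subseteq> S}"

definition restr :: "pstring \<Rightarrow> nat set \<Rightarrow> pstring" where
  "restr P S = (\<lambda>u. if u \<in> S then P u else PI)"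

definition glue :: "nat set \<Rightarrow> pstring \<Rightarrow> pstring \<Rightarrow> pstring" where
  "glue S P A = (\<lambda>u. if u \<in> S then P u else A u)"

definition pauli_mat :: "nat list \<Rightarrow> pstring \<Rightarrow> complex mat" where
  "pauli_mat us P = tensor us (\<lambda>u. sigma (P u))"

abbreviation pauli_op :: "nat \<Rightarrow> pstring \<Rightarrow> complex mat" where
  "pauli_op n P \<equiv> pauli_mat [0..<n] P"

definition pauli_span :: "nat \<Rightarrow> pstring set \<Rightarrow> complex mat set" where
  "pauli_span n A = {msum (2 ^ n) (\<lambda>P. c P \<cdot>\<^sub>m pauli_op n P) A | c. True}"

section \<open>Superoperators\<close>

type_synonym superop = "complex mat \<Rightarrow> complex mat"

text \<open>The adjoint for the Hilbert--Schmidt product \<open>Tr (A\<^sup>\<dagger> B)\<close>: its entry \<open>(i, j)\<close> at \<open>A\<close> is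
  \<open>Tr (E\<^sub>i\<^sub>j\<^sup>\<dagger> \<Phi>\<^sup>\<dagger>(A)) = Tr (\<Phi>(E\<^sub>i\<^sub>j)\<^sup>\<dagger> A)\<close> with \<open>E\<^sub>i\<^sub>j\<close> the matrix units.\<close>

definition hs_adjoint :: "nat \<Rightarrow> superop \<Rightarrow> superop" where
  "hs_adjoint d \<Phi> A = Matrix.mat d d (\<lambda>(i, j).
     mtrace (mat_adjoint (\<Phi> (Matrix.mat d d (\<lambda>ab. if ab = (i, j) then 1 else 0))) * A))"

definition norm_2_2 :: "nat \<Rightarrow> superop \<Rightarrow> real" where
  "norm_2_2 d \<Phi> = (SUP A\<in>{A \<in> carrier_mat d d. hs_norm A \<le> 1}. hs_norm (\<Phi> A))"

definition exp_superop :: "nat \<Rightarrow> real \<Rightarrow> superop \<Rightarrow> superop" where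
  "exp_superop d t \<Phi> A = Matrix.mat d d (\<lambda>(i, j).
     \<Sum>m. complex_of_real (t ^ m / fact m) * ((\<Phi> ^^ m) A) $$ (i, j))"

definition ptm :: "nat \<Rightarrow> superop \<Rightarrow> pstring \<Rightarrow> pstring \<Rightarrow> complex" where
  "ptm n \<Phi> P Q = mtrace (pauli_op n P * \<Phi> (pauli_op n Q)) / 2 ^ n"

definition chi_coeffs :: "nat \<Rightarrow> superop \<Rightarrow> (pstring \<Rightarrow> pstring \<Rightarrow> complex) \<Rightarrow> bool" where
  "chi_coeffs n \<Phi> chi \<longleftrightarrow>
     (\<forall>M\<in>carrier_mat (2 ^ n) (2 ^ n).
        \<Phi> M = msum (2 ^ n) (\<lambda>(P, Q). chi P Q \<cdot>\<^sub>m (pauli_op n P * M * pauli_op n Q))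
                (strings_on {..<n} \<times> strings_on {..<n}))"

section \<open>Local Lindblad generators\<close>

text \<open>\<open>jumps G e\<close> lists the operators \<open>L\<^bsub>e,a\<^esub>\<close>; only sets \<open>e\<close> of at most \<open>k\<close> qubits
  are used.\<close>

record lindblad =
  ham :: "complex mat"
  jumps :: "nat set \<Rightarrow> complex mat list"

definition regions :: "nat \<Rightarrow> nat \<Rightarrow> nat set set" where
  "regions n k = {e. e \<subseteq> {..<n} \<and> card e \<le> k}"

definition k_local :: "nat \<Rightarrow> nat \<Rightarrow> lindblad \<Rightarrow> bool" where
  "k_local n k G \<longleftrightarrow>
     mat_adjoint (ham G) = ham G \<and> mtrace (ham G) = 0 \<and>
     ham G \<in> pauli_span n {P \<in> strings_on {..<n}. card (supp P) \<le> k} \<and>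
     (\<forall>e\<in>regions n k. \<forall>L\<in>set (jumps G e). L \<in> pauli_span n (strings_on e) \<and> mtrace L = 0)"

definition ham_part :: "complex mat \<Rightarrow> superop" where
  "ham_part H M = (- \<i>) \<cdot>\<^sub>m (H * M - M * H)"

definition dissipator :: "complex mat \<Rightarrow> superop" where
  "dissipator L M = L * M * mat_adjoint L
     - (1 / 2) \<cdot>\<^sub>m (mat_adjoint L * L * M + M * (mat_adjoint L * L))"

definition jump_part :: "nat \<Rightarrow> lindblad \<Rightarrow> nat set \<Rightarrow> superop" where
  "jump_part n G e M = msum (2 ^ n) (\<lambda>a. dissipator (jumps G e ! a) M) {..<length (jumps G e)}"

definition lindbladian :: "nat \<Rightarrow> nat \<Rightarrow> lindblad \<Rightarrow> superop" where
  "lindbladian n k G M = ham_part (ham G) M + msum (2 ^ n) (\<lambda>e. jump_part n G e M) (regions n k)"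

text \<open>The part of the Hamiltonian assigned to \<open>e\<close> collects the Pauli terms with support
  exactly \<open>e\<close>, so every term is assigned once.\<close>

definition ham_on :: "nat \<Rightarrow> lindblad \<Rightarrow> nat set \<Rightarrow> complex mat" where
  "ham_on n G e = msum (2 ^ n)
     (\<lambda>P. (mtrace (pauli_op n P * ham G) / 2 ^ n) \<cdot>\<^sub>m pauli_op n P) {P. supp P = e}"

definition local_term :: "nat \<Rightarrow> lindblad \<Rightarrow> nat set \<Rightarrow> superop" where
  "local_term n G e M = ham_part (ham_on n G e) M + jump_part n G e M"

definition interaction_strength :: "nat \<Rightarrow> nat \<Rightarrow> lindblad \<Rightarrow> real" where
  "interaction_strength n k G =
     Max ((\<lambda>u. \<Sum>e | e \<in> regions n k \<and> u \<in> e.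
             norm_2_2 (2 ^ n) (hs_adjoint (2 ^ n) (local_term n G e))) ` {..<n})"

section \<open>Diagonal extensions\<close>

definition pairs :: "nat \<Rightarrow> nat \<Rightarrow> (pstring \<times> pstring) set" where
  "pairs n k = {(P, Q). P \<in> strings_on {..<n} \<and> Q \<in> strings_on {..<n} \<and>
     card (supp P \<union> supp Q) \<le> k}"

definition pairs0 :: "nat \<Rightarrow> nat \<Rightarrow> (pstring \<times> pstring) set" where
  "pairs0 n k = pairs n k - {(id_string, id_string)}"

definition large_pairs ::
    "nat \<Rightarrow> nat \<Rightarrow> (pstring \<Rightarrow> pstring \<Rightarrow> complex) \<Rightarrow> real \<Rightarrow> (pstring \<times> pstring) set" where
  "large_pairs n k chi \<tau> = {(P, Q) \<in> pairs0 n k. cmod (chi P Q) > \<tau>}"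

definition local_triples :: "nat \<Rightarrow> (nat set \<times> pstring \<times> pstring) set" where
  "local_triples n = (SIGMA S:Pow {..<n}. strings_on S \<times> strings_on S)"

definition extensions :: "nat \<Rightarrow> nat set \<Rightarrow> pstring set" where
  "extensions n S = strings_on ({..<n} - S) - {id_string}"

definition diag_degree ::
    "nat \<Rightarrow> nat \<Rightarrow> (pstring \<Rightarrow> pstring \<Rightarrow> complex) \<Rightarrow> real \<Rightarrow> nat" where
  "diag_degree n k chi \<tau> = Max ((\<lambda>(S, P, Q).
     card {A \<in> extensions n S. (glue S P A, glue S Q A) \<in> large_pairs n k chi \<tau>}) ` local_triples n)"

definition diag_D :: "nat \<Rightarrow> nat \<Rightarrow> (pstring \<Rightarrow> pstring \<Rightarrow> complex) \<Rightarrow> real \<Rightarrow> nat" where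
  "diag_D n k chi \<tau> = (\<Sum>l\<le>k. diag_degree n k chi \<tau> ^ l)"

definition diag_rho ::
    "nat \<Rightarrow> nat \<Rightarrow> (pstring \<Rightarrow> pstring \<Rightarrow> complex) \<Rightarrow> real \<Rightarrow> real" where
  "diag_rho n k chi \<tau> = Max ((\<lambda>(S, P, Q).
     \<Sum>A | A \<in> extensions n S \<and> (glue S P A, glue S Q A) \<notin> large_pairs n k chi \<tau>.
       cmod (chi (glue S P A) (glue S Q A))) ` local_triples n)"

text \<open>The matrix \<open>A\<^sub>S \<otimes> I\<close> on all qubits is represented by the string \<open>A\<^sub>S\<close> itself.\<close>

definition ptm_accurate ::
    "nat \<Rightarrow> nat \<Rightarrow> superop \<Rightarrow> (pstring \<Rightarrow> pstring \<Rightarrow> complex) \<Rightarrow> real \<Rightarrow> bool" where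
  "ptm_accurate n k \<Phi> Lhat \<epsilon> \<longleftrightarrow>
     (\<forall>S\<in>regions n k - {{}}. \<forall>A\<in>strings_on S. \<forall>B\<in>strings_on S.
        cmod (Lhat A B - ptm n \<Phi> A B) \<le> \<epsilon>)"

section \<open>Programs with an operation count\<close>

text \<open>A command returns the new state and the number of elementary operations spent.
  Elementary operations are one arithmetic operation or comparison on numbers, one table access,
  and one step on a single letter of a Pauli string or a single element of a set of
  at most \<open>k\<close> qubits.\<close>

type_synonym 's cmd = "'s \<Rightarrow> 's \<times> nat"

definition ops :: "nat \<Rightarrow> ('s \<Rightarrow> 's) \<Rightarrow> 's cmd" where
  "ops c f = (\<lambda>\<sigma>. (f \<sigma>, c))"

definition sequ :: "'s cmd \<Rightarrow> 's cmd \<Rightarrow> 's cmd" (infixr ";;" 60) where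
  "(p ;; q) = (\<lambda>\<sigma>. let (\<sigma>1, c1) = p \<sigma>; (\<sigma>2, c2) = q \<sigma>1 in (\<sigma>2, c1 + c2))"

text \<open>Evaluating the guard costs \<open>c\<close>.\<close>

definition whenever :: "nat \<Rightarrow> ('s \<Rightarrow> bool) \<Rightarrow> 's cmd \<Rightarrow> 's cmd" where
  "whenever c b p = (\<lambda>\<sigma>. (ops c id ;; (if b \<sigma> then p else ops 0 id)) \<sigma>)"

text \<open>Advancing the loop variable costs \<open>w\<close>.\<close>

fun for_each :: "nat \<Rightarrow> 'a list \<Rightarrow> ('a \<Rightarrow> 's cmd) \<Rightarrow> 's cmd" where
  "for_each w [] body = ops 1 id"
| "for_each w (x # xs) body = ops w id ;; body x ;; for_each w xs body"

section \<open>Guarded sparse recovery\<close>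

text \<open>The \<open>s\<close>-element subsets of \<open>{0..<n}\<close> as increasing lists, enumerated so that
  the successor of a subset is found in at most \<open>s + 1\<close> steps.\<close>

fun combs :: "nat \<Rightarrow> nat \<Rightarrow> nat list list" where
  "combs n 0 = [[]]"
| "combs 0 (Suc s) = []"
| "combs (Suc n) (Suc s) = combs n (Suc s) @ map (\<lambda>c. c @ [n]) (combs n s)"

fun string_list :: "nat list \<Rightarrow> pstring list" where
  "string_list [] = [id_string]"
| "string_list (u # us) = concat (map (\<lambda>a. map (\<lambda>P. P(u := a)) (string_list us)) [PI, PX, PY, PZ])"

record store =
  loc :: "nat set \<Rightarrow> pstring \<Rightarrow> pstring \<Rightarrow> complex"
  reg :: "nat set \<Rightarrow> pstring \<Rightarrow> pstring \<Rightarrow> complex"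
  cand :: complex
  accepted :: "(pstring \<times> pstring) set"
  est :: "pstring \<Rightarrow> pstring \<Rightarrow> complex"

definition set_entry ::
    "nat set \<Rightarrow> pstring \<Rightarrow> pstring \<Rightarrow> complex \<Rightarrow> (nat set \<Rightarrow> pstring \<Rightarrow> pstring \<Rightarrow> complex)
      \<Rightarrow> (nat set \<Rightarrow> pstring \<Rightarrow> pstring \<Rightarrow> complex)" where
  "set_entry S P Q z f = f(S := (f S)(P := (f S P)(Q := z)))"

text \<open>\<open>loc \<sigma> S P Q\<close> receives \<open>2\<^bsup>-3|S|\<^esup> \<Sum>\<^sub>A\<^sub>,\<^sub>B Lhat A B Tr (A Q B P)\<close>, the trace being over
  the qubits in \<open>S\<close> only.  The trace factorizes over these qubits: \<open>4|S|\<close> letters are read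
  and \<open>|S|\<close> tabulated one-qubit traces are looked up and multiplied.\<close>

definition local_coeff_step ::
    "(pstring \<Rightarrow> pstring \<Rightarrow> complex) \<Rightarrow> nat list \<Rightarrow> pstring \<Rightarrow> pstring \<Rightarrow> store cmd" where
  "local_coeff_step Lhat S P Q =
     ops (8 * length S + 2) (\<lambda>\<sigma>. \<sigma>\<lparr>loc := set_entry (set S) P Q 0 (loc \<sigma>),
                                 reg := set_entry (set S) P Q 0 (reg \<sigma>)\<rparr>) ;;
     for_each (length S) (string_list S) (\<lambda>A.
       for_each (length S) (string_list S) (\<lambda>B.
         ops (12 * length S + 4) (\<lambda>\<sigma>. \<sigma>\<lparr>loc := set_entry (set S) P Q
           (loc \<sigma> (set S) P Q + Lhat A B *
              mtrace (pauli_mat S A * pauli_mat S Q * pauli_mat S B * pauli_mat S P)) (loc \<sigma>)\<rparr>))) ;;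
     ops (9 * length S + 3) (\<lambda>\<sigma>. \<sigma>\<lparr>loc := set_entry (set S) P Q
           (loc \<sigma> (set S) P Q / 2 ^ (3 * length S)) (loc \<sigma>)\<rparr>)"

definition guarded_step :: "real \<Rightarrow> nat list \<Rightarrow> pstring \<Rightarrow> pstring \<Rightarrow> store cmd" where
  "guarded_step lam S P Q =
     whenever (3 * length S) (\<lambda>_. supp P \<union> supp Q = set S)
      (ops (6 * length S + 3) (\<lambda>\<sigma>. \<sigma>\<lparr>cand := loc \<sigma> (set S) P Q - reg \<sigma> (set S) P Q\<rparr>) ;;
       whenever 2 (\<lambda>\<sigma>. cmod (cand \<sigma>) > lam)
        (ops (4 * length S + 2) (\<lambda>\<sigma>. \<sigma>\<lparr>accepted := insert (P, Q) (accepted \<sigma>),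
                                    est := (est \<sigma>)(P := (est \<sigma> P)(Q := cand \<sigma>))\<rparr>) ;;
         for_each (length S + 1) (List.subseqs S) (\<lambda>T.
           whenever (5 * length S + 2)
             (\<lambda>_. T \<noteq> [] \<and> T \<noteq> S \<and> restr P (set S - set T) = restr Q (set S - set T))
             (ops (8 * length S + 3) (\<lambda>\<sigma>. \<sigma>\<lparr>reg := set_entry (set T) (restr P (set T)) (restr Q (set T))
               (reg \<sigma> (set T) (restr P (set T)) (restr Q (set T)) + est \<sigma> P Q) (reg \<sigma>)\<rparr>)))))"

definition guarded_recovery ::
    "nat \<Rightarrow> nat \<Rightarrow> (pstring \<Rightarrow> pstring \<Rightarrow> complex) \<Rightarrow> real \<Rightarrow> store cmd" where
  "guarded_recovery n k Lhat lam =
     ops 1 (\<lambda>\<sigma>. \<sigma>\<lparr>accepted := {}\<rparr>) ;;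
     for_each 1 [1..<Suc k] (\<lambda>s.
       for_each (s + 1) (combs n s) (\<lambda>S.
         for_each s (string_list S) (\<lambda>P.
           for_each s (string_list S) (\<lambda>Q. local_coeff_step Lhat S P Q)))) ;;
     for_each 1 (rev [1..<Suc k]) (\<lambda>s.
       for_each (s + 1) (combs n s) (\<lambda>S.
         for_each s (string_list S) (\<lambda>P.
           for_each s (string_list S) (\<lambda>Q. guarded_step lam S P Q))))"

text \<open>The initial contents of the store do not influence the result: everything that is read
  has been written before.\<close>

definition initial_store :: store where
  "initial_store = \<lparr>loc = (\<lambda>_ _ _. 0), reg = (\<lambda>_ _ _. 0), cand = 0, accepted = {}, est = (\<lambda>_ _. 0)\<rparr>"

definition recovered_set ::
    "nat \<Rightarrow> nat \<Rightarrow> (pstring \<Rightarrow> pstring \<Rightarrow> complex) \<Rightarrow> real \<Rightarrow> (pstring \<times> pstring) set" where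
  "recovered_set n k Lhat lam = accepted (fst (guarded_recovery n k Lhat lam initial_store))"

definition recovery_time ::
    "nat \<Rightarrow> nat \<Rightarrow> (pstring \<Rightarrow> pstring \<Rightarrow> complex) \<Rightarrow> real \<Rightarrow> nat" where
  "recovery_time n k Lhat lam = snd (guarded_recovery n k Lhat lam initial_store)"

section \<open>Process shadows\<close>

text \<open>One sample records the preparation bases \<open>W\<close>, the set \<open>s\<close> of qubits prepared in the
  eigenvalue \<open>-1\<close> state, the measurement bases \<open>V\<close>, and the set \<open>b\<close> of qubits with
  outcome \<open>-1\<close>.\<close>

type_synonym shot = "pstring \<times> nat set \<times> pstring \<times> nat set"

definition bases :: "nat \<Rightarrow> pstring set" where
  "bases n = {W. supp W = {..<n}}"

definition pm :: "nat set \<Rightarrow> nat \<Rightarrow> real" where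
  "pm s u = (if u \<in> s then - 1 else 1)"

definition eigenstate :: "nat \<Rightarrow> pstring \<Rightarrow> nat set \<Rightarrow> complex mat" where
  "eigenstate n W s = tensor [0..<n]
     (\<lambda>u. (1 / 2) \<cdot>\<^sub>m (sigma PI + complex_of_real (pm s u) \<cdot>\<^sub>m sigma (W u)))"

text \<open>Uniform choice of \<open>W\<close>, \<open>s\<close> and \<open>V\<close>, and the Born rule for \<open>b\<close> after evolution for
  time \<open>t\<close>.\<close>

definition shot_measure :: "nat \<Rightarrow> superop \<Rightarrow> real \<Rightarrow> shot measure" where
  "shot_measure n \<Phi> t = point_measure (bases n \<times> Pow {..<n} \<times> bases n \<times> Pow {..<n})
     (\<lambda>(W, s, V, b). ennreal (1 / (3 ^ n * 2 ^ n * 3 ^ n) *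
        Re (mtrace (eigenstate n V b * exp_superop (2 ^ n) t \<Phi> (eigenstate n W s)))))"

text \<open>An unbiased estimate of \<open>2\<^bsup>-n\<^esup> Tr (P e\<^bsup>t\<Phi>\<^esup>(Q))\<close>: since the states with \<open>W u = Q u\<close> average, with
  weight \<open>3 pm s u\<close>, to \<open>Q u / 2\<close>, and to \<open>I / 2\<close> on qubits where \<open>Q u\<close> is trivial.\<close>

definition side_estimate :: "pstring \<Rightarrow> pstring \<Rightarrow> nat set \<Rightarrow> real" where
  "side_estimate P V b = (if \<forall>u\<in>supp P. V u = P u then 3 ^ card (supp P) * (\<Prod>u\<in>supp P. pm b u) else 0)"

definition shot_estimate :: "pstring \<Rightarrow> pstring \<Rightarrow> shot \<Rightarrow> real" where
  "shot_estimate P Q = (\<lambda>(W, s, V, b). side_estimate Q W s * side_estimate P V b)"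

definition median :: "real list \<Rightarrow> real" where
  "median xs = sort xs ! (length xs div 2)"

definition median_of_means :: "nat \<Rightarrow> nat \<Rightarrow> (nat \<Rightarrow> real) \<Rightarrow> real" where
  "median_of_means K B z =
     median (map (\<lambda>\<kappa>. (\<Sum>l<B. z (\<kappa> * B + l)) / real B) [0..<K])"

section \<open>Robust polynomial regression\<close>

text \<open>The evaluation points are the \<open>m * q\<close> Chebyshev nodes of \<open>[0, T]\<close>, which put \<open>q\<close> points
  into each cell of the Chebyshev partition of \<open>[0, T]\<close> into \<open>m\<close> cells.  The regression is that of
  Kane, Karmalkar and Price: a cell-weighted \<open>\<ell>\<^sub>1\<close> fit, followed by rounds of refinement, each
  of which replaces the residuals in a cell by their median and corrects the fit by an
  \<open>\<ell>\<^sub>\<infinity>\<close> regression on these medians.\<close>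

definition cheb_node :: "real \<Rightarrow> nat \<Rightarrow> nat \<Rightarrow> real" where
  "cheb_node T J j = T / 2 * (1 - cos (pi * (2 * real j + 1) / (2 * real J)))"

definition cell_width :: "real \<Rightarrow> nat \<Rightarrow> nat \<Rightarrow> real" where
  "cell_width T m i = T / 2 * (cos (pi * real i / real m) - cos (pi * (real i + 1) / real m))"

definition l1_fit :: "real \<Rightarrow> nat \<Rightarrow> nat \<Rightarrow> nat \<Rightarrow> (nat \<Rightarrow> real) \<Rightarrow> real poly" where
  "l1_fit T d m q y = arg_min
     (\<lambda>p. \<Sum>i<m. cell_width T m i *
        ((\<Sum>l<q. \<bar>y (i * q + l) - poly p (cheb_node T (m * q) (i * q + l))\<bar>) / real q))
     (\<lambda>p. degree p \<le> d)"

definition refine_fit ::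
    "real \<Rightarrow> nat \<Rightarrow> nat \<Rightarrow> nat \<Rightarrow> (nat \<Rightarrow> real) \<Rightarrow> real poly \<Rightarrow> real poly" where
  "refine_fit T d m q y p = p + arg_min
     (\<lambda>r. MAX i\<in>{..<m}. \<bar>poly r (cheb_node T m i) -
        median (map (\<lambda>l. y (i * q + l) - poly p (cheb_node T (m * q) (i * q + l))) [0..<q])\<bar>)
     (\<lambda>r. degree r \<le> d)"

definition robust_fit :: "real \<Rightarrow> nat \<Rightarrow> nat \<Rightarrow> nat \<Rightarrow> (nat \<Rightarrow> real) \<Rightarrow> real poly" where
  "robust_fit T d m q y = (refine_fit T d m q y ^^ nat \<lceil>log 2 (real d)\<rceil>) (l1_fit T d m q y)"

section \<open>The derivative-estimation routine\<close>

record design =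
  deg :: nat
  cells :: nat
  per_cell :: nat
  batches :: nat
  batch_size :: nat

definition num_times :: "design \<Rightarrow> nat" where
  "num_times R = cells R * per_cell R"

definition num_samples :: "design \<Rightarrow> nat" where
  "num_samples R = num_times R * (batches R * batch_size R)"

text \<open>The data assign to \<open>(j, r)\<close> the \<open>r\<close>-th shot at the \<open>j\<close>-th evolution time.\<close>

definition data_measure :: "nat \<Rightarrow> superop \<Rightarrow> real \<Rightarrow> design \<Rightarrow> (nat \<times> nat \<Rightarrow> shot) measure" where
  "data_measure n \<Phi> T R = PiM ({..<num_times R} \<times> {..<batches R * batch_size R})
     (\<lambda>(j, r). shot_measure n \<Phi> (cheb_node T (num_times R) j))"

definition derivative_estimate ::
    "real \<Rightarrow> design \<Rightarrow> (nat \<times> nat \<Rightarrow> shot) \<Rightarrow> pstring \<Rightarrow> pstring \<Rightarrow> real" where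
  "derivative_estimate T R x P Q = poly (pderiv (robust_fit T (deg R) (cells R) (per_cell R)
     (\<lambda>j. median_of_means (batches R) (batch_size R) (\<lambda>r. shot_estimate P Q (x (j, r)))))) 0"

text \<open>The probability that all required PTM estimates are accurate to \<open>\<epsilon>\<close>, where \<open>a\<close> is the
  interaction strength used to set the time window.\<close>

definition success_prob :: "nat \<Rightarrow> nat \<Rightarrow> superop \<Rightarrow> real \<Rightarrow> design \<Rightarrow> real \<Rightarrow> real" where
  "success_prob n k \<Phi> a R \<epsilon> =
     (let T = 1 / (4 * a * real k); M = data_measure n \<Phi> T R
      in measure M {x \<in> space M. ptm_accurate n k \<Phi>
           (\<lambda>A B. complex_of_real (derivative_estimate T R x A B)) \<epsilon>})"

section \<open>Standing assumptions and asymptotic notation\<close>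

definition generator_setting ::
    "nat \<Rightarrow> nat \<Rightarrow> lindblad \<Rightarrow> (pstring \<Rightarrow> pstring \<Rightarrow> complex) \<Rightarrow> real \<Rightarrow> real \<Rightarrow> bool" where
  "generator_setting n k G chi lam \<gamma> \<longleftrightarrow>
     1 \<le> n \<and> k_local n k G \<and> chi_coeffs n (lindbladian n k G) chi \<and> 0 < \<gamma> \<and> \<gamma> < lam"

definition exact_threshold ::
    "nat \<Rightarrow> nat \<Rightarrow> (pstring \<Rightarrow> pstring \<Rightarrow> complex) \<Rightarrow> real \<Rightarrow> bool" where
  "exact_threshold n k chi \<tau> \<longleftrightarrow> (\<forall>(P, Q)\<in>pairs0 n k - large_pairs n k chi \<tau>. chi P Q = 0)"

definition margin_condition ::
    "nat \<Rightarrow> nat \<Rightarrow> (pstring \<Rightarrow> pstring \<Rightarrow> complex) \<Rightarrow> real \<Rightarrow> real \<Rightarrow> bool" where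
  "margin_condition n k chi lam \<gamma> \<longleftrightarrow>
     real (diag_D n k chi (lam - \<gamma>)) * diag_rho n k chi (lam + \<gamma>) \<le> \<gamma> / 2"

text \<open>\<open>a\<close> is the strength used by the routine, \<open>amax\<close> the bound on which constants may depend.\<close>

definition routine_setting ::
    "nat \<Rightarrow> nat \<Rightarrow> lindblad \<Rightarrow> real \<Rightarrow> real \<Rightarrow> real \<Rightarrow> bool" where
  "routine_setting n k G a amax \<delta> \<longleftrightarrow>
     interaction_strength n k G \<le> a \<and> 0 < a \<and> a \<le> amax \<and> 0 < \<delta> \<and> \<delta> < 1"

text \<open>Logarithms inside asymptotic bounds are read as being at least \<open>1\<close>.\<close>

definition lg :: "real \<Rightarrow> real" where
  "lg x = max 1 (ln x)"

end

theory Submission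
  imports Defs
begin

text \<open>Summing the coefficients over all diagonal extensions of a restricted pair gives a local coefficient,
  which is a linear function of the transfer matrix entries. In decreasing order of the support size,
  the accepted extensions have been subtracted when a pair is visited. The remaining error is the
  estimation error \<open>\<epsilon>\<close>, plus the mass \<open>\<rho>\<close> of rejected extensions, plus the errors of the at most
  \<open>d\<close> accepted ones. Hence it is at most \<open>(\<epsilon> + \<rho>) (1 + d + \<dots> + d\<^sup>k) \<le> \<gamma>\<close>.

  For the sampling bound, the semigroup is positive, so a shot is a random variable, and after
  rescaling its product with the input signs is an unbiased bounded estimate of the overlaps. In the
  Heisenberg picture the support of a local observable grows by \<open>k\<close> per application of the generator.
  This bounds the \<open>m\<close>-th Taylor coefficient of an overlap by \<open>(a k)\<^sup>m\<close>, so interpolation at logarithmically many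
  Chebyshev nodes recovers its derivative, and Hoeffding's inequality bounds the number of shots.\<close>

section \<open>Polynomial regression at Chebyshev nodes\<close>

text \<open>The kernel that inverts the transfer matrix has total absolute weight
  \<open>8 ^ length us\<close>, which the prefactor \<open>2 ^ (3 * length us)\<close> cancels
  exactly, so the accuracy \<epsilon> of single entries passes to local coefficients without loss.
  The two thresholds play different roles: as long as errors stay within \<gamma>, accepted pairs
  exceed \<open>lam - \<gamma>\<close>, which bounds their number by the degree at that level, and
  rejected pairs stay at or below \<open>lam + \<gamma>\<close>, which bounds their mass by \<rho>
  at that level. Error bound and decisions depend on each other and have to be carried in one
  invariant. Supports grow strictly under diagonal extension, so the error recursion has depth at
  most \<open>k\<close>. Growth of supports produces a factorial in the derivatives of an overlap,
  which the exponential series removes; the window \<open>1 / (4 * a * real k)\<close> then leaves a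
  geometric series of ratio 1/4. Interpolation amplifies nodal errors by only
  \<open>4 * real d ^ 3 / T\<close>, so a logarithmic degree makes truncation harmless. The routine
  is run with one node per cell and one batch, where the regression is plain interpolation and the
  median is a mean.\<close>

fun cheb :: "nat \<Rightarrow> real poly" where
  "cheb 0 = 1"
| "cheb (Suc 0) = [:0, 1:]"
| "cheb (Suc (Suc n)) = [:0, 2:] * cheb (Suc n) - cheb n"

lemma poly_cheb_cos: "poly (cheb n) (cos x) = cos (real n * x)"
proof (induction n rule: cheb.induct)
  case (3 n)
  have "cos (real (Suc (Suc n)) * x) + cos (real n * x) = 2 * cos x * cos (real (Suc n) * x)"
    by (simp add: cos_plus_cos algebra_simps add_divide_distrib)
  then show ?case using 3 by simp
qed simp_all

lemma degree_cheb: "degree (cheb n) \<le> n"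
proof (induction n rule: cheb.induct)
  case (3 n)
  have "degree ([:0, 2:] * cheb (Suc n)) \<le> Suc (Suc n)"
    using degree_mult_le[of "[:0, 2:]" "cheb (Suc n)"] 3(1) by simp
  then show ?case unfolding cheb.simps using 3(2) by (intro degree_diff_le) auto
qed simp_all

lemma poly_cheb_1: "poly (cheb n) 1 = 1"
  using poly_cheb_cos[of n 0] by simp

text \<open>Differentiating the recurrence at 1, where all these polynomials equal 1, gives
  \<open>a (n + 2) = 2 + 2 * a (n + 1) - a n\<close>, which is solved by squares. The value is the
  weight of the \<open>n\<close>-th Chebyshev coefficient in a derivative at the endpoint.\<close>

lemma pderiv_cheb_1: "poly (pderiv (cheb n)) 1 = (real n)\<^sup>2"
proof (induction n rule: cheb.induct)
  case (3 n)
  then show ?case using poly_cheb_1[of "Suc n"]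
    by (simp add: pderiv_diff pderiv_mult pderiv_pCons pderiv_smult power2_eq_square algebra_simps)
qed (simp_all add: pderiv_pCons)

text \<open>The kernel \<open>1 + 2 \<Sum> cos (i x)\<close> at \<open>x = m \<pi> / J\<close> depends only on the parity of \<open>m\<close>.\<close>

lemma dirichlet_kernel:
  "sin (x / 2) * (1 + 2 * (\<Sum>i\<in>{1..<Suc d}. cos (real i * x))) = sin ((real d + 1 / 2) * x)"
proof (induction d)
  case (Suc d)
  have "2 * sin (x / 2) * cos (real (Suc d) * x)
      = sin ((real (Suc d) + 1 / 2) * x) - sin ((real d + 1 / 2) * x)"
    by (simp add: sin_diff_sin algebra_simps add_divide_distrib diff_divide_distrib)
  then show ?case using Suc by (simp add: algebra_simps)
qed simp

text \<open>On the grid, \<open>(real (J - 1) + 1 / 2) * x\<close> is \<open>m * pi - x / 2\<close>,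
  whose sine is \<open>sin (x / 2)\<close> up to the sign \<open>- ((- 1) ^ m)\<close>. The
  hypothesis allows that sine to be cancelled.\<close>

lemma dirichlet_kernel_grid:
  assumes "0 < J" "sin (real m * pi / (2 * real J)) \<noteq> 0"
  shows "1 + 2 * (\<Sum>i\<in>{1..<J}. cos (real i * (real m * pi / real J))) = - ((- 1) ^ m)"
proof -
  let ?x = "real m * pi / real J"
  have "(real (J - 1) + 1 / 2) * ?x = real m * pi - ?x / 2"
    using assms(1) by (simp add: field_simps of_nat_diff)
  then have "sin (?x / 2) * (1 + 2 * (\<Sum>i\<in>{1..<J}. cos (real i * ?x))) = - ((- 1) ^ m) * sin (?x / 2)"
    using dirichlet_kernel[of ?x "J - 1"] assms(1) by (simp add: sin_diff mult.commute[of _ pi])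
  moreover have "sin (?x / 2) \<noteq> 0" using assms(2) by (simp add: mult.commute)
  ultimately have "sin (?x / 2) * (1 + 2 * (\<Sum>i\<in>{1..<J}. cos (real i * ?x)))
      = sin (?x / 2) * - ((- 1) ^ m)" by (simp only: mult_ac)
  then show ?thesis using \<open>sin (?x / 2) \<noteq> 0\<close> by (simp only: mult_cancel_left) simp
qed

section \<open>Interpolation at Chebyshev nodes and its stability at the endpoint\<close>

definition cheb_angle :: "nat \<Rightarrow> nat \<Rightarrow> real" where
  "cheb_angle J j = pi * (2 * real j + 1) / (2 * real J)"

lemma cheb_angle_bounds: "j < J \<Longrightarrow> 0 < cheb_angle J j \<and> cheb_angle J j < pi"
proof -
  assume "j < J"
  then have "2 * real j + 1 < 2 * real J" by linarith
  then have "pi * (2 * real j + 1) < pi * (2 * real J)" by (intro mult_strict_left_mono) auto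
  then show ?thesis using \<open>j < J\<close> by (simp add: cheb_angle_def add_pos_nonneg field_simps)
qed

text \<open>The product of cosines splits into cosines of the sum and the difference of the two
  angles, which are grid angles with indices \<open>j + l + 1\<close> and \<open>j - l\<close>.
  These have opposite parity, so the two kernels cancel, except on the diagonal, where the second
  angle is 0.\<close>

lemma discrete_orthogonality:
  assumes "j < J" "l < J"
  shows "1 + 2 * (\<Sum>i\<in>{1..<J}. cos (real i * cheb_angle J j) * cos (real i * cheb_angle J l))
    = (if j = l then real J else 0)"
proof -
  have J: "0 < J" using assms by simp
  \<comment> \<open>The symmetric case distinction \<open>l \<le> j\<close> makes the natural-number
    difference \<open>j - l\<close> a genuine one.\<close>
  have *: "1 + 2 * (\<Sum>i\<in>{1..<J}. cos (real i * cheb_angle J j) * cos (real i * cheb_angle J l))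
    = (if j = l then real J else 0)" if "j < J" "l \<le> j" for j l
  proof -
    define A where "A = (\<Sum>i\<in>{1..<J}. cos (real i * (real (j + l + 1) * pi / real J)))"
    define B where "B = (\<Sum>i\<in>{1..<J}. cos (real i * (real (j - l) * pi / real J)))"
    have "2 * cos (real i * cheb_angle J j) * cos (real i * cheb_angle J l)
      = cos (real i * (real (j + l + 1) * pi / real J)) + cos (real i * (real (j - l) * pi / real J))"
      for i
    proof -
      have "real i * cheb_angle J j - real i * cheb_angle J l = real i * (real (j - l) * pi / real J)"
        "real i * cheb_angle J j + real i * cheb_angle J l = real i * (real (j + l + 1) * pi / real J)"
        using that J by (simp_all add: cheb_angle_def of_nat_diff field_simps)
      then show ?thesis
        using cos_times_cos[of "real i * cheb_angle J j" "real i * cheb_angle J l"] by (simp add: field_simps)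
    qed
    then have lhs: "2 * (\<Sum>i\<in>{1..<J}. cos (real i * cheb_angle J j) * cos (real i * cheb_angle J l)) = A + B"
      unfolding A_def B_def sum_distrib_left sum.distrib[symmetric]
      by (intro sum.cong) (auto simp: mult.assoc)
    have bd: "0 < real m * pi / (2 * real J) \<and> real m * pi / (2 * real J) < pi"
      if "0 < m" "m < 2 * J" for m
    proof -
      have "real m * pi < real (2 * J) * pi" using that by (intro mult_strict_right_mono) auto
      then show ?thesis using that J by (simp add: field_simps)
    qed
    have "0 < real (j + l + 1) * pi / (2 * real J)" "real (j + l + 1) * pi / (2 * real J) < pi"
      using that bd[of "j + l + 1"] by auto
    then have "sin (real (j + l + 1) * pi / (2 * real J)) \<noteq> 0"
      using sin_gt_zero by (metis less_irrefl)
    from dirichlet_kernel_grid[OF J this] have A: "1 + 2 * A = - ((- 1) ^ (j + l + 1))" by (simp add: A_def)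
    show ?thesis
    proof (cases "j = l")
      case True
      then have "(- 1 :: real) ^ (j + l + 1) = - 1" by simp
      then have "A = 0" using A by simp
      moreover have "B = real J - 1" unfolding B_def using True J by (simp add: of_nat_diff)
      ultimately show ?thesis unfolding if_P[OF True] using lhs by linarith
    next
      case False
      have "0 < real (j - l) * pi / (2 * real J)" "real (j - l) * pi / (2 * real J) < pi"
        using that False bd[of "j - l"] by auto
      then have "sin (real (j - l) * pi / (2 * real J)) \<noteq> 0"
        using sin_gt_zero by (metis less_irrefl)
      from dirichlet_kernel_grid[OF J this] have "1 + 2 * B = - ((- 1) ^ (j - l))" by (simp add: B_def)
      moreover have "(- 1 :: real) ^ (j + l + 1) = - ((- 1) ^ (j - l))"
      proof -
        obtain m where "j = l + m" using le_Suc_ex[OF \<open>l \<le> j\<close>] by blast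
        moreover have "(- 1 :: real) ^ l * (- 1) ^ l = 1" by (simp flip: power_mult_distrib)
        ultimately show ?thesis by (simp add: power_add)
      qed
      ultimately have "A + B = - 1" using A by simp
      then show ?thesis unfolding if_not_P[OF False] using lhs by linarith
    qed
  qed
  show ?thesis
  proof (cases "l \<le> j")
    case True then show ?thesis using *[of j l] assms by simp
  next
    case False
    then show ?thesis using *[of l j] assms by (simp add: mult.commute)
  qed
qed

text \<open>The affine substitution sends 0 to 1 and \<open>T\<close> to -1. The endpoint at which
  the derivative is wanted thus becomes the point where value and derivative of the Chebyshev
  polynomials are known.\<close>

definition shifted_cheb :: "real \<Rightarrow> nat \<Rightarrow> real poly" where
  "shifted_cheb T i = pcompose (cheb i) [:1, - 2 / T:]"

lemma degree_shifted_cheb: "degree (shifted_cheb T i) \<le> i"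
proof -
  have "degree (shifted_cheb T i) \<le> degree (cheb i) * degree [:1, - 2 / T:]"
    unfolding shifted_cheb_def by (rule degree_pcompose_le)
  also have "\<dots> \<le> degree (cheb i) * 1" by (intro mult_left_mono) auto
  finally show ?thesis using degree_cheb[of i] by simp
qed

lemma poly_shifted_cheb_node:
  "0 < T \<Longrightarrow> poly (shifted_cheb T i) (cheb_node T J j) = cos (real i * cheb_angle J j)"
  using poly_cheb_cos[of i "cheb_angle J j"]
  by (simp add: shifted_cheb_def poly_pcompose cheb_node_def cheb_angle_def algebra_simps)

lemma pderiv_shifted_cheb_0: "poly (pderiv (shifted_cheb T i)) 0 = - 2 / T * (real i)\<^sup>2"
  by (simp add: shifted_cheb_def pderiv_pcompose poly_pcompose pderiv_cheb_1 pderiv_pCons)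

text \<open>The discrete cosine transform of the data; the weights 1 and 2 over \<open>J\<close>
  match the normalisation in the discrete orthogonality relation.\<close>

definition cheb_coeff :: "nat \<Rightarrow> (nat \<Rightarrow> real) \<Rightarrow> nat \<Rightarrow> real" where
  "cheb_coeff J y i = (if i = 0 then 1 else 2) / real J * (\<Sum>j<J. y j * cos (real i * cheb_angle J j))"

definition cheb_interp :: "real \<Rightarrow> nat \<Rightarrow> (nat \<Rightarrow> real) \<Rightarrow> real poly" where
  "cheb_interp T J y = (\<Sum>i<J. Polynomial.smult (cheb_coeff J y i) (shifted_cheb T i))"

lemma degree_cheb_interp: "degree (cheb_interp T (Suc d) y) \<le> d"
  unfolding cheb_interp_def
proof (rule degree_sum_le)
  fix i assume "i \<in> {..<Suc d}"
  then show "degree (Polynomial.smult (cheb_coeff (Suc d) y i) (shifted_cheb T i)) \<le> d"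
    using degree_smult_le[of "cheb_coeff (Suc d) y i" "shifted_cheb T i"] degree_shifted_cheb[of T i]
    by simp
qed simp

text \<open>After exchanging the two sums, the inner one is the orthogonality kernel, which acts as
  \<open>J\<close> times a Kronecker delta.\<close>

lemma poly_cheb_interp_node:
  assumes "0 < T" "l < J"
  shows "poly (cheb_interp T J y) (cheb_node T J l) = y l"
proof -
  let ?c = "\<lambda>i j. cos (real i * cheb_angle J j)"
  have J: "{..<J} = insert 0 {1..<J}" using assms(2) by auto
  have "poly (cheb_interp T J y) (cheb_node T J l)
      = (\<Sum>i<J. (if i = 0 then 1 else 2) / real J * (\<Sum>j<J. y j * ?c i j) * ?c i l)"
    by (simp add: cheb_interp_def poly_sum poly_shifted_cheb_node[OF assms(1)] cheb_coeff_def)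
  also have "\<dots> = (\<Sum>i<J. \<Sum>j<J. y j / real J * ((if i = 0 then 1 else 2) * ?c i j * ?c i l))"
    unfolding sum_distrib_left sum_distrib_right by (intro sum.cong refl) simp
  also have "\<dots> = (\<Sum>j<J. y j / real J * (\<Sum>i<J. (if i = 0 then 1 else 2) * ?c i j * ?c i l))"
    unfolding sum_distrib_left by (rule sum.swap)
  also have "\<dots> = (\<Sum>j<J. y j / real J * (if j = l then real J else 0))"
  proof (intro sum.cong refl arg_cong2[where f="(*)"])
    fix j assume "j \<in> {..<J}"
    have "(\<Sum>i<J. (if i = 0 then 1 else 2) * ?c i j * ?c i l) = 1 + 2 * (\<Sum>i\<in>{1..<J}. ?c i j * ?c i l)"
      unfolding J sum_distrib_left by (subst sum.insert) (auto intro!: sum.cong)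
    then show "(\<Sum>i<J. (if i = 0 then 1 else 2) * ?c i j * ?c i l) = (if j = l then real J else 0)"
      using discrete_orthogonality[of j J l] \<open>j \<in> {..<J}\<close> assms(2) by simp
  qed
  also have "\<dots> = (\<Sum>j<J. if j = l then y j else 0)"
    using assms(2) by (intro sum.cong) auto
  finally show ?thesis using assms(2) by simp
qed

lemma abs_cheb_coeff_le:
  assumes "\<And>j. j < J \<Longrightarrow> \<bar>y j\<bar> \<le> \<eta>" "0 < J"
  shows "\<bar>cheb_coeff J y i\<bar> \<le> 2 * \<eta>"
proof -
  have "\<bar>\<Sum>j<J. y j * cos (real i * cheb_angle J j)\<bar> \<le> (\<Sum>j<J. \<eta>)"
  proof (rule order_trans[OF sum_abs], rule sum_mono)
    fix j assume "j \<in> {..<J}"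
    then have "\<bar>y j\<bar> * \<bar>cos (real i * cheb_angle J j)\<bar> \<le> \<eta> * 1"
      using assms(1)[of j] by (intro mult_mono) auto
    then show "\<bar>y j * cos (real i * cheb_angle J j)\<bar> \<le> \<eta>" by (simp add: abs_mult)
  qed
  then have s: "\<bar>\<Sum>j<J. y j * cos (real i * cheb_angle J j)\<bar> \<le> real J * \<eta>" by simp
  have "0 \<le> \<eta>" using assms(1)[of 0] assms(2) by (meson abs_ge_zero order_trans)
  have "\<bar>cheb_coeff J y i\<bar> = (if i = 0 then 1 else 2) / real J * \<bar>\<Sum>j<J. y j * cos (real i * cheb_angle J j)\<bar>"
    by (simp add: cheb_coeff_def abs_mult)
  also have "\<dots> \<le> 2 / real J * (real J * \<eta>)"
    using s assms(2) \<open>0 \<le> \<eta>\<close> by (intro mult_mono) (auto simp: divide_right_mono)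
  finally show ?thesis using assms(2) by simp
qed

lemma cheb_node_inj:
  assumes "0 < T"
  shows "inj_on (cheb_node T J) {..<J}"
proof (rule inj_onI)
  fix i j assume "i \<in> {..<J}" "j \<in> {..<J}" "cheb_node T J i = cheb_node T J j"
  then have "cos (cheb_angle J i) = cos (cheb_angle J j)" "0 < J"
    using assms by (auto simp: cheb_node_def cheb_angle_def)
  then have "cheb_angle J i = cheb_angle J j"
    using cheb_angle_bounds[of i J] cheb_angle_bounds[of j J] \<open>i \<in> _\<close> \<open>j \<in> _\<close>
      cos_inj_pi[of "cheb_angle J i" "cheb_angle J j"] by auto
  then show "i = j" using \<open>0 < J\<close> by (simp add: cheb_angle_def)
qed

lemma cheb_node_bounds:
  assumes "0 < T"
  shows "0 \<le> cheb_node T J j" "cheb_node T J j \<le> T"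
proof -
  have "T / 2 * (1 - cos x) \<le> T / 2 * 2" for x
    using assms cos_ge_minus_one[of x] by (intro mult_left_mono) linarith+
  then show "cheb_node T J j \<le> T" by (simp add: cheb_node_def)
qed (use assms in \<open>simp add: cheb_node_def\<close>)

lemma poly_eq_at_nodes:
  assumes "0 < T" "degree p \<le> d" "degree q \<le> d"
    and "\<And>j. j < Suc d \<Longrightarrow> poly p (cheb_node T (Suc d) j) = poly q (cheb_node T (Suc d) j)"
  shows "p = q"
proof (rule poly_eqI_degree)
  show "poly p x = poly q x" if "x \<in> cheb_node T (Suc d) ` {..<Suc d}" for x
    using that assms(4) by auto
qed (use assms in \<open>simp_all add: card_image[OF cheb_node_inj]\<close>)

text \<open>A Markov-type inequality at the endpoint from nodal values only. \<open>q\<close> is its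
  own interpolant, its Chebyshev coefficients are at most \<open>2 * \<eta>\<close>, and the
  \<open>i\<close>-th basis polynomial has slope \<open>- 2 / T * i\<^sup>2\<close> at 0; there are
  \<open>d\<close> terms, each at most the last slope times \<open>2 * \<eta>\<close>.\<close>

lemma abs_pderiv_0_le:
  assumes "0 < T" "degree q \<le> d" "\<And>j. j < Suc d \<Longrightarrow> \<bar>poly q (cheb_node T (Suc d) j)\<bar> \<le> \<eta>"
  shows "\<bar>poly (pderiv q) 0\<bar> \<le> 4 * real d ^ 3 * \<eta> / T"
proof -
  define y where "y j = poly q (cheb_node T (Suc d) j)" for j
  have q: "q = cheb_interp T (Suc d) y"
  proof (rule poly_eq_at_nodes[OF assms(1,2) degree_cheb_interp])
    show "poly q (cheb_node T (Suc d) j) = poly (cheb_interp T (Suc d) y) (cheb_node T (Suc d) j)"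
      if "j < Suc d" for j
      unfolding poly_cheb_interp_node[OF assms(1) that] y_def ..
  qed
  have \<eta>: "0 \<le> \<eta>" using order_trans[OF abs_ge_zero assms(3)[of 0]] by simp
  have c: "\<bar>cheb_coeff (Suc d) y i\<bar> \<le> 2 * \<eta>" for i
    by (rule abs_cheb_coeff_le[OF _ zero_less_Suc]) (simp only: y_def assms(3))
  have "poly (pderiv q) 0 = (\<Sum>i<Suc d. cheb_coeff (Suc d) y i * (- 2 / T * (real i)\<^sup>2))"
    by (subst q) (simp add: cheb_interp_def pderiv_sum pderiv_smult poly_sum pderiv_shifted_cheb_0
        del: sum.lessThan_Suc)
  also have "\<dots> = (\<Sum>i\<in>{1..<Suc d}. cheb_coeff (Suc d) y i * (- 2 / T * (real i)\<^sup>2))"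
    by (rule sum.mono_neutral_right) auto
  finally have "\<bar>poly (pderiv q) 0\<bar> \<le> (\<Sum>i\<in>{1..<Suc d}. \<bar>cheb_coeff (Suc d) y i * (- 2 / T * (real i)\<^sup>2)\<bar>)"
    by (metis sum_abs)
  also have "\<dots> \<le> (\<Sum>i\<in>{1..<Suc d}. 2 * \<eta> * (2 / T * (real d)\<^sup>2))"
  proof (rule sum_mono)
    fix i assume "i \<in> {1..<Suc d}"
    then have "\<bar>cheb_coeff (Suc d) y i\<bar> * (2 / T * (real i)\<^sup>2) \<le> 2 * \<eta> * (2 / T * (real d)\<^sup>2)"
      using assms(1) c[of i] \<eta> by (intro mult_mono power_mono) auto
    then show "\<bar>cheb_coeff (Suc d) y i * (- 2 / T * (real i)\<^sup>2)\<bar> \<le> 2 * \<eta> * (2 / T * (real d)\<^sup>2)"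
      using assms(1) by (simp add: abs_mult)
  qed
  also have "\<dots> = 4 * real d ^ 3 * \<eta> / T" by (simp add: power3_eq_cube power2_eq_square)
  finally show ?thesis .
qed

section \<open>The robust regression with one node per cell\<close>

text \<open>\<open>arg_min\<close> is a choice and says something only if a minimiser exists. Here a
  zero of the nonnegative objective is one, and every minimiser must then be a zero as well.\<close>

lemma arg_min_zero:
  fixes f :: "'a \<Rightarrow> real"
  assumes "\<And>x. P x \<Longrightarrow> 0 \<le> f x" "P x0" "f x0 = 0"
  shows "P (arg_min f P)" "f (arg_min f P) = 0"
proof -
  have "is_arg_min f P x0" using assms by (force simp: is_arg_min_def)
  then have "is_arg_min f P (arg_min f P)" unfolding arg_min_def by (rule someI)
  then show "P (arg_min f P)" "f (arg_min f P) = 0"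
    using assms by (force simp: is_arg_min_def)+
qed

lemma cell_width_pos:
  assumes "0 < T" "i < m"
  shows "0 < cell_width T m i"
proof -
  have "pi * (real i + 1) \<le> pi * real m" using assms by (intro mult_left_mono) auto
  then have "pi * (real i + 1) / real m \<le> pi" using assms by (simp add: field_simps)
  then have "cos (pi * (real i + 1) / real m) < cos (pi * real i / real m)"
    using assms by (intro cos_monotone_0_pi) (auto simp: field_simps)
  then show ?thesis using assms by (simp add: cell_width_def)
qed

text \<open>The interpolant has loss 0, so the chosen minimiser has loss 0; since all cell widths
  are positive, each residual must vanish.\<close>

lemma poly_l1_fit_node:
  assumes "0 < T"
  shows "degree (l1_fit T d (Suc d) 1 y) \<le> d"
    and "j < Suc d \<Longrightarrow> poly (l1_fit T d (Suc d) 1 y) (cheb_node T (Suc d) j) = y j"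
proof -
  let ?f = "\<lambda>p. \<Sum>i<Suc d. cell_width T (Suc d) i *
        ((\<Sum>l<1. \<bar>y (i * 1 + l) - poly p (cheb_node T (Suc d * 1) (i * 1 + l))\<bar>) / real 1)"
  have pos: "0 \<le> ?f p" for p
    using cell_width_pos[OF assms] by (intro sum_nonneg mult_nonneg_nonneg) (auto intro: less_imp_le)
  have "?f (cheb_interp T (Suc d) y) = 0"
    by (intro sum.neutral) (auto simp: poly_cheb_interp_node[OF assms])
  note am = arg_min_zero[of "\<lambda>p. degree p \<le> d" ?f, OF pos degree_cheb_interp this]
  show "degree (l1_fit T d (Suc d) 1 y) \<le> d" using am(1) by (simp only: l1_fit_def)
  assume j: "j < Suc d"
  have "?f (l1_fit T d (Suc d) 1 y) = 0" using am(2) by (simp only: l1_fit_def)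
  moreover have "0 \<le> cell_width T (Suc d) i * ((\<Sum>l<1. \<bar>y (i * 1 + l) -
      poly (l1_fit T d (Suc d) 1 y) (cheb_node T (Suc d * 1) (i * 1 + l))\<bar>) / real 1)"
    if "i \<in> {..<Suc d}" for i
    using cell_width_pos[OF assms, of i "Suc d"] that
    by (intro mult_nonneg_nonneg divide_nonneg_nonneg sum_nonneg) auto
  ultimately have "cell_width T (Suc d) j * ((\<Sum>l<1. \<bar>y (j * 1 + l) -
      poly (l1_fit T d (Suc d) 1 y) (cheb_node T (Suc d * 1) (j * 1 + l))\<bar>) / real 1) = 0"
    using j by (subst (asm) sum_nonneg_eq_0_iff) (blast | simp)+
  then show "poly (l1_fit T d (Suc d) 1 y) (cheb_node T (Suc d) j) = y j"
    using cell_width_pos[OF assms j] by simp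
qed

text \<open>With one node per cell, the node representing a cell and its data point coincide, and
  the median of one residual is that residual, here 0. The correction therefore minimises the
  largest nodal value; 0 attains 0, and a polynomial of degree at most \<open>d\<close> that
  vanishes at \<open>d + 1\<close> nodes is 0.\<close>

lemma refine_fit_eq:
  assumes "0 < T" "\<And>j. j < Suc d \<Longrightarrow> poly p (cheb_node T (Suc d) j) = y j"
  shows "refine_fit T d (Suc d) 1 y p = p"
proof -
  let ?f = "\<lambda>r. MAX i\<in>{..<Suc d}. \<bar>poly r (cheb_node T (Suc d) i) -
        median (map (\<lambda>l. y (i * 1 + l) - poly p (cheb_node T (Suc d * 1) (i * 1 + l))) [0..<1])\<bar>"
  have f: "?f = (\<lambda>r. MAX i\<in>{..<Suc d}. \<bar>poly r (cheb_node T (Suc d) i)\<bar>)"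
  proof (rule ext, rule arg_cong[where f = Max], rule image_cong[OF refl])
    fix r i assume "i \<in> {..<Suc d}"
    then show "\<bar>poly r (cheb_node T (Suc d) i) -
        median (map (\<lambda>l. y (i * 1 + l) - poly p (cheb_node T (Suc d * 1) (i * 1 + l))) [0..<1])\<bar>
      = \<bar>poly r (cheb_node T (Suc d) i)\<bar>"
      using assms(2)[of i] by (simp add: median_def)
  qed
  have ge: "\<bar>poly r (cheb_node T (Suc d) i)\<bar> \<le> ?f r" if "i < Suc d" for r i
    unfolding fun_cong[OF f, of r]
    by (rule Max_ge[OF finite_imageI[OF finite_lessThan]], rule imageI, rule lessThan_iff[THEN iffD2, OF that])
  have pos: "0 \<le> ?f r" for r using ge[of 0 r] by linarith
  have "?f 0 = 0"
  proof -
    have "(\<lambda>i. \<bar>poly (0 :: real poly) (cheb_node T (Suc d) i)\<bar>) ` {..<Suc d} = {0}" by auto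
    then show ?thesis unfolding fun_cong[OF f, of 0] by (simp only: Max_singleton)
  qed
  have "degree (0 :: real poly) \<le> d" by simp
  note am = arg_min_zero[of "\<lambda>p. degree p \<le> d" ?f, OF pos this \<open>?f 0 = 0\<close>]
  have "arg_min ?f (\<lambda>p. degree p \<le> d) = 0"
  proof (rule poly_eq_at_nodes[OF assms(1)])
    show "degree (arg_min ?f (\<lambda>p. degree p \<le> d)) \<le> d" by (rule am(1))
    show "poly (arg_min ?f (\<lambda>p. degree p \<le> d)) (cheb_node T (Suc d) j) = poly 0 (cheb_node T (Suc d) j)"
      if "j < Suc d" for j
      using ge[OF that, of "arg_min ?f (\<lambda>p. degree p \<le> d)"] unfolding am(2) by simp
  qed simp
  then show ?thesis unfolding refine_fit_def by (simp only: add_0_right)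
qed

text \<open>With \<open>d + 1\<close> nodes the regression degenerates to interpolation.\<close>

lemma poly_robust_fit_node:
  assumes "0 < T"
  shows "degree (robust_fit T d (Suc d) 1 y) \<le> d"
    and "j < Suc d \<Longrightarrow> poly (robust_fit T d (Suc d) 1 y) (cheb_node T (Suc d) j) = y j"
proof -
  have fix1: "refine_fit T d (Suc d) 1 y (l1_fit T d (Suc d) 1 y) = l1_fit T d (Suc d) 1 y"
    by (rule refine_fit_eq[OF assms]) (rule poly_l1_fit_node[OF assms])
  have "(refine_fit T d (Suc d) 1 y ^^ m) (l1_fit T d (Suc d) 1 y) = l1_fit T d (Suc d) 1 y" for m
    by (induction m) (simp_all only: funpow.simps id_apply o_apply fix1)
  then have eq: "robust_fit T d (Suc d) 1 y = l1_fit T d (Suc d) 1 y"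
    by (simp only: robust_fit_def)
  show "degree (robust_fit T d (Suc d) 1 y) \<le> d"
    unfolding eq by (rule poly_l1_fit_node(1)[OF assms])
  show "poly (robust_fit T d (Suc d) 1 y) (cheb_node T (Suc d) j) = y j" if "j < Suc d"
    unfolding eq by (rule poly_l1_fit_node(2)[OF assms that])
qed

lemma robust_fit_pderiv_error:
  assumes "0 < T" "degree p \<le> d" "\<And>j. j < Suc d \<Longrightarrow> \<bar>y j - poly p (cheb_node T (Suc d) j)\<bar> \<le> \<eta>"
  shows "\<bar>poly (pderiv (robust_fit T d (Suc d) 1 y)) 0 - poly (pderiv p) 0\<bar> \<le> 4 * real d ^ 3 * \<eta> / T"
proof -
  have "\<bar>poly (pderiv (robust_fit T d (Suc d) 1 y - p)) 0\<bar> \<le> 4 * real d ^ 3 * \<eta> / T"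
  proof (rule abs_pderiv_0_le[OF assms(1)])
    show "degree (robust_fit T d (Suc d) 1 y - p) \<le> d"
      by (intro degree_diff_le poly_robust_fit_node assms)
    show "\<bar>poly (robust_fit T d (Suc d) 1 y - p) (cheb_node T (Suc d) j)\<bar> \<le> \<eta>" if "j < Suc d" for j
      using assms(3)[OF that] poly_robust_fit_node(2)[OF assms(1) that] by simp
  qed
  then show ?thesis by (simp add: pderiv_diff)
qed

section \<open>Running time\<close>

text \<open>The bound is uniform in the store, so costs of consecutive commands add up without any
  knowledge of the intermediate state.\<close>

definition time_le :: "'s cmd \<Rightarrow> nat \<Rightarrow> bool" where
  "time_le p c \<longleftrightarrow> (\<forall>\<sigma>. snd (p \<sigma>) \<le> c)"

lemma time_le_mono: "time_le p a \<Longrightarrow> a \<le> b \<Longrightarrow> time_le p b"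
  unfolding time_le_def using order_trans by blast

lemma time_le_ops: "a \<le> c \<Longrightarrow> time_le (ops a f) c"
  by (simp add: time_le_def ops_def)

lemma time_le_sequ: "time_le p a \<Longrightarrow> time_le q b \<Longrightarrow> time_le (p ;; q) (a + b)"
  by (auto simp: time_le_def sequ_def split: prod.splits) (metis add_mono snd_conv)

lemma time_le_whenever:
  assumes "time_le p a" "c \<le> c'"
  shows "time_le (whenever c b p) (c' + a)"
  using assms by (auto simp: time_le_def whenever_def sequ_def ops_def split: prod.splits)
    (metis add_mono snd_conv)

text \<open>The final \<open>+ 1\<close> pays for leaving the loop.\<close>

lemma time_le_for_each:
  assumes "\<And>x. x \<in> set xs \<Longrightarrow> time_le (body x) c" "length xs \<le> L" "w \<le> W"
  shows "time_le (for_each w xs body) (L * (W + c) + 1)"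
proof -
  have "time_le (for_each w xs body) (length xs * (W + c) + 1)" using assms(1)
  proof (induction xs)
    case Nil
    then show ?case by (simp add: time_le_ops)
  next
    case (Cons x xs)
    have "time_le (for_each w (x # xs) body) (W + (c + (length xs * (W + c) + 1)))"
      unfolding for_each.simps using Cons assms(3)
      by (intro time_le_sequ) (auto intro: time_le_ops)
    then show ?case by (simp add: algebra_simps)
  qed
  then show ?thesis using assms(2) by (elim time_le_mono) simp
qed

lemma length_string_list: "length (string_list us) = 4 ^ length us"
  by (induction us) auto

lemma length_combs: "length (combs n s) \<le> n ^ s"
proof (induction n s rule: combs.induct)
  case (3 n s)
  have "n * n ^ s + n ^ s \<le> Suc n * Suc n ^ s"
    using mult_le_mono2[OF power_mono[of n "Suc n" s], of "Suc n"] by simp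
  then show ?case using 3 by simp
qed simp_all

lemma length_of_combs: "S \<in> set (combs n s) \<Longrightarrow> length S = s"
  by (induction n s arbitrary: S rule: combs.induct) auto

lemma time_le_local_coeff_step:
  assumes "length S \<le> k"
  shows "time_le (local_coeff_step Lhat S P Q)
    ((8 * k + 2) + ((4 ^ k * (k + (4 ^ k * (k + (12 * k + 4)) + 1)) + 1) + (9 * k + 3)))"
  unfolding local_coeff_step_def using assms
  by (intro time_le_sequ time_le_for_each time_le_ops)
    (auto simp: length_string_list power_increasing)

lemma time_le_guarded_step:
  assumes "length S \<le> k"
  shows "time_le (guarded_step lam S P Q)
    (3 * k + ((6 * k + 3) + (2 + ((4 * k + 2) + (2 ^ k * ((k + 1) + ((5 * k + 2) + (8 * k + 3))) + 1)))))"
  unfolding guarded_step_def using assms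
  by (intro time_le_whenever time_le_sequ time_le_for_each time_le_ops)
    (auto simp: length_subseqs power_increasing)

lemma time_le_combs_loop:
  assumes "\<And>S P Q. length S \<le> k \<Longrightarrow> time_le (body S P Q) c" "1 \<le> n" "set ss \<subseteq> {..k}" "length ss \<le> k"
  shows "time_le (for_each 1 ss (\<lambda>s. for_each (s + 1) (combs n s) (\<lambda>S.
         for_each s (string_list S) (\<lambda>P. for_each s (string_list S) (\<lambda>Q. body S P Q)))))
    (k * (1 + (n ^ k * ((k + 1) + (4 ^ k * (k + (4 ^ k * (k + c) + 1)) + 1)) + 1)) + 1)"
proof (intro time_le_for_each)
  fix s S assume "s \<in> set ss" "S \<in> set (combs n s)"
  then show "length (string_list S) \<le> 4 ^ k"
    using assms(3) by (auto simp: length_string_list length_of_combs power_increasing)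
  show "s \<le> k" using \<open>s \<in> set ss\<close> assms(3) by auto
  then show "time_le (body S P Q) c" for P Q
    using assms(1) length_of_combs[OF \<open>S \<in> set (combs n s)\<close>] by simp
  show "length (string_list S) \<le> 4 ^ k" by fact
  show "s \<le> k" by fact
next
  fix s assume "s \<in> set ss"
  then show "length (combs n s) \<le> n ^ k"
    using length_combs[of n s] assms(2,3) order_trans power_increasing[of s k n] by fastforce
  show "s + 1 \<le> k + 1" using \<open>s \<in> set ss\<close> assms(3) by auto
qed (use assms in auto)

lemma recovery_time_bound:
  "\<exists>C::real. \<forall>n\<ge>1. \<forall>Lhat. \<forall>lam>0. real (recovery_time n k Lhat lam) \<le> C * real n ^ k"
proof -
  define c1 where "c1 = ((8 * k + 2) + ((4 ^ k * (k + (4 ^ k * (k + (12 * k + 4)) + 1)) + 1) + (9 * k + 3)))"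
  define c2 where "c2 = (3 * k + ((6 * k + 3) + (2 + ((4 * k + 2) + (2 ^ k * ((k + 1) + ((5 * k + 2) + (8 * k + 3))) + 1)))))"
  define d where "d c = (k + 1) + (4 ^ k * (k + (4 ^ k * (k + c) + 1)) + 1)" for c
  define C where "C = 1 + ((k * (1 + (d c1 + 1)) + 1) + (k * (1 + (d c2 + 1)) + 1))"
  have "recovery_time n k Lhat lam \<le> C * n ^ k" if "1 \<le> n" for n Lhat lam
  proof -
    have "time_le (guarded_recovery n k Lhat lam)
      (1 + ((k * (1 + (n ^ k * d c1 + 1)) + 1) + (k * (1 + (n ^ k * d c2 + 1)) + 1)))"
      unfolding guarded_recovery_def d_def c1_def c2_def using that
      by (intro time_le_sequ time_le_combs_loop time_le_local_coeff_step time_le_guarded_step)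
        (auto intro: time_le_ops)
    then have "recovery_time n k Lhat lam
        \<le> 1 + ((k * (1 + (n ^ k * d c1 + 1)) + 1) + (k * (1 + (n ^ k * d c2 + 1)) + 1))"
      by (simp add: time_le_def recovery_time_def)
    \<comment> \<open>What is collected here does not grow with \<open>n\<close>; it is absorbed
      into a multiple of \<open>n ^ k\<close> because \<open>n\<close> is positive.\<close>
    also have "\<dots> = (3 + 4 * k) * 1 + (k * d c1 + k * d c2) * n ^ k" by (simp add: algebra_simps)
    also have "\<dots> \<le> (3 + 4 * k) * n ^ k + (k * d c1 + k * d c2) * n ^ k"
      using that by (intro add_mono mult_le_mono2) auto
    also have "\<dots> = C * n ^ k" by (simp add: C_def algebra_simps)
    finally show ?thesis .
  qed
  then have "\<forall>n\<ge>1. \<forall>Lhat. \<forall>lam>0. real (recovery_time n k Lhat lam) \<le> real C * real n ^ k"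
    by (metis of_nat_le_iff of_nat_mult of_nat_power)
  then show ?thesis by blast
qed

section \<open>Tensor products and Pauli strings\<close>

lemma mat_adjoint_index [simp]:
  "i < dim_col A \<Longrightarrow> j < dim_row A \<Longrightarrow> mat_adjoint A $$ (i, j) = cnj (A $$ (j, i :: nat) :: complex)"
  by (simp add: mat_adjoint_def mat_of_rows_index)

lemma mat_adjoint_dims [simp]: "dim_row (mat_adjoint A) = dim_col A" "dim_col (mat_adjoint A) = dim_row A"
  by (simp_all add: mat_adjoint_def)

lemma mat_adjoint_carrier [intro, simp]: "A \<in> carrier_mat a b \<Longrightarrow> mat_adjoint A \<in> carrier_mat b a"
  by (intro carrier_matI) auto

lemma mat_mult_index:
  "A \<in> carrier_mat a b \<Longrightarrow> B \<in> carrier_mat b c \<Longrightarrow> i < a \<Longrightarrow> j < c \<Longrightarrow>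
    (A * B) $$ (i, j) = (\<Sum>l<b. A $$ (i, l) * B $$ (l, j))"
  by (auto simp: scalar_prod_def atLeast0LessThan intro!: sum.cong)

lemma tensor_carrier [intro, simp]: "tensor us M \<in> carrier_mat (2 ^ length us) (2 ^ length us)"
  by (simp add: tensor_def)

lemma sigma_carrier [intro, simp]: "sigma a \<in> carrier_mat 2 2"
  by (cases a) (simp_all add: mat_of_rows_list_def numeral_2_eq_2)

lemma digit_add_high:
  assumes "r < m"
  shows "(j + 2 ^ m) div 2 ^ r mod 2 = j div 2 ^ r mod (2::nat)"
proof -
  have "(2::nat) ^ m = 2 ^ r * (2 * 2 ^ (m - r - 1))"
    using assms by (simp only: power_add[symmetric] power_Suc[symmetric]) simp
  then have "(j + 2 ^ m) div 2 ^ r = j div 2 ^ r + 2 * 2 ^ (m - r - 1)" by simp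
  then show ?thesis by simp
qed

text \<open>An index below \<open>2 ^ m\<close> is a free choice of \<open>m\<close> binary digits,
  so this is the distributive law. The induction splits the range by the top digit. All tensor
  product identities for product and trace rest on it.\<close>

lemma sum_digits_prod:
  fixes f :: "nat \<Rightarrow> nat \<Rightarrow> 'a :: comm_semiring_1"
  shows "(\<Sum>j<2 ^ m. \<Prod>r<m. f r (j div 2 ^ r mod 2)) = (\<Prod>r<m. f r 0 + f r 1)"
proof (induction m)
  case (Suc m)
  let ?g = "\<lambda>j. \<Prod>r<m. f r (j div 2 ^ r mod 2)"
  have split: "{..<(2::nat) ^ Suc m} = {..<2 ^ m} \<union> (\<lambda>j. j + 2 ^ m) ` {..<2 ^ m}"
  proof (intro equalityI subsetI)
    fix x :: nat assume "x \<in> {..<2 ^ Suc m}"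
    then show "x \<in> {..<2 ^ m} \<union> (\<lambda>j. j + 2 ^ m) ` {..<2 ^ m}"
      by (cases "x < 2 ^ m") (auto intro!: image_eqI[of _ _ "x - 2 ^ m"])
  qed auto
  have "(\<Sum>j<2 ^ Suc m. \<Prod>r<Suc m. f r (j div 2 ^ r mod 2))
      = (\<Sum>j<2 ^ m. \<Prod>r<Suc m. f r (j div 2 ^ r mod 2))
        + (\<Sum>j<2 ^ m. \<Prod>r<Suc m. f r ((j + 2 ^ m) div 2 ^ r mod 2))"
    unfolding split by (subst sum.union_disjoint) (auto simp: sum.reindex inj_on_def)
  also have "(\<Sum>j<2 ^ m. \<Prod>r<Suc m. f r (j div 2 ^ r mod 2)) = (\<Sum>j<2 ^ m. ?g j * f m 0)"
    by (intro sum.cong) auto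
  also have "(\<Sum>j<2 ^ m. \<Prod>r<Suc m. f r ((j + 2 ^ m) div 2 ^ r mod 2)) = (\<Sum>j<2 ^ m. ?g j * f m 1)"
    by (intro sum.cong refl) (simp add: digit_add_high)
  finally show ?case unfolding sum_distrib_right[symmetric] Suc.IH by (simp add: distrib_left)
qed simp

lemma mat2_mult_index:
  "M \<in> carrier_mat 2 2 \<Longrightarrow> N \<in> carrier_mat 2 2 \<Longrightarrow> i < 2 \<Longrightarrow> j < 2 \<Longrightarrow>
    (M * N) $$ (i, j) = M $$ (i, 0) * N $$ (0, j) + M $$ (i, 1) * N $$ (1, j)"
  by (subst mat_mult_index[of M 2 2 N 2]) (simp_all add: numeral_2_eq_2)

text \<open>The contracted index runs through all digit strings, so its sum factors into one
  two-by-two matrix product per qubit.\<close>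

lemma tensor_mult:
  assumes "\<And>u. M u \<in> carrier_mat 2 2" "\<And>u. N u \<in> carrier_mat 2 2"
  shows "tensor us M * tensor us N = tensor us (\<lambda>u. M u * N u)"
proof (rule eq_matI)
  let ?m = "length us"
  fix i j assume "i < dim_row (tensor us (\<lambda>u. M u * N u))" "j < dim_col (tensor us (\<lambda>u. M u * N u))"
  then have ij: "i < 2 ^ ?m" "j < 2 ^ ?m" by (simp_all add: tensor_def)
  let ?b = "\<lambda>i r. i div 2 ^ r mod (2::nat)"
  have "(tensor us M * tensor us N) $$ (i, j)
      = (\<Sum>l<2 ^ ?m. \<Prod>r<?m. M (us ! r) $$ (?b i r, ?b l r) * N (us ! r) $$ (?b l r, ?b j r))"
    using ij by (subst mat_mult_index[OF tensor_carrier tensor_carrier])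
      (auto simp: tensor_def prod.distrib intro!: sum.cong)
  also have "\<dots> = (\<Prod>r<?m. M (us ! r) $$ (?b i r, 0) * N (us ! r) $$ (0, ?b j r)
      + M (us ! r) $$ (?b i r, 1) * N (us ! r) $$ (1, ?b j r))"
    by (rule sum_digits_prod)
  also have "\<dots> = (\<Prod>r<?m. (M (us ! r) * N (us ! r)) $$ (?b i r, ?b j r))"
    by (intro prod.cong refl mat2_mult_index[symmetric] assms) auto
  finally show "(tensor us M * tensor us N) $$ (i, j) = tensor us (\<lambda>u. M u * N u) $$ (i, j)"
    using ij by (simp add: tensor_def)
qed (simp_all add: tensor_def)

lemma mtrace_carrier: "A \<in> carrier_mat d d \<Longrightarrow> mtrace A = (\<Sum>i<d. A $$ (i, i))"
  by (simp add: mtrace_def)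

lemma prod_nth_distinct: "distinct us \<Longrightarrow> (\<Prod>r<length us. f (us ! r)) = prod f (set us)"
  using prod.reindex_bij_betw[OF bij_betw_nth[of us, OF _ refl refl], of f] by simp

lemma mtrace_tensor:
  assumes "\<And>u. M u \<in> carrier_mat 2 2" "distinct us"
  shows "mtrace (tensor us M) = (\<Prod>u\<in>set us. mtrace (M u))"
proof -
  have "mtrace (tensor us M)
      = (\<Sum>i<2 ^ length us. \<Prod>r<length us. M (us ! r) $$ (i div 2 ^ r mod 2, i div 2 ^ r mod 2))"
    by (simp add: mtrace_carrier[OF tensor_carrier]) (simp add: tensor_def)
  also have "\<dots> = (\<Prod>r<length us. mtrace (M (us ! r)))"
    by (subst sum_digits_prod[of "\<lambda>r x. M (us ! r) $$ (x, x)"])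
      (simp add: mtrace_carrier[OF assms(1)] numeral_2_eq_2)
  finally show ?thesis by (simp only: prod_nth_distinct[OF assms(2), of "\<lambda>u. mtrace (M u)"])
qed

lemma mat_adjoint_tensor:
  assumes "\<And>u. M u \<in> carrier_mat 2 2"
  shows "mat_adjoint (tensor us M) = tensor us (\<lambda>u. mat_adjoint (M u))"
proof (rule eq_matI)
  have d: "dim_row (M u) = 2" "dim_col (M u) = 2" for u using assms[of u] by auto
  fix i j assume "i < dim_row (tensor us (\<lambda>u. mat_adjoint (M u)))" "j < dim_col (tensor us (\<lambda>u. mat_adjoint (M u)))"
  then show "mat_adjoint (tensor us M) $$ (i, j) = tensor us (\<lambda>u. mat_adjoint (M u)) $$ (i, j)"
    by (simp add: tensor_def d)
qed (simp_all add: tensor_def)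

lemma eq_if_digits_eq:
  fixes i j :: nat
  assumes "i < 2 ^ m" "j < 2 ^ m" "\<And>r. r < m \<Longrightarrow> i div 2 ^ r mod 2 = j div 2 ^ r mod 2"
  shows "i = j"
proof (rule bit_eqI)
  fix r
  show "bit i r = bit j r"
  proof (cases "r < m")
    case True
    then show ?thesis using assms(3)[OF True] by (simp add: bit_iff_odd odd_iff_mod_2_eq_one)
  next
    case False
    then have "(2::nat) ^ m \<le> 2 ^ r" by simp
    then have "i < 2 ^ r" "j < 2 ^ r" using assms(1,2) by linarith+
    then show ?thesis by (simp add: bit_iff_odd)
  qed
qed

lemma tensor_one: "tensor us (\<lambda>u. sigma PI) = 1\<^sub>m (2 ^ length us)"
proof (rule eq_matI)
  have s: "sigma PI $$ (a, b) = of_bool (a = b)" if "a < 2" "b < 2" for a b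
    using that by (auto simp: mat_of_rows_list_def less_2_cases_iff)
  fix i j assume "i < dim_row (1\<^sub>m (2 ^ length us))" "j < dim_col (1\<^sub>m (2 ^ length us))"
  then have ij: "i < 2 ^ length us" "j < 2 ^ length us" by simp_all
  have "(\<Prod>r<length us. sigma PI $$ (i div 2 ^ r mod 2, j div 2 ^ r mod 2))
      = (\<Prod>r<length us. of_bool (i div 2 ^ r mod 2 = j div 2 ^ r mod 2))"
    by (intro prod.cong refl s) auto
  also have "\<dots> = (of_bool (i = j) :: complex)"
    using eq_if_digits_eq[OF ij] by (cases "i = j") auto
  finally show "tensor us (\<lambda>u. sigma PI) $$ (i, j) = 1\<^sub>m (2 ^ length us) $$ (i, j)"
    using ij by (simp add: tensor_def del: sigma.simps)
qed (simp_all add: tensor_def)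

section \<open>The one-qubit Pauli algebra\<close>

lemma UNIV_pauli: "UNIV = {PI, PX, PY, PZ}"
  using pauli.exhaust by auto

instance pauli :: finite
  by standard (simp add: UNIV_pauli)

text \<open>Multiplication up to phase, that is, the Klein four-group with neutral element
  \<open>PI\<close>. The phase is kept apart in \<open>pauli_phase\<close>, so that supports can be
  tracked by the group alone.\<close>

fun pauli_mult :: "pauli \<Rightarrow> pauli \<Rightarrow> pauli" where
  "pauli_mult PI b = b"
| "pauli_mult a PI = a"
| "pauli_mult PX PX = PI" | "pauli_mult PX PY = PZ" | "pauli_mult PX PZ = PY"
| "pauli_mult PY PX = PZ" | "pauli_mult PY PY = PI" | "pauli_mult PY PZ = PX"
| "pauli_mult PZ PX = PY" | "pauli_mult PZ PY = PX" | "pauli_mult PZ PZ = PI"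

fun pauli_phase :: "pauli \<Rightarrow> pauli \<Rightarrow> complex" where
  "pauli_phase PX PY = \<i>" | "pauli_phase PX PZ = - \<i>"
| "pauli_phase PY PX = - \<i>" | "pauli_phase PY PZ = \<i>"
| "pauli_phase PZ PX = \<i>" | "pauli_phase PZ PY = - \<i>"
| "pauli_phase _ _ = 1"

lemma mat2_eqI:
  assumes "A \<in> carrier_mat 2 2" "B \<in> carrier_mat 2 2"
    "A $$ (0, 0) = B $$ (0, 0)" "A $$ (0, 1) = B $$ (0, 1)" "A $$ (1, 0) = B $$ (1, 0)" "A $$ (1, 1) = B $$ (1, 1)"
  shows "A = B"
proof (rule eq_matI)
  fix i j assume "i < dim_row B" "j < dim_col B"
  then have "i \<in> {0, 1}" "j \<in> {0, 1}" using assms(2) by (auto simp: less_2_cases_iff)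
  then show "A $$ (i, j) = B $$ (i, j)" using assms(3-) by auto
qed (use assms in auto)

lemma sigma_index:
  "sigma PI $$ (0, 0) = 1" "sigma PI $$ (0, Suc 0) = 0" "sigma PI $$ (Suc 0, 0) = 0" "sigma PI $$ (Suc 0, Suc 0) = 1"
  "sigma PX $$ (0, 0) = 0" "sigma PX $$ (0, Suc 0) = 1" "sigma PX $$ (Suc 0, 0) = 1" "sigma PX $$ (Suc 0, Suc 0) = 0"
  "sigma PY $$ (0, 0) = 0" "sigma PY $$ (0, Suc 0) = - \<i>" "sigma PY $$ (Suc 0, 0) = \<i>" "sigma PY $$ (Suc 0, Suc 0) = 0"
  "sigma PZ $$ (0, 0) = 1" "sigma PZ $$ (0, Suc 0) = 0" "sigma PZ $$ (Suc 0, 0) = 0" "sigma PZ $$ (Suc 0, Suc 0) = - 1"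
  by (simp_all add: mat_of_rows_list_def)

declare sigma.simps [simp del]

lemma sigma_dims [simp]: "dim_row (sigma a) = 2" "dim_col (sigma a) = 2"
  using carrier_matD[OF sigma_carrier[of a]] .

lemma sigma_mult: "sigma a * sigma b = pauli_phase a b \<cdot>\<^sub>m sigma (pauli_mult a b)"
proof (rule mat2_eqI)
  show "sigma a * sigma b \<in> carrier_mat 2 2" by (rule mult_carrier_mat[OF sigma_carrier sigma_carrier])
qed (cases a; cases b; simp add: mat2_mult_index sigma_index del: index_mult_mat(1))+

lemma mat_adjoint_sigma: "mat_adjoint (sigma a) = sigma a"
  by (rule mat2_eqI; cases a) (simp_all add: sigma_index)

lemma mtrace_sigma: "mtrace (sigma a) = (if a = PI then 2 else 0)"
  by (cases a) (simp_all add: mtrace_def numeral_2_eq_2 sigma_index)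

lemma mtrace_smult: "mtrace (c \<cdot>\<^sub>m A) = c * mtrace A" if "A \<in> carrier_mat d d"
  using that by (simp add: mtrace_def sum_distrib_left)

lemma pauli_mult_eq_PI: "pauli_mult a b = PI \<longleftrightarrow> a = b"
  by (cases a; cases b) auto

lemma pauli_phase_self: "pauli_phase a a = 1"
  by (cases a) auto

lemma mtrace_sigma_mult: "mtrace (sigma a * sigma b) = (if a = b then 2 else 0)"
  by (simp add: sigma_mult mtrace_smult[OF sigma_carrier] mtrace_sigma pauli_mult_eq_PI pauli_phase_self)

text \<open>Grouping the factors in pairs turns each pair into a phase times a Pauli matrix, and
  distinct Pauli matrices are orthogonal for the trace.\<close>

lemma mtrace_sigma4:
  "mtrace (sigma a * sigma p * sigma b * sigma q)
    = (if pauli_mult a p = pauli_mult b q then 2 * pauli_phase a p * pauli_phase b q else 0)"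
proof -
  have "sigma a * sigma p * sigma b * sigma q = (sigma a * sigma p) * (sigma b * sigma q)"
    by (rule assoc_mult_mat[of _ 2 2 _ 2 _ 2]) auto
  also have "\<dots> = (pauli_phase a p * pauli_phase b q) \<cdot>\<^sub>m (sigma (pauli_mult a p) * sigma (pauli_mult b q))"
    unfolding sigma_mult[of a p] sigma_mult[of b q]
    by (rule eq_matI) (auto simp: scalar_prod_def sum_distrib_left mult_ac intro!: sum.cong)
  finally show ?thesis
    by (simp add: mtrace_smult[of _ 2, OF mult_carrier_mat[OF sigma_carrier sigma_carrier]] mtrace_sigma_mult)
qed

lemma sum_pauli: "(\<Sum>a\<in>UNIV. f a) = f PI + f PX + f PY + f PZ"
  unfolding UNIV_pauli by (simp add: add.assoc)

text \<open>The second trace is the complex conjugate of the first one taken at \<open>p'\<close>,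
  \<open>q'\<close>, so this is orthogonality of the one-qubit kernel. On the diagonal each
  \<open>a\<close> admits one \<open>b\<close>, with a trace of squared modulus 4.\<close>

lemma sum_mtrace_sigma4:
  "(\<Sum>a\<in>UNIV. \<Sum>b\<in>UNIV. mtrace (sigma a * sigma p * sigma b * sigma q)
      * mtrace (sigma a * sigma q' * sigma b * sigma p'))
    = (if p = p' \<and> q = q' then 16 else 0)"
  unfolding mtrace_sigma4 sum_pauli by (cases p; cases q; cases p'; cases q'; simp)

text \<open>Each \<open>a\<close> admits exactly one \<open>b\<close> with nonzero trace, of modulus
  2. The resulting 8 per qubit is what the factor \<open>2 ^ 3\<close> per qubit in the local
  coefficients cancels.\<close>

lemma sum_norm_mtrace_sigma4:
  "(\<Sum>a\<in>UNIV. \<Sum>b\<in>UNIV. cmod (mtrace (sigma a * sigma q * sigma b * sigma p))) = 8"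
  unfolding mtrace_sigma4 sum_pauli by (cases p; cases q) (simp_all add: norm_mult)

section \<open>Sums over Pauli strings and traces of their products\<close>

lemma strings_on_empty: "strings_on {} = {id_string}"
  by (auto simp: strings_on_def supp_def)

lemma strings_on_insert:
  "strings_on (insert u S) = (\<lambda>(P, a). P(u := a)) ` (strings_on S \<times> UNIV)"
proof (intro equalityI subsetI)
  fix P assume "P \<in> strings_on (insert u S)"
  then show "P \<in> (\<lambda>(P, a). P(u := a)) ` (strings_on S \<times> UNIV)"
    by (intro image_eqI[of _ _ "(P(u := PI), P u)"]) (auto simp: strings_on_def supp_def)
qed (auto simp: strings_on_def supp_def split: if_splits)

lemma finite_strings_on [simp]: "finite S \<Longrightarrow> finite (strings_on S)"
  by (induction S rule: finite_induct) (simp_all add: strings_on_empty strings_on_insert)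

lemma strings_on_outside: "P \<in> strings_on S \<Longrightarrow> u \<notin> S \<Longrightarrow> P u = PI"
  by (auto simp: strings_on_def supp_def)

text \<open>A string on \<open>S\<close> is a free choice of one letter per qubit, so this is again
  a distributive law, now with four alternatives per factor.\<close>

lemma sum_strings_prod:
  fixes f :: "nat \<Rightarrow> pauli \<Rightarrow> 'a :: comm_semiring_1"
  assumes "finite S"
  shows "(\<Sum>A\<in>strings_on S. \<Prod>u\<in>S. f u (A u)) = (\<Prod>u\<in>S. \<Sum>a\<in>UNIV. f u a)"
  using assms
proof (induction S rule: finite_induct)
  case empty
  then show ?case by (simp add: strings_on_empty)
next
  case (insert u S)
  have inj: "inj_on (\<lambda>(P, a). P(u := a)) (strings_on S \<times> UNIV)"
  proof (rule inj_onI, clarify)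
    fix P a Q b assume *: "P \<in> strings_on S" "Q \<in> strings_on S" "P(u := a) = Q(u := b)"
    then have "P u = Q u" using strings_on_outside insert by metis
    then show "P = Q \<and> a = b" using *(3) by (metis fun_upd_eqD fun_upd_triv fun_upd_upd)
  qed
  have "(\<Sum>A\<in>strings_on (insert u S). \<Prod>v\<in>insert u S. f v (A v))
      = (\<Sum>(P, a)\<in>strings_on S \<times> UNIV. \<Prod>v\<in>insert u S. f v ((P(u := a)) v))"
    unfolding strings_on_insert by (subst sum.reindex[OF inj]) (auto intro!: sum.cong)
  also have "\<dots> = (\<Sum>(P, a)\<in>strings_on S \<times> UNIV. f u a * (\<Prod>v\<in>S. f v (P v)))"
  proof (intro sum.cong refl, clarify)
    fix P a
    have "(\<Prod>v\<in>S. f v ((P(u := a)) v)) = (\<Prod>v\<in>S. f v (P v))"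
      using insert by (intro prod.cong) auto
    then show "(\<Prod>v\<in>insert u S. f v ((P(u := a)) v)) = f u a * (\<Prod>v\<in>S. f v (P v))"
      using insert by simp
  qed
  also have "\<dots> = (\<Sum>a\<in>UNIV. f u a) * (\<Sum>P\<in>strings_on S. \<Prod>v\<in>S. f v (P v))"
    unfolding sum_product sum.cartesian_product[symmetric] by (rule sum.swap)
  finally show ?case using insert by simp
qed

lemma pauli_mat_carrier [intro, simp]: "pauli_mat us P \<in> carrier_mat (2 ^ length us) (2 ^ length us)"
  by (simp add: pauli_mat_def)

lemma pauli_op_carrier [intro, simp]: "pauli_op n P \<in> carrier_mat (2 ^ n) (2 ^ n)"
  using pauli_mat_carrier[of "[0..<n]" P] by simp

lemma pauli_mat_mult: "pauli_mat us P * pauli_mat us Q = tensor us (\<lambda>u. sigma (P u) * sigma (Q u))"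
  by (simp add: pauli_mat_def tensor_mult)

lemma mat_adjoint_pauli_mat: "mat_adjoint (pauli_mat us P) = pauli_mat us P"
  by (simp add: pauli_mat_def mat_adjoint_tensor mat_adjoint_sigma)

lemma pauli_mat_id: "pauli_mat us id_string = 1\<^sub>m (2 ^ length us)"
  by (simp add: pauli_mat_def tensor_one)

lemma pauli_op_id: "pauli_op n id_string = 1\<^sub>m (2 ^ n)"
  by (simp add: pauli_mat_id)

lemma pauli_mat_commute:
  assumes "supp P \<inter> supp Q = {}"
  shows "pauli_mat us P * pauli_mat us Q = pauli_mat us Q * pauli_mat us P"
proof -
  have "sigma (P u) * sigma (Q u) = sigma (Q u) * sigma (P u)" for u
  proof (cases "P u = PI")
    case True then show ?thesis by (cases "Q u") (simp_all add: sigma_mult)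
  next
    case False
    then have "Q u = PI" using assms by (auto simp: supp_def)
    then show ?thesis by (cases "P u") (simp_all add: sigma_mult)
  qed
  then show ?thesis by (simp add: pauli_mat_mult)
qed

lemma sigma_mult_carrier [simp, intro]: "sigma a * sigma b \<in> carrier_mat 2 2"
  using mult_carrier_mat[OF sigma_carrier sigma_carrier] .

lemma mtrace_pauli_mat_mult:
  assumes "distinct us"
  shows "mtrace (pauli_mat us P * pauli_mat us Q) = (\<Prod>u\<in>set us. if P u = Q u then 2 else 0)"
  using assms by (simp add: pauli_mat_mult mtrace_tensor mtrace_sigma_mult)

lemma mtrace_pauli_op_mult:
  assumes "P \<in> strings_on {..<n}" "Q \<in> strings_on {..<n}"
  shows "mtrace (pauli_op n P * pauli_op n Q) = (if P = Q then 2 ^ n else 0)"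
proof (cases "P = Q")
  case False
  then obtain u where "P u \<noteq> Q u" by auto
  moreover from this have "u < n" using assms strings_on_outside by (metis lessThan_iff)
  ultimately show ?thesis using False by (auto simp: mtrace_pauli_mat_mult)
qed (simp add: mtrace_pauli_mat_mult)

lemma pauli_mat_mult4:
  "pauli_mat us A * pauli_mat us P * pauli_mat us B * pauli_mat us Q
    = tensor us (\<lambda>u. sigma (A u) * sigma (P u) * sigma (B u) * sigma (Q u))"
  unfolding pauli_mat_def by (simp add: tensor_mult mult_carrier_mat[of _ 2 2 _ 2])

lemma mtrace_pauli_mat_mult4:
  assumes "distinct us"
  shows "mtrace (pauli_mat us A * pauli_mat us P * pauli_mat us B * pauli_mat us Q)
    = (\<Prod>u\<in>set us. mtrace (sigma (A u) * sigma (P u) * sigma (B u) * sigma (Q u)))"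
  unfolding pauli_mat_mult4
  by (rule mtrace_tensor[OF _ assms]) (simp add: mult_carrier_mat[of _ 2 2 _ 2])

lemma sum_norm_mtrace_pauli_mat_mult4:
  assumes "distinct us"
  shows "(\<Sum>A\<in>strings_on (set us). \<Sum>B\<in>strings_on (set us).
      cmod (mtrace (pauli_mat us A * pauli_mat us Q * pauli_mat us B * pauli_mat us P))) = 8 ^ length us"
proof -
  let ?c = "\<lambda>u a b. cmod (mtrace (sigma a * sigma (Q u) * sigma b * sigma (P u)))"
  have "(\<Sum>A\<in>strings_on (set us). \<Sum>B\<in>strings_on (set us).
      cmod (mtrace (pauli_mat us A * pauli_mat us Q * pauli_mat us B * pauli_mat us P)))
    = (\<Sum>A\<in>strings_on (set us). \<Sum>B\<in>strings_on (set us). \<Prod>u\<in>set us. ?c u (A u) (B u))"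
    by (simp add: mtrace_pauli_mat_mult4[OF assms] prod_norm)
  also have "\<dots> = (\<Prod>u\<in>set us. \<Sum>a\<in>UNIV. \<Sum>b\<in>UNIV. ?c u a b)"
    by (subst sum_strings_prod, simp)
      (subst sum_strings_prod[of "set us" "\<lambda>u a. \<Sum>b\<in>UNIV. ?c u a b"], simp_all)
  finally show ?thesis using assms by (simp add: sum_norm_mtrace_sigma4 distinct_card)
qed

text \<open>This is the inversion formula for the coefficients: the pair \<open>(P, Q)\<close> contributes only to
  the local coefficients of its restriction, and only if it is diagonal outside \<open>us\<close>.\<close>

lemma sum_local_trace:
  assumes "distinct us" "set us \<subseteq> {..<n}"
  shows "(\<Sum>A\<in>strings_on (set us). \<Sum>B\<in>strings_on (set us).
      mtrace (pauli_op n A * pauli_op n P * pauli_op n B * pauli_op n Q) / 2 ^ n *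
      mtrace (pauli_mat us A * pauli_mat us Q' * pauli_mat us B * pauli_mat us P'))
    = (if (\<forall>u\<in>set us. P u = P' u \<and> Q u = Q' u) \<and> (\<forall>u\<in>{..<n} - set us. P u = Q u)
       then 8 ^ length us else 0)"
proof -
  let ?t = "\<lambda>a p b q. mtrace (sigma a * sigma p * sigma b * sigma q)"
  have fin: "finite (set us)" by simp
  \<comment> \<open>Outside \<open>us\<close> the probing strings are trivial, and the normalised
    one-qubit trace compares the letters of \<open>P\<close> and \<open>Q\<close>. This is where the
    restriction to diagonal extensions originates.\<close>
  have outer: "(\<Prod>u\<in>{..<n} - set us. ?t PI (P u) PI (Q u) / 2)
      = (if \<forall>u\<in>{..<n} - set us. P u = Q u then 1 else 0)"
  proof -
    have "?t PI p PI q / 2 = (if p = q then 1 else 0)" for p q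
      by (cases p; cases q) (simp_all add: mtrace_sigma4)
    then show ?thesis by (auto intro: prod_zero)
  qed
  have full: "mtrace (pauli_op n A * pauli_op n P * pauli_op n B * pauli_op n Q) / 2 ^ n
      = (\<Prod>u\<in>set us. ?t (A u) (P u) (B u) (Q u) / 2) * (\<Prod>u\<in>{..<n} - set us. ?t PI (P u) PI (Q u) / 2)"
    if "A \<in> strings_on (set us)" "B \<in> strings_on (set us)" for A B
  proof -
    have "mtrace (pauli_op n A * pauli_op n P * pauli_op n B * pauli_op n Q) / 2 ^ n
        = (\<Prod>u<n. ?t (A u) (P u) (B u) (Q u) / 2)"
      by (simp add: mtrace_pauli_mat_mult4 prod_dividef atLeast0LessThan)
    also have "\<dots> = (\<Prod>u\<in>{..<n} - set us. ?t (A u) (P u) (B u) (Q u) / 2) * (\<Prod>u\<in>set us. ?t (A u) (P u) (B u) (Q u) / 2)"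
      using assms by (intro prod.subset_diff) auto
    also have "(\<Prod>u\<in>{..<n} - set us. ?t (A u) (P u) (B u) (Q u) / 2) = (\<Prod>u\<in>{..<n} - set us. ?t PI (P u) PI (Q u) / 2)"
      using that by (intro prod.cong refl) (auto simp: strings_on_outside)
    finally show ?thesis by (simp add: mult.commute)
  qed
  \<comment> \<open>On \<open>us\<close> the normalisation of the large trace contributes 1/2 per
    qubit, which reduces the 16 of the one-qubit orthogonality to 8.\<close>
  let ?g = "\<lambda>u a b. ?t a (P u) b (Q u) / 2 * ?t a (Q' u) b (P' u)"
  have "(\<Sum>A\<in>strings_on (set us). \<Sum>B\<in>strings_on (set us).
      mtrace (pauli_op n A * pauli_op n P * pauli_op n B * pauli_op n Q) / 2 ^ n *
      mtrace (pauli_mat us A * pauli_mat us Q' * pauli_mat us B * pauli_mat us P'))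
    = (\<Sum>A\<in>strings_on (set us). \<Sum>B\<in>strings_on (set us).
        (\<Prod>u\<in>{..<n} - set us. ?t PI (P u) PI (Q u) / 2) * (\<Prod>u\<in>set us. ?g u (A u) (B u)))"
    by (intro sum.cong refl, subst full)
      (simp_all only: mtrace_pauli_mat_mult4[OF assms(1)] prod.distrib mult_ac)
  also have "\<dots> = (\<Prod>u\<in>{..<n} - set us. ?t PI (P u) PI (Q u) / 2) *
      (\<Sum>A\<in>strings_on (set us). \<Sum>B\<in>strings_on (set us). \<Prod>u\<in>set us. ?g u (A u) (B u))"
    by (simp add: sum_distrib_left)
  also have "(\<Sum>A\<in>strings_on (set us). \<Sum>B\<in>strings_on (set us). \<Prod>u\<in>set us. ?g u (A u) (B u))
      = (\<Prod>u\<in>set us. \<Sum>a\<in>UNIV. \<Sum>b\<in>UNIV. ?g u a b)"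
    by (subst sum_strings_prod[OF fin])
      (rule sum_strings_prod[OF fin, of "\<lambda>u a. \<Sum>b\<in>UNIV. ?g u a b"])
  also have "\<dots> = (\<Prod>u\<in>set us. if P u = P' u \<and> Q u = Q' u then 8 else 0)"
  proof (intro prod.cong refl)
    fix u
    have "(\<Sum>a\<in>UNIV. \<Sum>b\<in>UNIV. ?g u a b)
        = 1 / 2 * (\<Sum>a\<in>UNIV. \<Sum>b\<in>UNIV. ?t a (P u) b (Q u) * ?t a (Q' u) b (P' u))"
      unfolding sum_distrib_left by (intro sum.cong refl) simp
    also have "\<dots> = (if P u = P' u \<and> Q u = Q' u then 8 else 0)"
      unfolding sum_mtrace_sigma4 by simp
    finally show "(\<Sum>a\<in>UNIV. \<Sum>b\<in>UNIV. ?g u a b) = (if P u = P' u \<and> Q u = Q' u then 8 else 0)" .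
  qed
  also have "\<dots> = (if \<forall>u\<in>set us. P u = P' u \<and> Q u = Q' u then 8 ^ length us else 0)"
    using assms(1) by (auto simp: distinct_card intro: prod_zero)
  finally show ?thesis unfolding outer by simp
qed

section \<open>Linear maps on matrices and their exponentials\<close>

lemma msum_carrier [intro, simp]: "msum d f X \<in> carrier_mat d d"
  by (simp add: msum_def)

lemma msum_index [simp]: "i < d \<Longrightarrow> j < d \<Longrightarrow> msum d f X $$ (i, j) = (\<Sum>x\<in>X. f x $$ (i, j))"
  by (simp add: msum_def)

lemma msum_dims [simp]: "dim_row (msum d f X) = d" "dim_col (msum d f X) = d"
  by (simp_all add: msum_def)

lemma carrier_index:
  fixes A B :: "complex mat"
  assumes "A \<in> carrier_mat d d" "i < d" "j < d"
  shows "B \<in> carrier_mat d d \<Longrightarrow> (A + B) $$ (i, j) = A $$ (i, j) + B $$ (i, j)"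
    and "B \<in> carrier_mat d d \<Longrightarrow> (A - B) $$ (i, j) = A $$ (i, j) - B $$ (i, j)"
    and "(c \<cdot>\<^sub>m A) $$ (i, j) = c * A $$ (i, j)"
    and "mat_adjoint A $$ (i, j) = cnj (A $$ (j, i))"
  using assms by auto

lemma eq_carrierI:
  assumes "A \<in> carrier_mat d d" "B \<in> carrier_mat d d" "\<And>i j. i < d \<Longrightarrow> j < d \<Longrightarrow> A $$ (i, j) = B $$ (i, j)"
  shows "A = B"
  using assms by (intro eq_matI) auto

lemma minus_carrier [intro]:
  "A \<in> carrier_mat d d \<Longrightarrow> B \<in> carrier_mat d d \<Longrightarrow> A - B \<in> carrier_mat d d"
  by (rule minus_carrier_mat)

lemma msum_empty: "msum d f {} = 0\<^sub>m d d"
  by (rule eq_matI) simp_all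

lemma msum_insert:
  "finite X \<Longrightarrow> x \<notin> X \<Longrightarrow> f x \<in> carrier_mat d d \<Longrightarrow> msum d f (insert x X) = f x + msum d f X"
  by (rule eq_matI) simp_all

lemma msum_cong: "(\<And>x. x \<in> X \<Longrightarrow> f x = g x) \<Longrightarrow> msum d f X = msum d g X"
  unfolding msum_def by (intro cong_mat) (auto intro!: sum.cong)

lemma mtrace_add: "A \<in> carrier_mat d d \<Longrightarrow> B \<in> carrier_mat d d \<Longrightarrow> mtrace (A + B) = mtrace A + mtrace B"
  by (simp add: mtrace_def sum.distrib)

lemma mtrace_minus: "A \<in> carrier_mat d d \<Longrightarrow> B \<in> carrier_mat d d \<Longrightarrow> mtrace (A - B) = mtrace A - mtrace B"
  by (simp add: mtrace_def sum_subtractf)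

lemma mtrace_msum: "(\<And>x. x \<in> X \<Longrightarrow> f x \<in> carrier_mat d d) \<Longrightarrow> mtrace (msum d f X) = (\<Sum>x\<in>X. mtrace (f x))"
proof -
  assume c: "\<And>x. x \<in> X \<Longrightarrow> f x \<in> carrier_mat d d"
  have "mtrace (msum d f X) = (\<Sum>i<d. \<Sum>x\<in>X. f x $$ (i, i))"
    by (subst mtrace_carrier[OF msum_carrier]) simp
  also have "\<dots> = (\<Sum>x\<in>X. \<Sum>i<d. f x $$ (i, i))" by (rule sum.swap)
  also have "\<dots> = (\<Sum>x\<in>X. mtrace (f x))" by (intro sum.cong refl mtrace_carrier[symmetric] c)
  finally show ?thesis .
qed

lemma mtrace_mult:
  "A \<in> carrier_mat d d \<Longrightarrow> B \<in> carrier_mat d d \<Longrightarrow> mtrace (A * B) = (\<Sum>i<d. \<Sum>l<d. A $$ (i, l) * B $$ (l, i))"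
  by (simp add: mtrace_carrier[OF mult_carrier_mat] mat_mult_index[of A d d B d] del: index_mult_mat)

lemma mtrace_commute:
  assumes "A \<in> carrier_mat d d" "B \<in> carrier_mat d d"
  shows "mtrace (A * B) = mtrace (B * A)"
  unfolding mtrace_mult[OF assms] mtrace_mult[OF assms(2,1)]
  by (subst sum.swap) (simp add: mult.commute)

lemma mult_msum:
  assumes "A \<in> carrier_mat d d" "\<And>x. x \<in> X \<Longrightarrow> f x \<in> carrier_mat d d"
  shows "A * msum d f X = msum d (\<lambda>x. A * f x) X"
proof (rule eq_matI)
  fix i j assume "i < dim_row (msum d (\<lambda>x. A * f x) X)" "j < dim_col (msum d (\<lambda>x. A * f x) X)"
  then have ij: "i < d" "j < d" by auto
  have "(A * msum d f X) $$ (i, j) = (\<Sum>l<d. \<Sum>x\<in>X. A $$ (i, l) * f x $$ (l, j))"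
    using ij assms(1) by (simp add: mat_mult_index[of A d d _ d] sum_distrib_left del: index_mult_mat(1))
  also have "\<dots> = (\<Sum>x\<in>X. \<Sum>l<d. A $$ (i, l) * f x $$ (l, j))" by (rule sum.swap)
  also have "\<dots> = (\<Sum>x\<in>X. (A * f x) $$ (i, j))"
    by (intro sum.cong refl mat_mult_index[symmetric, OF assms ij])
  finally show "(A * msum d f X) $$ (i, j) = msum d (\<lambda>x. A * f x) X $$ (i, j)" using ij by simp
qed (use assms in auto)

lemma msum_mult:
  assumes "A \<in> carrier_mat d d" "\<And>x. x \<in> X \<Longrightarrow> f x \<in> carrier_mat d d"
  shows "msum d f X * A = msum d (\<lambda>x. f x * A) X"
proof (rule eq_matI)
  fix i j assume "i < dim_row (msum d (\<lambda>x. f x * A) X)" "j < dim_col (msum d (\<lambda>x. f x * A) X)"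
  then have ij: "i < d" "j < d" by auto
  have "(msum d f X * A) $$ (i, j) = (\<Sum>l<d. \<Sum>x\<in>X. f x $$ (i, l) * A $$ (l, j))"
    using ij assms(1) by (simp add: mat_mult_index[of _ d d A d] sum_distrib_right del: index_mult_mat(1))
  also have "\<dots> = (\<Sum>x\<in>X. \<Sum>l<d. f x $$ (i, l) * A $$ (l, j))" by (rule sum.swap)
  also have "\<dots> = (\<Sum>x\<in>X. (f x * A) $$ (i, j))"
    by (intro sum.cong refl mat_mult_index[symmetric, OF assms(2,1) ij])
  finally show "(msum d f X * A) $$ (i, j) = msum d (\<lambda>x. f x * A) X $$ (i, j)" using ij by simp
qed (use assms in auto)

lemma mat_adjoint_mult:
  "A \<in> carrier_mat d d \<Longrightarrow> B \<in> carrier_mat d d \<Longrightarrow>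
    mat_adjoint (A * B) = mat_adjoint B * mat_adjoint (A :: complex mat)"
proof (rule eq_carrierI[of _ d])
  assume A: "A \<in> carrier_mat d d" and B: "B \<in> carrier_mat d d"
  then show "mat_adjoint (A * B) \<in> carrier_mat d d" "mat_adjoint B * mat_adjoint A \<in> carrier_mat d d"
    by (auto intro: mult_carrier_mat)
  fix i j assume "i < d" "j < d"
  then show "mat_adjoint (A * B) $$ (i, j) = (mat_adjoint B * mat_adjoint A) $$ (i, j)"
    by (simp add: carrier_index(4)[OF mult_carrier_mat[OF A B]] mat_mult_index[OF A B] carrier_index(4)[OF A]
        carrier_index(4)[OF B] mat_mult_index[OF mat_adjoint_carrier[OF B] mat_adjoint_carrier[OF A]]
        mult.commute del: mat_adjoint_index index_mult_mat(1))
qed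

lemma mat_adjoint_add:
  "A \<in> carrier_mat d d \<Longrightarrow> B \<in> carrier_mat d d \<Longrightarrow> mat_adjoint (A + B) = mat_adjoint A + mat_adjoint (B :: complex mat)"
  by (rule eq_matI) simp_all

lemma mat_adjoint_minus:
  "A \<in> carrier_mat d d \<Longrightarrow> B \<in> carrier_mat d d \<Longrightarrow> mat_adjoint (A - B) = mat_adjoint A - mat_adjoint (B :: complex mat)"
  by (rule eq_matI) simp_all

lemma mat_adjoint_smult: "mat_adjoint (c \<cdot>\<^sub>m A) = cnj c \<cdot>\<^sub>m mat_adjoint A"
  by (rule eq_matI) simp_all

lemma mat_adjoint_adjoint [simp]: "mat_adjoint (mat_adjoint A) = (A :: complex mat)"
  by (rule eq_matI) simp_all

lemma mat_adjoint_msum: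
  "(\<And>x. x \<in> X \<Longrightarrow> f x \<in> carrier_mat d d) \<Longrightarrow> mat_adjoint (msum d f X) = msum d (\<lambda>x. mat_adjoint (f x)) X"
  by (rule eq_carrierI[of _ d]) (auto intro!: sum.cong simp: carrier_index(4)[of _ d] simp del: mat_adjoint_index)

lemma mtrace_adjoint: "A \<in> carrier_mat d d \<Longrightarrow> mtrace (mat_adjoint A) = cnj (mtrace A)"
  by (simp add: mtrace_def)

section \<open>Linear superoperators\<close>

text \<open>Superoperators are functions on matrices of all dimensions; linearity is asked on square
  matrices of dimension \<open>d\<close>, on which they are meant to act.\<close>

definition lin :: "nat \<Rightarrow> superop \<Rightarrow> bool" where
  "lin d \<Phi> \<longleftrightarrow> (\<forall>A\<in>carrier_mat d d. \<Phi> A \<in> carrier_mat d d) \<and>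
     (\<forall>A\<in>carrier_mat d d. \<forall>B\<in>carrier_mat d d. \<Phi> (A + B) = \<Phi> A + \<Phi> B) \<and>
     (\<forall>c. \<forall>A\<in>carrier_mat d d. \<Phi> (c \<cdot>\<^sub>m A) = c \<cdot>\<^sub>m \<Phi> A)"

lemma linD:
  assumes "lin d \<Phi>"
  shows "A \<in> carrier_mat d d \<Longrightarrow> \<Phi> A \<in> carrier_mat d d"
    and "A \<in> carrier_mat d d \<Longrightarrow> B \<in> carrier_mat d d \<Longrightarrow> \<Phi> (A + B) = \<Phi> A + \<Phi> B"
    and "A \<in> carrier_mat d d \<Longrightarrow> \<Phi> (c \<cdot>\<^sub>m A) = c \<cdot>\<^sub>m \<Phi> A"
  using assms by (auto simp: lin_def)

lemma lin_zero: "lin d \<Phi> \<Longrightarrow> \<Phi> (0\<^sub>m d d) = 0\<^sub>m d d"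
proof -
  assume l: "lin d \<Phi>"
  have "0 \<cdot>\<^sub>m \<Phi> (0\<^sub>m d d) = \<Phi> (0 \<cdot>\<^sub>m 0\<^sub>m d d)" by (rule linD(3)[OF l, symmetric]) simp
  also have "0 \<cdot>\<^sub>m 0\<^sub>m d d = (0\<^sub>m d d :: complex mat)" by (rule eq_matI) simp_all
  finally have "\<Phi> (0\<^sub>m d d) = 0 \<cdot>\<^sub>m \<Phi> (0\<^sub>m d d)" by simp
  moreover have "0 \<cdot>\<^sub>m \<Phi> (0\<^sub>m d d) = 0\<^sub>m d d"
    using linD(1)[OF l, of "0\<^sub>m d d"] by (intro eq_matI) auto
  ultimately show ?thesis by simp
qed

lemma lin_msum_arg:
  assumes "lin d \<Phi>" "finite X" "\<And>x. x \<in> X \<Longrightarrow> f x \<in> carrier_mat d d"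
  shows "\<Phi> (msum d f X) = msum d (\<lambda>x. \<Phi> (f x)) X"
  using assms(2,3)
proof (induction X rule: finite_induct)
  case empty
  then show ?case using lin_zero[OF assms(1)] by (simp add: msum_empty)
next
  case (insert x X)
  then show ?case using linD[OF assms(1)] by (simp add: msum_insert)
qed

lemma lin_funpow: "lin d \<Phi> \<Longrightarrow> lin d (\<Phi> ^^ m)"
  by (induction m) (auto simp: lin_def)

lemma lin_add: "lin d \<Phi> \<Longrightarrow> lin d \<Psi> \<Longrightarrow> lin d (\<lambda>M. \<Phi> M + \<Psi> M)"
proof -
  assume l: "lin d \<Phi>" "lin d \<Psi>"
  note * = linD[OF l(1)] linD[OF l(2)]
  show ?thesis unfolding lin_def
    by (intro conjI ballI allI eq_carrierI[of _ d])
      (auto simp: * carrier_index[of _ d] algebra_simps simp del: index_add_mat index_smult_mat)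
qed

lemma lin_smult: "lin d \<Phi> \<Longrightarrow> lin d (\<lambda>M. c \<cdot>\<^sub>m \<Phi> M)"
proof -
  assume l: "lin d \<Phi>"
  note * = linD[OF l(1)]
  show ?thesis unfolding lin_def
    by (intro conjI ballI allI eq_carrierI[of _ d])
      (auto simp: * carrier_index[of _ d] algebra_simps simp del: index_add_mat index_smult_mat)
qed

lemma lin_msum: "(\<And>x. x \<in> X \<Longrightarrow> lin d (\<Phi> x)) \<Longrightarrow> lin d (\<lambda>M. msum d (\<lambda>x. \<Phi> x M) X)"
proof -
  assume l: "\<And>x. x \<in> X \<Longrightarrow> lin d (\<Phi> x)"
  show ?thesis unfolding lin_def
  proof (intro conjI ballI allI)
    fix A B :: "complex mat" assume AB: "A \<in> carrier_mat d d" "B \<in> carrier_mat d d"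
    show "msum d (\<lambda>x. \<Phi> x (A + B)) X = msum d (\<lambda>x. \<Phi> x A) X + msum d (\<lambda>x. \<Phi> x B) X"
    proof (rule eq_matI)
      fix i j assume "i < dim_row (msum d (\<lambda>x. \<Phi> x A) X + msum d (\<lambda>x. \<Phi> x B) X)"
        "j < dim_col (msum d (\<lambda>x. \<Phi> x A) X + msum d (\<lambda>x. \<Phi> x B) X)"
      then have ij: "i < d" "j < d" by auto
      have "\<Phi> x (A + B) $$ (i, j) = \<Phi> x A $$ (i, j) + \<Phi> x B $$ (i, j)" if "x \<in> X" for x
        using AB ij by (simp add: linD[OF l[OF that]] carrier_index[of _ d] del: index_add_mat)
      then show "msum d (\<lambda>x. \<Phi> x (A + B)) X $$ (i, j) = (msum d (\<lambda>x. \<Phi> x A) X + msum d (\<lambda>x. \<Phi> x B) X) $$ (i, j)"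
        using ij by (simp add: sum.distrib)
    qed auto
  next
    fix c and A :: "complex mat" assume A: "A \<in> carrier_mat d d"
    show "msum d (\<lambda>x. \<Phi> x (c \<cdot>\<^sub>m A)) X = c \<cdot>\<^sub>m msum d (\<lambda>x. \<Phi> x A) X"
    proof (rule eq_matI)
      fix i j assume "i < dim_row (c \<cdot>\<^sub>m msum d (\<lambda>x. \<Phi> x A) X)" "j < dim_col (c \<cdot>\<^sub>m msum d (\<lambda>x. \<Phi> x A) X)"
      then have ij: "i < d" "j < d" by auto
      have "\<Phi> x (c \<cdot>\<^sub>m A) $$ (i, j) = c * \<Phi> x A $$ (i, j)" if "x \<in> X" for x
        using A ij by (simp add: linD[OF l[OF that]] carrier_index[of _ d] del: index_smult_mat)
      then show "msum d (\<lambda>x. \<Phi> x (c \<cdot>\<^sub>m A)) X $$ (i, j) = (c \<cdot>\<^sub>m msum d (\<lambda>x. \<Phi> x A) X) $$ (i, j)"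
        using ij by (simp add: sum_distrib_left)
    qed auto
  qed simp
qed

lemma lin_sandwich:
  assumes "A \<in> carrier_mat d d" "B \<in> carrier_mat d d"
  shows "lin d (\<lambda>M. A * M * B)"
  unfolding lin_def using assms
  by (auto simp: mult_add_distrib_mat[of _ d d _ d] add_mult_distrib_mat[of _ d d _ _ d]
      mult_smult_distrib[of _ d d _ d] mult_smult_assoc_mat[of _ d d _ d])

lemma lin_left: "A \<in> carrier_mat d d \<Longrightarrow> lin d (\<lambda>M. A * M)"
  unfolding lin_def by (auto simp: mult_add_distrib_mat[of _ d d _ d] mult_smult_distrib[of _ d d _ d])

lemma lin_right: "A \<in> carrier_mat d d \<Longrightarrow> lin d (\<lambda>M. M * A)"
  unfolding lin_def by (auto simp: add_mult_distrib_mat[of _ d d _ _ d] mult_smult_assoc_mat[of _ d d _ d])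

lemma lin_minus: "lin d \<Phi> \<Longrightarrow> lin d \<Psi> \<Longrightarrow> lin d (\<lambda>M. \<Phi> M - \<Psi> M)"
proof -
  assume l: "lin d \<Phi>" "lin d \<Psi>"
  note * = linD[OF l(1)] linD[OF l(2)]
  show ?thesis unfolding lin_def
    by (intro conjI ballI allI eq_carrierI[of _ d])
      (auto simp: * carrier_index[of _ d] minus_carrier algebra_simps
        simp del: index_add_mat index_smult_mat index_minus_mat)
qed

section \<open>The Hilbert-Schmidt norm\<close>

text \<open>Reading the norm as the Euclidean norm of the entries makes the triangle and
  Cauchy-Schwarz inequalities of \<open>L2_set\<close> available.\<close>

lemma hs_norm_L2:
  assumes "A \<in> carrier_mat d d"
  shows "hs_norm A = L2_set (\<lambda>(i, j). cmod (A $$ (i, j))) ({..<d} \<times> {..<d})"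
proof -
  have "mtrace (mat_adjoint A * A) = (\<Sum>i<d. \<Sum>l<d. cnj (A $$ (l, i)) * A $$ (l, i))"
    using assms by (subst mtrace_mult[of _ d]) auto
  also have "\<dots> = (\<Sum>l<d. \<Sum>i<d. cnj (A $$ (l, i)) * A $$ (l, i))" by (rule sum.swap)
  also have "\<dots> = complex_of_real (\<Sum>l<d. \<Sum>i<d. (cmod (A $$ (l, i)))\<^sup>2)"
    by (simp only: of_real_sum complex_norm_square mult.commute[of "cnj _"])
  finally show ?thesis
    by (simp add: hs_norm_def L2_set_def sum.cartesian_product case_prod_unfold)
qed

lemma hs_norm_nonneg: "A \<in> carrier_mat d d \<Longrightarrow> 0 \<le> hs_norm A"
  by (simp add: hs_norm_L2)

lemma hs_norm_triangle:
  assumes "A \<in> carrier_mat d d" "B \<in> carrier_mat d d"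
  shows "hs_norm (A + B) \<le> hs_norm A + hs_norm B"
proof -
  have "hs_norm (A + B) \<le> L2_set (\<lambda>x. (case x of (i, j) \<Rightarrow> cmod (A $$ (i, j))) + (case x of (i, j) \<Rightarrow> cmod (B $$ (i, j))))
      ({..<d} \<times> {..<d})"
    unfolding hs_norm_L2[OF add_carrier_mat[OF assms(2)]] using assms
    by (intro L2_set_mono) (auto intro: norm_triangle_ineq)
  also have "\<dots> \<le> hs_norm A + hs_norm B"
    unfolding hs_norm_L2[OF assms(1)] hs_norm_L2[OF assms(2)] by (rule L2_set_triangle_ineq)
  finally show ?thesis .
qed

lemma hs_norm_smult:
  assumes "A \<in> carrier_mat d d"
  shows "hs_norm (c \<cdot>\<^sub>m A) = cmod c * hs_norm A"
proof -
  have "hs_norm (c \<cdot>\<^sub>m A) = L2_set (\<lambda>x. cmod c * (case x of (i, j) \<Rightarrow> cmod (A $$ (i, j)))) ({..<d} \<times> {..<d})"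
    unfolding hs_norm_L2[OF smult_carrier_mat[OF assms]] using assms
    by (intro L2_set_cong) (auto simp: norm_mult)
  then show ?thesis by (simp add: hs_norm_L2[OF assms] L2_set_right_distrib)
qed

lemma hs_norm_zero: "hs_norm (0\<^sub>m d d) = 0"
  using hs_norm_smult[of "0\<^sub>m d d" d 0] by simp

lemma hs_norm_msum:
  assumes "finite X" "\<And>x. x \<in> X \<Longrightarrow> f x \<in> carrier_mat d d"
  shows "hs_norm (msum d f X) \<le> (\<Sum>x\<in>X. hs_norm (f x))"
  using assms
proof (induction X rule: finite_induct)
  case (insert x X)
  then have "hs_norm (f x + msum d f X) \<le> hs_norm (f x) + hs_norm (msum d f X)"
    by (intro hs_norm_triangle) auto
  then show ?case using insert by (simp add: msum_insert)
qed (simp add: msum_empty hs_norm_zero)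

lemma entry_le_hs_norm:
  assumes "A \<in> carrier_mat d d" "i < d" "j < d"
  shows "cmod (A $$ (i, j)) \<le> hs_norm A"
  unfolding hs_norm_L2[OF assms(1)]
  using member_le_L2_set[of "{..<d} \<times> {..<d}" "(i, j)" "\<lambda>(i, j). cmod (A $$ (i, j))"] assms by simp

lemma hs_norm_eq_0:
  assumes "A \<in> carrier_mat d d" "hs_norm A = 0"
  shows "A = 0\<^sub>m d d"
  using entry_le_hs_norm[OF assms(1)] assms by (intro eq_matI) auto

text \<open>Cauchy-Schwarz for the entries of \<open>A\<close> and of the transpose of
  \<open>B\<close>; transposition only permutes the entries and keeps the norm.\<close>

lemma mtrace_mult_le:
  assumes "A \<in> carrier_mat d d" "B \<in> carrier_mat d d"
  shows "cmod (mtrace (A * B)) \<le> hs_norm A * hs_norm B"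
proof -
  let ?X = "{..<d} \<times> {..<d}"
  have "cmod (mtrace (A * B)) = cmod (\<Sum>(i, j)\<in>?X. A $$ (i, j) * B $$ (j, i))"
    by (simp add: mtrace_mult[OF assms] sum.cartesian_product)
  also have "\<dots> \<le> (\<Sum>(i, j)\<in>?X. cmod (A $$ (i, j)) * cmod (B $$ (j, i)))"
    by (rule order_trans[OF norm_sum]) (simp add: case_prod_unfold norm_mult)
  also have "\<dots> \<le> L2_set (\<lambda>(i, j). cmod (A $$ (i, j))) ?X * L2_set (\<lambda>(i, j). cmod (B $$ (j, i))) ?X"
    using L2_set_mult_ineq[of "\<lambda>(i, j). cmod (A $$ (i, j))" "\<lambda>(i, j). cmod (B $$ (j, i))" ?X]
    by (simp add: case_prod_unfold)
  also have "L2_set (\<lambda>(i, j). cmod (B $$ (j, i))) ?X = hs_norm B"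
    unfolding hs_norm_L2[OF assms(2)] L2_set_def
    by (rule arg_cong[where f = sqrt], rule sum.reindex_bij_witness[of _ prod.swap prod.swap]) auto
  finally show ?thesis unfolding hs_norm_L2[OF assms(1)] .
qed

definition matrix_unit :: "nat \<Rightarrow> nat \<Rightarrow> nat \<Rightarrow> complex mat" where
  "matrix_unit d i j = Matrix.mat d d (\<lambda>ab. if ab = (i, j) then 1 else 0)"

lemma matrix_unit_carrier [intro, simp]: "matrix_unit d i j \<in> carrier_mat d d"
  by (simp add: matrix_unit_def)

lemma msum_matrix_unit:
  assumes "A \<in> carrier_mat d d"
  shows "A = msum d (\<lambda>(i, j). A $$ (i, j) \<cdot>\<^sub>m matrix_unit d i j) ({..<d} \<times> {..<d})"
proof (rule eq_matI)
  fix a b assume "a < dim_row (msum d (\<lambda>(i, j). A $$ (i, j) \<cdot>\<^sub>m matrix_unit d i j) ({..<d} \<times> {..<d}))"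
    "b < dim_col (msum d (\<lambda>(i, j). A $$ (i, j) \<cdot>\<^sub>m matrix_unit d i j) ({..<d} \<times> {..<d}))"
  then have ab: "a < d" "b < d" by auto
  have "(\<Sum>x\<in>{..<d} \<times> {..<d}. (case x of (i, j) \<Rightarrow> A $$ (i, j) \<cdot>\<^sub>m matrix_unit d i j) $$ (a, b))
      = (\<Sum>x\<in>{..<d} \<times> {..<d}. if x = (a, b) then A $$ (a, b) else 0)"
    using ab by (intro sum.cong refl) (auto simp: matrix_unit_def)
  also have "\<dots> = A $$ (a, b)" using ab by (subst sum.delta) auto
  finally show "A $$ (a, b) = msum d (\<lambda>(i, j). A $$ (i, j) \<cdot>\<^sub>m matrix_unit d i j) ({..<d} \<times> {..<d}) $$ (a, b)"
    using ab by simp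
qed (use assms in auto)

text \<open>Expansion in matrix units, whose coefficients are at most the norm of the matrix. The
  constant is crude: it serves to make the supremum in \<open>norm_2_2\<close> finite and the
  exponential series convergent.\<close>

lemma lin_bounded:
  assumes "lin d \<Phi>"
  shows "\<exists>C\<ge>0. \<forall>A\<in>carrier_mat d d. hs_norm (\<Phi> A) \<le> C * hs_norm A"
proof (intro exI conjI ballI)
  let ?X = "{..<d} \<times> {..<d}"
  let ?C = "\<Sum>(i, j)\<in>?X. hs_norm (\<Phi> (matrix_unit d i j))"
  have nn: "0 \<le> hs_norm (\<Phi> (matrix_unit d i j))" for i j
    by (rule hs_norm_nonneg[OF linD(1)[OF assms matrix_unit_carrier]])
  show "0 \<le> ?C" by (intro sum_nonneg) (auto simp: nn)
  fix A :: "complex mat" assume A: "A \<in> carrier_mat d d"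
  have "\<Phi> A = \<Phi> (msum d (\<lambda>(i, j). A $$ (i, j) \<cdot>\<^sub>m matrix_unit d i j) ?X)"
    using msum_matrix_unit[OF A] by simp
  also have "\<dots> = msum d (\<lambda>x. \<Phi> ((\<lambda>(i, j). A $$ (i, j) \<cdot>\<^sub>m matrix_unit d i j) x)) ?X"
    by (rule lin_msum_arg[OF assms]) auto
  finally have "hs_norm (\<Phi> A) \<le> (\<Sum>x\<in>?X. hs_norm (\<Phi> ((\<lambda>(i, j). A $$ (i, j) \<cdot>\<^sub>m matrix_unit d i j) x)))"
    using hs_norm_msum[of ?X "\<lambda>x. \<Phi> ((\<lambda>(i, j). A $$ (i, j) \<cdot>\<^sub>m matrix_unit d i j) x)" d] linD(1)[OF assms]
    by fastforce
  also have "\<dots> \<le> (\<Sum>x\<in>?X. (\<lambda>(i, j). hs_norm (\<Phi> (matrix_unit d i j))) x * hs_norm A)"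
  proof (rule sum_mono)
    fix x assume "x \<in> ?X"
    then obtain i j where x: "x = (i, j)" "i < d" "j < d" by auto
    have "hs_norm (\<Phi> (A $$ (i, j) \<cdot>\<^sub>m matrix_unit d i j)) = cmod (A $$ (i, j)) * hs_norm (\<Phi> (matrix_unit d i j))"
      by (simp add: linD(3)[OF assms] hs_norm_smult[of _ d] linD(1)[OF assms])
    also have "\<dots> \<le> hs_norm A * hs_norm (\<Phi> (matrix_unit d i j))"
      using entry_le_hs_norm[OF A x(2,3)] nn by (rule mult_right_mono)
    finally show "hs_norm (\<Phi> ((\<lambda>(i, j). A $$ (i, j) \<cdot>\<^sub>m matrix_unit d i j) x))
        \<le> (\<lambda>(i, j). hs_norm (\<Phi> (matrix_unit d i j))) x * hs_norm A"
      by (simp add: x mult.commute)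
  qed
  finally show "hs_norm (\<Phi> A) \<le> ?C * hs_norm A"
    by (simp add: sum_distrib_right)
qed

text \<open>A real supremum bounds its members only if the set is bounded, which finite dimension
  provides; the rest is rescaling to norm 1.\<close>

lemma hs_norm_le_norm_2_2:
  assumes "lin d \<Phi>" "A \<in> carrier_mat d d"
  shows "hs_norm (\<Phi> A) \<le> norm_2_2 d \<Phi> * hs_norm A"
proof (cases "hs_norm A = 0")
  case True
  then show ?thesis using hs_norm_eq_0[OF assms(2)] lin_zero[OF assms(1)] by (simp add: hs_norm_zero)
next
  case False
  then have pos: "0 < hs_norm A" using hs_norm_nonneg[OF assms(2)] by simp
  obtain C where C: "0 \<le> C" "\<And>A. A \<in> carrier_mat d d \<Longrightarrow> hs_norm (\<Phi> A) \<le> C * hs_norm A"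
    using lin_bounded[OF assms(1)] by blast
  let ?B = "complex_of_real (1 / hs_norm A) \<cdot>\<^sub>m A"
  have B: "?B \<in> carrier_mat d d" "hs_norm ?B = 1"
    using assms(2) pos by (simp_all add: hs_norm_smult[OF assms(2)] norm_divide)
  have "bdd_above ((\<lambda>A. hs_norm (\<Phi> A)) ` {A \<in> carrier_mat d d. hs_norm A \<le> 1})"
  proof (rule bdd_aboveI2[where M = C], clarify)
    fix A :: "complex mat" assume "A \<in> carrier_mat d d" "hs_norm A \<le> 1"
    then show "hs_norm (\<Phi> A) \<le> C" using C(2)[of A] mult_left_le[of "hs_norm A" C] C(1) by fastforce
  qed
  then have "hs_norm (\<Phi> ?B) \<le> norm_2_2 d \<Phi>"
    unfolding norm_2_2_def using B by (intro cSUP_upper) auto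
  moreover have "hs_norm (\<Phi> ?B) = 1 / hs_norm A * hs_norm (\<Phi> A)"
    using pos by (simp add: linD(3)[OF assms] hs_norm_smult[OF linD(1)[OF assms]] norm_divide)
  ultimately have "1 / hs_norm A * hs_norm (\<Phi> A) \<le> norm_2_2 d \<Phi>" by simp
  then show ?thesis using pos by (simp add: field_simps)
qed

lemma norm_2_2_nonneg: "lin d \<Phi> \<Longrightarrow> 0 \<le> norm_2_2 d \<Phi>"
proof -
  assume l: "lin d \<Phi>"
  obtain C where C: "0 \<le> C" "\<And>A. A \<in> carrier_mat d d \<Longrightarrow> hs_norm (\<Phi> A) \<le> C * hs_norm A"
    using lin_bounded[OF l] by blast
  have "bdd_above ((\<lambda>A. hs_norm (\<Phi> A)) ` {A \<in> carrier_mat d d. hs_norm A \<le> 1})"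
  proof (rule bdd_aboveI2[where M = C], clarify)
    fix A :: "complex mat" assume "A \<in> carrier_mat d d" "hs_norm A \<le> 1"
    then show "hs_norm (\<Phi> A) \<le> C" using C(2)[of A] mult_left_le[of "hs_norm A" C] C(1) by fastforce
  qed
  then have "hs_norm (\<Phi> (0\<^sub>m d d)) \<le> norm_2_2 d \<Phi>"
    unfolding norm_2_2_def by (intro cSUP_upper) (auto simp: hs_norm_zero)
  then show ?thesis by (simp add: lin_zero[OF l] hs_norm_zero)
qed

lemma hs_norm_funpow_le:
  assumes "lin d \<Phi>" "\<And>A. A \<in> carrier_mat d d \<Longrightarrow> hs_norm (\<Phi> A) \<le> C * hs_norm A" "0 \<le> C" "A \<in> carrier_mat d d"
  shows "hs_norm ((\<Phi> ^^ m) A) \<le> C ^ m * hs_norm A"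
proof (induction m)
  case (Suc m)
  have "hs_norm ((\<Phi> ^^ Suc m) A) \<le> C * hs_norm ((\<Phi> ^^ m) A)"
    using assms(2) linD(1)[OF lin_funpow[OF assms(1)] assms(4)] by simp
  also have "\<dots> \<le> C * (C ^ m * hs_norm A)" using Suc assms(3) by (rule mult_left_mono)
  finally show ?case by (simp add: mult.assoc)
qed simp

section \<open>Convergence of the exponential series\<close>

lemma exp_superop_carrier [intro, simp]: "exp_superop d t \<Phi> A \<in> carrier_mat d d"
  by (simp add: exp_superop_def)

text \<open>The exponential is defined entrywise by an infinite sum, which is meaningful only once
  convergence is known. The series is dominated by that of \<open>exp (\<bar>t\<bar> * C)\<close>
  with \<open>C\<close> a norm bound for the generator.\<close>

lemma exp_superop_entry_sums:
  assumes "lin d \<Phi>" "A \<in> carrier_mat d d" "i < d" "j < d"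
  shows "(\<lambda>m. complex_of_real (t ^ m / fact m) * ((\<Phi> ^^ m) A) $$ (i, j)) sums (exp_superop d t \<Phi> A $$ (i, j))"
proof -
  obtain C where C: "0 \<le> C" "\<And>A. A \<in> carrier_mat d d \<Longrightarrow> hs_norm (\<Phi> A) \<le> C * hs_norm A"
    using lin_bounded[OF assms(1)] by blast
  have "summable (\<lambda>m. complex_of_real (t ^ m / fact m) * ((\<Phi> ^^ m) A) $$ (i, j))"
  proof (rule summable_comparison_test')
    show "summable (\<lambda>m. ((\<bar>t\<bar> * C) ^ m / fact m) * hs_norm A)"
      using summable_exp[of "\<bar>t\<bar> * C"] by (intro summable_mult2) (simp add: divide_inverse mult.commute)
    fix m
    have "cmod (((\<Phi> ^^ m) A) $$ (i, j)) \<le> C ^ m * hs_norm A"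
      using entry_le_hs_norm[OF linD(1)[OF lin_funpow[OF assms(1)] assms(2)] assms(3,4), of m]
        hs_norm_funpow_le[OF assms(1) C(2,1) assms(2), of m] by linarith
    then have "\<bar>t\<bar> ^ m / fact m * cmod (((\<Phi> ^^ m) A) $$ (i, j)) \<le> \<bar>t\<bar> ^ m / fact m * (C ^ m * hs_norm A)"
      by (intro mult_left_mono) auto
    then show "cmod (complex_of_real (t ^ m / fact m) * ((\<Phi> ^^ m) A) $$ (i, j)) \<le> ((\<bar>t\<bar> * C) ^ m / fact m) * hs_norm A"
      by (simp add: norm_mult norm_divide norm_power power_mult_distrib)
  qed
  then show ?thesis using assms(3,4) by (simp add: exp_superop_def summable_sums)
qed

lemma mtrace_exp_superop_sums:
  assumes "lin d \<Phi>" "A \<in> carrier_mat d d" "B \<in> carrier_mat d d"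
  shows "(\<lambda>m. complex_of_real (t ^ m / fact m) * mtrace (B * (\<Phi> ^^ m) A)) sums mtrace (B * exp_superop d t \<Phi> A)"
proof -
  note F = linD(1)[OF lin_funpow[OF assms(1)] assms(2)]
  have "(\<lambda>m. \<Sum>i<d. \<Sum>l<d. B $$ (i, l) * (complex_of_real (t ^ m / fact m) * ((\<Phi> ^^ m) A) $$ (l, i)))
      sums (\<Sum>i<d. \<Sum>l<d. B $$ (i, l) * exp_superop d t \<Phi> A $$ (l, i))"
    by (intro sums_sum sums_mult exp_superop_entry_sums assms) auto
  then show ?thesis
    unfolding mtrace_mult[OF assms(3) exp_superop_carrier]
    by (simp add: mtrace_mult[OF assms(3) F] sum_distrib_left mult_ac)
qed

section \<open>Positivity of the semigroup\<close>

lemma square_mat_simps: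
  fixes A B C :: "complex mat"
  assumes "A \<in> carrier_mat d d" "B \<in> carrier_mat d d" "C \<in> carrier_mat d d"
  shows "A * B * C = A * (B * C)" "A * (B + C) = A * B + A * C" "(A + B) * C = A * C + B * C"
    "A * (B - C) = A * B - A * C" "(A - B) * C = A * C - B * C"
    "A * (c \<cdot>\<^sub>m B) = c \<cdot>\<^sub>m (A * B)" "(c \<cdot>\<^sub>m A) * B = c \<cdot>\<^sub>m (A * B)" "A * B \<in> carrier_mat d d"
  using assms
  by (auto simp: assoc_mult_mat[of _ d d _ d _ d] mult_add_distrib_mat[of _ d d _ d]
      add_mult_distrib_mat[of _ d d _ _ d] mult_minus_distrib_mat[of _ d d _ d]
      minus_mult_distrib_mat[of _ d d _ _ d] mult_smult_distrib[of _ d d _ d]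
      mult_smult_assoc_mat[of _ d d _ d])

text \<open>Positivity tested against square matrices instead of vectors. The trace adds the
  quadratic form over the columns of \<open>X\<close>, so both tests agree, and the closure
  properties become trace identities.\<close>

definition posm :: "nat \<Rightarrow> complex mat \<Rightarrow> bool" where
  "posm d M \<longleftrightarrow> M \<in> carrier_mat d d \<and> (\<forall>X\<in>carrier_mat d d. 0 \<le> Re (mtrace (mat_adjoint X * (M * X))))"

lemma posm_add: "posm d A \<Longrightarrow> posm d B \<Longrightarrow> posm d (A + B)"
  unfolding posm_def by (auto simp: square_mat_simps[of _ d] mtrace_add[of _ d])

lemma posm_smult: "posm d A \<Longrightarrow> 0 \<le> s \<Longrightarrow> posm d (complex_of_real s \<cdot>\<^sub>m A)"
  unfolding posm_def by (auto simp: square_mat_simps[of _ d] mtrace_smult[of _ d])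

lemma posm_zero: "posm d (0\<^sub>m d d)"
  unfolding posm_def by (auto simp: mtrace_def)

lemma posm_msum:
  "finite X \<Longrightarrow> (\<And>x. x \<in> X \<Longrightarrow> posm d (f x)) \<Longrightarrow> posm d (msum d f X)"
proof (induction X rule: finite_induct)
  case (insert x X)
  then have "f x \<in> carrier_mat d d" by (simp add: posm_def)
  then show ?case using insert by (auto simp: msum_insert intro: posm_add)
qed (simp add: msum_empty posm_zero)

lemma posm_sandwich:
  assumes "posm d M" "A \<in> carrier_mat d d"
  shows "posm d (A * M * mat_adjoint A)"
proof -
  have M: "M \<in> carrier_mat d d" using assms(1) by (simp add: posm_def)
  have "0 \<le> Re (mtrace (mat_adjoint X * (A * M * mat_adjoint A * X)))" if X: "X \<in> carrier_mat d d" for X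
  proof -
    have "mat_adjoint X * (A * M * mat_adjoint A * X)
        = mat_adjoint (mat_adjoint A * X) * (M * (mat_adjoint A * X))"
      using M X assms(2) by (simp add: mat_adjoint_mult[of _ d] square_mat_simps[of _ d])
    then show ?thesis using assms X M by (simp add: posm_def square_mat_simps[of _ d])
  qed
  then show ?thesis using M assms(2) by (simp add: posm_def square_mat_simps[of _ d])
qed

text \<open>The projector itself is the test matrix: by cyclicity the trace of \<open>E * M\<close>
  is that of \<open>E * M * E\<close>.\<close>

lemma mtrace_projector_posm:
  assumes "posm d M" "E \<in> carrier_mat d d" "E * E = E" "mat_adjoint E = E"
  shows "0 \<le> Re (mtrace (E * M))"
proof -
  have M: "M \<in> carrier_mat d d" using assms(1) by (simp add: posm_def)
  have "mtrace (mat_adjoint E * (M * E)) = mtrace (E * E * M)"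
    using M assms(2,4) mtrace_commute[of "E * M" d E] by (simp add: square_mat_simps[of _ d])
  then show ?thesis using assms by (metis posm_def)
qed

lemma posm_projector:
  assumes "E \<in> carrier_mat d d" "E * E = E" "mat_adjoint E = E"
  shows "posm d E"
proof -
  have "0 \<le> Re (mtrace (mat_adjoint X * (E * X)))" if X: "X \<in> carrier_mat d d" for X
  proof -
    have "mat_adjoint X * (E * X) = mat_adjoint X * (E * E * X)" using assms(2) by simp
    also have "\<dots> = mat_adjoint (E * X) * (E * X)"
      using X assms(1,3) by (simp add: mat_adjoint_mult[of _ d] square_mat_simps[of _ d])
    finally have "mtrace (mat_adjoint X * (E * X)) = (\<Sum>i<d. \<Sum>l<d. cnj ((E * X) $$ (l, i)) * (E * X) $$ (l, i))"
      using X assms(1) by (simp add: mtrace_mult[of _ d] square_mat_simps[of _ d] carrier_index(4)[of _ d]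
          del: mat_adjoint_index index_mult_mat(1))
    also have "\<dots> = complex_of_real (\<Sum>i<d. \<Sum>l<d. (cmod ((E * X) $$ (l, i)))\<^sup>2)"
      by (simp only: of_real_sum complex_norm_square mult.commute[of "cnj _"])
    finally show ?thesis by (simp add: sum_nonneg)
  qed
  then show ?thesis using assms by (simp add: posm_def)
qed

section \<open>Euler products converging to the semigroup\<close>

text \<open>Pascal's rule. \<open>g m\<close> stands for the trace against the \<open>m\<close>-th
  power of the generator, and one more Euler step replaces it by
  \<open>g m + s * g (Suc m)\<close>.\<close>

lemma sum_binomial_Suc:
  fixes g :: "nat \<Rightarrow> complex"
  shows "(\<Sum>m\<le>N. of_nat (N choose m) * s ^ m * (g m + s * g (Suc m)))
    = (\<Sum>m\<le>Suc N. of_nat (Suc N choose m) * s ^ m * g m)"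
proof -
  define X where "X m = s ^ Suc m * g (Suc m)" for m
  have "(\<Sum>m\<le>N. of_nat (N choose m) * s ^ m * (g m + s * g (Suc m)))
      = (\<Sum>m\<le>N. of_nat (N choose m) * s ^ m * g m) + (\<Sum>m\<le>N. of_nat (N choose m) * X m)"
    unfolding X_def sum.distrib[symmetric] by (intro sum.cong refl) (simp add: algebra_simps)
  also have "(\<Sum>m\<le>N. of_nat (N choose m) * s ^ m * g m) = (\<Sum>m\<le>Suc N. of_nat (N choose m) * s ^ m * g m)"
    by simp
  also have "\<dots> = g 0 + (\<Sum>m\<le>N. of_nat (N choose Suc m) * X m)"
    unfolding sum.atMost_Suc_shift X_def by (simp only: mult.assoc) simp
  also have "g 0 + (\<Sum>m\<le>N. of_nat (N choose Suc m) * X m) + (\<Sum>m\<le>N. of_nat (N choose m) * X m)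
      = g 0 + (\<Sum>m\<le>N. of_nat (Suc N choose Suc m) * X m)"
    by (simp add: sum.distrib distrib_right)
  also have "\<dots> = (\<Sum>m\<le>Suc N. of_nat (Suc N choose m) * s ^ m * g m)"
    unfolding sum.atMost_Suc_shift X_def by (simp only: mult.assoc) simp
  finally show ?thesis .
qed

text \<open>The binomial expansion of the \<open>N\<close>-th power of \<open>1 + s B\<close>, taken
  under the trace so that only scalar sums have to be rearranged.\<close>

lemma mtrace_funpow_euler:
  assumes "lin d B" "E \<in> carrier_mat d d" "M \<in> carrier_mat d d"
  shows "mtrace (E * ((\<lambda>A. A + s \<cdot>\<^sub>m B A) ^^ N) M)
    = (\<Sum>m\<le>N. of_nat (N choose m) * s ^ m * mtrace (E * (B ^^ m) M))"
  using assms(3)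
proof (induction N arbitrary: M)
  case (Suc N)
  let ?g = "\<lambda>m. mtrace (E * (B ^^ m) M)"
  note c = linD(1)[OF lin_funpow[OF assms(1)]] linD(1)[OF assms(1)]
  have "(B ^^ m) (M + s \<cdot>\<^sub>m B M) = (B ^^ m) M + s \<cdot>\<^sub>m (B ^^ Suc m) M" for m
    using Suc.prems c by (simp add: linD[OF lin_funpow[OF assms(1)]] funpow_swap1)
  then have g: "mtrace (E * (B ^^ m) (M + s \<cdot>\<^sub>m B M)) = ?g m + s * ?g (Suc m)" for m
    using Suc.prems assms(2) c
    by (simp add: square_mat_simps[of _ d] mtrace_add[of _ d] mtrace_smult[of _ d] del: funpow.simps)
  have "mtrace (E * ((\<lambda>A. A + s \<cdot>\<^sub>m B A) ^^ Suc N) M)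
      = mtrace (E * ((\<lambda>A. A + s \<cdot>\<^sub>m B A) ^^ N) (M + s \<cdot>\<^sub>m B M))"
    by (simp only: funpow_Suc_right o_apply)
  also have "\<dots> = (\<Sum>m\<le>N. of_nat (N choose m) * s ^ m * (?g m + s * ?g (Suc m)))"
    using Suc.IH[of "M + s \<cdot>\<^sub>m B M"] Suc.prems c by (simp add: g del: funpow.simps)
  also have "\<dots> = (\<Sum>m\<le>Suc N. of_nat (Suc N choose m) * s ^ m * ?g m)"
    by (rule sum_binomial_Suc)
  finally show ?case .
qed simp

lemma binomial_over_power_tendsto:
  "(\<lambda>N. real (N choose m) / real N ^ m) \<longlonglongrightarrow> 1 / fact m"
proof -
  have "(\<lambda>N. (\<Prod>i=0..<m. (real N - real i) / real N) / fact m) \<longlonglongrightarrow> (\<Prod>i=0..<m. 1) / fact m"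
  proof (intro tendsto_divide tendsto_prod tendsto_const)
    fix i show "(\<lambda>N. (real N - real i) / real N) \<longlonglongrightarrow> 1" by real_asymp
  qed simp
  moreover have "(\<Prod>i=0..<m. (real N - real i) / real N) / fact m = real (N choose m) / real N ^ m" for N
    by (simp add: binomial_gbinomial gbinomial_prod_rev prod_dividef)
  ultimately show ?thesis by simp
qed

text \<open>In the binomial expansion, the \<open>m\<close>-th term tends to the \<open>m\<close>-th
  term of the exponential series, because \<open>N choose m\<close> over \<open>N ^ m\<close> tends
  to \<open>1 / fact m\<close> and the perturbation \<open>K\<close> enters with a factor
  \<open>t / N\<close>. Tannery's theorem exchanges limit and sum, with majorant
  \<open>(t * C) ^ m / fact m\<close>. The freedom in \<open>K\<close> is what allows Euler steps
  that are visibly positive.\<close>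

lemma euler_product_tendsto:
  fixes t :: real
  assumes L: "lin d L" and K: "lin d K" and E: "E \<in> carrier_mat d d" and M: "M \<in> carrier_mat d d" and t: "0 \<le> t"
  defines "B \<equiv> \<lambda>s A. L A + complex_of_real s \<cdot>\<^sub>m K A"
  shows "(\<lambda>N. mtrace (E * ((\<lambda>A. A + complex_of_real (t / real N) \<cdot>\<^sub>m B (t / real N) A) ^^ N) M))
    \<longlonglongrightarrow> mtrace (E * exp_superop d t L M)"
proof -
  have B: "lin d (B s)" for s unfolding B_def by (intro lin_add lin_smult L K)
  note cB = linD(1)[OF B] linD(1)[OF lin_funpow[OF B]] and cL = linD(1)[OF L] linD(1)[OF lin_funpow[OF L]]
    and cK = linD(1)[OF K]
  obtain a where a: "0 \<le> a" "\<And>A. A \<in> carrier_mat d d \<Longrightarrow> hs_norm (L A) \<le> a * hs_norm A"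
    using lin_bounded[OF L] by blast
  obtain b where b: "0 \<le> b" "\<And>A. A \<in> carrier_mat d d \<Longrightarrow> hs_norm (K A) \<le> b * hs_norm A"
    using lin_bounded[OF K] by blast
  define C where "C = a + b"
  have C: "0 \<le> C" using a b by (simp add: C_def)
  have BC: "hs_norm (B s A) \<le> C * hs_norm A" if "A \<in> carrier_mat d d" "0 \<le> s" "s \<le> 1" for s A
  proof -
    have "hs_norm (B s A) \<le> hs_norm (L A) + s * hs_norm (K A)"
      unfolding B_def using hs_norm_triangle[of "L A" d "complex_of_real s \<cdot>\<^sub>m K A"] cL cK that
      by (simp add: hs_norm_smult[of _ d])
    also have "s * hs_norm (K A) \<le> 1 * hs_norm (K A)"
      using that hs_norm_nonneg[OF cK[OF that(1)]] by (intro mult_right_mono)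
    finally show ?thesis using a(2)[OF that(1)] b(2)[OF that(1)] by (simp add: C_def algebra_simps)
  qed
  \<comment> \<open>For fixed \<open>m\<close> the powers of the perturbed and the exact generator
    differ by at most a constant times \<open>s\<close>. With \<open>X\<close> and \<open>Y\<close>
    the previous powers, the new difference is \<open>B s (X - Y)\<close> plus \<open>s\<close>
    times \<open>K Y\<close>.\<close>
  have diff: "\<exists>c. \<forall>s. 0 \<le> s \<longrightarrow> s \<le> 1 \<longrightarrow> hs_norm ((B s ^^ m) M - (L ^^ m) M) \<le> c * s" for m
  proof (induction m)
    case 0
    have "hs_norm (M - M) = 0" using M hs_norm_zero[of d] by simp
    then show ?case by (intro exI[of _ 0]) simp
  next
    case (Suc m)
    then obtain c where c: "\<And>s. 0 \<le> s \<Longrightarrow> s \<le> 1 \<Longrightarrow> hs_norm ((B s ^^ m) M - (L ^^ m) M) \<le> c * s" by blast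
    let ?k = "hs_norm (K ((L ^^ m) M))"
    have "hs_norm ((B s ^^ Suc m) M - (L ^^ Suc m) M) \<le> (C * c + ?k) * s" if s: "0 \<le> s" "s \<le> 1" for s
    proof -
      let ?X = "(B s ^^ m) M" and ?Y = "(L ^^ m) M"
      have X: "?X \<in> carrier_mat d d" and Y: "?Y \<in> carrier_mat d d" using cB cL M by auto
      have D: "?X - ?Y \<in> carrier_mat d d" using X Y by (rule minus_carrier)
      have "?X = (?X - ?Y) + ?Y" using X Y by (intro eq_carrierI[of _ d]) auto
      then have "B s ?X = B s (?X - ?Y) + B s ?Y" using linD(2)[OF B D Y] by metis
      then have "B s ?X - L ?Y = B s (?X - ?Y) + complex_of_real s \<cdot>\<^sub>m K ?Y"
        using cB(1)[OF D] cL(1)[OF Y] cK[OF Y]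
        by (intro eq_carrierI[of _ d]) (auto simp: B_def)
      then have "hs_norm (B s ?X - L ?Y) \<le> hs_norm (B s (?X - ?Y)) + s * ?k"
        using hs_norm_triangle[OF cB(1)[OF D], of "complex_of_real s \<cdot>\<^sub>m K ?Y"] cK[OF Y] s
        by (simp add: hs_norm_smult[of _ d])
      also have "hs_norm (B s (?X - ?Y)) \<le> C * (c * s)"
        using BC[OF D s] c[OF s] C by (meson mult_left_mono order_trans)
      finally show ?thesis by (simp add: algebra_simps)
    qed
    then show ?case by blast
  qed
  have lim: "(\<lambda>N. mtrace (E * (B (t / real N) ^^ m) M)) \<longlonglongrightarrow> mtrace (E * (L ^^ m) M)" for m
  proof -
    obtain c where c: "\<And>s. 0 \<le> s \<Longrightarrow> s \<le> 1 \<Longrightarrow> hs_norm ((B s ^^ m) M - (L ^^ m) M) \<le> c * s" using diff by blast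
    have bnd: "\<forall>\<^sub>F N in sequentially. cmod (mtrace (E * (B (t / real N) ^^ m) M) - mtrace (E * (L ^^ m) M))
        \<le> hs_norm E * (c * (t / real N))"
    \<comment> \<open>From this index on the step size \<open>t / real N\<close> lies between 0 and
      1, the range in which the difference bound applies.\<close>
    proof (rule eventually_sequentiallyI[of "nat \<lceil>t\<rceil> + 1"])
      fix N assume "nat \<lceil>t\<rceil> + 1 \<le> N"
      then have "t \<le> real N" "0 < N" by linarith+
      then have s: "0 \<le> t / real N" "t / real N \<le> 1" using t by (auto simp: field_simps)
      let ?X = "(B (t / real N) ^^ m) M" and ?Y = "(L ^^ m) M"
      have X: "?X \<in> carrier_mat d d" and Y: "?Y \<in> carrier_mat d d" using cB cL M by auto
      have "mtrace (E * ?X) - mtrace (E * ?Y) = mtrace (E * (?X - ?Y))"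
        using X Y E by (simp add: square_mat_simps[of _ d] mtrace_minus[of _ d])
      also have "cmod \<dots> \<le> hs_norm E * hs_norm (?X - ?Y)" by (rule mtrace_mult_le[OF E minus_carrier[OF X Y]])
      also have "\<dots> \<le> hs_norm E * (c * (t / real N))"
        using c[OF s] hs_norm_nonneg[OF E] by (rule mult_left_mono)
      finally show "cmod (mtrace (E * ?X) - mtrace (E * ?Y)) \<le> hs_norm E * (c * (t / real N))" .
    qed
    have "(\<lambda>N. hs_norm E * (c * (t / real N))) \<longlonglongrightarrow> 0" by real_asymp
    from Lim_null_comparison[OF bnd this] show ?thesis by (simp add: LIM_zero_iff)
  qed
  define F where "F m N = complex_of_real (real (N choose m) / real N ^ m * t ^ m) * mtrace (E * (B (t / real N) ^^ m) M)" for m N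
  define G where "G m = complex_of_real (1 / fact m * t ^ m) * mtrace (E * (L ^^ m) M)" for m
  have "((\<lambda>N. \<Sum>m. F m N) \<longlongrightarrow> suminf G) sequentially"
  proof (rule tannerys_theorem[THEN conjunct2, THEN conjunct2])
    show "F m \<longlonglongrightarrow> G m" for m
      unfolding F_def G_def
      by (intro tendsto_mult tendsto_of_real tendsto_const binomial_over_power_tendsto lim)
    show "summable (\<lambda>m. ((t * C) ^ m / fact m) * (hs_norm E * hs_norm M))"
      using summable_exp[of "t * C"] by (intro summable_mult2) (simp add: divide_inverse mult.commute)
    have "cmod (F m N) \<le> ((t * C) ^ m / fact m) * (hs_norm E * hs_norm M)" if N: "nat \<lceil>t\<rceil> + 1 \<le> N" for m N
    proof -
      have "t \<le> real N" "0 < N" using N by linarith+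
      then have s: "0 \<le> t / real N" "t / real N \<le> 1" using t by (auto simp: field_simps)
      have "cmod (mtrace (E * (B (t / real N) ^^ m) M)) \<le> hs_norm E * hs_norm ((B (t / real N) ^^ m) M)"
        by (rule mtrace_mult_le[OF E cB(2)[OF M]])
      also have "\<dots> \<le> hs_norm E * (C ^ m * hs_norm M)"
        using hs_norm_funpow_le[OF B BC[OF _ s] C M] hs_norm_nonneg[OF E] by (intro mult_left_mono)
      finally have 1: "cmod (mtrace (E * (B (t / real N) ^^ m) M)) \<le> C ^ m * (hs_norm E * hs_norm M)"
        by (simp add: mult_ac)
      have "real ((N choose m) * fact m) \<le> real (N ^ m)"
        using binomial_fact_pow[of N m] by (simp only: of_nat_le_iff)
      then have "real (N choose m) / real N ^ m \<le> 1 / fact m"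
        using \<open>0 < N\<close> by (simp add: field_simps)
      then have 2: "real (N choose m) / real N ^ m * t ^ m \<le> 1 / fact m * t ^ m"
        using t by (intro mult_right_mono) auto
      have "cmod (F m N) = (real (N choose m) / real N ^ m * t ^ m) * cmod (mtrace (E * (B (t / real N) ^^ m) M))"
        unfolding F_def norm_mult norm_of_real using t by simp
      also have "\<dots> \<le> (1 / fact m * t ^ m) * (C ^ m * (hs_norm E * hs_norm M))"
        by (intro mult_mono 1 2) (use t in auto)
      finally show ?thesis by (simp add: power_mult_distrib mult_ac)
    qed
    then have "\<forall>\<^sub>F N in sequentially. \<forall>m. cmod (F m N) \<le> ((t * C) ^ m / fact m) * (hs_norm E * hs_norm M)"
      by (intro eventually_sequentiallyI) blast
    from eventually_prodI[OF eventually_True[of at_top] this]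
    show "\<forall>\<^sub>F (m, N) in at_top \<times>\<^sub>F sequentially. cmod (F m N) \<le> ((t * C) ^ m / fact m) * (hs_norm E * hs_norm M)"
      by (rule eventually_mono) (simp add: case_prod_beta)
  qed simp
  moreover have "(\<Sum>m. F m N) = mtrace (E * ((\<lambda>A. A + complex_of_real (t / real N) \<cdot>\<^sub>m B (t / real N) A) ^^ N) M)" for N
  proof -
    \<comment> \<open>Binomial coefficients vanish beyond \<open>N\<close>, so the series fed to
      Tannery's theorem is the finite expansion.\<close>
    have "(\<Sum>m. F m N) = (\<Sum>m\<le>N. F m N)" by (rule suminf_finite) (auto simp: F_def)
    also have "\<dots> = (\<Sum>m\<le>N. of_nat (N choose m) * complex_of_real (t / real N) ^ m * mtrace (E * (B (t / real N) ^^ m) M))"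
      by (intro sum.cong refl) (simp add: F_def power_divide)
    finally show ?thesis by (simp only: mtrace_funpow_euler[OF B E M])
  qed
  moreover have "suminf G = mtrace (E * exp_superop d t L M)"
  proof -
    have "G = (\<lambda>m. complex_of_real (t ^ m / fact m) * mtrace (E * (L ^^ m) M))"
      by (simp add: G_def fun_eq_iff)
    then show ?thesis using sums_unique[OF mtrace_exp_superop_sums[OF L M E, of t]] by (simp only:)
  qed
  ultimately show ?thesis by simp
qed

text \<open>The maps \<open>M + s L(M) + s\<^sup>2 K M K\<^sup>\<dagger> = (1 + s K) M (1 + s K)\<^sup>\<dagger> + s \<Sum> L\<^sub>x M L\<^sub>x\<^sup>\<dagger>\<close> are
  positive, and their \<open>N\<close>-th iterates with \<open>s = t / N\<close> converge to the exponential.\<close>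

lemma mtrace_exp_lindblad_nonneg:
  assumes K: "K \<in> carrier_mat d d" and J: "finite X" "\<And>x. x \<in> X \<Longrightarrow> J x \<in> carrier_mat d d"
    and L: "\<And>M. M \<in> carrier_mat d d \<Longrightarrow>
      L M = (K * M + M * mat_adjoint K) + msum d (\<lambda>x. J x * M * mat_adjoint (J x)) X"
    and lin: "lin d L"
    and E: "E \<in> carrier_mat d d" "E * E = E" "mat_adjoint E = E"
    and M: "posm d M" and t: "0 \<le> t"
  shows "0 \<le> Re (mtrace (E * exp_superop d t L M))"
proof -
  let ?K = "\<lambda>A. K * A * mat_adjoint K"
  let ?B = "\<lambda>s A. L A + complex_of_real s \<cdot>\<^sub>m ?K A"
  let ?\<Lambda> = "\<lambda>s A. A + complex_of_real s \<cdot>\<^sub>m ?B s A"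
  have linK: "lin d ?K" using K by (intro lin_sandwich) auto
  have step: "posm d (?\<Lambda> s A)" if A: "posm d A" and s: "0 \<le> s" for s A
  proof -
    have cA: "A \<in> carrier_mat d d" using A by (simp add: posm_def)
    let ?I = "1\<^sub>m d + complex_of_real s \<cdot>\<^sub>m K"
    let ?J = "\<lambda>x. J x * A * mat_adjoint (J x)"
    have I: "?I \<in> carrier_mat d d" using K by simp
    have adj: "mat_adjoint ?I = 1\<^sub>m d + complex_of_real s \<cdot>\<^sub>m mat_adjoint K"
      using K by (intro eq_carrierI[of _ d]) (auto simp: carrier_index[of _ d])
    have "?I * A * mat_adjoint ?I = A + complex_of_real s \<cdot>\<^sub>m (K * A + A * mat_adjoint K)
        + complex_of_real (s * s) \<cdot>\<^sub>m (K * A * mat_adjoint K)"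
    proof -
      have "?I * A * mat_adjoint ?I = (A + complex_of_real s \<cdot>\<^sub>m (K * A)) * (1\<^sub>m d + complex_of_real s \<cdot>\<^sub>m mat_adjoint K)"
        unfolding adj using K cA by (simp add: square_mat_simps[of _ d])
      also have "\<dots> = (A + complex_of_real s \<cdot>\<^sub>m (K * A))
          + (complex_of_real s \<cdot>\<^sub>m (A * mat_adjoint K) + complex_of_real s \<cdot>\<^sub>m (complex_of_real s \<cdot>\<^sub>m (K * A * mat_adjoint K)))"
      proof -
        have kc: "complex_of_real s \<cdot>\<^sub>m mat_adjoint K \<in> carrier_mat d d" "A + complex_of_real s \<cdot>\<^sub>m (K * A) \<in> carrier_mat d d"
          using K cA by (auto intro!: add_carrier_mat smult_carrier_mat mult_carrier_mat)
        show ?thesis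
          using kc K cA square_mat_simps(2)[OF kc(2) one_carrier_mat kc(1)]
          by (simp add: square_mat_simps[of _ d], intro eq_carrierI[of _ d])
            (auto simp: algebra_simps intro!: mult_carrier_mat simp del: index_mult_mat(1))
      qed
      also have "\<dots> = A + complex_of_real s \<cdot>\<^sub>m (K * A + A * mat_adjoint K)
        + complex_of_real (s * s) \<cdot>\<^sub>m (K * A * mat_adjoint K)"
      proof (rule eq_carrierI[of _ d])
        fix i j assume "i < d" "j < d"
        moreover have "K * A \<in> carrier_mat d d" "A * mat_adjoint K \<in> carrier_mat d d" "K * A * mat_adjoint K \<in> carrier_mat d d"
          using K cA by (auto intro!: mult_carrier_mat)
        ultimately show "((A + complex_of_real s \<cdot>\<^sub>m (K * A))
          + (complex_of_real s \<cdot>\<^sub>m (A * mat_adjoint K) + complex_of_real s \<cdot>\<^sub>m (complex_of_real s \<cdot>\<^sub>m (K * A * mat_adjoint K)))) $$ (i, j)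
          = (A + complex_of_real s \<cdot>\<^sub>m (K * A + A * mat_adjoint K)
        + complex_of_real (s * s) \<cdot>\<^sub>m (K * A * mat_adjoint K)) $$ (i, j)"
          using cA by (simp add: carrier_index[of _ d] algebra_simps del: index_add_mat index_smult_mat index_mult_mat)
      qed (use K cA in \<open>auto intro!: mult_carrier_mat\<close>)
      finally show ?thesis .
    qed
    moreover have "?\<Lambda> s A = (A + complex_of_real s \<cdot>\<^sub>m (K * A + A * mat_adjoint K)
        + complex_of_real (s * s) \<cdot>\<^sub>m (K * A * mat_adjoint K)) + complex_of_real s \<cdot>\<^sub>m msum d ?J X"
    proof (rule eq_carrierI[of _ d])
      have c: "K * A \<in> carrier_mat d d" "A * mat_adjoint K \<in> carrier_mat d d" "K * A * mat_adjoint K \<in> carrier_mat d d"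
        using K cA by (auto intro!: mult_carrier_mat)
      show "?\<Lambda> s A \<in> carrier_mat d d" using linD(1)[OF lin cA] c cA by auto
      fix i j assume ij: "i < d" "j < d"
      show "?\<Lambda> s A $$ (i, j) = ((A + complex_of_real s \<cdot>\<^sub>m (K * A + A * mat_adjoint K)
        + complex_of_real (s * s) \<cdot>\<^sub>m (K * A * mat_adjoint K)) + complex_of_real s \<cdot>\<^sub>m msum d ?J X) $$ (i, j)"
        unfolding L[OF cA] using ij c cA
        by (simp add: carrier_index[of _ d] algebra_simps
            del: index_add_mat index_smult_mat index_mult_mat msum_index)
    qed (use K cA in \<open>auto intro!: mult_carrier_mat\<close>)
    ultimately have "?\<Lambda> s A = ?I * A * mat_adjoint ?I + complex_of_real s \<cdot>\<^sub>m msum d ?J X" by simp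
    moreover have "posm d (?I * A * mat_adjoint ?I + complex_of_real s \<cdot>\<^sub>m msum d ?J X)"
      by (intro posm_add posm_smult posm_msum posm_sandwich A I s J)
    ultimately show ?thesis by simp
  qed
  have iter: "posm d ((?\<Lambda> s ^^ N) M)" if "0 \<le> s" for s N
    by (induction N) (use M step that in auto)
  have lim: "(\<lambda>N. Re (mtrace (E * (?\<Lambda> (t / real N) ^^ N) M))) \<longlonglongrightarrow> Re (mtrace (E * exp_superop d t L M))"
    using M by (intro tendsto_Re euler_product_tendsto[OF lin linK E(1) _ t]) (simp add: posm_def)
  show ?thesis
    by (rule LIMSEQ_le_const[OF lim], intro exI allI impI, rule mtrace_projector_posm[OF iter E])
      (simp add: t)
qed

section \<open>The Lindbladian and its dual\<close>

definition herm_preserving :: "nat \<Rightarrow> superop \<Rightarrow> bool" where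
  "herm_preserving d \<Phi> \<longleftrightarrow> (\<forall>M\<in>carrier_mat d d. mat_adjoint (\<Phi> M) = \<Phi> (mat_adjoint M))"

text \<open>Duality for the bilinear trace pairing, which involves no conjugation. For maps that
  preserve adjoints it coincides with the Hilbert-Schmidt adjoint.\<close>

definition dual_maps :: "nat \<Rightarrow> superop \<Rightarrow> superop \<Rightarrow> bool" where
  "dual_maps d \<Phi> \<Psi> \<longleftrightarrow>
    (\<forall>X\<in>carrier_mat d d. \<forall>M\<in>carrier_mat d d. mtrace (X * \<Phi> M) = mtrace (\<Psi> X * M))"

definition ham_dual :: "complex mat \<Rightarrow> superop" where
  "ham_dual H X = \<i> \<cdot>\<^sub>m (H * X - X * H)"

definition dissipator_dual :: "complex mat \<Rightarrow> superop" where
  "dissipator_dual L X = mat_adjoint L * X * L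
     - (1 / 2) \<cdot>\<^sub>m (mat_adjoint L * L * X + X * (mat_adjoint L * L))"

lemma lin_ham_part: "H \<in> carrier_mat d d \<Longrightarrow> lin d (ham_part H)"
  unfolding ham_part_def by (intro lin_smult lin_minus lin_left lin_right)

lemma lin_ham_dual: "H \<in> carrier_mat d d \<Longrightarrow> lin d (ham_dual H)"
  unfolding ham_dual_def by (intro lin_smult lin_minus lin_left lin_right)

lemma lin_dissipator: "L \<in> carrier_mat d d \<Longrightarrow> lin d (dissipator L)"
  unfolding dissipator_def
  by (intro lin_smult lin_minus lin_add lin_left lin_right lin_sandwich mult_carrier_mat[of _ d d]) auto

lemma lin_dissipator_dual: "L \<in> carrier_mat d d \<Longrightarrow> lin d (dissipator_dual L)"
  unfolding dissipator_dual_def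
  by (intro lin_smult lin_minus lin_add lin_left lin_right lin_sandwich mult_carrier_mat[of _ d d]) auto

lemma dual_ham_part:
  assumes "H \<in> carrier_mat d d"
  shows "dual_maps d (ham_part H) (ham_dual H)"
  unfolding dual_maps_def
proof (intro ballI)
  fix X M :: "complex mat" assume c: "X \<in> carrier_mat d d" "M \<in> carrier_mat d d"
  have "mtrace (X * (M * H)) = mtrace (H * (X * M))"
    using mtrace_commute[of "X * M" d H] c assms by (simp add: square_mat_simps[of _ d])
  then show "mtrace (X * ham_part H M) = mtrace (ham_dual H X * M)"
    using c assms unfolding ham_part_def ham_dual_def
    by (simp add: square_mat_simps[of _ d] mtrace_smult[of _ d] mtrace_minus[of _ d] minus_carrier[of _ d] algebra_simps)
qed

lemma dual_dissipator:
  assumes "L \<in> carrier_mat d d"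
  shows "dual_maps d (dissipator L) (dissipator_dual L)"
  unfolding dual_maps_def
proof (intro ballI)
  fix X M :: "complex mat" assume c: "X \<in> carrier_mat d d" "M \<in> carrier_mat d d"
  let ?A = "mat_adjoint L"
  have A: "?A \<in> carrier_mat d d" using assms by auto
  have 1: "mtrace (X * (L * (M * ?A))) = mtrace (?A * (X * (L * M)))"
    using mtrace_commute[of "X * (L * M)" d ?A] c assms A by (simp add: square_mat_simps[of _ d])
  have 2: "mtrace (X * (M * (?A * L))) = mtrace (?A * (L * (X * M)))"
    using mtrace_commute[of "X * M" d "?A * L"] c assms A by (simp add: square_mat_simps[of _ d])
  show "mtrace (X * dissipator L M) = mtrace (dissipator_dual L X * M)"
    using c assms A 1 2 unfolding dissipator_def dissipator_dual_def
    by (simp add: square_mat_simps[of _ d] mtrace_smult[of _ d] mtrace_minus[of _ d] mtrace_add[of _ d] minus_carrier[of _ d])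
qed

lemma herm_ham_part:
  assumes "H \<in> carrier_mat d d" "mat_adjoint H = H"
  shows "herm_preserving d (ham_part H)"
  unfolding herm_preserving_def
proof (intro ballI)
  fix M :: "complex mat" assume c: "M \<in> carrier_mat d d"
  have "mat_adjoint (ham_part H M) = \<i> \<cdot>\<^sub>m (mat_adjoint M * H - H * mat_adjoint M)"
    using c assms unfolding ham_part_def
    by (simp add: mat_adjoint_smult mat_adjoint_minus[of _ d] mat_adjoint_mult[of _ d] square_mat_simps[of _ d])
  also have "\<dots> = ham_part H (mat_adjoint M)"
  proof (rule eq_carrierI[of _ d])
    have p: "mat_adjoint M * H \<in> carrier_mat d d" "H * mat_adjoint M \<in> carrier_mat d d"
      using c assms by (auto intro: mult_carrier_mat)
    fix i j assume "i < d" "j < d"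
    then show "(\<i> \<cdot>\<^sub>m (mat_adjoint M * H - H * mat_adjoint M)) $$ (i, j) = ham_part H (mat_adjoint M) $$ (i, j)"
      unfolding ham_part_def using p minus_carrier[OF p] minus_carrier[OF p(2,1)]
      by (simp add: carrier_index[of _ d] algebra_simps del: index_mult_mat(1) index_smult_mat(1) index_minus_mat(1))
  qed (use c assms in \<open>auto simp: ham_part_def intro!: mult_carrier_mat minus_carrier smult_carrier_mat\<close>)
  finally show "mat_adjoint (ham_part H M) = ham_part H (mat_adjoint M)" .
qed

lemma herm_dissipator:
  assumes "L \<in> carrier_mat d d"
  shows "herm_preserving d (dissipator L)"
  unfolding herm_preserving_def
proof (intro ballI)
  fix M :: "complex mat" assume c: "M \<in> carrier_mat d d"
  have p: "mat_adjoint L * L * mat_adjoint M \<in> carrier_mat d d" "mat_adjoint M * (mat_adjoint L * L) \<in> carrier_mat d d"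
    using c assms by (auto intro!: mult_carrier_mat)
  have "mat_adjoint (dissipator L M) = L * mat_adjoint M * mat_adjoint L
     - (1 / 2) \<cdot>\<^sub>m (mat_adjoint M * (mat_adjoint L * L) + mat_adjoint L * L * mat_adjoint M)"
    using c assms unfolding dissipator_def
    by (simp add: mat_adjoint_smult mat_adjoint_minus[of _ d] mat_adjoint_add[of _ d] mat_adjoint_mult[of _ d] square_mat_simps[of _ d])
  also have "\<dots> = dissipator L (mat_adjoint M)"
    unfolding dissipator_def comm_add_mat[OF p] ..
  finally show "mat_adjoint (dissipator L M) = dissipator L (mat_adjoint M)" .
qed

lemma herm_add:
  "herm_preserving d \<Phi> \<Longrightarrow> herm_preserving d \<Psi> \<Longrightarrow> lin d \<Phi> \<Longrightarrow> lin d \<Psi> \<Longrightarrow> herm_preserving d (\<lambda>M. \<Phi> M + \<Psi> M)"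
  by (auto simp: herm_preserving_def mat_adjoint_add[of _ d] lin_def)

lemma herm_msum:
  assumes "\<And>x. x \<in> X \<Longrightarrow> herm_preserving d (\<Phi> x)" "\<And>x. x \<in> X \<Longrightarrow> lin d (\<Phi> x)"
  shows "herm_preserving d (\<lambda>M. msum d (\<lambda>x. \<Phi> x M) X)"
  unfolding herm_preserving_def
proof (intro ballI)
  fix M :: "complex mat" assume M: "M \<in> carrier_mat d d"
  have "mat_adjoint (msum d (\<lambda>x. \<Phi> x M) X) = msum d (\<lambda>x. mat_adjoint (\<Phi> x M)) X"
    by (rule mat_adjoint_msum) (use linD(1)[OF assms(2) M] in auto)
  also have "\<dots> = msum d (\<lambda>x. \<Phi> x (mat_adjoint M)) X"
    by (rule msum_cong) (use assms(1) M in \<open>auto simp: herm_preserving_def\<close>)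
  finally show "mat_adjoint (msum d (\<lambda>x. \<Phi> x M) X) = msum d (\<lambda>x. \<Phi> x (mat_adjoint M)) X" .
qed

lemma dual_add:
  assumes "dual_maps d \<Phi> \<Phi>'" "dual_maps d \<Psi> \<Psi>'" "lin d \<Phi>" "lin d \<Psi>" "lin d \<Phi>'" "lin d \<Psi>'"
  shows "dual_maps d (\<lambda>M. \<Phi> M + \<Psi> M) (\<lambda>M. \<Phi>' M + \<Psi>' M)"
  using assms linD(1)[OF assms(3)] linD(1)[OF assms(4)] linD(1)[OF assms(5)] linD(1)[OF assms(6)]
  by (auto simp: dual_maps_def square_mat_simps[of _ d] mtrace_add[of _ d])

lemma dual_msum:
  assumes "\<And>x. x \<in> X \<Longrightarrow> dual_maps d (\<Phi> x) (\<Psi> x)" "\<And>x. x \<in> X \<Longrightarrow> lin d (\<Phi> x)" "\<And>x. x \<in> X \<Longrightarrow> lin d (\<Psi> x)"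
  shows "dual_maps d (\<lambda>M. msum d (\<lambda>x. \<Phi> x M) X) (\<lambda>M. msum d (\<lambda>x. \<Psi> x M) X)"
  unfolding dual_maps_def
proof (intro ballI)
  fix A M :: "complex mat" assume c: "A \<in> carrier_mat d d" "M \<in> carrier_mat d d"
  note cc = linD(1)[OF assms(2) c(2)] linD(1)[OF assms(3) c(1)]
  have "mtrace (A * msum d (\<lambda>x. \<Phi> x M) X) = (\<Sum>x\<in>X. mtrace (A * \<Phi> x M))"
    using c cc by (simp add: mult_msum mtrace_msum[of _ _ d] square_mat_simps(8)[of _ d])
  also have "\<dots> = (\<Sum>x\<in>X. mtrace (\<Psi> x A * M))"
    using assms(1) c by (intro sum.cong) (auto simp: dual_maps_def)
  also have "\<dots> = mtrace (msum d (\<lambda>x. \<Psi> x A) X * M)"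
    using c cc by (simp add: msum_mult mtrace_msum[of _ _ d] square_mat_simps(8)[of _ d])
  finally show "mtrace (A * msum d (\<lambda>x. \<Phi> x M) X) = mtrace (msum d (\<lambda>x. \<Psi> x A) X * M)" .
qed

lemma dual_funpow:
  assumes "dual_maps d \<Phi> \<Psi>" "lin d \<Phi>" "lin d \<Psi>" "X \<in> carrier_mat d d" "M \<in> carrier_mat d d"
  shows "mtrace (X * (\<Phi> ^^ m) M) = mtrace ((\<Psi> ^^ m) X * M)"
  using assms(4)
proof (induction m arbitrary: X)
  case (Suc m)
  have "mtrace (X * (\<Phi> ^^ Suc m) M) = mtrace (\<Psi> X * (\<Phi> ^^ m) M)"
    using assms(1) Suc.prems linD(1)[OF lin_funpow[OF assms(2)] assms(5)] by (auto simp: dual_maps_def)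
  also have "\<dots> = mtrace ((\<Psi> ^^ m) (\<Psi> X) * M)"
    using Suc linD(1)[OF assms(3)] by blast
  finally show ?case by (simp only: funpow_Suc_right o_apply)
qed simp

text \<open>The definition of \<open>hs_adjoint\<close> takes the adjoint of the image of a matrix
  unit. Preservation of adjoints moves it onto the matrix unit, and duality then reads off the entry
  \<open>(i, j)\<close> of \<open>\<Psi> A\<close>.\<close>

lemma hs_adjoint_eq:
  assumes "dual_maps d \<Phi> \<Psi>" "lin d \<Phi>" "lin d \<Psi>" "herm_preserving d \<Phi>" "A \<in> carrier_mat d d"
  shows "hs_adjoint d \<Phi> A = \<Psi> A"
proof (rule eq_carrierI[of _ d])
  fix i j assume ij: "i < d" "j < d"
  let ?E = "matrix_unit d i j"
  have "hs_adjoint d \<Phi> A $$ (i, j) = mtrace (mat_adjoint (\<Phi> ?E) * A)"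
    using ij by (simp add: hs_adjoint_def matrix_unit_def)
  also have "\<dots> = mtrace (A * \<Phi> (mat_adjoint ?E))"
    using assms(2,4,5) by (subst mtrace_commute[of _ d]) (auto simp: herm_preserving_def lin_def)
  also have "\<dots> = mtrace (\<Psi> A * mat_adjoint ?E)"
    using assms(1,5) by (auto simp: dual_maps_def)
  also have "\<dots> = (\<Sum>a<d. \<Sum>b<d. if a = i then (if b = j then \<Psi> A $$ (a, b) else 0) else 0)"
    using linD(1)[OF assms(3,5)] by (subst mtrace_mult[of _ d]) (auto simp: matrix_unit_def intro!: sum.cong)
  also have "\<dots> = (\<Sum>a<d. if a = i then \<Psi> A $$ (a, j) else 0)"
    using ij by (intro sum.cong refl) auto
  also have "\<dots> = \<Psi> A $$ (i, j)" using ij by simp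
  finally show "hs_adjoint d \<Phi> A $$ (i, j) = \<Psi> A $$ (i, j)" .
qed (use linD(1)[OF assms(3,5)] in \<open>auto simp: hs_adjoint_def\<close>)

section \<open>Supports of observables\<close>

lemma pauli_span_carrier: "L \<in> pauli_span n A \<Longrightarrow> L \<in> carrier_mat (2 ^ n) (2 ^ n)"
  by (auto simp: pauli_span_def)

lemma pauli_span_adjoint:
  assumes "L \<in> pauli_span n A"
  shows "mat_adjoint L \<in> pauli_span n A"
proof -
  obtain c where L: "L = msum (2 ^ n) (\<lambda>P. c P \<cdot>\<^sub>m pauli_op n P) A" using assms by (auto simp: pauli_span_def)
  have "mat_adjoint L = msum (2 ^ n) (\<lambda>P. cnj (c P) \<cdot>\<^sub>m pauli_op n P) A"
    unfolding L by (subst mat_adjoint_msum) (auto simp: mat_adjoint_smult mat_adjoint_pauli_mat)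
  then show ?thesis unfolding pauli_span_def by (intro CollectI exI[of _ "\<lambda>P. cnj (c P)"]) simp
qed

definition commuting :: "complex mat \<Rightarrow> complex mat \<Rightarrow> bool" where
  "commuting A B \<longleftrightarrow> A * B = B * A"

lemma commuting_sym: "commuting A B \<Longrightarrow> commuting B A"
  by (simp add: commuting_def)

lemma commuting_closed:
  assumes "P \<in> carrier_mat d d" "A \<in> carrier_mat d d" "B \<in> carrier_mat d d" "commuting P A" "commuting P B"
  shows "commuting P (A * B)" "commuting P (A + B)" "commuting P (A - B)" "commuting P (c \<cdot>\<^sub>m A)"
proof -
  have "P * (A * B) = A * (P * B)" using assms square_mat_simps(1)[of P d A B] square_mat_simps(1)[of A d P B]
    by (simp add: commuting_def)
  then show "commuting P (A * B)"
    using assms square_mat_simps(1)[of A d B P] by (simp add: commuting_def)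
qed (use assms in \<open>auto simp: commuting_def square_mat_simps[of _ d]\<close>)

lemma commuting_msum:
  assumes "P \<in> carrier_mat d d" "\<And>x. x \<in> X \<Longrightarrow> f x \<in> carrier_mat d d" "\<And>x. x \<in> X \<Longrightarrow> commuting P (f x)"
  shows "commuting P (msum d f X)"
  using assms unfolding commuting_def by (simp add: mult_msum msum_mult cong: msum_cong)

lemma commuting_pauli_span:
  assumes "X \<in> carrier_mat (2 ^ n) (2 ^ n)" "\<And>P. P \<in> A \<Longrightarrow> commuting X (pauli_op n P)" "L \<in> pauli_span n A"
  shows "commuting X L"
proof -
  obtain c where L: "L = msum (2 ^ n) (\<lambda>P. c P \<cdot>\<^sub>m pauli_op n P) A" using assms(3) by (auto simp: pauli_span_def)
  show ?thesis unfolding L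
    using assms(1,2) commuting_closed(4)[OF assms(1) pauli_op_carrier pauli_op_carrier]
    by (intro commuting_msum) auto
qed

text \<open>An observable is supported on \<open>S\<close> if and only if it commutes with all Pauli strings off \<open>S\<close>.\<close>

definition supported :: "nat \<Rightarrow> nat set \<Rightarrow> complex mat \<Rightarrow> bool" where
  "supported n S X \<longleftrightarrow> X \<in> carrier_mat (2 ^ n) (2 ^ n) \<and>
     (\<forall>P\<in>strings_on ({..<n} - S). commuting (pauli_op n P) X)"

lemma supported_pauli: "supported n (supp P) (pauli_op n P)"
  unfolding supported_def commuting_def
  by (auto simp: strings_on_def intro!: pauli_mat_commute)

lemma supported_span:
  assumes "L \<in> pauli_span n (strings_on e)"
  shows "supported n e L"
  unfolding supported_def
proof (intro conjI ballI)
  fix P assume P: "P \<in> strings_on ({..<n} - e)"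
  have "commuting (pauli_op n P) (pauli_op n Q)" if "Q \<in> strings_on e" for Q
    unfolding commuting_def by (rule pauli_mat_commute) (use P that in \<open>auto simp: strings_on_def\<close>)
  then show "commuting (pauli_op n P) L" by (rule commuting_pauli_span[OF pauli_op_carrier _ assms])
qed (rule pauli_span_carrier[OF assms])

lemma supported_span_commuting:
  assumes "L \<in> pauli_span n (strings_on e)" "e \<subseteq> {..<n}" "supported n S X" "e \<inter> S = {}"
  shows "commuting X L"
proof (rule commuting_pauli_span[OF _ _ assms(1)])
  show "X \<in> carrier_mat (2 ^ n) (2 ^ n)" using assms(3) by (simp add: supported_def)
  fix P assume "P \<in> strings_on e"
  then have "P \<in> strings_on ({..<n} - S)" using assms(2,4) by (auto simp: strings_on_def)
  then show "commuting X (pauli_op n P)" using assms(3) by (auto simp: supported_def intro: commuting_sym)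
qed

lemma supported_mono: "supported n S X \<Longrightarrow> S \<subseteq> S' \<Longrightarrow> supported n S' X"
  by (auto simp: supported_def strings_on_def)

lemma ham_dual_zero: "H \<in> carrier_mat d d \<Longrightarrow> X \<in> carrier_mat d d \<Longrightarrow> commuting X H \<Longrightarrow> ham_dual H X = 0\<^sub>m d d"
  unfolding ham_dual_def commuting_def
  by (rule eq_carrierI[of _ d]) (auto intro!: smult_carrier_mat minus_carrier mult_carrier_mat simp del: index_mult_mat(1))

text \<open>If \<open>X\<close> commutes with \<open>L\<close> and its adjoint, the sandwich and
  both halves of the anticommutator are the same operator, and the factor 1/2 makes them
  cancel.\<close>

lemma dissipator_dual_zero:
  assumes "L \<in> carrier_mat d d" "X \<in> carrier_mat d d" "commuting X L" "commuting X (mat_adjoint L)"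
  shows "dissipator_dual L X = 0\<^sub>m d d"
proof -
  let ?A = "mat_adjoint L"
  have A: "?A \<in> carrier_mat d d" using assms(1) by auto
  have 1: "?A * X * L = X * (?A * L)" "?A * L * X = X * (?A * L)"
    using assms A commuting_closed(1)[OF assms(2) A assms(1,4,3)]
    by (simp_all add: commuting_def square_mat_simps(1)[of _ d] flip: assms(4)[unfolded commuting_def])
  have c: "X * (?A * L) \<in> carrier_mat d d" using A assms by (intro mult_carrier_mat)
  have c': "X * (?A * L) + X * (?A * L) \<in> carrier_mat d d" using c by simp
  show ?thesis unfolding dissipator_dual_def 1
  proof (rule eq_carrierI[of _ d])
    fix i j assume ij: "i < d" "j < d"
    show "(X * (?A * L) - 1 / 2 \<cdot>\<^sub>m (X * (?A * L) + X * (?A * L))) $$ (i, j) = 0\<^sub>m d d $$ (i, j)"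
      unfolding carrier_index(2)[OF c ij smult_carrier_mat[OF c']] carrier_index(3)[OF c' ij]
        carrier_index(1)[OF c ij c] using ij by simp
  qed (use c in \<open>auto intro!: minus_carrier\<close>)
qed

lemma supported_closed:
  assumes "supported n S A" "supported n S B"
  shows "supported n S (A * B)" "supported n S (A + B)" "supported n S (A - B)" "supported n S (c \<cdot>\<^sub>m A)"
  using assms commuting_closed[OF pauli_op_carrier, of A n B]
  by (auto simp: supported_def intro: mult_carrier_mat minus_carrier)

lemma supported_smult: "supported n S A \<Longrightarrow> supported n S (c \<cdot>\<^sub>m A)"
  by (rule supported_closed(4))

lemma supported_msum: "(\<And>x. x \<in> X \<Longrightarrow> supported n S (f x)) \<Longrightarrow> supported n S (msum (2 ^ n) f X)"
  unfolding supported_def by (auto intro!: commuting_msum)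

lemma finite_regions: "finite (regions n k)"
  by (rule finite_subset[of _ "Pow {..<n}"]) (auto simp: regions_def)

lemma hs_norm_pauli: "hs_norm (pauli_op n P) = sqrt (2 ^ n)"
  by (simp add: hs_norm_def mat_adjoint_pauli_mat mtrace_pauli_mat_mult)

section \<open>Growth of supports under the dual generator\<close>

locale local_generator =
  fixes n k :: nat and G :: lindblad
  assumes local_G: "k_local n k G"
begin

abbreviation N :: nat where "N \<equiv> 2 ^ n"

lemma jumps_span: "e \<in> regions n k \<Longrightarrow> a < length (jumps G e) \<Longrightarrow> jumps G e ! a \<in> pauli_span n (strings_on e)"
  using local_G by (auto simp: k_local_def)

lemma jumps_carrier: "e \<in> regions n k \<Longrightarrow> a < length (jumps G e) \<Longrightarrow> jumps G e ! a \<in> carrier_mat N N"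
  by (rule pauli_span_carrier[OF jumps_span])

lemma ham_carrier: "ham G \<in> carrier_mat N N"
  using local_G by (auto simp: k_local_def intro: pauli_span_carrier)

lemma ham_adjoint: "mat_adjoint (ham G) = ham G"
  using local_G by (simp add: k_local_def)

lemma ham_on_carrier [intro, simp]: "ham_on n G e \<in> carrier_mat N N"
  by (simp add: ham_on_def)

lemma ham_on_adjoint: "mat_adjoint (ham_on n G e) = ham_on n G e"
proof -
  have "cnj (mtrace (pauli_op n P * ham G)) = mtrace (pauli_op n P * ham G)" for P
  proof -
    have "cnj (mtrace (pauli_op n P * ham G)) = mtrace (ham G * pauli_op n P)"
      using ham_carrier
      by (simp add: mtrace_adjoint[of _ N, symmetric] square_mat_simps(8)[of _ N] mat_adjoint_mult[of _ N]
          ham_adjoint mat_adjoint_pauli_mat)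
    then show ?thesis using mtrace_commute[OF ham_carrier pauli_op_carrier, of P] by simp
  qed
  then show ?thesis unfolding ham_on_def
    by (subst mat_adjoint_msum) (auto simp: mat_adjoint_smult mat_adjoint_pauli_mat)
qed

lemma ham_on_span: "e \<subseteq> {..<n} \<Longrightarrow> ham_on n G e \<in> pauli_span n (strings_on e)"
proof -
  assume e: "e \<subseteq> {..<n}"
  have fin: "finite (strings_on e)" by (rule finite_strings_on[OF finite_subset[OF e finite_lessThan]])
  let ?c = "\<lambda>P. if supp P = e then mtrace (pauli_op n P * ham G) / 2 ^ n else 0"
  have "ham_on n G e = msum N (\<lambda>P. ?c P \<cdot>\<^sub>m pauli_op n P) (strings_on e)"
  proof (rule eq_carrierI[of _ N])
    fix i j assume "i < N" "j < N"
    then show "ham_on n G e $$ (i, j) = msum N (\<lambda>P. ?c P \<cdot>\<^sub>m pauli_op n P) (strings_on e) $$ (i, j)"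
      using fin unfolding ham_on_def
      by (simp add: carrier_index(3)[OF pauli_op_carrier] del: index_smult_mat(1))
        (auto simp: strings_on_def intro!: sum.mono_neutral_cong_left split: if_splits)
  qed auto
  then show ?thesis unfolding pauli_span_def by (intro CollectI exI[of _ ?c]) simp
qed

text \<open>Distinct Pauli strings are orthogonal for the trace, so the coefficients of the given
  expansion are the normalised traces that define \<open>ham_on\<close>. Grouping the strings by
  support gives the sum over regions.\<close>

lemma ham_decomposition: "ham G = msum N (ham_on n G) (regions n k)"
proof -
  let ?S = "{P \<in> strings_on {..<n}. card (supp P) \<le> k}"
  have fin: "finite ?S" by simp
  obtain c where H: "ham G = msum N (\<lambda>P. c P \<cdot>\<^sub>m pauli_op n P) ?S"
    using local_G by (auto simp: k_local_def pauli_span_def)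
  have coeff: "mtrace (pauli_op n Q * ham G) / 2 ^ n = c Q" if "Q \<in> ?S" for Q
  proof -
    have "mtrace (pauli_op n Q * ham G) = (\<Sum>P\<in>?S. c P * mtrace (pauli_op n Q * pauli_op n P))"
      unfolding H mult_msum[OF pauli_op_carrier smult_carrier_mat[OF pauli_op_carrier]]
        mtrace_msum[OF smult_carrier_mat[OF mult_carrier_mat[OF pauli_op_carrier pauli_op_carrier]]]
        mult_smult_distrib[OF pauli_op_carrier pauli_op_carrier]
        mtrace_smult[OF mult_carrier_mat[OF pauli_op_carrier pauli_op_carrier]] ..
    also have "\<dots> = (\<Sum>P\<in>?S. if P = Q then c P * 2 ^ n else 0)"
      using that by (intro sum.cong refl) (auto simp: mtrace_pauli_op_mult)
    also have "\<dots> = c Q * 2 ^ n" using that fin by simp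
    finally show ?thesis by simp
  qed
  show ?thesis
  proof (rule eq_carrierI[OF ham_carrier msum_carrier])
    fix i j assume ij: "i < N" "j < N"
    have "ham_on n G e $$ (i, j) = (\<Sum>P\<in>{P \<in> ?S. supp P = e}. c P * pauli_op n P $$ (i, j))"
      if "e \<in> regions n k" for e
    proof -
      have "{P. supp P = e} = {P \<in> ?S. supp P = e}" using that by (auto simp: regions_def strings_on_def)
      then have "ham_on n G e $$ (i, j) = (\<Sum>P\<in>{P \<in> ?S. supp P = e}. mtrace (pauli_op n P * ham G) / 2 ^ n * pauli_op n P $$ (i, j))"
        using ij carrier_matD[OF pauli_op_carrier] by (simp add: ham_on_def)
      also have "\<dots> = (\<Sum>P\<in>{P \<in> ?S. supp P = e}. c P * pauli_op n P $$ (i, j))"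
        by (rule sum.cong[OF refl], subst coeff) auto
      finally show ?thesis .
    qed
    then have "msum N (ham_on n G) (regions n k) $$ (i, j)
        = (\<Sum>e\<in>regions n k. \<Sum>P\<in>{P \<in> ?S. supp P = e}. c P * pauli_op n P $$ (i, j))"
      using ij by simp
    also have "\<dots> = (\<Sum>P\<in>?S. c P * pauli_op n P $$ (i, j))"
      by (rule sum.group[OF fin finite_regions]) (auto simp: regions_def strings_on_def)
    finally show "ham G $$ (i, j) = msum N (ham_on n G) (regions n k) $$ (i, j)"
      unfolding H using ij by (simp add: carrier_index(3)[OF pauli_op_carrier] del: index_smult_mat(1))
  qed
qed

definition local_dual :: "nat set \<Rightarrow> superop" where
  "local_dual e X = ham_dual (ham_on n G e) X
     + msum N (\<lambda>a. dissipator_dual (jumps G e ! a) X) {..<length (jumps G e)}"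

definition total_dual :: superop where
  "total_dual X = msum N (\<lambda>e. local_dual e X) (regions n k)"

lemma lin_jump_part: "e \<in> regions n k \<Longrightarrow> lin N (jump_part n G e)"
  unfolding jump_part_def by (intro lin_msum lin_dissipator jumps_carrier) auto

lemma lin_local_term: "e \<in> regions n k \<Longrightarrow> lin N (local_term n G e)"
  unfolding local_term_def by (intro lin_add lin_ham_part lin_jump_part ham_on_carrier)

lemma lin_local_dual: "e \<in> regions n k \<Longrightarrow> lin N (local_dual e)"
  unfolding local_dual_def by (intro lin_add lin_ham_dual lin_msum lin_dissipator_dual jumps_carrier) auto

lemma herm_local_term: "e \<in> regions n k \<Longrightarrow> herm_preserving N (local_term n G e)"
  unfolding local_term_def jump_part_def
  by (intro herm_add herm_ham_part herm_msum herm_dissipator lin_ham_part lin_msum lin_dissipator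
      ham_on_carrier ham_on_adjoint jumps_carrier) auto

lemma dual_local_term: "e \<in> regions n k \<Longrightarrow> dual_maps N (local_term n G e) (local_dual e)"
  unfolding local_term_def jump_part_def local_dual_def
  by (intro dual_add dual_ham_part dual_msum dual_dissipator lin_ham_part lin_ham_dual lin_msum
      lin_dissipator lin_dissipator_dual ham_on_carrier jumps_carrier) auto

text \<open>The generator is defined with the Hamiltonian as a whole, the interaction strength
  through the local terms. The decomposition of the Hamiltonian by support reconciles the
  two.\<close>

lemma lindbladian_eq:
  assumes "M \<in> carrier_mat N N"
  shows "lindbladian n k G M = msum N (\<lambda>e. local_term n G e M) (regions n k)"
proof (rule eq_carrierI[of _ N])
  have H: "ham_part (ham G) M = msum N (\<lambda>e. ham_part (ham_on n G e) M) (regions n k)"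
  proof -
    have "lin N (\<lambda>H. ham_part H M)"
      unfolding ham_part_def using assms by (intro lin_smult lin_minus lin_left lin_right)
    from lin_msum_arg[OF this finite_regions ham_on_carrier] show ?thesis
      by (subst ham_decomposition)
  qed
  have J: "jump_part n G e M \<in> carrier_mat N N" "ham_part (ham_on n G e) M \<in> carrier_mat N N"
    if "e \<in> regions n k" for e
    using linD(1)[OF lin_jump_part[OF that] assms] linD(1)[OF lin_ham_part[OF ham_on_carrier] assms] by auto
  show "lindbladian n k G M \<in> carrier_mat N N"
    by (simp add: lindbladian_def)
  fix i j assume ij: "i < N" "j < N"
  show "lindbladian n k G M $$ (i, j) = msum N (\<lambda>e. local_term n G e M) (regions n k) $$ (i, j)"
    unfolding lindbladian_def H local_term_def carrier_index(1)[OF msum_carrier ij msum_carrier]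
      msum_index[OF ij] sum.distrib[symmetric]
    by (intro sum.cong refl) (simp only: carrier_index(1)[OF J(2) ij J(1)])
qed simp

lemma lin_cong: "lin d \<Phi> \<Longrightarrow> (\<And>M. M \<in> carrier_mat d d \<Longrightarrow> \<Psi> M = \<Phi> M) \<Longrightarrow> lin d \<Psi>"
  unfolding lin_def by auto

lemma lin_lindbladian: "lin N (lindbladian n k G)"
  by (rule lin_cong[OF lin_msum[OF lin_local_term] lindbladian_eq])

lemma lin_total_dual: "lin N total_dual"
  unfolding total_dual_def by (intro lin_msum lin_local_dual)

lemma dual_lindbladian: "dual_maps N (lindbladian n k G) total_dual"
  using dual_msum[OF dual_local_term lin_local_term lin_local_dual, of "regions n k"]
  by (simp add: dual_maps_def lindbladian_eq total_dual_def)

lemma herm_lindbladian: "herm_preserving N (lindbladian n k G)"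
  using herm_msum[OF herm_local_term lin_local_term, of "regions n k"]
  by (simp add: herm_preserving_def lindbladian_eq)

text \<open>An observable off \<open>e\<close> commutes with the Hamiltonian part and the jumps on
  \<open>e\<close>, so the commutator vanishes and the dissipator cancels. In the Schroedinger
  picture a local term need not annihilate such an operator, which is why the derivatives are
  estimated through the dual.\<close>

lemma local_dual_zero:
  assumes "e \<in> regions n k" "supported n S X" "e \<inter> S = {}"
  shows "local_dual e X = 0\<^sub>m N N"
proof -
  have e: "e \<subseteq> {..<n}" using assms(1) by (simp add: regions_def)
  have X: "X \<in> carrier_mat N N" using assms(2) by (simp add: supported_def)
  have "ham_dual (ham_on n G e) X = 0\<^sub>m N N"
    by (rule ham_dual_zero[OF ham_on_carrier X supported_span_commuting[OF ham_on_span[OF e] e assms(2,3)]])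
  moreover have "dissipator_dual (jumps G e ! a) X = 0\<^sub>m N N" if "a < length (jumps G e)" for a
    using jumps_span[OF assms(1) that] jumps_carrier[OF assms(1) that]
    by (intro dissipator_dual_zero X supported_span_commuting[OF _ e assms(2,3)] pauli_span_adjoint)
  ultimately show ?thesis unfolding local_dual_def
    by (intro eq_carrierI[of _ N]) auto
qed

lemma supported_local_dual:
  assumes "e \<in> regions n k" "supported n S X"
  shows "supported n (S \<union> e) (local_dual e X)"
proof -
  have e: "e \<subseteq> {..<n}" using assms(1) by (simp add: regions_def)
  have X: "supported n (S \<union> e) X" using assms(2) by (rule supported_mono) simp
  have J: "supported n (S \<union> e) (jumps G e ! a)" "supported n (S \<union> e) (mat_adjoint (jumps G e ! a))"
    if "a < length (jumps G e)" for a
    using supported_span[OF jumps_span[OF assms(1) that]] supported_span[OF pauli_span_adjoint[OF jumps_span[OF assms(1) that]]]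
    by (auto intro: supported_mono)
  have H: "supported n (S \<union> e) (ham_on n G e)"
    using supported_span[OF ham_on_span[OF e]] by (rule supported_mono) simp
  show ?thesis unfolding local_dual_def ham_dual_def dissipator_dual_def
    by (intro supported_closed(1-3) supported_smult supported_msum X H J) auto
qed

lemma norm_local_dual:
  assumes "e \<in> regions n k"
  shows "norm_2_2 N (hs_adjoint N (local_term n G e)) = norm_2_2 N (local_dual e)"
  unfolding norm_2_2_def
  by (intro SUP_cong refl)
    (use hs_adjoint_eq[OF dual_local_term lin_local_term lin_local_dual herm_local_term] assms in auto)

text \<open>Each region meeting \<open>S\<close> is charged to the qubits of \<open>S\<close> that
  it contains, of which there is at least one; the regions through a fixed qubit sum to at most the
  interaction strength.\<close>

lemma sum_norm_le:
  assumes "S \<subseteq> {..<n}" "interaction_strength n k G \<le> a"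
  shows "(\<Sum>e\<in>{e \<in> regions n k. e \<inter> S \<noteq> {}}. norm_2_2 N (local_dual e)) \<le> real (card S) * a"
proof -
  let ?f = "\<lambda>e. norm_2_2 N (local_dual e)"
  have finS: "finite S" using assms(1) finite_subset by auto
  have f: "0 \<le> ?f e" if "e \<in> regions n k" for e using norm_2_2_nonneg[OF lin_local_dual[OF that]] .
  have "(\<Sum>e\<in>{e \<in> regions n k. e \<inter> S \<noteq> {}}. ?f e)
      \<le> (\<Sum>e\<in>{e \<in> regions n k. e \<inter> S \<noteq> {}}. \<Sum>u\<in>S. if u \<in> e then ?f e else 0)"
  proof (rule sum_mono)
    fix e assume "e \<in> {e \<in> regions n k. e \<inter> S \<noteq> {}}"
    then obtain u where u: "u \<in> e" "u \<in> S" "e \<in> regions n k" by auto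
    have "?f e = (if u \<in> e then ?f e else 0)" using u by simp
    also have "\<dots> \<le> (\<Sum>u\<in>S. if u \<in> e then ?f e else 0)"
      using f[OF u(3)] by (intro member_le_sum u finS) auto
    finally show "?f e \<le> (\<Sum>u\<in>S. if u \<in> e then ?f e else 0)" .
  qed
  also have "\<dots> \<le> (\<Sum>e\<in>regions n k. \<Sum>u\<in>S. if u \<in> e then ?f e else 0)"
    by (rule sum_mono2[OF finite_regions]) (auto intro!: sum_nonneg f)
  also have "\<dots> = (\<Sum>u\<in>S. \<Sum>e\<in>regions n k. if u \<in> e then ?f e else 0)" by (rule sum.swap)
  also have "\<dots> \<le> (\<Sum>u\<in>S. a)"
  proof (rule sum_mono)
    fix u assume "u \<in> S"
    have "(\<Sum>e\<in>regions n k. if u \<in> e then ?f e else 0) = (\<Sum>e | e \<in> regions n k \<and> u \<in> e. ?f e)"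
      using finite_regions by (subst sum.inter_filter[symmetric]) auto
    also have "\<dots> = (\<Sum>e | e \<in> regions n k \<and> u \<in> e. norm_2_2 N (hs_adjoint N (local_term n G e)))"
      by (intro sum.cong refl) (auto simp: norm_local_dual)
    also have "\<dots> \<le> interaction_strength n k G"
      unfolding interaction_strength_def using \<open>u \<in> S\<close> assms(1) by (intro Max_ge) auto
    finally show "(\<Sum>e\<in>regions n k. if u \<in> e then ?f e else 0) \<le> a" using assms(2) by simp
  qed
  finally show ?thesis by simp
qed

lemma total_dual_supported:
  assumes "supported n S X"
  shows "total_dual X = msum N (\<lambda>e. local_dual e X) {e \<in> regions n k. e \<inter> S \<noteq> {}}"
  unfolding total_dual_def
proof (rule eq_carrierI[of _ N])
  fix i j assume ij: "i < N" "j < N"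
  have "local_dual e X $$ (i, j) = 0" if "e \<in> regions n k" "e \<inter> S = {}" for e
    using local_dual_zero[OF that(1) assms that(2)] ij by simp
  then have "(\<Sum>e\<in>regions n k. local_dual e X $$ (i, j)) = (\<Sum>e\<in>{e \<in> regions n k. e \<inter> S \<noteq> {}}. local_dual e X $$ (i, j))"
    using finite_regions by (intro sum.mono_neutral_right) auto
  then show "msum N (\<lambda>e. local_dual e X) (regions n k) $$ (i, j)
      = msum N (\<lambda>e. local_dual e X) {e \<in> regions n k. e \<inter> S \<noteq> {}} $$ (i, j)"
    using ij by simp
qed auto

text \<open>Each application of the dual enlarges the support by at most \<open>k\<close> qubits, and only the terms
  meeting the current support contribute.\<close>

lemma hs_norm_total_dual_funpow:
  assumes "interaction_strength n k G \<le> a" "0 \<le> a" "S \<subseteq> {..<n}" "card S \<le> j * k" "supported n S X"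
  shows "hs_norm ((total_dual ^^ m) X) \<le> (\<Prod>i<m. real (j + i) * real k * a) * hs_norm X"
  using assms(3-)
proof (induction m arbitrary: S X j)
  case (Suc m)
  have X: "X \<in> carrier_mat N N" using Suc.prems by (simp add: supported_def)
  let ?R = "{e \<in> regions n k. e \<inter> S \<noteq> {}}"
  let ?p = "\<Prod>i<m. real (Suc j + i) * real k * a"
  have p: "0 \<le> ?p" using assms(2) by (intro prod_nonneg) auto
  have fin: "finite ?R" using finite_regions by auto
  have Y: "local_dual e X \<in> carrier_mat N N" if "e \<in> ?R" for e
    using that linD(1)[OF lin_local_dual X] by auto
  have "(total_dual ^^ Suc m) X = (total_dual ^^ m) (msum N (\<lambda>e. local_dual e X) ?R)"
    by (simp only: funpow_Suc_right o_apply total_dual_supported[OF Suc.prems(3)])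
  also have "\<dots> = msum N (\<lambda>e. (total_dual ^^ m) (local_dual e X)) ?R"
    by (rule lin_msum_arg[OF lin_funpow[OF lin_total_dual] fin Y])
  finally have "hs_norm ((total_dual ^^ Suc m) X) \<le> (\<Sum>e\<in>?R. hs_norm ((total_dual ^^ m) (local_dual e X)))"
    using hs_norm_msum[OF fin, of "\<lambda>e. (total_dual ^^ m) (local_dual e X)" N]
      linD(1)[OF lin_funpow[OF lin_total_dual] Y] by auto
  also have "\<dots> \<le> (\<Sum>e\<in>?R. ?p * (norm_2_2 N (local_dual e) * hs_norm X))"
  proof (rule sum_mono)
    fix e assume e: "e \<in> ?R"
    then have er: "e \<in> regions n k" by simp
    \<comment> \<open>The counter \<open>j\<close> measures the support in blocks of
      \<open>k\<close> qubits. A region adds at most one block, which shifts the product of the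
      induction hypothesis by one factor.\<close>
    have "card (S \<union> e) \<le> Suc j * k"
      using card_Un_le[of S e] e Suc.prems(2) by (auto simp: regions_def)
    then have "hs_norm ((total_dual ^^ m) (local_dual e X)) \<le> ?p * hs_norm (local_dual e X)"
      using Suc.IH[OF _ _ supported_local_dual[OF er Suc.prems(3)], of "Suc j"] Suc.prems(1) er
      by (auto simp: regions_def)
    also have "\<dots> \<le> ?p * (norm_2_2 N (local_dual e) * hs_norm X)"
      using p hs_norm_le_norm_2_2[OF lin_local_dual[OF er] X] by (rule mult_left_mono[rotated])
    finally show "hs_norm ((total_dual ^^ m) (local_dual e X)) \<le> ?p * (norm_2_2 N (local_dual e) * hs_norm X)" .
  qed
  also have "\<dots> = ?p * (\<Sum>e\<in>?R. norm_2_2 N (local_dual e)) * hs_norm X"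
    by (simp add: sum_distrib_left sum_distrib_right mult.assoc)
  also have "\<dots> \<le> ?p * (real j * real k * a) * hs_norm X"
  proof (intro mult_right_mono mult_left_mono p hs_norm_nonneg[OF X])
    have "real (card S) * a \<le> real (j * k) * a"
      using Suc.prems(2) assms(2) by (intro mult_right_mono) (auto simp del: of_nat_mult)
    then show "(\<Sum>e\<in>?R. norm_2_2 N (local_dual e)) \<le> real j * real k * a"
      using sum_norm_le[OF Suc.prems(1) assms(1)] by simp
  qed
  also have "?p * (real j * real k * a) = (\<Prod>i<Suc m. real (j + i) * real k * a)"
    by (subst prod.lessThan_Suc_shift) (simp add: mult.commute)
  finally show ?case .
qed simp

text \<open>The dual powers act on the observable \<open>P\<close>, whose support fits into one
  block, so the growth factors start at 1 and multiply to a factorial. Cauchy-Schwarz contributes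
  \<open>sqrt (2 ^ n)\<close> from either Pauli operator.\<close>

lemma mtrace_funpow_bound:
  assumes "interaction_strength n k G \<le> a" "0 \<le> a" "P \<in> strings_on {..<n}" "card (supp P) \<le> k"
  shows "cmod (mtrace (pauli_op n P * (lindbladian n k G ^^ m) (pauli_op n Q))) \<le> 2 ^ n * ((real k * a) ^ m * fact m)"
proof -
  have "(\<Prod>i<m. real (1 + i) * real k * a) = (real k * a) ^ m * fact m"
    by (induction m) (simp_all add: algebra_simps)
  then have "hs_norm ((total_dual ^^ m) (pauli_op n P)) \<le> (real k * a) ^ m * fact m * sqrt (2 ^ n)"
    using hs_norm_total_dual_funpow[OF assms(1,2) _ _ supported_pauli, of P 1 m] assms(3,4)
    by (simp add: strings_on_def hs_norm_pauli)
  then have "hs_norm ((total_dual ^^ m) (pauli_op n P)) * hs_norm (pauli_op n Q)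
      \<le> (real k * a) ^ m * fact m * sqrt (2 ^ n) * sqrt (2 ^ n)"
    unfolding hs_norm_pauli by (rule mult_right_mono) simp
  also have "\<dots> = (real k * a) ^ m * fact m * (sqrt (2 ^ n) * sqrt (2 ^ n))" by (simp only: mult.assoc)
  also have "sqrt (2 ^ n) * sqrt (2 ^ n) = (2 ^ n :: real)" by simp
  finally have "hs_norm ((total_dual ^^ m) (pauli_op n P)) * hs_norm (pauli_op n Q)
      \<le> (real k * a) ^ m * fact m * 2 ^ n" .
  moreover have "cmod (mtrace ((total_dual ^^ m) (pauli_op n P) * pauli_op n Q))
      \<le> hs_norm ((total_dual ^^ m) (pauli_op n P)) * hs_norm (pauli_op n Q)"
    by (rule mtrace_mult_le[of _ N]) (auto intro!: linD(1)[OF lin_funpow[OF lin_total_dual]])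
  moreover have "mtrace (pauli_op n P * (lindbladian n k G ^^ m) (pauli_op n Q))
      = mtrace ((total_dual ^^ m) (pauli_op n P) * pauli_op n Q)"
    by (rule dual_funpow[OF dual_lindbladian lin_lindbladian lin_total_dual]) auto
  ultimately show ?thesis by (simp add: mult_ac)
qed

lemma herm_funpow: "herm_preserving N (lindbladian n k G ^^ m)"
proof (induction m)
  case (Suc m)
  then show ?case
    using herm_lindbladian linD(1)[OF lin_funpow[OF lin_lindbladian]] by (auto simp: herm_preserving_def)
qed (simp add: herm_preserving_def)

text \<open>Both factors are Hermitian, so conjugating the trace only reverses their order. Working
  with real parts of overlaps and derivatives therefore loses nothing.\<close>

lemma mtrace_funpow_real:
  "mtrace (pauli_op n P * (lindbladian n k G ^^ m) (pauli_op n Q)) \<in> \<real>"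
proof -
  let ?M = "(lindbladian n k G ^^ m) (pauli_op n Q)"
  have M: "?M \<in> carrier_mat N N" by (rule linD(1)[OF lin_funpow[OF lin_lindbladian]]) auto
  have adj: "mat_adjoint ?M = ?M"
    using herm_funpow[of m] by (simp add: herm_preserving_def mat_adjoint_pauli_mat)
  have "cnj (mtrace (pauli_op n P * ?M)) = mtrace (mat_adjoint (pauli_op n P * ?M))"
    using M by (simp add: mtrace_adjoint[of _ N] square_mat_simps(8)[of _ N])
  also have "\<dots> = mtrace (pauli_op n P * ?M)"
    using M mtrace_commute[OF M pauli_op_carrier]
    by (simp add: mat_adjoint_mult[of _ N] adj mat_adjoint_pauli_mat)
  finally show ?thesis by (simp add: Reals_cnj_iff)
qed

text \<open>Trace preservation is unitality of the dual: the identity is supported on the empty set,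
  which no region meets.\<close>

lemma mtrace_lindbladian:
  assumes "M \<in> carrier_mat N N"
  shows "mtrace (lindbladian n k G M) = 0"
proof -
  have "supported n {} (1\<^sub>m N)" using supported_pauli[of n id_string] by (simp add: pauli_op_id supp_def)
  then have "total_dual (1\<^sub>m N) = 0\<^sub>m N N"
    using total_dual_supported[of "{}" "1\<^sub>m N"] by (simp add: msum_empty)
  moreover have "mtrace (1\<^sub>m N * lindbladian n k G M) = mtrace (total_dual (1\<^sub>m N) * M)"
    using dual_lindbladian assms by (simp add: dual_maps_def)
  ultimately show ?thesis
    using assms linD(1)[OF lin_lindbladian assms] by (simp add: mtrace_def)
qed

section \<open>Drift and jump form of the generator, and positivity of shot weights\<close>

definition jump_index :: "(nat set \<times> nat) set" where
  "jump_index = (SIGMA e:regions n k. {..<length (jumps G e)})"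

definition jump_op :: "nat set \<times> nat \<Rightarrow> complex mat" where
  "jump_op = (\<lambda>(e, a). jumps G e ! a)"

text \<open>The generator of the no-jump evolution, that is, \<open>- \<i>\<close> times the
  non-Hermitian effective Hamiltonian. It collects the commutator and the anticommutators into one
  left and one right multiplication, the form in which Euler steps can be completed to a
  square.\<close>

definition drift :: "complex mat" where
  "drift = (- \<i>) \<cdot>\<^sub>m ham G + (- 1 / 2) \<cdot>\<^sub>m msum N (\<lambda>x. mat_adjoint (jump_op x) * jump_op x) jump_index"

lemma jump_op_carrier: "x \<in> jump_index \<Longrightarrow> jump_op x \<in> carrier_mat N N"
  by (auto simp: jump_index_def jump_op_def jumps_carrier)

lemma lindbladian_drift_form:
  assumes M: "M \<in> carrier_mat N N"
  shows "lindbladian n k G M = (drift * M + M * mat_adjoint drift)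
    + msum N (\<lambda>x. jump_op x * M * mat_adjoint (jump_op x)) jump_index"
proof -
  let ?Q = "\<lambda>x. mat_adjoint (jump_op x) * jump_op x"
  have Q: "?Q x \<in> carrier_mat N N" "mat_adjoint (?Q x) = ?Q x" "jump_op x * M * mat_adjoint (jump_op x) \<in> carrier_mat N N"
    "?Q x * M \<in> carrier_mat N N" "M * ?Q x \<in> carrier_mat N N"
    if "x \<in> jump_index" for x
    using jump_op_carrier[OF that] M by (auto simp: mat_adjoint_mult[of _ N] intro!: mult_carrier_mat)
  have HM: "ham G * M \<in> carrier_mat N N" "M * ham G \<in> carrier_mat N N"
    using ham_carrier M by (auto intro: mult_carrier_mat)
  have adj: "mat_adjoint drift = \<i> \<cdot>\<^sub>m ham G + (- 1 / 2) \<cdot>\<^sub>m msum N ?Q jump_index"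
  proof -
    have "mat_adjoint (msum N ?Q jump_index) = msum N ?Q jump_index"
      using Q by (simp add: mat_adjoint_msum cong: msum_cong)
    then show ?thesis using ham_carrier
      by (simp add: drift_def mat_adjoint_add[of _ N] mat_adjoint_smult ham_adjoint)
  qed
  have K: "drift * M = (- \<i>) \<cdot>\<^sub>m (ham G * M) + (- 1 / 2) \<cdot>\<^sub>m msum N (\<lambda>x. ?Q x * M) jump_index"
    unfolding drift_def using ham_carrier M Q by (simp add: square_mat_simps[of _ N] msum_mult)
  have K': "M * mat_adjoint drift = \<i> \<cdot>\<^sub>m (M * ham G) + (- 1 / 2) \<cdot>\<^sub>m msum N (\<lambda>x. M * ?Q x) jump_index"
    unfolding adj using ham_carrier M Q by (simp add: square_mat_simps[of _ N] mult_msum)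
  show ?thesis
  proof (rule eq_carrierI[of _ N])
    show "lindbladian n k G M \<in> carrier_mat N N" by (rule linD(1)[OF lin_lindbladian M])
    show "(drift * M + M * mat_adjoint drift)
      + msum N (\<lambda>x. jump_op x * M * mat_adjoint (jump_op x)) jump_index \<in> carrier_mat N N"
      unfolding K K' by (intro add_carrier_mat msum_carrier)
    fix i j assume ij: "i < N" "j < N"
    have diss: "dissipator (jump_op x) M $$ (i, j) = (jump_op x * M * mat_adjoint (jump_op x)) $$ (i, j)
        - 1 / 2 * ((?Q x * M) $$ (i, j) + (M * ?Q x) $$ (i, j))" if "x \<in> jump_index" for x
      unfolding dissipator_def using Q[OF that] ij
      by (simp add: carrier_index[of _ N] del: index_add_mat index_minus_mat index_smult_mat index_mult_mat(1))
    have "lindbladian n k G M $$ (i, j) = ham_part (ham G) M $$ (i, j)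
        + (\<Sum>e\<in>regions n k. \<Sum>a<length (jumps G e). dissipator (jump_op (e, a)) M $$ (i, j))"
      using ij linD(1)[OF lin_ham_part[OF ham_carrier] M]
      by (simp add: lindbladian_def jump_part_def jump_op_def carrier_index[of _ N] del: index_add_mat)
    also have "(\<Sum>e\<in>regions n k. \<Sum>a<length (jumps G e). dissipator (jump_op (e, a)) M $$ (i, j))
        = (\<Sum>x\<in>jump_index. dissipator (jump_op x) M $$ (i, j))"
      unfolding jump_index_def by (subst sum.Sigma) (auto simp: finite_regions case_prod_unfold)
    also have "\<dots> = (\<Sum>x\<in>jump_index. (jump_op x * M * mat_adjoint (jump_op x)) $$ (i, j)
        - 1 / 2 * ((?Q x * M) $$ (i, j) + (M * ?Q x) $$ (i, j)))"
      by (rule sum.cong[OF refl diss])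
    also have "\<dots> = (\<Sum>x\<in>jump_index. (jump_op x * M * mat_adjoint (jump_op x)) $$ (i, j))
        - 1 / 2 * ((\<Sum>x\<in>jump_index. (?Q x * M) $$ (i, j)) + (\<Sum>x\<in>jump_index. (M * ?Q x) $$ (i, j)))"
      by (simp only: sum_subtractf sum.distrib sum_distrib_left[symmetric])
    also have "ham_part (ham G) M $$ (i, j) = - \<i> * (ham G * M) $$ (i, j) + \<i> * (M * ham G) $$ (i, j)"
      unfolding ham_part_def using HM minus_carrier[OF HM] ij
      by (simp add: carrier_index[of _ N] algebra_simps del: index_minus_mat index_smult_mat index_mult_mat(1))
    finally show "lindbladian n k G M $$ (i, j) = ((drift * M + M * mat_adjoint drift)
      + msum N (\<lambda>x. jump_op x * M * mat_adjoint (jump_op x)) jump_index) $$ (i, j)"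
      unfolding K K' using ij HM
      by (simp add: carrier_index[of _ N] algebra_simps
          del: index_add_mat index_smult_mat index_mult_mat(1))
  qed
qed

text \<open>With \<open>E\<close> a measurement projector and \<open>F\<close> a prepared eigenstate
  this is the Born weight of a shot up to its positive normalisation.\<close>

lemma mtrace_exp_nonneg:
  assumes "E \<in> carrier_mat N N" "E * E = E" "mat_adjoint E = E"
    and "F \<in> carrier_mat N N" "F * F = F" "mat_adjoint F = F" and "0 \<le> t"
  shows "0 \<le> Re (mtrace (E * exp_superop N t (lindbladian n k G) F))"
proof (rule mtrace_exp_lindblad_nonneg[OF _ _ jump_op_carrier lindbladian_drift_form lin_lindbladian assms(1-3) posm_projector[OF assms(4-6)] assms(7)])
  show "drift \<in> carrier_mat N N" unfolding drift_def by (intro add_carrier_mat smult_carrier_mat msum_carrier)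
  show "finite jump_index" by (auto simp: jump_index_def finite_regions)
qed

text \<open>Every term of the exponential series beyond the zeroth is an image of the generator and
  hence traceless.\<close>

lemma mtrace_exp_superop:
  assumes "M \<in> carrier_mat N N"
  shows "mtrace (exp_superop N t (lindbladian n k G) M) = mtrace M"
proof -
  have c: "(lindbladian n k G ^^ m) M \<in> carrier_mat N N" for m
    by (rule linD(1)[OF lin_funpow[OF lin_lindbladian] assms])
  let ?f = "\<lambda>m. complex_of_real (t ^ m / fact m) * mtrace (1\<^sub>m N * (lindbladian n k G ^^ m) M)"
  have "?f m = 0" if "m \<noteq> 0" for m
    using that c mtrace_lindbladian[OF c, of "m - 1"] left_mult_one_mat[OF c[of m]] by (cases m) auto
  then have "?f sums (\<Sum>m\<in>{0}. ?f m)" by (intro sums_finite) auto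
  moreover have "?f sums mtrace (1\<^sub>m N * exp_superop N t (lindbladian n k G) M)"
    by (rule mtrace_exp_superop_sums[OF lin_lindbladian assms]) simp
  ultimately have "(\<Sum>m\<in>{0}. ?f m) = mtrace (1\<^sub>m N * exp_superop N t (lindbladian n k G) M)"
    by (rule sums_unique2)
  then show ?thesis using assms left_mult_one_mat[OF exp_superop_carrier[of N t "lindbladian n k G" M]] by simp
qed

end

section \<open>Coefficients and their local sums\<close>

lemma square_mult_carrier:
  "A \<in> carrier_mat d d \<Longrightarrow> B \<in> carrier_mat d d \<Longrightarrow> A * B \<in> carrier_mat d d"
  by (rule mult_carrier_mat)

lemma pauli_op_mult_carrier [simp]: "pauli_op n A * pauli_op n B \<in> carrier_mat (2 ^ n) (2 ^ n)"
  by (intro square_mult_carrier pauli_op_carrier)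

text \<open>The value computed by the loops of \<open>local_coeff_step\<close>, for an arbitrary
  table \<open>L\<close>, so that estimated and exact transfer matrix entries can be
  compared.\<close>

definition local_sum ::
    "(pstring \<Rightarrow> pstring \<Rightarrow> complex) \<Rightarrow> nat list \<Rightarrow> pstring \<Rightarrow> pstring \<Rightarrow> complex" where
  "local_sum L us P Q = (\<Sum>A\<in>strings_on (set us). \<Sum>B\<in>strings_on (set us). L A B *
     mtrace (pauli_mat us A * pauli_mat us Q * pauli_mat us B * pauli_mat us P)) / 2 ^ (3 * length us)"

text \<open>The kernel has absolute row sum \<open>8 ^ length us\<close>, the inverse of the
  prefactor, so the accuracy of the entries is inherited with constant 1.\<close>

lemma local_sum_close:
  assumes "distinct us"
    and "\<And>A B. A \<in> strings_on (set us) \<Longrightarrow> B \<in> strings_on (set us) \<Longrightarrow> cmod (L A B - L' A B) \<le> \<epsilon>"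
  shows "cmod (local_sum L us P Q - local_sum L' us P Q) \<le> \<epsilon>"
proof -
  let ?t = "\<lambda>A B. mtrace (pauli_mat us A * pauli_mat us Q * pauli_mat us B * pauli_mat us P)"
  let ?S = "strings_on (set us)"
  have "local_sum L us P Q - local_sum L' us P Q
      = (\<Sum>A\<in>?S. \<Sum>B\<in>?S. (L A B - L' A B) * ?t A B) / 2 ^ (3 * length us)"
    by (simp add: local_sum_def diff_divide_distrib[symmetric] sum_subtractf[symmetric] left_diff_distrib)
  also have "cmod \<dots> = cmod (\<Sum>A\<in>?S. \<Sum>B\<in>?S. (L A B - L' A B) * ?t A B) / 2 ^ (3 * length us)"
    by (simp add: norm_divide norm_power)
  also have "\<dots> \<le> (\<Sum>A\<in>?S. \<Sum>B\<in>?S. \<epsilon> * cmod (?t A B)) / 2 ^ (3 * length us)"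
  proof (intro divide_right_mono order_trans[OF norm_sum] sum_mono)
    fix A B assume "A \<in> ?S" "B \<in> ?S"
    then show "cmod ((L A B - L' A B) * ?t A B) \<le> \<epsilon> * cmod (?t A B)"
      unfolding norm_mult by (intro mult_right_mono assms(2)) auto
  qed simp
  also have "\<dots> = \<epsilon> * 8 ^ length us / 2 ^ (3 * length us)"
    by (simp add: sum_norm_mtrace_pauli_mat_mult4[OF assms(1)] sum_distrib_left[symmetric])
  also have "\<dots> = \<epsilon>" by (simp add: power_mult)
  finally show ?thesis .
qed

lemma ptm_chi:
  assumes "chi_coeffs n \<Phi> chi"
  shows "ptm n \<Phi> A B = (\<Sum>(P, Q)\<in>strings_on {..<n} \<times> strings_on {..<n}.
    chi P Q * (mtrace (pauli_op n A * pauli_op n P * pauli_op n B * pauli_op n Q) / 2 ^ n))"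
proof -
  let ?X = "strings_on {..<n} \<times> strings_on {..<n}" and ?N = "2 ^ n :: nat"
  let ?f = "\<lambda>x. case x of (P, Q) \<Rightarrow> chi P Q \<cdot>\<^sub>m (pauli_op n P * pauli_op n B * pauli_op n Q)"
  have c: "pauli_op n P * pauli_op n B * pauli_op n Q \<in> carrier_mat ?N ?N" for P Q
    by (intro square_mult_carrier pauli_op_carrier)
  then have f: "?f x \<in> carrier_mat ?N ?N" for x by (simp split: prod.split)
  have "pauli_op n A * \<Phi> (pauli_op n B) = msum ?N (\<lambda>x. pauli_op n A * ?f x) ?X"
    using assms by (simp add: chi_coeffs_def mult_msum[OF pauli_op_carrier f])
  then have "mtrace (pauli_op n A * \<Phi> (pauli_op n B)) = (\<Sum>x\<in>?X. mtrace (pauli_op n A * ?f x))"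
    by (simp add: mtrace_msum[OF mult_carrier_mat[OF pauli_op_carrier f]])
  also have "\<dots> = (\<Sum>(P, Q)\<in>?X. chi P Q * mtrace (pauli_op n A * pauli_op n P * pauli_op n B * pauli_op n Q))"
  proof (intro sum.cong refl, clarify)
    fix P Q
    have "pauli_op n A * (pauli_op n P * pauli_op n B * pauli_op n Q) = pauli_op n A * pauli_op n P * pauli_op n B * pauli_op n Q"
      by (simp add: assoc_mult_mat[of _ ?N ?N _ ?N _ ?N])
    then show "mtrace (pauli_op n A * (chi P Q \<cdot>\<^sub>m (pauli_op n P * pauli_op n B * pauli_op n Q)))
      = chi P Q * mtrace (pauli_op n A * pauli_op n P * pauli_op n B * pauli_op n Q)"
      unfolding mult_smult_distrib[OF pauli_op_carrier c] mtrace_smult[OF mult_carrier_mat[OF pauli_op_carrier c]]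
      by (simp only:)
  qed
  finally show ?thesis by (simp add: ptm_def sum_divide_distrib case_prod_unfold)
qed

lemma restr_strings [simp]: "restr P S \<in> strings_on S"
  by (auto simp: restr_def strings_on_def supp_def)

lemma glue_strings: "P \<in> strings_on S \<Longrightarrow> A \<in> strings_on (U - S) \<Longrightarrow> S \<subseteq> U \<Longrightarrow> glue S P A \<in> strings_on U"
  by (auto simp: glue_def strings_on_def supp_def)

lemma glue_id: "P \<in> strings_on S \<Longrightarrow> glue S P id_string = P"
  by (auto simp: glue_def fun_eq_iff strings_on_outside)

text \<open>Inserting the coefficient expansion and exchanging sums leaves the inversion kernel. It
  keeps exactly the pairs that restrict to \<open>(P, Q)\<close> on \<open>us\<close> and agree
  elsewhere; such a pair is determined by its common tail \<open>A\<close>, the trivial tail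
  included.\<close>

lemma local_sum_ptm:
  assumes "chi_coeffs n \<Phi> chi" "distinct us" "set us \<subseteq> {..<n}"
    and "P \<in> strings_on (set us)" "Q \<in> strings_on (set us)"
  shows "local_sum (ptm n \<Phi>) us P Q
    = (\<Sum>A\<in>strings_on ({..<n} - set us). chi (glue (set us) P A) (glue (set us) Q A))"
proof -
  let ?S = "strings_on (set us)" and ?X = "strings_on {..<n} \<times> strings_on {..<n}"
  let ?t = "\<lambda>A B. mtrace (pauli_mat us A * pauli_mat us Q * pauli_mat us B * pauli_mat us P)"
  let ?T = "\<lambda>P Q A B. mtrace (pauli_op n A * pauli_op n P * pauli_op n B * pauli_op n Q) / 2 ^ n"
  let ?c = "\<lambda>P' Q'. (\<forall>u\<in>set us. P' u = P u \<and> Q' u = Q u) \<and> (\<forall>u\<in>{..<n} - set us. P' u = Q' u)"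
  have "(\<Sum>A\<in>?S. \<Sum>B\<in>?S. ptm n \<Phi> A B * ?t A B)
      = (\<Sum>A\<in>?S. \<Sum>B\<in>?S. \<Sum>x\<in>?X. chi (fst x) (snd x) * (?T (fst x) (snd x) A B * ?t A B))"
    by (simp only: ptm_chi[OF assms(1)] sum_distrib_right case_prod_beta mult.assoc)
  also have "\<dots> = (\<Sum>A\<in>?S. \<Sum>x\<in>?X. \<Sum>B\<in>?S. chi (fst x) (snd x) * (?T (fst x) (snd x) A B * ?t A B))"
    by (intro sum.cong refl sum.swap)
  also have "\<dots> = (\<Sum>x\<in>?X. \<Sum>A\<in>?S. \<Sum>B\<in>?S. chi (fst x) (snd x) * (?T (fst x) (snd x) A B * ?t A B))"
    by (rule sum.swap)
  also have "\<dots> = (\<Sum>x\<in>?X. chi (fst x) (snd x) * (if ?c (fst x) (snd x) then 8 ^ length us else 0))"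
    by (simp only: sum_distrib_left[symmetric] sum_local_trace[OF assms(2,3)])
  also have "\<dots> = (\<Sum>x\<in>{x \<in> ?X. ?c (fst x) (snd x)}. chi (fst x) (snd x) * 8 ^ length us)"
    by (rule sum.mono_neutral_cong_right) auto
  also have "\<dots> = (\<Sum>A\<in>strings_on ({..<n} - set us). chi (glue (set us) P A) (glue (set us) Q A) * 8 ^ length us)"
  proof (rule sum.reindex_bij_witness[of _ "\<lambda>A. (glue (set us) P A, glue (set us) Q A)" "\<lambda>x. restr (fst x) ({..<n} - set us)"])
    fix x assume x: "x \<in> {x \<in> ?X. ?c (fst x) (snd x)}"
    have "fst x u = glue (set us) P (restr (fst x) ({..<n} - set us)) u"
      "snd x u = glue (set us) Q (restr (fst x) ({..<n} - set us)) u" for u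
      using x assms(3) strings_on_outside[of "fst x" "{..<n}" u] strings_on_outside[of "snd x" "{..<n}" u]
      by (auto simp: glue_def restr_def mem_Times_iff)
    then have e: "glue (set us) P (restr (fst x) ({..<n} - set us)) = fst x"
      "glue (set us) Q (restr (fst x) ({..<n} - set us)) = snd x" by (auto simp: fun_eq_iff)
    show "(glue (set us) P (restr (fst x) ({..<n} - set us)), glue (set us) Q (restr (fst x) ({..<n} - set us))) = x"
      by (simp add: e)
    show "chi (glue (set us) P (restr (fst x) ({..<n} - set us))) (glue (set us) Q (restr (fst x) ({..<n} - set us))) * 8 ^ length us
      = chi (fst x) (snd x) * 8 ^ length us" by (simp add: e)
    show "restr (fst x) ({..<n} - set us) \<in> strings_on ({..<n} - set us)" by simp
  next
    fix A assume A: "A \<in> strings_on ({..<n} - set us)"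
    show "restr (fst (glue (set us) P A, glue (set us) Q A)) ({..<n} - set us) = A"
      using strings_on_outside[OF A] by (auto simp: restr_def glue_def fun_eq_iff)
    show "(glue (set us) P A, glue (set us) Q A) \<in> {x \<in> ?X. ?c (fst x) (snd x)}"
      using A assms(3-5) by (auto intro: glue_strings) (auto simp: glue_def)
  qed
  finally show ?thesis unfolding local_sum_def by (simp add: power_mult sum_distrib_right[symmetric])
qed

text \<open>When \<open>us\<close> comprises all qubits no tail is left. In particular the
  coefficients on these strings are determined by the superoperator, so properties of the generator
  can be transferred to the given table.\<close>

lemma chi_eq_local_sum:
  assumes "chi_coeffs n \<Phi> chi" "P \<in> strings_on {..<n}" "Q \<in> strings_on {..<n}"
  shows "chi P Q = local_sum (ptm n \<Phi>) [0..<n] P Q"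
proof -
  have "local_sum (ptm n \<Phi>) [0..<n] P Q
    = (\<Sum>A\<in>strings_on ({..<n} - set [0..<n]). chi (glue (set [0..<n]) P A) (glue (set [0..<n]) Q A))"
    by (rule local_sum_ptm[OF assms(1)]) (use assms in \<open>simp_all add: atLeast0LessThan\<close>)
  then show ?thesis using assms by (simp add: atLeast0LessThan strings_on_empty glue_id)
qed

lemma local_sum_zero: "local_sum (\<lambda>_ _. 0) us P Q = 0"
  by (simp add: local_sum_def)

lemma local_sum_lincomb:
  "local_sum (\<lambda>A B. L A B + c * L' A B) us P Q = local_sum L us P Q + c * local_sum L' us P Q"
  by (simp add: local_sum_def sum.distrib sum_distrib_left add_divide_distrib distrib_right mult.assoc)

section \<open>Locality of the coefficients\<close>

text \<open>The coefficient at \<open>(P, Q)\<close> is expressed as a local sum over all qubits. In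
  this form it makes sense for every summand of the generator separately, without exhibiting a
  coefficient table for each.\<close>

definition coeff_vanishes :: "nat \<Rightarrow> pstring \<Rightarrow> pstring \<Rightarrow> superop \<Rightarrow> bool" where
  "coeff_vanishes n P Q \<Phi> \<longleftrightarrow> (\<forall>M\<in>carrier_mat (2 ^ n) (2 ^ n). \<Phi> M \<in> carrier_mat (2 ^ n) (2 ^ n)) \<and>
     local_sum (ptm n \<Phi>) [0..<n] P Q = 0"

lemma coeff_vanishes_lincomb:
  assumes "coeff_vanishes n P Q \<Phi>" "coeff_vanishes n P Q \<Psi>"
  shows "coeff_vanishes n P Q (\<lambda>M. \<Phi> M + c \<cdot>\<^sub>m \<Psi> M)"
proof -
  have c: "\<Phi> (pauli_op n B) \<in> carrier_mat (2 ^ n) (2 ^ n)" "\<Psi> (pauli_op n B) \<in> carrier_mat (2 ^ n) (2 ^ n)" for B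
    using assms by (auto simp: coeff_vanishes_def)
  have "ptm n (\<lambda>M. \<Phi> M + c \<cdot>\<^sub>m \<Psi> M) = (\<lambda>A B. ptm n \<Phi> A B + c * ptm n \<Psi> A B)"
    by (simp only: fun_eq_iff ptm_def mult_add_distrib_mat[OF pauli_op_carrier c(1) smult_carrier_mat[OF c(2)]]
        mult_smult_distrib[OF pauli_op_carrier c(2)]
        mtrace_add[OF mult_carrier_mat[OF pauli_op_carrier c(1)] smult_carrier_mat[OF mult_carrier_mat[OF pauli_op_carrier c(2)]]]
        mtrace_smult[OF mult_carrier_mat[OF pauli_op_carrier c(2)]] add_divide_distrib) simp
  then show ?thesis using assms by (auto simp: coeff_vanishes_def local_sum_lincomb)
qed

lemma coeff_vanishes_cong:
  "coeff_vanishes n P Q \<Phi> \<Longrightarrow> (\<And>M. M \<in> carrier_mat (2 ^ n) (2 ^ n) \<Longrightarrow> \<Psi> M = \<Phi> M) \<Longrightarrow> coeff_vanishes n P Q \<Psi>"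
  by (simp add: coeff_vanishes_def ptm_def[abs_def])

lemma coeff_vanishes_msum:
  assumes "finite X" "\<And>x. x \<in> X \<Longrightarrow> coeff_vanishes n P Q (\<Phi> x)"
  shows "coeff_vanishes n P Q (\<lambda>M. msum (2 ^ n) (\<lambda>x. \<Phi> x M) X)"
  using assms
proof (induction X rule: finite_induct)
  case empty
  have "ptm n (\<lambda>M. msum (2 ^ n) (\<lambda>x. \<Phi> x M) {}) = (\<lambda>_ _. 0)"
    by (simp add: fun_eq_iff ptm_def msum_empty mtrace_def right_mult_zero_mat[OF pauli_op_carrier])
  then show ?case by (simp add: coeff_vanishes_def local_sum_zero)
next
  case (insert x X)
  then have "coeff_vanishes n P Q (\<lambda>M. msum (2 ^ n) (\<lambda>x. \<Phi> x M) X)" "coeff_vanishes n P Q (\<Phi> x)" by auto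
  from coeff_vanishes_lincomb[OF this(2,1), of 1] show ?case
    by (rule coeff_vanishes_cong)
      (use insert in \<open>auto simp: msum_insert coeff_vanishes_def intro!: eq_carrierI[of _ "2 ^ n"]\<close>)
qed

lemma mtrace_span:
  assumes "Z \<in> carrier_mat (2 ^ n) (2 ^ n)"
  shows "mtrace (Z * msum (2 ^ n) (\<lambda>P. c P \<cdot>\<^sub>m pauli_op n P) A) = (\<Sum>P\<in>A. c P * mtrace (Z * pauli_op n P))"
  unfolding mult_msum[OF assms smult_carrier_mat[OF pauli_op_carrier]]
    mult_smult_distrib[OF assms pauli_op_carrier]
    mtrace_msum[OF smult_carrier_mat[OF mult_carrier_mat[OF assms pauli_op_carrier]]]
    mtrace_smult[OF mult_carrier_mat[OF assms pauli_op_carrier]] ..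

text \<open>The coefficient table of the map that multiplies by \<open>U\<close> from the left and
  \<open>V\<close> from the right is the product of their Pauli expansions, hence supported on
  \<open>A1\<close> times \<open>A2\<close>.\<close>

lemma coeff_vanishes_sandwich:
  assumes "U \<in> pauli_span n A1" "V \<in> pauli_span n A2" "A1 \<subseteq> strings_on {..<n}" "A2 \<subseteq> strings_on {..<n}"
    and "P \<in> strings_on {..<n}" "Q \<in> strings_on {..<n}" "P \<notin> A1 \<or> Q \<notin> A2"
  shows "coeff_vanishes n P Q (\<lambda>M. U * M * V)"
proof -
  let ?N = "2 ^ n :: nat" and ?S = "strings_on {..<n}"
  obtain u where U: "U = msum ?N (\<lambda>P. u P \<cdot>\<^sub>m pauli_op n P) A1" using assms(1) by (auto simp: pauli_span_def)
  obtain v where V: "V = msum ?N (\<lambda>P. v P \<cdot>\<^sub>m pauli_op n P) A2" using assms(2) by (auto simp: pauli_span_def)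
  have c: "U \<in> carrier_mat ?N ?N" "V \<in> carrier_mat ?N ?N" by (simp_all add: U V)
  let ?t = "\<lambda>A B. mtrace (pauli_op n A * pauli_op n Q * pauli_op n B * pauli_op n P)"
  let ?T = "\<lambda>P' Q' A B. mtrace (pauli_op n A * pauli_op n P' * pauli_op n B * pauli_op n Q') / 2 ^ n"
  have ptm: "ptm n (\<lambda>M. U * M * V) A B = (\<Sum>P'\<in>A1. \<Sum>Q'\<in>A2. u P' * v Q' * ?T P' Q' A B)" for A B
  proof -
    let ?a = "pauli_op n A" and ?b = "pauli_op n B"
    \<comment> \<open>Cyclicity brings \<open>U\<close>, and afterwards \<open>V\<close>, to the
      right end, where a Pauli expansion can be pulled out of the trace.\<close>
    have "mtrace (?a * (U * ?b * V)) = mtrace ((?b * V * ?a) * U)"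
      using c mtrace_commute[of "?b * V * ?a" ?N U]
        mtrace_commute[of "?a" ?N "U * ?b * V"]
      by (simp add: square_mat_simps(1,8)[of _ ?N])
    also have "\<dots> = (\<Sum>P'\<in>A1. u P' * mtrace ((?b * V * ?a) * pauli_op n P'))"
      unfolding U by (rule mtrace_span) (use c in \<open>auto intro!: mult_carrier_mat\<close>)
    also have "\<dots> = (\<Sum>P'\<in>A1. u P' * (\<Sum>Q'\<in>A2. v Q' * mtrace (?a * pauli_op n P' * ?b * pauli_op n Q')))"
    proof (intro sum.cong refl arg_cong2[where f = "(*)"])
      fix P'
      have "mtrace ((?b * V * ?a) * pauli_op n P') = mtrace ((?a * pauli_op n P' * ?b) * V)"
        using c mtrace_commute[of "?b * V" ?N "?a * pauli_op n P'"]
          mtrace_commute[of "?a * pauli_op n P'" ?N "?b * V"]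
        by (simp add: square_mat_simps(1,8)[of _ ?N])
      then show "mtrace ((?b * V * ?a) * pauli_op n P') = (\<Sum>Q'\<in>A2. v Q' * mtrace (?a * pauli_op n P' * ?b * pauli_op n Q'))"
        unfolding V by (subst mtrace_span[symmetric]) (auto intro!: mult_carrier_mat[of _ ?N ?N])
    qed
    finally show ?thesis by (simp add: ptm_def sum_divide_distrib sum_distrib_left mult.assoc)
  qed
  have X: "(\<Sum>A\<in>?S. \<Sum>B\<in>?S. ?T P' Q' A B * ?t A B) = 0" if "P' \<in> A1" "Q' \<in> A2" for P' Q'
  proof -
    have "\<not> (\<forall>u\<in>{..<n}. P' u = P u \<and> Q' u = Q u)"
    proof
      assume *: "\<forall>u\<in>{..<n}. P' u = P u \<and> Q' u = Q u"
      have m: "P' \<in> strings_on {..<n}" "Q' \<in> strings_on {..<n}" using that assms(3,4) by auto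
      have "P' u = P u \<and> Q' u = Q u" for u
      proof (cases "u \<in> {..<n}")
        case False
        then show ?thesis by (simp only: strings_on_outside[OF _ False] m assms(5,6))
      qed (use * in blast)
      then have "P' = P" "Q' = Q" by auto
      then show False using assms(7) that by auto
    qed
    then show ?thesis
      using sum_local_trace[of "[0..<n]" n P' Q' Q P] by (auto simp: atLeast0LessThan)
  qed
  have "(\<Sum>A\<in>?S. \<Sum>B\<in>?S. ptm n (\<lambda>M. U * M * V) A B * ?t A B)
      = (\<Sum>A\<in>?S. \<Sum>B\<in>?S. \<Sum>x\<in>A1 \<times> A2. u (fst x) * v (snd x) * (?T (fst x) (snd x) A B * ?t A B))"
    by (simp only: ptm sum_distrib_right sum.cartesian_product case_prod_beta mult.assoc)
  also have "\<dots> = (\<Sum>A\<in>?S. \<Sum>x\<in>A1 \<times> A2. \<Sum>B\<in>?S. u (fst x) * v (snd x) * (?T (fst x) (snd x) A B * ?t A B))"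
    by (intro sum.cong refl sum.swap)
  also have "\<dots> = (\<Sum>x\<in>A1 \<times> A2. \<Sum>A\<in>?S. \<Sum>B\<in>?S. u (fst x) * v (snd x) * (?T (fst x) (snd x) A B * ?t A B))"
    by (rule sum.swap)
  also have "\<dots> = 0"
    unfolding sum_distrib_left[symmetric]
  proof (rule sum.neutral, rule ballI)
    fix x assume "x \<in> A1 \<times> A2"
    then show "u (fst x) * v (snd x) * (\<Sum>A\<in>?S. \<Sum>B\<in>?S. ?T (fst x) (snd x) A B * ?t A B) = 0"
      by (subst X) (auto simp: mem_Times_iff)
  qed
  finally have "local_sum (ptm n (\<lambda>M. U * M * V)) [0..<n] P Q = 0"
    by (simp add: local_sum_def atLeast0LessThan)
  then show ?thesis unfolding coeff_vanishes_def using c by (auto intro!: mult_carrier_mat[of _ ?N ?N])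
qed

lemma pauli_span_pauli: "finite A \<Longrightarrow> P \<in> A \<Longrightarrow> pauli_op n P \<in> pauli_span n A"
proof -
  assume A: "finite A" "P \<in> A"
  have "pauli_op n P = msum (2 ^ n) (\<lambda>Q. (if Q = P then 1 else 0) \<cdot>\<^sub>m pauli_op n Q) A"
  proof (rule eq_carrierI[of _ "2 ^ n"])
    fix i j :: nat assume ij: "i < 2 ^ n" "j < 2 ^ n"
    have "msum (2 ^ n) (\<lambda>Q. (if Q = P then 1 else 0) \<cdot>\<^sub>m pauli_op n Q) A $$ (i, j)
        = (\<Sum>Q\<in>A. if Q = P then pauli_op n P $$ (i, j) else 0)"
      unfolding msum_index[OF ij] carrier_index(3)[OF pauli_op_carrier ij] by (intro sum.cong) auto
    then show "pauli_op n P $$ (i, j) = msum (2 ^ n) (\<lambda>Q. (if Q = P then 1 else 0) \<cdot>\<^sub>m pauli_op n Q) A $$ (i, j)"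
      using A by simp
  qed auto
  then show ?thesis unfolding pauli_span_def by (intro CollectI exI[of _ "\<lambda>Q. if Q = P then 1 else 0"]) simp
qed

lemma pauli_span_smult: "U \<in> pauli_span n A \<Longrightarrow> z \<cdot>\<^sub>m U \<in> pauli_span n A"
proof -
  assume "U \<in> pauli_span n A"
  then obtain c where U: "U = msum (2 ^ n) (\<lambda>P. c P \<cdot>\<^sub>m pauli_op n P) A" by (auto simp: pauli_span_def)
  have "z \<cdot>\<^sub>m U = msum (2 ^ n) (\<lambda>P. (z * c P) \<cdot>\<^sub>m pauli_op n P) A"
  proof (rule eq_carrierI[of _ "2 ^ n"])
    fix i j :: nat assume ij: "i < 2 ^ n" "j < 2 ^ n"
    show "(z \<cdot>\<^sub>m U) $$ (i, j) = msum (2 ^ n) (\<lambda>P. (z * c P) \<cdot>\<^sub>m pauli_op n P) A $$ (i, j)"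
      unfolding U carrier_index(3)[OF msum_carrier ij] msum_index[OF ij] carrier_index(3)[OF pauli_op_carrier ij]
      by (simp add: sum_distrib_left mult.assoc)
  qed (auto simp: U)
  then show ?thesis unfolding pauli_span_def by (intro CollectI exI[of _ "\<lambda>P. z * c P"]) simp
qed

lemma pauli_span_msum:
  assumes "\<And>x. x \<in> X \<Longrightarrow> f x \<in> pauli_span n A"
  shows "msum (2 ^ n) f X \<in> pauli_span n A"
proof -
  have "\<forall>x\<in>X. \<exists>c. f x = msum (2 ^ n) (\<lambda>P. c P \<cdot>\<^sub>m pauli_op n P) A" using assms by (auto simp: pauli_span_def)
  then obtain c where c: "\<And>x. x \<in> X \<Longrightarrow> f x = msum (2 ^ n) (\<lambda>P. c x P \<cdot>\<^sub>m pauli_op n P) A"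
    by (metis bchoice)
  have "msum (2 ^ n) f X = msum (2 ^ n) (\<lambda>P. (\<Sum>x\<in>X. c x P) \<cdot>\<^sub>m pauli_op n P) A"
  proof (rule eq_carrierI[of _ "2 ^ n"])
    fix i j :: nat assume ij: "i < 2 ^ n" "j < 2 ^ n"
    have "msum (2 ^ n) f X $$ (i, j) = (\<Sum>x\<in>X. \<Sum>P\<in>A. c x P * pauli_op n P $$ (i, j))"
      unfolding msum_index[OF ij]
      by (intro sum.cong refl) (simp only: c msum_index[OF ij] carrier_index(3)[OF pauli_op_carrier ij])
    also have "\<dots> = (\<Sum>P\<in>A. \<Sum>x\<in>X. c x P * pauli_op n P $$ (i, j))" by (rule sum.swap)
    finally show "msum (2 ^ n) f X $$ (i, j) = msum (2 ^ n) (\<lambda>P. (\<Sum>x\<in>X. c x P) \<cdot>\<^sub>m pauli_op n P) A $$ (i, j)"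
      unfolding msum_index[OF ij] carrier_index(3)[OF pauli_op_carrier ij] by (simp add: sum_distrib_right)
  qed auto
  then show ?thesis unfolding pauli_span_def by (intro CollectI exI[of _ "\<lambda>P. \<Sum>x\<in>X. c x P"]) simp
qed

lemma pauli_op_mult_span:
  assumes "finite e" "P \<in> strings_on e" "Q \<in> strings_on e"
  shows "pauli_op n P * pauli_op n Q \<in> pauli_span n (strings_on e)"
proof -
  let ?R = "\<lambda>u. pauli_mult (P u) (Q u)" and ?z = "\<Prod>r<n. pauli_phase (P r) (Q r)"
  have "pauli_op n P * pauli_op n Q = ?z \<cdot>\<^sub>m pauli_op n ?R"
  proof (rule eq_carrierI[of _ "2 ^ n"])
    fix i j :: nat assume ij: "i < 2 ^ n" "j < 2 ^ n"
    show "(pauli_op n P * pauli_op n Q) $$ (i, j) = (?z \<cdot>\<^sub>m pauli_op n ?R) $$ (i, j)"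
    proof -
      have "(pauli_op n P * pauli_op n Q) $$ (i, j)
          = (\<Prod>r<n. (pauli_phase (P r) (Q r) \<cdot>\<^sub>m sigma (?R r)) $$ (i div 2 ^ r mod 2, j div 2 ^ r mod 2))"
        using ij unfolding pauli_mat_mult sigma_mult by (simp add: tensor_def del: index_smult_mat(1))
      also have "\<dots> = (\<Prod>r<n. pauli_phase (P r) (Q r) * sigma (?R r) $$ (i div 2 ^ r mod 2, j div 2 ^ r mod 2))"
        by (intro prod.cong refl carrier_index(3)[OF sigma_carrier]) auto
      also have "\<dots> = ?z * pauli_op n ?R $$ (i, j)"
        using ij unfolding prod.distrib pauli_mat_def by (simp add: tensor_def)
      finally show ?thesis unfolding carrier_index(3)[OF pauli_op_carrier ij] .
    qed
  qed (auto intro: mult_carrier_mat[of _ "2 ^ n" "2 ^ n"])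
  moreover have "?R \<in> strings_on e"
  proof -
    have "?R u = PI" if "u \<notin> e" for u
      by (simp only: strings_on_outside[OF assms(2) that] strings_on_outside[OF assms(3) that] pauli_mult.simps)
    then show ?thesis by (auto simp: strings_on_def supp_def)
  qed
  ultimately show ?thesis using assms(1) by (simp add: pauli_span_smult pauli_span_pauli)
qed

lemma pauli_span_mult:
  assumes "finite e" "U \<in> pauli_span n (strings_on e)" "V \<in> pauli_span n (strings_on e)"
  shows "U * V \<in> pauli_span n (strings_on e)"
proof -
  let ?N = "2 ^ n :: nat" and ?S = "strings_on e"
  obtain u where U: "U = msum ?N (\<lambda>P. u P \<cdot>\<^sub>m pauli_op n P) ?S" using assms(2) by (auto simp: pauli_span_def)
  obtain v where V: "V = msum ?N (\<lambda>P. v P \<cdot>\<^sub>m pauli_op n P) ?S" using assms(3) by (auto simp: pauli_span_def)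
  have "U * V = msum ?N (\<lambda>P. (u P \<cdot>\<^sub>m pauli_op n P) * V) ?S"
    unfolding U by (rule msum_mult) (auto simp: V)
  also have "\<dots> = msum ?N (\<lambda>P. u P \<cdot>\<^sub>m msum ?N (\<lambda>Q. v Q \<cdot>\<^sub>m (pauli_op n P * pauli_op n Q)) ?S) ?S"
  proof (rule msum_cong)
    fix P
    have "(u P \<cdot>\<^sub>m pauli_op n P) * V = u P \<cdot>\<^sub>m (pauli_op n P * V)"
      unfolding V by (rule mult_smult_assoc_mat[OF pauli_op_carrier msum_carrier])
    then show "(u P \<cdot>\<^sub>m pauli_op n P) * V = u P \<cdot>\<^sub>m msum ?N (\<lambda>Q. v Q \<cdot>\<^sub>m (pauli_op n P * pauli_op n Q)) ?S"
      unfolding V mult_msum[OF pauli_op_carrier smult_carrier_mat[OF pauli_op_carrier]]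
        mult_smult_distrib[OF pauli_op_carrier pauli_op_carrier] .
  qed
  finally have "U * V = msum ?N (\<lambda>P. u P \<cdot>\<^sub>m msum ?N (\<lambda>Q. v Q \<cdot>\<^sub>m (pauli_op n P * pauli_op n Q)) ?S) ?S" .
  then show ?thesis by (auto intro!: pauli_span_msum pauli_span_smult pauli_op_mult_span assms(1))
qed

context local_generator begin

text \<open>The generator is a combination of two-sided multiplications. In the dissipators both
  factors live on a common region of at most \<open>k\<close> qubits, and in the commutator one
  factor is the identity, so no pair of larger joint support occurs.\<close>

lemma coeff_vanishes_lindbladian:
  assumes P: "P \<in> strings_on {..<n}" "Q \<in> strings_on {..<n}" and np: "(P, Q) \<notin> pairs n k"
  shows "coeff_vanishes n P Q (lindbladian n k G)"
proof -
  have one: "1\<^sub>m N \<in> pauli_span n {id_string}"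
    using pauli_span_pauli[of "{id_string}" id_string n] by (simp add: pauli_op_id)
  have sub: "strings_on e \<subseteq> strings_on {..<n}" if "e \<in> regions n k" for e
    using that by (auto simp: regions_def strings_on_def)
  have fin: "finite e" if "e \<in> regions n k" for e
    using that finite_subset[OF _ finite_lessThan, of e n] by (auto simp: regions_def)
  have out: "P \<notin> strings_on e \<or> Q \<notin> strings_on e" if "e \<in> regions n k" for e
  proof (rule ccontr)
    assume "\<not> ?thesis"
    then have "supp P \<union> supp Q \<subseteq> e" by (auto simp: strings_on_def)
    then have "card (supp P \<union> supp Q) \<le> card e" using fin[OF that] by (rule card_mono[rotated])
    then show False using np P that by (auto simp: pairs_def regions_def)
  qed
  have id: "{id_string} \<subseteq> strings_on S" for S by (simp add: strings_on_def supp_def)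
  have idm: "id_string \<in> strings_on S" for S using id by auto
  let ?S = "{P \<in> strings_on {..<n}. card (supp P) \<le> k}"
  have Hs: "ham G \<in> pauli_span n ?S" using local_G by (simp add: k_local_def)
  have supp0: "supp id_string = {}" by (simp add: supp_def)
  \<comment> \<open>With the identity on one side the joint support is that of a single Hamiltonian
    string.\<close>
  have outH: "P \<notin> ?S \<or> Q \<notin> {id_string}" "P \<notin> {id_string} \<or> Q \<notin> ?S"
    using np P by (auto simp: pairs_def supp0)
  have v1: "coeff_vanishes n P Q (\<lambda>M. ham G * M * 1\<^sub>m N)"
    by (rule coeff_vanishes_sandwich[OF Hs one _ id P outH(1)]) auto
  have v2: "coeff_vanishes n P Q (\<lambda>M. 1\<^sub>m N * M * ham G)"
    by (rule coeff_vanishes_sandwich[OF one Hs id _ P outH(2)]) auto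
  \<comment> \<open>An empty sum, used as the starting point because
    \<open>coeff_vanishes_lincomb\<close> adds a multiple to a given map.\<close>
  have zero: "coeff_vanishes n P Q (\<lambda>M. msum N (\<lambda>x. M) ({} :: nat set))" by (rule coeff_vanishes_msum) auto
  have ham: "coeff_vanishes n P Q (ham_part (ham G))"
  proof (rule coeff_vanishes_cong[OF coeff_vanishes_lincomb[OF coeff_vanishes_lincomb[OF zero v1, of "- \<i>"] v2, of \<i>]])
    fix M :: "complex mat" assume M: "M \<in> carrier_mat N N"
    note c = mult_carrier_mat[OF ham_carrier M] mult_carrier_mat[OF M ham_carrier]
    show "ham_part (ham G) M = msum N (\<lambda>x. M) ({} :: nat set) + (- \<i>) \<cdot>\<^sub>m (ham G * M * 1\<^sub>m N) + \<i> \<cdot>\<^sub>m (1\<^sub>m N * M * ham G)"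
      unfolding ham_part_def msum_empty right_mult_one_mat[OF c(1)] left_mult_one_mat[OF M]
    proof (rule eq_carrierI[of _ N])
      fix i j assume ij: "i < N" "j < N"
      show "((- \<i>) \<cdot>\<^sub>m (ham G * M - M * ham G)) $$ (i, j)
          = (0\<^sub>m N N + (- \<i>) \<cdot>\<^sub>m (ham G * M) + \<i> \<cdot>\<^sub>m (M * ham G)) $$ (i, j)"
        using c minus_carrier[OF c] ij
        by (simp add: carrier_index[of _ N] algebra_simps
            del: index_add_mat index_smult_mat index_minus_mat index_mult_mat(1))
    qed (use c minus_carrier[OF c] in auto)
  qed
  have diss: "coeff_vanishes n P Q (dissipator L)" if e: "e \<in> regions n k" and L: "L \<in> pauli_span n (strings_on e)" for e L
  proof -
    let ?A = "mat_adjoint L"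
    have A: "?A \<in> pauli_span n (strings_on e)" by (rule pauli_span_adjoint[OF L])
    have AL: "?A * L \<in> pauli_span n (strings_on e)" by (rule pauli_span_mult[OF fin[OF e] A L])
    have o: "P \<notin> strings_on e \<or> Q \<notin> {id_string}" "P \<notin> {id_string} \<or> Q \<notin> strings_on e"
      using out[OF e] idm by auto
    have w1: "coeff_vanishes n P Q (\<lambda>M. L * M * ?A)"
      by (rule coeff_vanishes_sandwich[OF L A sub[OF e] sub[OF e] P out[OF e]])
    have w2: "coeff_vanishes n P Q (\<lambda>M. (?A * L) * M * 1\<^sub>m N)"
      by (rule coeff_vanishes_sandwich[OF AL one sub[OF e] id P o(1)])
    have w3: "coeff_vanishes n P Q (\<lambda>M. 1\<^sub>m N * M * (?A * L))"
      by (rule coeff_vanishes_sandwich[OF one AL id sub[OF e] P o(2)])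
    show ?thesis
    proof (rule coeff_vanishes_cong[OF coeff_vanishes_lincomb[OF coeff_vanishes_lincomb[OF w1 w2, of "- 1 / 2"] w3, of "- 1 / 2"]])
      fix M :: "complex mat" assume M: "M \<in> carrier_mat N N"
      have cL: "L \<in> carrier_mat N N" and cAL: "?A * L \<in> carrier_mat N N"
        using pauli_span_carrier[OF L] pauli_span_carrier[OF AL] .
      have c: "?A * L * M \<in> carrier_mat N N" "M * (?A * L) \<in> carrier_mat N N" "L * M * ?A \<in> carrier_mat N N"
        using cL cAL M by (auto intro!: mult_carrier_mat)
      show "dissipator L M = L * M * ?A + (- 1 / 2) \<cdot>\<^sub>m (?A * L * M * 1\<^sub>m N) + (- 1 / 2) \<cdot>\<^sub>m (1\<^sub>m N * M * (?A * L))"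
        unfolding dissipator_def right_mult_one_mat[OF c(1)] left_mult_one_mat[OF M]
      proof (rule eq_carrierI[of _ N])
        fix i j assume ij: "i < N" "j < N"
        show "(L * M * ?A - (1 / 2) \<cdot>\<^sub>m (?A * L * M + M * (?A * L))) $$ (i, j)
          = (L * M * ?A + (- 1 / 2) \<cdot>\<^sub>m (?A * L * M) + (- 1 / 2) \<cdot>\<^sub>m (M * (?A * L))) $$ (i, j)"
          using c ij by (simp add: carrier_index[of _ N] algebra_simps
              del: index_add_mat index_smult_mat index_minus_mat index_mult_mat(1))
      qed (use c in \<open>auto intro!: minus_carrier\<close>)
    qed
  qed
  have "coeff_vanishes n P Q (\<lambda>M. msum N (\<lambda>e. jump_part n G e M) (regions n k))"
    unfolding jump_part_def
    by (intro coeff_vanishes_msum finite_regions finite_lessThan, rule diss, assumption, rule jumps_span) auto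
  from coeff_vanishes_lincomb[OF ham this, of 1] show ?thesis
    by (rule coeff_vanishes_cong) (auto simp: lindbladian_def intro!: eq_carrierI[of _ N] linD(1)[OF lin_ham_part[OF ham_carrier]])
qed

text \<open>The sums in \<open>diag_rho\<close> run over all diagonal extensions, including those
  reaching beyond \<open>k\<close> qubits; locality of the generator settles these.\<close>

lemma chi_local:
  assumes "chi_coeffs n (lindbladian n k G) chi" "P \<in> strings_on {..<n}" "Q \<in> strings_on {..<n}" "(P, Q) \<notin> pairs n k"
  shows "chi P Q = 0"
  using coeff_vanishes_lindbladian[OF assms(2-4)] chi_eq_local_sum[OF assms(1-3)]
  by (simp add: coeff_vanishes_def)

end

section \<open>Diagonal degree and rejected mass\<close>

lemma finite_local_triples: "finite (local_triples n)"
  unfolding local_triples_def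
  by (intro finite_SigmaI finite_cartesian_product finite_strings_on) (auto dest: finite_subset)

lemma extensions_subset: "extensions n S \<subseteq> strings_on {..<n}"
  by (auto simp: extensions_def strings_on_def)

lemma finite_extensions [simp]: "finite (extensions n S)"
  by (rule finite_subset[OF extensions_subset]) simp

lemma diag_degree_ge:
  assumes "S \<subseteq> {..<n}" "P \<in> strings_on S" "Q \<in> strings_on S"
  shows "card {A \<in> extensions n S. (glue S P A, glue S Q A) \<in> large_pairs n k chi \<tau>} \<le> diag_degree n k chi \<tau>"
  unfolding diag_degree_def
  by (rule Max_ge[OF finite_imageI[OF finite_local_triples]], rule image_eqI[of _ _ "(S, P, Q)"])
    (use assms in \<open>auto simp: local_triples_def\<close>)

lemma diag_rho_ge:
  assumes "S \<subseteq> {..<n}" "P \<in> strings_on S" "Q \<in> strings_on S"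
  shows "(\<Sum>A | A \<in> extensions n S \<and> (glue S P A, glue S Q A) \<notin> large_pairs n k chi \<tau>.
       cmod (chi (glue S P A) (glue S Q A))) \<le> diag_rho n k chi \<tau>"
  unfolding diag_rho_def
  by (rule Max_ge[OF finite_imageI[OF finite_local_triples]], rule image_eqI[of _ _ "(S, P, Q)"])
    (use assms in \<open>auto simp: local_triples_def\<close>)

lemma diag_rho_nonneg: "0 \<le> diag_rho n k chi \<tau>"
  by (rule order_trans[OF _ diag_rho_ge[where S = "{}" and P = id_string and Q = id_string]])
    (auto intro!: sum_nonneg simp: strings_on_def supp_def)

lemma diag_D_ge_1: "1 \<le> diag_D n k chi \<tau>"
proof -
  have "diag_degree n k chi \<tau> ^ 0 \<le> diag_D n k chi \<tau>"
    unfolding diag_D_def by (rule member_le_sum) auto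
  then show ?thesis by simp
qed

text \<open>An extension that is not large either belongs to \<open>pairs n k\<close>, where
  exactness makes its coefficient 0, or has too large a support, where locality does.\<close>

lemma exact_threshold_rho:
  assumes "generator_setting n k G chi lam \<gamma>" "exact_threshold n k chi (lam + \<gamma>)"
  shows "diag_rho n k chi (lam + \<gamma>) = 0" "margin_condition n k chi lam \<gamma>"
proof -
  interpret local_generator n k G
    by unfold_locales (use assms(1) in \<open>simp add: generator_setting_def\<close>)
  have z: "(\<Sum>A | A \<in> extensions n S \<and> (glue S P A, glue S Q A) \<notin> large_pairs n k chi (lam + \<gamma>).
       cmod (chi (glue S P A) (glue S Q A))) = 0" if t: "(S, P, Q) \<in> local_triples n" for S P Q
  proof (rule sum.neutral, clarify)
    fix A assume A: "A \<in> extensions n S" "(glue S P A, glue S Q A) \<notin> large_pairs n k chi (lam + \<gamma>)"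
    have SPQ: "S \<subseteq> {..<n}" "P \<in> strings_on S" "Q \<in> strings_on S" using t by (auto simp: local_triples_def)
    have A': "A \<in> strings_on ({..<n} - S)" "A \<noteq> id_string" using A by (auto simp: extensions_def)
    have g: "glue S P A \<in> strings_on {..<n}" "glue S Q A \<in> strings_on {..<n}"
      by (rule glue_strings[OF SPQ(2) A'(1) SPQ(1)], rule glue_strings[OF SPQ(3) A'(1) SPQ(1)])
    obtain u where u: "A u \<noteq> PI" using A'(2) by auto
    then have "u \<notin> S" using strings_on_outside[OF A'(1), of u] by auto
    then have "glue S P A u \<noteq> PI" using u by (simp add: glue_def)
    then have "glue S P A \<noteq> id_string" by metis
    then show "cmod (chi (glue S P A) (glue S Q A)) = 0"
      using A(2) assms(2) chi_local[OF _ g] assms(1)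
      by (cases "(glue S P A, glue S Q A) \<in> pairs n k")
        (auto simp: exact_threshold_def pairs0_def generator_setting_def)
  qed
  have "({}, id_string, id_string) \<in> local_triples n"
    by (simp add: local_triples_def strings_on_def supp_def)
  then have ne: "local_triples n \<noteq> {}" by blast
  have "(\<lambda>(S, P, Q). \<Sum>A | A \<in> extensions n S \<and> (glue S P A, glue S Q A) \<notin> large_pairs n k chi (lam + \<gamma>).
       cmod (chi (glue S P A) (glue S Q A))) ` local_triples n = (\<lambda>_. 0) ` local_triples n"
  proof (rule image_cong[OF refl])
    fix t assume "t \<in> local_triples n"
    then show "(case t of (S, P, Q) \<Rightarrow> \<Sum>A | A \<in> extensions n S \<and> (glue S P A, glue S Q A) \<notin> large_pairs n k chi (lam + \<gamma>).
       cmod (chi (glue S P A) (glue S Q A))) = 0"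
      by (cases t) (simp only: prod.case z)
  qed
  also have "(\<lambda>_. 0) ` local_triples n = {0 :: real}" using ne by auto
  finally have "diag_rho n k chi (lam + \<gamma>) = Max {0}" unfolding diag_rho_def by (rule arg_cong)
  then show r: "diag_rho n k chi (lam + \<gamma>) = 0" by simp
  show "margin_condition n k chi lam \<gamma>"
    using assms(1) by (simp add: margin_condition_def r generator_setting_def)
qed

section \<open>Correctness of guarded recovery\<close>

lemma fst_ops [simp]: "fst (ops c f \<sigma>) = f \<sigma>"
  by (simp add: ops_def)

lemma fst_sequ [simp]: "fst ((p ;; q) \<sigma>) = fst (q (fst (p \<sigma>)))"
  by (simp add: sequ_def split: prod.splits)

lemma fst_whenever: "fst (whenever c b p \<sigma>) = (if b \<sigma> then fst (p \<sigma>) else \<sigma>)"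
  by (simp add: whenever_def)

lemma fst_for_each: "fst (for_each w xs body \<sigma>) = fold (\<lambda>x \<sigma>. fst (body x \<sigma>)) xs \<sigma>"
  by (induction xs arbitrary: \<sigma>) simp_all

text \<open>The invariant may speak about the elements visited so far, and each step sees the
  position of its element in the whole list, so that distinctness and order of the list can be
  used.\<close>

lemma fold_invariant_prefix:
  assumes "I [] \<sigma>" "\<And>ys x zs \<sigma>. xs = ys @ x # zs \<Longrightarrow> I ys \<sigma> \<Longrightarrow> I (ys @ [x]) (f x \<sigma>)"
  shows "I xs (fold f xs \<sigma>)"
proof -
  have "I ys (fold f ys \<sigma>)" if "xs = ys @ zs" for ys zs
    using that
  proof (induction ys arbitrary: zs rule: rev_induct)
    case Nil
    then show ?case using assms(1) by simp
  next
    case (snoc y ys)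
    then have "I ys (fold f ys \<sigma>)" by simp
    then show ?case using assms(2)[of ys y zs "fold f ys \<sigma>"] snoc.prems by simp
  qed
  then show ?thesis by simp
qed

section \<open>The pairs visited by the loops\<close>

lemma string_list_props:
  assumes "distinct us"
  shows "set (string_list us) = strings_on (set us)" "distinct (string_list us)"
proof -
  have "set (string_list us) = strings_on (set us) \<and> distinct (string_list us)"
    using assms
  proof (induction us)
    case Nil
    then show ?case by (simp add: strings_on_empty)
  next
    case (Cons u us)
    then have IH: "set (string_list us) = strings_on (set us)" "distinct (string_list us)" and u: "u \<notin> set us" by auto
    have "set (string_list (u # us)) = strings_on (set (u # us))"
      unfolding list.set(2) strings_on_insert by (auto simp: IH image_iff) (metis pauli.exhaust)
    moreover have inj: "inj_on (\<lambda>P. P(u := a)) (strings_on (set us))" for a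
    proof (rule inj_onI)
      fix P Q assume *: "P \<in> strings_on (set us)" "Q \<in> strings_on (set us)" "P(u := a) = Q(u := a)"
      then have "P u = Q u" using strings_on_outside[OF _ u] by metis
      then show "P = Q" using *(3) by (metis fun_upd_triv fun_upd_upd)
    qed
    have "distinct (string_list (u # us))"
      using inj by (auto simp: distinct_map IH dest: fun_cong[of _ _ u] elim!: inj_on_subset)
    ultimately show ?case by simp
  qed
  then show "set (string_list us) = strings_on (set us)" "distinct (string_list us)" by auto
qed

lemma combs_props: "S \<in> set (combs n s) \<longleftrightarrow> sorted_wrt (<) S \<and> set S \<subseteq> {..<n} \<and> length S = s"
proof (induction n s arbitrary: S rule: combs.induct)
  case (1 n)
  then show ?case by auto
next
  case (2 s)
  then show ?case by auto
next
  case (3 n s)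
  show ?case
  proof
    assume "S \<in> set (combs (Suc n) (Suc s))"
    then consider "S \<in> set (combs n (Suc s))" | c where "S = c @ [n]" "c \<in> set (combs n s)" by auto
    then show "sorted_wrt (<) S \<and> set S \<subseteq> {..<Suc n} \<and> length S = Suc s"
    proof cases
      case 1
      then have "sorted_wrt (<) S \<and> set S \<subseteq> {..<n} \<and> length S = Suc s" using 3 by blast
      then show ?thesis by auto
    next
      case 2
      then have "sorted_wrt (<) c \<and> set c \<subseteq> {..<n} \<and> length c = s" using 3 by blast
      then show ?thesis using 2 by (auto simp: sorted_wrt_append)
    qed
  next
    assume S: "sorted_wrt (<) S \<and> set S \<subseteq> {..<Suc n} \<and> length S = Suc s"
    then obtain c x where c: "S = c @ [x]" by (metis length_0_conv nat.distinct(1) rev_exhaust)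
    then have cx: "sorted_wrt (<) c" "\<forall>y\<in>set c. y < x" "x < Suc n" "length c = s"
      using S by (auto simp: sorted_wrt_append)
    show "S \<in> set (combs (Suc n) (Suc s))"
    proof (cases "x = n")
      case True
      then have "c \<in> set (combs n s)" using cx 3 by auto
      then show ?thesis using c True by simp
    next
      case False
      then have "set S \<subseteq> {..<n}" using cx c by force
      then show ?thesis using S 3 by simp
    qed
  qed
qed

lemma distinct_combs: "distinct (combs n s)"
proof (induction n s rule: combs.induct)
  case (3 n s)
  have "S \<notin> set (combs n (Suc s))" if "S \<in> (\<lambda>c. c @ [n]) ` set (combs n s)" for S
    using that combs_props[of S n "Suc s"] by auto
  then show ?case using 3 by (auto simp: distinct_map inj_on_def)
qed simp_all

text \<open>The loop nests of the program visit these triples.\<close>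

definition triples_of :: "nat list \<Rightarrow> (nat list \<times> pstring \<times> pstring) list" where
  "triples_of S = map (\<lambda>(P, Q). (S, P, Q)) (List.product (string_list S) (string_list S))"

definition visits :: "nat \<Rightarrow> nat list \<Rightarrow> (nat list \<times> pstring \<times> pstring) list" where
  "visits n ss = concat (map (\<lambda>s. concat (map triples_of (combs n s))) ss)"

lemma fold_concat_map: "fold f (concat (map h xs)) = fold (\<lambda>x. fold f (h x)) xs"
  by (induction xs) (simp_all add: fun_eq_iff)

lemma fold_visits:
  "fold (\<lambda>s. fold (\<lambda>S. fold (\<lambda>P. fold (\<lambda>Q. g S P Q) (string_list S)) (string_list S)) (combs n s)) ss
    = fold (\<lambda>(S, P, Q). g S P Q) (visits n ss)"
proof -
  have "fold (\<lambda>(S, P, Q). g S P Q) (triples_of S) = fold (\<lambda>P. fold (\<lambda>Q. g S P Q) (string_list S)) (string_list S)" for S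
    by (simp add: triples_of_def product_concat_map fold_concat_map fold_map comp_def)
  then show ?thesis by (simp add: visits_def fold_concat_map)
qed

lemma set_triples_of: "distinct S \<Longrightarrow> set (triples_of S) = {S} \<times> strings_on (set S) \<times> strings_on (set S)"
  by (auto simp: triples_of_def string_list_props)

lemma distinct_triples_of: "distinct S \<Longrightarrow> distinct (triples_of S)"
  by (auto simp: triples_of_def distinct_map distinct_product string_list_props inj_on_def)

lemma sorted_distinct: "sorted_wrt (<) (S :: nat list) \<Longrightarrow> distinct S"
  by (simp add: strict_sorted_iff)

lemma combs_distinct: "S \<in> set (combs n s) \<Longrightarrow> distinct S"
  by (auto simp: combs_props sorted_distinct)

lemma set_visits: "set (visits n ss)
    = {(S, P, Q). sorted_wrt (<) S \<and> set S \<subseteq> {..<n} \<and> length S \<in> set ss \<and> P \<in> strings_on (set S) \<and> Q \<in> strings_on (set S)}"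
  by (auto simp: visits_def set_triples_of[OF combs_distinct]) (auto simp: combs_props set_triples_of sorted_distinct)

lemma distinct_visits: "distinct ss \<Longrightarrow> distinct (visits n ss)"
proof (induction ss)
  case (Cons s ss)
  have "distinct (concat (map triples_of (combs n s)))"
  proof -
    have *: "distinct (concat (map triples_of cs))" if "distinct cs" "\<forall>c\<in>set cs. distinct c" for cs
      using that by (induction cs) (auto simp: distinct_triples_of set_triples_of)
    show ?thesis by (rule *[OF distinct_combs]) (auto intro: combs_distinct)
  qed
  moreover have "set (visits n ss) \<inter> set (concat (map triples_of (combs n s))) = {}"
    using Cons.prems by (auto simp: set_visits set_triples_of[OF combs_distinct] dest: length_of_combs)
  ultimately show ?case using Cons by (auto simp: visits_def)
qed (simp add: visits_def)

text \<open>Descending support size is what guarantees that all relevant extensions of a pair have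
  been decided before the pair itself.\<close>

lemma sorted_visits:
  "sorted_wrt (\<ge>) ss \<Longrightarrow> sorted_wrt (\<lambda>x y. length (fst y) \<le> length (fst x)) (visits n ss)"
proof (induction ss)
  case (Cons s ss)
  have l: "length (fst x) = s" if "x \<in> set (concat (map triples_of (combs n s)))" for x
    using that by (auto simp: set_triples_of[OF combs_distinct] dest: length_of_combs)
  have "sorted_wrt (\<lambda>x y. length (fst y) \<le> length (fst x)) xs"
    if "\<And>x. x \<in> set xs \<Longrightarrow> length (fst x) = s" for xs :: "(nat list \<times> pstring \<times> pstring) list"
    using that by (induction xs) auto
  from this[of "concat (map triples_of (combs n s))"] l
  have "sorted_wrt (\<lambda>x y. length (fst y) \<le> length (fst x)) (concat (map triples_of (combs n s)))" by blast
  moreover have "visits n (s # ss) = concat (map triples_of (combs n s)) @ visits n ss" by (simp add: visits_def)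
  ultimately show ?case using Cons l
    by (simp only: sorted_wrt_append) (auto simp: set_visits)
qed (simp add: visits_def)

text \<open>The loops run over lists while the tables are indexed by sets; an increasing list can be
  recovered from its set.\<close>

lemma visits_inj:
  "(S, P, Q) \<in> set (visits n ss) \<Longrightarrow> (S', P', Q') \<in> set (visits n ss) \<Longrightarrow> set S = set S' \<Longrightarrow> S = S'"
  by (auto simp: set_visits strict_sorted_iff intro: sorted_distinct_set_unique)

section \<open>Effect of single program steps on the store\<close>

lemma set_entry_apply: "set_entry S P Q z f S' P' Q' = (if S' = S \<and> P' = P \<and> Q' = Q then z else f S' P' Q')"
  by (simp add: set_entry_def)

lemma set_entry_overwrite: "set_entry S P Q z (set_entry S P Q z' f) = set_entry S P Q z f"
  by (simp add: set_entry_def)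

text \<open>\<open>upd z\<close> stands for adding \<open>z\<close> to one fixed table entry.
  Successive additions merge, so a loop of additions becomes a single one; starting from
  \<open>upd z \<sigma>\<close> keeps the induction within such states.\<close>

lemma fold_accumulate:
  assumes "\<And>x \<sigma>. f x \<sigma> = upd (h x) \<sigma>" "\<And>a b \<sigma>. upd a (upd b \<sigma>) = upd (b + a) \<sigma>" "\<And>\<sigma>. upd 0 (upd z \<sigma>) = upd z \<sigma>"
  shows "fold f xs (upd (z :: complex) \<sigma>) = upd (z + (\<Sum>x\<leftarrow>xs. h x)) \<sigma>"
  by (induction xs arbitrary: z \<sigma>) (simp_all add: assms(1,2) add.assoc)

lemma local_coeff_step_result:
  assumes "distinct S"
  shows "fst (local_coeff_step Lhat S P Q \<sigma>) = \<sigma>\<lparr>loc := set_entry (set S) P Q (local_sum Lhat S P Q) (loc \<sigma>),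
    reg := set_entry (set S) P Q 0 (reg \<sigma>)\<rparr>"
proof -
  define upd where "upd z \<sigma> = \<sigma>\<lparr>loc := set_entry (set S) P Q (loc \<sigma> (set S) P Q + z) (loc \<sigma>)\<rparr>" for z and \<sigma> :: store
  let ?h = "\<lambda>A B. Lhat A B * mtrace (pauli_mat S A * pauli_mat S Q * pauli_mat S B * pauli_mat S P)"
  define \<tau> where "\<tau> = \<sigma>\<lparr>loc := set_entry (set S) P Q 0 (loc \<sigma>), reg := set_entry (set S) P Q 0 (reg \<sigma>)\<rparr>"
  have upd: "upd a (upd b \<sigma>) = upd (b + a) \<sigma>" for a b \<sigma>
    by (simp add: upd_def set_entry_apply set_entry_overwrite add.assoc)
  have \<tau>0: "upd 0 \<tau> = \<tau>" by (simp add: upd_def \<tau>_def set_entry_apply set_entry_overwrite)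
  have inner: "fold (\<lambda>B. upd (?h A B)) (string_list S) (upd z \<sigma>) = upd (z + (\<Sum>B\<leftarrow>string_list S. ?h A B)) \<sigma>" for A z \<sigma>
    by (rule fold_accumulate) (simp_all add: upd)
  have inner0: "upd 0 \<sigma> = \<sigma>" for \<sigma> :: store
  proof -
    have "set_entry (set S) P Q (loc \<sigma> (set S) P Q) (loc \<sigma>) = loc \<sigma>" by (intro ext) (simp add: set_entry_apply)
    then show ?thesis by (simp add: upd_def)
  qed
  have inner': "fold (\<lambda>B. upd (?h A B)) (string_list S) \<sigma> = upd (\<Sum>B\<leftarrow>string_list S. ?h A B) \<sigma>" for A \<sigma>
    using inner[of A 0 \<sigma>] by (simp add: inner0)
  have "fold (\<lambda>A. fold (\<lambda>B. upd (?h A B)) (string_list S)) (string_list S) (upd 0 \<tau>)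
      = upd (0 + (\<Sum>A\<leftarrow>string_list S. \<Sum>B\<leftarrow>string_list S. ?h A B)) \<tau>"
    by (rule fold_accumulate) (simp_all add: upd inner')
  then have main: "fold (\<lambda>A. fold (\<lambda>B. upd (?h A B)) (string_list S)) (string_list S) \<tau>
      = upd (\<Sum>A\<in>strings_on (set S). \<Sum>B\<in>strings_on (set S). ?h A B) \<tau>"
    by (simp add: \<tau>0 sum_list_distinct_conv_sum_set string_list_props[OF assms])
  have "fst (local_coeff_step Lhat S P Q \<sigma>)
      = (\<lambda>\<sigma>. \<sigma>\<lparr>loc := set_entry (set S) P Q (loc \<sigma> (set S) P Q / 2 ^ (3 * length S)) (loc \<sigma>)\<rparr>)
          (fold (\<lambda>A. fold (\<lambda>B. upd (?h A B)) (string_list S)) (string_list S) \<tau>)"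
    unfolding local_coeff_step_def upd_def \<tau>_def by (simp add: fst_for_each)
  then show ?thesis unfolding main
    by (simp add: upd_def \<tau>_def local_sum_def set_entry_apply set_entry_overwrite)
qed

text \<open>A step that writes to an already filled entry must come from the same list, since the
  set determines it, and then writes the same value; hence earlier results survive.\<close>

lemma first_loop:
  fixes n k Lhat
  defines "xs \<equiv> visits n [1..<Suc k]"
  defines "\<sigma> \<equiv> fold (\<lambda>(S, P, Q) \<sigma>. fst (local_coeff_step Lhat S P Q \<sigma>)) xs (initial_store\<lparr>accepted := {}\<rparr>)"
  shows "reg \<sigma> = (\<lambda>_ _ _. 0)" "accepted \<sigma> = {}"
    "(S, P, Q) \<in> set xs \<Longrightarrow> loc \<sigma> (set S) P Q = local_sum Lhat S P Q"
proof -
  let ?I = "\<lambda>ys \<sigma>. reg \<sigma> = (\<lambda>_ _ _. 0) \<and> accepted \<sigma> = {} \<and>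
    (\<forall>(S, P, Q)\<in>set ys. loc \<sigma> (set S) P Q = local_sum Lhat S P Q)"
  have "?I xs \<sigma>" unfolding \<sigma>_def
  proof (rule fold_invariant_prefix[where I = ?I])
    show "?I [] (initial_store\<lparr>accepted := {}\<rparr>)" by (simp add: initial_store_def)
    fix ys x zs and \<sigma> :: store assume xs: "xs = ys @ x # zs" and I: "?I ys \<sigma>"
    obtain S P Q where x: "x = (S, P, Q)" by (cases x)
    have mem: "(S, P, Q) \<in> set xs" "\<And>y. y \<in> set ys \<Longrightarrow> y \<in> set xs" using xs x by auto
    then have d: "distinct S" by (auto simp: xs_def set_visits sorted_distinct)
    have inj: "S' = S" if "(S', P', Q') \<in> set ys" "set S' = set S" for S' P' Q'
      using visits_inj[OF mem(2)[OF that(1), unfolded xs_def] mem(1)[unfolded xs_def] that(2)] .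
    have z: "set_entry (set S) P Q 0 (\<lambda>_ _ _. 0) = (\<lambda>_ _ _. 0 :: complex)"
      by (intro ext) (simp add: set_entry_apply)
    show "?I (ys @ [x]) ((\<lambda>(S, P, Q) \<sigma>. fst (local_coeff_step Lhat S P Q \<sigma>)) x \<sigma>)"
      using I inj unfolding x by (auto simp: local_coeff_step_result[OF d] z set_entry_apply)
  qed
  then show "reg \<sigma> = (\<lambda>_ _ _. 0)" "accepted \<sigma> = {}"
    "(S, P, Q) \<in> set xs \<Longrightarrow> loc \<sigma> (set S) P Q = local_sum Lhat S P Q" by auto
qed

text \<open>The accepted pair \<open>(P, Q)\<close> is booked in the register
  \<open>(T, P', Q')\<close>. The program skips the empty set, whose registers are never read;
  statements relating the two therefore carry the guard \<open>T \<noteq> {}\<close>.\<close>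

definition contributes :: "pstring \<Rightarrow> pstring \<Rightarrow> nat set \<Rightarrow> pstring \<Rightarrow> pstring \<Rightarrow> bool" where
  "contributes P Q T P' Q' \<longleftrightarrow> T \<subset> supp P \<union> supp Q \<and>
     restr P (supp P \<union> supp Q - T) = restr Q (supp P \<union> supp Q - T) \<and> P' = restr P T \<and> Q' = restr Q T"

text \<open>Different subsequences have different sets and hence address different registers, so
  each register is increased at most once, always by the same estimate.\<close>

lemma register_loop:
  fixes b :: "nat list \<Rightarrow> bool" and p q :: "nat set \<Rightarrow> pstring" and P Q :: pstring and \<sigma> :: store
  assumes "distinct (map set Ts)"
  defines "f \<equiv> \<lambda>T \<sigma>. if b T then \<sigma>\<lparr>reg := set_entry (set T) (p (set T)) (q (set T))
      (reg \<sigma> (set T) (p (set T)) (q (set T)) + est \<sigma> P Q) (reg \<sigma>)\<rparr> else \<sigma>"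
  shows "\<exists>r. fold f Ts \<sigma> = \<sigma>\<lparr>reg := r\<rparr> \<and> (\<forall>X Y Z. r X Y Z = reg \<sigma> X Y Z +
    (if (\<exists>T\<in>set Ts. b T \<and> set T = X \<and> p X = Y \<and> q X = Z) then est \<sigma> P Q else 0))"
  using assms(1)
proof (induction Ts arbitrary: \<sigma>)
  case Nil
  then show ?case by (intro exI[of _ "reg \<sigma>"]) simp
next
  case (Cons T Ts)
  obtain r where r: "fold f Ts (f T \<sigma>) = (f T \<sigma>)\<lparr>reg := r\<rparr>"
    "\<And>X Y Z. r X Y Z = reg (f T \<sigma>) X Y Z +
      (if (\<exists>T\<in>set Ts. b T \<and> set T = X \<and> p X = Y \<and> q X = Z) then est (f T \<sigma>) P Q else 0)"
    using Cons by force
  have e: "est (f T \<sigma>) = est \<sigma>" "(f T \<sigma>)\<lparr>reg := r\<rparr> = \<sigma>\<lparr>reg := r\<rparr>" by (simp_all add: f_def)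
  have new: "set T \<noteq> set T'" if "T' \<in> set Ts" for T' using Cons.prems that by auto
  have "r X Y Z = reg \<sigma> X Y Z +
    (if (\<exists>T\<in>set (T # Ts). b T \<and> set T = X \<and> p X = Y \<and> q X = Z) then est \<sigma> P Q else 0)" for X Y Z
  proof (cases "b T \<and> set T = X \<and> p X = Y \<and> q X = Z")
    case True
    then have "\<not> (\<exists>T\<in>set Ts. b T \<and> set T = X \<and> p X = Y \<and> q X = Z)" using new by auto
    then show ?thesis using True r(2)[of X Y Z] by (auto simp: f_def set_entry_apply)
  next
    case False
    then have "reg (f T \<sigma>) X Y Z = reg \<sigma> X Y Z" by (auto simp: f_def set_entry_apply)
    then show ?thesis using False r(2)[of X Y Z] by (auto simp: e)
  qed
  note r' = this
  show ?case
  proof (intro exI conjI allI)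
    show "fold f (T # Ts) \<sigma> = \<sigma>\<lparr>reg := r\<rparr>" using r(1) unfolding e(2) by simp
  qed (rule r')
qed

lemma guarded_step_result:
  fixes \<sigma> :: store and P Q :: pstring
  assumes S: "sorted_wrt (<) S"
  defines "c \<equiv> loc \<sigma> (set S) P Q - reg \<sigma> (set S) P Q"
  shows "supp P \<union> supp Q \<noteq> set S \<Longrightarrow> fst (guarded_step lam S P Q \<sigma>) = \<sigma>"
    and "supp P \<union> supp Q = set S \<Longrightarrow> \<not> cmod c > lam \<Longrightarrow> fst (guarded_step lam S P Q \<sigma>) = \<sigma>\<lparr>cand := c\<rparr>"
    and "supp P \<union> supp Q = set S \<Longrightarrow> cmod c > lam \<Longrightarrow> \<exists>r. fst (guarded_step lam S P Q \<sigma>)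
      = \<sigma>\<lparr>cand := c, accepted := insert (P, Q) (accepted \<sigma>), est := (est \<sigma>)(P := (est \<sigma> P)(Q := c)), reg := r\<rparr> \<and>
      (\<forall>T P' Q'. T \<noteq> {} \<longrightarrow> r T P' Q' = reg \<sigma> T P' Q' + (if contributes P Q T P' Q' then c else 0))"
proof -
  have d: "distinct S" by (rule sorted_distinct[OF S])
  show "fst (guarded_step lam S P Q \<sigma>) = \<sigma>" if "supp P \<union> supp Q \<noteq> set S"
    using that by (simp add: guarded_step_def fst_whenever)
  show "fst (guarded_step lam S P Q \<sigma>) = \<sigma>\<lparr>cand := c\<rparr>" if "supp P \<union> supp Q = set S" "\<not> cmod c > lam"
    using that by (simp add: guarded_step_def fst_whenever c_def)
  assume g: "supp P \<union> supp Q = set S" "cmod c > lam"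
  let ?\<sigma> = "\<sigma>\<lparr>cand := c, accepted := insert (P, Q) (accepted \<sigma>), est := (est \<sigma>)(P := (est \<sigma> P)(Q := c))\<rparr>"
  let ?b = "\<lambda>T. T \<noteq> [] \<and> T \<noteq> S \<and> restr P (set S - set T) = restr Q (set S - set T)"
  have "distinct (map set (List.subseqs S))" by (rule distinct_set_subseqs[OF d])
  from register_loop[OF this, of ?b "restr P" "restr Q" P Q ?\<sigma>] obtain r where
    r: "fold (\<lambda>T \<sigma>. if ?b T then \<sigma>\<lparr>reg := set_entry (set T) (restr P (set T)) (restr Q (set T))
      (reg \<sigma> (set T) (restr P (set T)) (restr Q (set T)) + est \<sigma> P Q) (reg \<sigma>)\<rparr> else \<sigma>) (List.subseqs S) ?\<sigma> = ?\<sigma>\<lparr>reg := r\<rparr>"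
    "\<And>X Y Z. r X Y Z = reg ?\<sigma> X Y Z +
    (if (\<exists>T\<in>set (List.subseqs S). ?b T \<and> set T = X \<and> restr P X = Y \<and> restr Q X = Z) then est ?\<sigma> P Q else 0)" by blast
  have "fst (guarded_step lam S P Q \<sigma>) = ?\<sigma>\<lparr>reg := r\<rparr>"
    using g r(1) unfolding guarded_step_def fst_sequ fst_whenever fst_ops fst_for_each
    by (simp add: c_def)
  moreover have "(\<exists>T\<in>set (List.subseqs S). ?b T \<and> set T = X \<and> restr P X = Y \<and> restr Q X = Z) \<longleftrightarrow> contributes P Q X Y Z"
    if "X \<noteq> {}" for X Y Z
  proof
    assume "\<exists>T\<in>set (List.subseqs S). ?b T \<and> set T = X \<and> restr P X = Y \<and> restr Q X = Z"
    then obtain T where T: "T \<in> set (List.subseqs S)" "?b T" "set T = X" "restr P X = Y" "restr Q X = Z" by blast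
    have sub: "set T \<subseteq> set S" using T(1) subseqs_powset[of S] by auto
    \<comment> \<open>The program compares lists, \<open>contributes\<close> compares sets.
      Subsequences of a distinct list are determined by their sets, so the two comparisons
      agree.\<close>
    have "set T \<noteq> set S"
    proof
      assume "set T = set S"
      moreover have "inj_on set (set (List.subseqs S))"
        using distinct_set_subseqs[OF d] by (simp add: distinct_map)
      ultimately have "T = S" using T(1) by (meson inj_onD subseqs_refl)
      then show False using T(2) by simp
    qed
    then show "contributes P Q X Y Z" using sub T by (auto simp: contributes_def g(1))
  next
    assume C: "contributes P Q X Y Z"
    then have "X \<subset> set S" by (simp add: contributes_def g(1))
    then obtain T where T: "T \<in> set (List.subseqs S)" "set T = X"
      using subseqs_powset[of S] by (metis Pow_iff image_iff list.set_map psubset_imp_subset)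
    then show "\<exists>T\<in>set (List.subseqs S). ?b T \<and> set T = X \<and> restr P X = Y \<and> restr Q X = Z"
      using C that \<open>X \<subset> set S\<close> by (intro bexI[of _ T]) (auto simp: contributes_def g(1))
  qed
  ultimately show "\<exists>r. fst (guarded_step lam S P Q \<sigma>)
      = \<sigma>\<lparr>cand := c, accepted := insert (P, Q) (accepted \<sigma>), est := (est \<sigma>)(P := (est \<sigma> P)(Q := c)), reg := r\<rparr> \<and>
      (\<forall>T P' Q'. T \<noteq> {} \<longrightarrow> r T P' Q' = reg \<sigma> T P' Q' + (if contributes P Q T P' Q' then c else 0))"
    using r(2) by (intro exI[of _ r]) simp
qed

text \<open>Contributing pairs correspond to nontrivial tails \<open>A\<close>: they agree off
  \<open>S\<close>, so one tail serves both strings, and strictness of the inclusion of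
  \<open>S\<close> in their joint support says that the tail is nontrivial.\<close>

lemma register_sum:
  assumes S: "supp P \<union> supp Q = S" "P \<in> strings_on S" "Q \<in> strings_on S"
    and X: "finite X" "X \<subseteq> strings_on {..<n} \<times> strings_on {..<n}"
  shows "(\<Sum>(P', Q')\<in>X. if contributes P' Q' S P Q then f P' Q' else 0)
    = (\<Sum>A | A \<in> extensions n S \<and> (glue S P A, glue S Q A) \<in> X. f (glue S P A) (glue S Q A))"
proof -
  let ?Y = "{x \<in> X. contributes (fst x) (snd x) S P Q}"
  have "(\<Sum>(P', Q')\<in>X. if contributes P' Q' S P Q then f P' Q' else 0) = (\<Sum>x\<in>?Y. f (fst x) (snd x))"
    using X(1) by (simp add: sum.inter_filter case_prod_beta)
  also have "\<dots> = (\<Sum>A | A \<in> extensions n S \<and> (glue S P A, glue S Q A) \<in> X. f (glue S P A) (glue S Q A))"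
  proof (rule sum.reindex_bij_witness[of _ "\<lambda>A. (glue S P A, glue S Q A)" "\<lambda>x. restr (fst x) ({..<n} - S)"])
    fix x assume x: "x \<in> ?Y"
    obtain P' Q' where x': "x = (P', Q')" by (cases x)
    have c: "contributes P' Q' S P Q" and m: "P' \<in> strings_on {..<n}" "Q' \<in> strings_on {..<n}"
      using x x' X(2) by auto
    have eq: "P' u = Q' u" if "u \<notin> S" for u
    proof (cases "u \<in> supp P' \<union> supp Q'")
      case True
      have "restr P' (supp P' \<union> supp Q' - S) u = restr Q' (supp P' \<union> supp Q' - S) u"
        using c by (simp add: contributes_def)
      then show ?thesis using True that by (simp add: restr_def)
    qed (simp add: supp_def)
    have PQ: "P = restr P' S" "Q = restr Q' S" using c by (auto simp: contributes_def)
    have e: "glue S P (restr P' ({..<n} - S)) = P'" "glue S Q (restr P' ({..<n} - S)) = Q'"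
      using eq strings_on_outside[OF m(1)] strings_on_outside[OF m(2)] by (auto simp: fun_eq_iff glue_def restr_def PQ)
    then show "(glue S P (restr (fst x) ({..<n} - S)), glue S Q (restr (fst x) ({..<n} - S))) = x"
      by (simp add: x')
    have "\<exists>u\<in>supp P' \<union> supp Q'. u \<notin> S" using c by (auto simp: contributes_def)
    then obtain u where u: "u \<notin> S" "P' u \<noteq> PI" using eq by (force simp: supp_def)
    then have "u < n" using strings_on_outside[OF m(1), of u] by auto
    then have "restr P' ({..<n} - S) u \<noteq> PI" using u by (simp add: restr_def)
    then have "restr P' ({..<n} - S) \<noteq> id_string" by metis
    then show "restr (fst x) ({..<n} - S) \<in> {A. A \<in> extensions n S \<and> (glue S P A, glue S Q A) \<in> X}"
      using x by (simp add: extensions_def x' e)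
    show "f (glue S P (restr (fst x) ({..<n} - S))) (glue S Q (restr (fst x) ({..<n} - S))) = f (fst x) (snd x)"
      by (simp add: x' e)
  next
    fix A assume A: "A \<in> {A. A \<in> extensions n S \<and> (glue S P A, glue S Q A) \<in> X}"
    then have As: "A \<in> strings_on ({..<n} - S)" "A \<noteq> id_string" by (auto simp: extensions_def)
    then show "restr (fst (glue S P A, glue S Q A)) ({..<n} - S) = A"
      using strings_on_outside[OF As(1)] by (auto simp: restr_def glue_def fun_eq_iff)
    have out: "glue S P A u = A u" "glue S Q A u = A u" if "u \<notin> S" for u using that by (simp_all add: glue_def)
    obtain u where u: "A u \<noteq> PI" using As(2) by auto
    then have uS: "u \<notin> S" using strings_on_outside[OF As(1), of u] by auto
    have sub: "S \<subseteq> supp (glue S P A) \<union> supp (glue S Q A)"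
      unfolding S(1)[symmetric] by (auto simp: supp_def glue_def)
    have "contributes (glue S P A) (glue S Q A) S P Q"
      unfolding contributes_def
    proof (intro conjI)
      show "S \<subset> supp (glue S P A) \<union> supp (glue S Q A)"
        using sub u uS out[OF uS] by (auto simp: supp_def)
      show "P = restr (glue S P A) S" "Q = restr (glue S Q A) S"
        using S(2,3) by (auto simp: restr_def glue_def fun_eq_iff strings_on_outside)
    qed (auto simp: restr_def fun_eq_iff glue_def)
    then show "(glue S P A, glue S Q A) \<in> {x \<in> X. contributes (fst x) (snd x) S P Q}"
      using A by simp
  qed
  finally show ?thesis .
qed

lemma glue_supp:
  assumes "supp P \<union> supp Q = S" "A \<in> extensions n S"
  shows "S \<subset> supp (glue S P A) \<union> supp (glue S Q A)"
proof -
  have As: "A \<in> strings_on ({..<n} - S)" "A \<noteq> id_string" using assms(2) by (auto simp: extensions_def)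
  then obtain u where u: "A u \<noteq> PI" by auto
  then have uS: "u \<notin> S" using strings_on_outside[OF As(1), of u] by auto
  have "S \<subseteq> supp (glue S P A) \<union> supp (glue S Q A)"
    unfolding assms(1)[symmetric] by (auto simp: supp_def glue_def)
  moreover have "u \<in> supp (glue S P A)" using u uS by (simp add: supp_def glue_def)
  ultimately show ?thesis using uS by auto
qed

section \<open>The invariant of the recovery loop\<close>

lemma recovered_set_eq:
  "recovered_set n k Lhat lam = accepted (fold (\<lambda>(S, P, Q) \<sigma>. fst (guarded_step lam S P Q \<sigma>)) (visits n (rev [1..<Suc k]))
     (fold (\<lambda>(S, P, Q) \<sigma>. fst (local_coeff_step Lhat S P Q \<sigma>)) (visits n [1..<Suc k]) (initial_store\<lparr>accepted := {}\<rparr>)))"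
  unfolding recovered_set_def guarded_recovery_def fst_sequ fst_ops fst_for_each fold_visits ..

text \<open>A candidate differs from its coefficient by the estimation error, the rejected
  extensions and the errors of the accepted ones. The invariant keeps the exact register contents
  together with the consequences of each decision, because counting the accepted extensions requires
  that they are truly large, and this in turn comes from the error bound at larger supports.\<close>

lemma recovery_correct:
  assumes gs: "generator_setting n k G chi lam \<gamma>" and mc: "margin_condition n k chi lam \<gamma>"
    and eps: "\<epsilon> \<le> \<gamma> / (2 * real (diag_D n k chi (lam - \<gamma>)))"
    and acc: "ptm_accurate n k (lindbladian n k G) Lhat \<epsilon>" and k: "1 \<le> k"
  shows "recovered_set n k Lhat lam \<subseteq> pairs n k"
    and "(P0, Q0) \<in> pairs0 n k \<Longrightarrow> cmod (chi P0 Q0) > lam + \<gamma> \<Longrightarrow> (P0, Q0) \<in> recovered_set n k Lhat lam"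
    and "(P0, Q0) \<in> pairs0 n k \<Longrightarrow> cmod (chi P0 Q0) < lam - \<gamma> \<Longrightarrow> (P0, Q0) \<notin> recovered_set n k Lhat lam"
proof -
  have chi: "chi_coeffs n (lindbladian n k G) chi" and n: "1 \<le> n" and \<gamma>: "0 < \<gamma>"
    using gs by (auto simp: generator_setting_def)
  define d where "d = real (diag_degree n k chi (lam - \<gamma>))"
  define \<rho> where "\<rho> = diag_rho n k chi (lam + \<gamma>)"
  \<comment> \<open>The solution of \<open>Eb (Suc j) = \<epsilon> + \<rho> + d * Eb j\<close> with
    \<open>Eb 0 = \<epsilon> + \<rho>\<close>; the index is the number of qubits by which a support
    falls short of \<open>k\<close>.\<close>
  define Eb where "Eb j = (\<epsilon> + \<rho>) * (\<Sum>l\<le>j. d ^ l)" for j :: nat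
  define xs where "xs = visits n (rev [1..<Suc k])"
  define \<sigma>1 where "\<sigma>1 = fold (\<lambda>(S, P, Q) \<sigma>. fst (local_coeff_step Lhat S P Q \<sigma>)) (visits n [1..<Suc k]) (initial_store\<lparr>accepted := {}\<rparr>)"
  \<comment> \<open>Nonnegativity of \<epsilon> is extracted from accuracy at one entry, for which a
    nonempty region is required; \<open>1 \<le> n\<close> and \<open>1 \<le> k\<close> provide
    it.\<close>
  have "{0} \<in> regions n k - {{}}" using n k by (auto simp: regions_def)
  moreover have "id_string \<in> strings_on {0}" by (simp add: strings_on_def supp_def)
  ultimately have "cmod (Lhat id_string id_string - ptm n (lindbladian n k G) id_string id_string) \<le> \<epsilon>"
    using acc unfolding ptm_accurate_def by blast
  then have \<epsilon>: "0 \<le> \<epsilon>" by (meson norm_ge_zero order_trans)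
  have \<rho>: "0 \<le> \<rho>" unfolding \<rho>_def by (rule diag_rho_nonneg)
  have d0: "0 \<le> d" by (simp add: d_def)
  have Eb_Suc: "Eb (Suc j) = \<epsilon> + \<rho> + d * Eb j" for j
    unfolding Eb_def by (subst sum.atMost_Suc_shift) (simp add: sum_distrib_left algebra_simps)
  have Eb_mono: "Eb i \<le> Eb j" if "i \<le> j" for i j
    unfolding Eb_def using that \<epsilon> \<rho> d0 by (intro mult_left_mono sum_mono2) auto
  \<comment> \<open>The geometric sum is \<open>diag_D\<close>, and its products with \<epsilon> and
    with \<rho> each use up one half of \<gamma>.\<close>
  have Eb_k: "Eb k \<le> \<gamma>"
  proof -
    have D: "(\<Sum>l\<le>k. d ^ l) = real (diag_D n k chi (lam - \<gamma>))" by (simp add: diag_D_def d_def)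
    have D1: "1 \<le> real (diag_D n k chi (lam - \<gamma>))" using diag_D_ge_1 by (metis of_nat_1 of_nat_le_iff)
    then have "\<epsilon> * real (diag_D n k chi (lam - \<gamma>)) \<le> \<gamma> / 2" using eps by (simp add: field_simps)
    moreover have "real (diag_D n k chi (lam - \<gamma>)) * \<rho> \<le> \<gamma> / 2"
      using mc by (simp add: margin_condition_def \<rho>_def)
    ultimately show ?thesis unfolding Eb_def D by (simp add: algebra_simps)
  qed
  have vis: "(S, P, Q) \<in> set xs \<longleftrightarrow> sorted_wrt (<) S \<and> set S \<subseteq> {..<n} \<and> 1 \<le> length S \<and> length S \<le> k \<and>
      P \<in> strings_on (set S) \<and> Q \<in> strings_on (set S)" for S P Q
    unfolding xs_def set_visits by auto
  have vis': "set (visits n [1..<Suc k]) = set xs" unfolding xs_def set_visits by auto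
  note fl = first_loop[where Lhat = Lhat and n = n and k = k, folded \<sigma>1_def, unfolded vis']
  have dist: "distinct xs" unfolding xs_def by (rule distinct_visits) simp
  have "sorted_wrt (\<ge>) (rev [1..<Suc k])" using sorted_upt[of 1 "Suc k"] by (simp only: sorted_wrt_rev)
  then have srt: "sorted_wrt (\<lambda>x y. length (fst y) \<le> length (fst x)) xs" unfolding xs_def by (rule sorted_visits)
  have close: "cmod (local_sum Lhat S P Q - (\<Sum>A\<in>strings_on ({..<n} - set S). chi (glue (set S) P A) (glue (set S) Q A))) \<le> \<epsilon>"
    if "(S, P, Q) \<in> set xs" for S P Q
  proof -
    have S: "distinct S" "set S \<subseteq> {..<n}" "1 \<le> length S" "length S \<le> k" "P \<in> strings_on (set S)" "Q \<in> strings_on (set S)"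
      using that vis sorted_distinct by auto
    then have "set S \<in> regions n k - {{}}" by (auto simp: regions_def distinct_card)
    then show ?thesis
      unfolding local_sum_ptm[OF chi S(1,2,5,6), symmetric]
      using acc by (intro local_sum_close S(1)) (auto simp: ptm_accurate_def)
  qed
  let ?I = "\<lambda>ys \<sigma>. loc \<sigma> = loc \<sigma>1 \<and>
    accepted \<sigma> \<subseteq> {(P, Q). \<exists>S. (S, P, Q) \<in> set ys \<and> supp P \<union> supp Q = set S} \<and>
    (\<forall>T P' Q'. T \<noteq> {} \<longrightarrow> reg \<sigma> T P' Q' = (\<Sum>(P, Q)\<in>accepted \<sigma>. if contributes P Q T P' Q' then est \<sigma> P Q else 0)) \<and>
    (\<forall>S P Q. (S, P, Q) \<in> set ys \<longrightarrow> supp P \<union> supp Q = set S \<longrightarrow>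
      ((P, Q) \<in> accepted \<sigma> \<longrightarrow> lam - \<gamma> < cmod (chi P Q) \<and> cmod (est \<sigma> P Q - chi P Q) \<le> Eb (k - length S)) \<and>
      ((P, Q) \<notin> accepted \<sigma> \<longrightarrow> cmod (chi P Q) \<le> lam + \<gamma>))"
  \<comment> \<open>An accepted extension has a larger support, so its error is at most \<open>Eb\<close> one level down, and
    there are at most \<open>d\<close> of them, all genuinely large; the rejected ones contribute at most \<open>\<rho>\<close>.\<close>
  have inv: "?I xs (fold (\<lambda>(S, P, Q) \<sigma>. fst (guarded_step lam S P Q \<sigma>)) xs \<sigma>1)"
  proof (rule fold_invariant_prefix[where I = ?I])
    show "?I [] \<sigma>1" by (simp add: fl)
    fix ys x zs and \<sigma> :: store assume xs: "xs = ys @ x # zs" and I: "?I ys \<sigma>"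
    obtain S P Q where x: "x = (S, P, Q)" by (cases x)
    have mem: "(S, P, Q) \<in> set xs" and sub: "\<And>y. y \<in> set ys \<Longrightarrow> y \<in> set xs" using xs x by auto
    have S: "sorted_wrt (<) S" "set S \<subseteq> {..<n}" "1 \<le> length S" "length S \<le> k" "P \<in> strings_on (set S)" "Q \<in> strings_on (set S)"
      using mem vis by auto
    have cardS: "card (set S) = length S" using sorted_distinct[OF S(1)] by (simp add: distinct_card)
    have Ia: "loc \<sigma> = loc \<sigma>1"
      and Ib: "\<And>P Q. (P, Q) \<in> accepted \<sigma> \<Longrightarrow> \<exists>S. (S, P, Q) \<in> set ys \<and> supp P \<union> supp Q = set S"
      and Ic: "\<And>T P' Q'. T \<noteq> {} \<Longrightarrow> reg \<sigma> T P' Q' = (\<Sum>(P, Q)\<in>accepted \<sigma>. if contributes P Q T P' Q' then est \<sigma> P Q else 0)"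
      and Id: "\<And>S P Q. (S, P, Q) \<in> set ys \<Longrightarrow> supp P \<union> supp Q = set S \<Longrightarrow> (P, Q) \<in> accepted \<sigma> \<Longrightarrow>
        lam - \<gamma> < cmod (chi P Q) \<and> cmod (est \<sigma> P Q - chi P Q) \<le> Eb (k - length S)"
      and Ie: "\<And>S P Q. (S, P, Q) \<in> set ys \<Longrightarrow> supp P \<union> supp Q = set S \<Longrightarrow> (P, Q) \<notin> accepted \<sigma> \<Longrightarrow> cmod (chi P Q) \<le> lam + \<gamma>"
      using I by blast+
    note res = guarded_step_result[OF S(1), where lam = lam and \<sigma> = \<sigma> and P = P and Q = Q]
    let ?c = "loc \<sigma> (set S) P Q - reg \<sigma> (set S) P Q"
    have Ib': "\<exists>S. (S, P', Q') \<in> set (ys @ [x]) \<and> supp P' \<union> supp Q' = set S" if h: "(P', Q') \<in> accepted \<sigma>" for P' Q'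
    proof -
      obtain S' where "(S', P', Q') \<in> set ys" "supp P' \<union> supp Q' = set S'" using Ib[OF h] by blast
      then show ?thesis by (intro exI[of _ S']) simp
    qed
    have cases: "(S', P', Q') \<in> set ys \<or> (S', P', Q') = (S, P, Q)" if "(S', P', Q') \<in> set (ys @ [x])" for S' P' Q'
      using that by (auto simp: x)
    show "?I (ys @ [x]) ((\<lambda>(S, P, Q) \<sigma>. fst (guarded_step lam S P Q \<sigma>)) x \<sigma>)"
    proof (cases "supp P \<union> supp Q = set S")
      case False
      then have "fst (guarded_step lam S P Q \<sigma>) = \<sigma>" by (rule res(1))
      then have eq: "(\<lambda>(S, P, Q) \<sigma>. fst (guarded_step lam S P Q \<sigma>)) x \<sigma> = \<sigma>" by (simp add: x)
      show ?thesis unfolding eq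
      proof (intro conjI allI impI)
        show "accepted \<sigma> \<subseteq> {(P, Q). \<exists>S. (S, P, Q) \<in> set (ys @ [x]) \<and> supp P \<union> supp Q = set S}"
          using Ib' by blast
        fix S' P' Q' assume e: "(S', P', Q') \<in> set (ys @ [x])" "supp P' \<union> supp Q' = set S'"
        have old: "(S', P', Q') \<in> set ys" using cases[OF e(1)] e(2) False by blast
        show "lam - \<gamma> < cmod (chi P' Q')" if "(P', Q') \<in> accepted \<sigma>" using Id[OF old e(2) that] by simp
        show "cmod (est \<sigma> P' Q' - chi P' Q') \<le> Eb (k - length S')" if "(P', Q') \<in> accepted \<sigma>"
          using Id[OF old e(2) that] by simp
        show "cmod (chi P' Q') \<le> lam + \<gamma>" if "(P', Q') \<notin> accepted \<sigma>" by (rule Ie[OF old e(2) that])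
      qed (rule Ia Ic | assumption)+
    next
      case True
      \<comment> \<open>A pair is treated only at the list of its own joint support, which is
        visited once, so no earlier decision or estimate is overwritten.\<close>
      have fresh: "(S', P, Q) \<notin> set ys" if "supp P \<union> supp Q = set S'" for S'
      proof
        assume "(S', P, Q) \<in> set ys"
        then have "S' = S" using visits_inj[OF sub[unfolded xs_def] mem[unfolded xs_def]] that True by auto
        then show False using \<open>(S', P, Q) \<in> set ys\<close> dist xs x by auto
      qed
      then have new: "(P, Q) \<notin> accepted \<sigma>" using Ib by blast
      have fin: "finite (accepted \<sigma>)"
        by (rule finite_subset[of _ "snd ` set ys"]) (use Ib in \<open>force+\<close>)
      have accsub: "accepted \<sigma> \<subseteq> strings_on {..<n} \<times> strings_on {..<n}"
      proof clarify
        fix P' Q' assume "(P', Q') \<in> accepted \<sigma>"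
        then obtain S' where "(S', P', Q') \<in> set xs" using Ib sub by blast
        then show "P' \<in> strings_on {..<n} \<and> Q' \<in> strings_on {..<n}" unfolding vis strings_on_def by auto
      qed
      let ?ext = "extensions n (set S)" and ?p = "\<lambda>A. glue (set S) P A" and ?q = "\<lambda>A. glue (set S) Q A"
      let ?acc = "{A \<in> ?ext. (?p A, ?q A) \<in> accepted \<sigma>}" and ?rej = "{A \<in> ?ext. (?p A, ?q A) \<notin> accepted \<sigma>}"
      have err: "cmod (?c - chi P Q) \<le> Eb (k - length S)"
      proof -
        have "set S \<noteq> {}" using S(3) by auto
        from Ic[OF this, of P Q] register_sum[OF True S(5,6) fin accsub, of "est \<sigma>"]
        have "reg \<sigma> (set S) P Q = (\<Sum>A\<in>?acc. est \<sigma> (?p A) (?q A))" by (rule trans)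
        \<comment> \<open>The trivial tail yields the coefficient being estimated; the nontrivial
          ones are split below into rejected and accepted extensions.\<close>
        moreover have "(\<Sum>A\<in>strings_on ({..<n} - set S). chi (?p A) (?q A)) = chi P Q + (\<Sum>A\<in>?ext. chi (?p A) (?q A))"
        proof -
          have "strings_on ({..<n} - set S) = insert id_string ?ext"
            by (auto simp: extensions_def strings_on_def supp_def)
          moreover have "id_string \<notin> ?ext" by (simp add: extensions_def)
          ultimately show ?thesis by (simp add: glue_id[OF S(5)] glue_id[OF S(6)])
        qed
        moreover have "(\<Sum>A\<in>?ext. chi (?p A) (?q A)) = (\<Sum>A\<in>?rej. chi (?p A) (?q A)) + (\<Sum>A\<in>?acc. chi (?p A) (?q A))"
        proof -
          have "?ext = ?rej \<union> ?acc" "?rej \<inter> ?acc = {}" by auto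
          then show ?thesis by (metis (no_types, lifting) finite_Un finite_extensions sum.union_disjoint)
        qed
        moreover have "?c = local_sum Lhat S P Q - reg \<sigma> (set S) P Q" using fl(3)[OF mem] Ia by simp
        ultimately have "?c - chi P Q = (local_sum Lhat S P Q - (\<Sum>A\<in>strings_on ({..<n} - set S). chi (?p A) (?q A)))
            + (\<Sum>A\<in>?rej. chi (?p A) (?q A)) + (\<Sum>A\<in>?acc. chi (?p A) (?q A) - est \<sigma> (?p A) (?q A))"
          by (simp add: sum_subtractf)
        note e = this
        have "cmod (?c - chi P Q) \<le> cmod (local_sum Lhat S P Q - (\<Sum>A\<in>strings_on ({..<n} - set S). chi (?p A) (?q A)))
            + cmod (\<Sum>A\<in>?rej. chi (?p A) (?q A)) + cmod (\<Sum>A\<in>?acc. chi (?p A) (?q A) - est \<sigma> (?p A) (?q A))"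
          unfolding e by (rule order_trans[OF norm_triangle_ineq add_right_mono[OF norm_triangle_ineq]])
        also have "\<dots> \<le> \<epsilon> + \<rho> + real (card ?acc) * Eb (k - length S - 1)"
        proof (intro add_mono)
          show "cmod (local_sum Lhat S P Q - (\<Sum>A\<in>strings_on ({..<n} - set S). chi (?p A) (?q A))) \<le> \<epsilon>"
            by (rule close[OF mem])
          have "cmod (\<Sum>A\<in>?rej. chi (?p A) (?q A)) \<le> (\<Sum>A\<in>?rej. cmod (chi (?p A) (?q A)))" by (rule norm_sum)
          also have "\<dots> \<le> (\<Sum>A | A \<in> ?ext \<and> (?p A, ?q A) \<notin> large_pairs n k chi (lam + \<gamma>). cmod (chi (?p A) (?q A)))"
          proof (rule sum_mono2)
            show "?rej \<subseteq> {A. A \<in> ?ext \<and> (?p A, ?q A) \<notin> large_pairs n k chi (lam + \<gamma>)}"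
            proof (clarify)
              fix A assume A: "A \<in> ?ext" "(?p A, ?q A) \<notin> accepted \<sigma>" "(?p A, ?q A) \<in> large_pairs n k chi (lam + \<gamma>)"
              let ?S = "supp (?p A) \<union> supp (?q A)"
              have st: "?p A \<in> strings_on {..<n}" "?q A \<in> strings_on {..<n}" "card ?S \<le> k"
                using A(3) by (auto simp: large_pairs_def pairs0_def pairs_def)
              then have fS: "finite ?S" "?S \<subseteq> {..<n}" by (auto simp: strings_on_def intro: finite_subset)
              have ss: "set S \<subset> ?S" by (rule glue_supp[OF True A(1)])
              then have lt: "length S < card ?S" using psubset_card_mono[OF fS(1) ss] cardS by simp
              have ev: "(sorted_list_of_set ?S, ?p A, ?q A) \<in> set xs"
                unfolding vis using fS st lt by (auto simp: strict_sorted_iff strings_on_def)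
              \<comment> \<open>If this extension were still to come, the descending order would
                make its support no larger than the current one, whereas it is strictly
                larger.\<close>
              have "(sorted_list_of_set ?S, ?p A, ?q A) \<in> set ys"
              proof (rule ccontr)
                assume "\<not> ?thesis"
                then have "(sorted_list_of_set ?S, ?p A, ?q A) \<in> set (x # zs)" using ev xs by auto
                then have "length (sorted_list_of_set ?S) \<le> length S"
                  using srt unfolding xs by (auto simp: sorted_wrt_append x)
                then show False using lt by simp
              qed
              then have "cmod (chi (?p A) (?q A)) \<le> lam + \<gamma>" using Ie[OF _ _ A(2)] fS(1) by auto
              then show False using A(3) by (simp add: large_pairs_def)
            qed
          qed auto
          also have "\<dots> \<le> \<rho>" unfolding \<rho>_def by (rule diag_rho_ge[OF S(2,5,6)])
          finally show "cmod (\<Sum>A\<in>?rej. chi (?p A) (?q A)) \<le> \<rho>" .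
          have "cmod (\<Sum>A\<in>?acc. chi (?p A) (?q A) - est \<sigma> (?p A) (?q A)) \<le> (\<Sum>A\<in>?acc. Eb (k - length S - 1))"
          proof (rule order_trans[OF norm_sum sum_mono])
            fix A assume A: "A \<in> ?acc"
            then obtain S' where S': "(S', ?p A, ?q A) \<in> set ys" "supp (?p A) \<union> supp (?q A) = set S'" using Ib by blast
            have "set S \<subset> set S'" using glue_supp[OF True, of A n] A S'(2) by auto
            then have "length S < length S'"
              using psubset_card_mono[of "set S'" "set S"] cardS card_length[of S'] by simp
            then have "Eb (k - length S') \<le> Eb (k - length S - 1)" by (intro Eb_mono) simp
            moreover have "cmod (est \<sigma> (?p A) (?q A) - chi (?p A) (?q A)) \<le> Eb (k - length S')" using Id[OF S'] A by simp
            ultimately show "cmod (chi (?p A) (?q A) - est \<sigma> (?p A) (?q A)) \<le> Eb (k - length S - 1)"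
              by (simp add: norm_minus_commute)
          qed
          then show "cmod (\<Sum>A\<in>?acc. chi (?p A) (?q A) - est \<sigma> (?p A) (?q A)) \<le> real (card ?acc) * Eb (k - length S - 1)"
            by simp
        qed
        also have "\<dots> \<le> Eb (k - length S)"
        proof (cases "k - length S")
          \<comment> \<open>At full size \<open>k\<close> no accepted extension exists, since its
            support would exceed \<open>k\<close>; the truncated index
            \<open>k - length S - 1\<close> then multiplies an empty count.\<close>
          case 0
          have "?acc = {}"
          proof (rule ccontr)
            assume "?acc \<noteq> {}"
            then obtain A where A: "A \<in> ?acc" by blast
            then obtain S' where S': "(S', ?p A, ?q A) \<in> set ys" "supp (?p A) \<union> supp (?q A) = set S'" using Ib by blast
            have "set S \<subset> set S'" using glue_supp[OF True, of A n] A S'(2) by auto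
            then have "length S < length S'"
              using psubset_card_mono[of "set S'" "set S"] cardS card_length[of S'] by simp
            moreover have "length S' \<le> k" using sub[OF S'(1)] vis by simp
            ultimately show False using 0 by simp
          qed
          then have "card ?acc = 0" by (simp only: card.empty)
          then show ?thesis unfolding 0 by (simp only: Eb_def) simp
        next
          case (Suc j)
          \<comment> \<open>The invariant certifies accepted pairs as exceeding
            \<open>lam - \<gamma>\<close>, so their number is bounded by the degree at the lower
            threshold.\<close>
          have "?acc \<subseteq> {A \<in> ?ext. (?p A, ?q A) \<in> large_pairs n k chi (lam - \<gamma>)}"
          proof clarify
            fix A assume A: "A \<in> ?ext" "(?p A, ?q A) \<in> accepted \<sigma>"
            then obtain S' where S': "(S', ?p A, ?q A) \<in> set ys" "supp (?p A) \<union> supp (?q A) = set S'" using Ib by blast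
            have "card (set S') \<le> k" using card_length[of S'] sub[OF S'(1)] vis by (meson order_trans)
            moreover have "set S' \<noteq> {}" using glue_supp[OF True A(1)] S'(2) by auto
            ultimately show "(?p A, ?q A) \<in> large_pairs n k chi (lam - \<gamma>)"
              using Id[OF S' A(2)] accsub A(2) S'(2)
              by (auto simp: large_pairs_def pairs0_def pairs_def supp_def)
          qed
          then have "card ?acc \<le> card {A \<in> ?ext. (?p A, ?q A) \<in> large_pairs n k chi (lam - \<gamma>)}"
            by (intro card_mono) auto
          also have "\<dots> \<le> diag_degree n k chi (lam - \<gamma>)" by (rule diag_degree_ge[OF S(2,5,6)])
          finally have "real (card ?acc) \<le> d" by (simp add: d_def)
          moreover have "0 \<le> Eb j" unfolding Eb_def using \<epsilon> \<rho> d0 by (intro mult_nonneg_nonneg sum_nonneg) auto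
          ultimately have "real (card ?acc) * Eb j \<le> d * Eb j" by (rule mult_right_mono)
          then show ?thesis unfolding Suc Eb_Suc by simp
        qed
        finally show ?thesis .
      qed
      also have "Eb (k - length S) \<le> Eb k" by (intro Eb_mono) simp
      finally have err': "cmod (?c - chi P Q) \<le> \<gamma>" using Eb_k by simp
      show ?thesis
      proof (cases "cmod ?c > lam")
        case False
        have eq: "(\<lambda>(S, P, Q) \<sigma>. fst (guarded_step lam S P Q \<sigma>)) x \<sigma> = \<sigma>\<lparr>cand := ?c\<rparr>"
          using res(2)[OF True False] by (simp add: x)
        have "cmod (chi P Q) \<le> cmod ?c + cmod (?c - chi P Q)"
          using norm_triangle_sub[of "chi P Q" ?c] by (simp add: norm_minus_commute)
        then have "cmod (chi P Q) \<le> lam + \<gamma>" using False err' by simp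
        note small = this
        show ?thesis unfolding eq
        proof (intro conjI allI impI)
          show "loc (\<sigma>\<lparr>cand := ?c\<rparr>) = loc \<sigma>1" using Ia by simp
          show "accepted (\<sigma>\<lparr>cand := ?c\<rparr>) \<subseteq> {(P, Q). \<exists>S. (S, P, Q) \<in> set (ys @ [x]) \<and> supp P \<union> supp Q = set S}"
            using Ib' by auto
          show "reg (\<sigma>\<lparr>cand := ?c\<rparr>) T P' Q' = (\<Sum>(P, Q)\<in>accepted (\<sigma>\<lparr>cand := ?c\<rparr>).
              if contributes P Q T P' Q' then est (\<sigma>\<lparr>cand := ?c\<rparr>) P Q else 0)" if "T \<noteq> {}" for T P' Q'
          proof -
            have "est (\<sigma>\<lparr>cand := ?c\<rparr>) = est \<sigma>" "accepted (\<sigma>\<lparr>cand := ?c\<rparr>) = accepted \<sigma>" "reg (\<sigma>\<lparr>cand := ?c\<rparr>) = reg \<sigma>"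
              by simp_all
            then show ?thesis by (simp only: Ic[OF that])
          qed
          fix S' P' Q' assume e: "(S', P', Q') \<in> set (ys @ [x])" "supp P' \<union> supp Q' = set S'"
          have acc_old: "(S', P', Q') \<in> set ys" if "(P', Q') \<in> accepted (\<sigma>\<lparr>cand := ?c\<rparr>)"
            using cases[OF e(1)] that new by auto
          show "lam - \<gamma> < cmod (chi P' Q')" if a: "(P', Q') \<in> accepted (\<sigma>\<lparr>cand := ?c\<rparr>)"
            using Id[OF acc_old[OF a] e(2)] a by simp
          show "cmod (est (\<sigma>\<lparr>cand := ?c\<rparr>) P' Q' - chi P' Q') \<le> Eb (k - length S')" if a: "(P', Q') \<in> accepted (\<sigma>\<lparr>cand := ?c\<rparr>)"
            using Id[OF acc_old[OF a] e(2)] a by simp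
          show "cmod (chi P' Q') \<le> lam + \<gamma>" if a: "(P', Q') \<notin> accepted (\<sigma>\<lparr>cand := ?c\<rparr>)"
            using cases[OF e(1)]
          proof
            assume "(S', P', Q') \<in> set ys"
            from Ie[OF this e(2)] a show ?thesis by simp
          qed (use small in simp)
        qed
      next
        case acc: True
        obtain r where r: "fst (guarded_step lam S P Q \<sigma>)
          = \<sigma>\<lparr>cand := ?c, accepted := insert (P, Q) (accepted \<sigma>), est := (est \<sigma>)(P := (est \<sigma> P)(Q := ?c)), reg := r\<rparr>"
          "\<And>T P' Q'. T \<noteq> {} \<Longrightarrow> r T P' Q' = reg \<sigma> T P' Q' + (if contributes P Q T P' Q' then ?c else 0)"
          using res(3)[OF True acc] by blast
        let ?\<sigma> = "\<sigma>\<lparr>cand := ?c, accepted := insert (P, Q) (accepted \<sigma>), est := (est \<sigma>)(P := (est \<sigma> P)(Q := ?c)), reg := r\<rparr>"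
        have eq: "(\<lambda>(S, P, Q) \<sigma>. fst (guarded_step lam S P Q \<sigma>)) x \<sigma> = ?\<sigma>" using r(1) by (simp add: x)
        have estP: "est ?\<sigma> P Q = ?c" by simp
        have est: "est ?\<sigma> P' Q' = est \<sigma> P' Q'" if "(P', Q') \<noteq> (P, Q)" for P' Q' using that by auto
        have "cmod ?c \<le> cmod (chi P Q) + cmod (?c - chi P Q)" by (rule norm_triangle_sub)
        then have big: "lam - \<gamma> < cmod (chi P Q)" using acc err' by simp
        have c1: "reg ?\<sigma> T P' Q' = (\<Sum>(P, Q)\<in>accepted ?\<sigma>. if contributes P Q T P' Q' then est ?\<sigma> P Q else 0)"
          if "T \<noteq> {}" for T P' Q'
        proof -
          have "(\<Sum>(P, Q)\<in>accepted \<sigma>. if contributes P Q T P' Q' then est ?\<sigma> P Q else 0)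
              = (\<Sum>(P, Q)\<in>accepted \<sigma>. if contributes P Q T P' Q' then est \<sigma> P Q else 0)"
            using new est by (intro sum.cong refl) (auto split: prod.splits)
          then show ?thesis using r(2)[OF that] Ic[OF that] fin new estP by simp
        qed
        have c2: "(P', Q') \<noteq> (P, Q)" if "(S', P', Q') \<in> set ys" "supp P' \<union> supp Q' = set S'" for S' P' Q'
          using fresh that by auto
        show ?thesis unfolding eq
        proof (intro conjI allI impI)
          show "loc ?\<sigma> = loc \<sigma>1" using Ia by simp
          show "accepted ?\<sigma> \<subseteq> {(P, Q). \<exists>S. (S, P, Q) \<in> set (ys @ [x]) \<and> supp P \<union> supp Q = set S}"
          proof clarify
            fix P' Q' assume "(P', Q') \<in> accepted ?\<sigma>"
            then consider "(P', Q') = (P, Q)" | "(P', Q') \<in> accepted \<sigma>" by auto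
            then show "\<exists>S. (S, P', Q') \<in> set (ys @ [x]) \<and> supp P' \<union> supp Q' = set S"
            proof cases
              case 1
              then show ?thesis using True by (intro exI[of _ S]) (simp add: x)
            qed (rule Ib')
          qed
          show "reg ?\<sigma> T P' Q' = (\<Sum>(P, Q)\<in>accepted ?\<sigma>. if contributes P Q T P' Q' then est ?\<sigma> P Q else 0)"
            if "T \<noteq> {}" for T P' Q' by (rule c1[OF that])
          fix S' P' Q' assume e: "(S', P', Q') \<in> set (ys @ [x])" "supp P' \<union> supp Q' = set S'"
          note cases = cases[OF e(1)]
          show "lam - \<gamma> < cmod (chi P' Q')" if "(P', Q') \<in> accepted ?\<sigma>"
            using cases
          proof
            assume old: "(S', P', Q') \<in> set ys"
            then have "(P', Q') \<in> accepted \<sigma>" using c2[OF old e(2)] that by auto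
            then show ?thesis using Id[OF old e(2)] by simp
          qed (use big in simp)
          show "cmod (est ?\<sigma> P' Q' - chi P' Q') \<le> Eb (k - length S')" if "(P', Q') \<in> accepted ?\<sigma>"
            using cases
          proof
            assume old: "(S', P', Q') \<in> set ys"
            then have "(P', Q') \<in> accepted \<sigma>" using c2[OF old e(2)] that by auto
            then show ?thesis unfolding est[OF c2[OF old e(2)]] using Id[OF old e(2)] by simp
          qed (use err in simp)
          show "cmod (chi P' Q') \<le> lam + \<gamma>" if "(P', Q') \<notin> accepted ?\<sigma>"
            using cases
          proof
            assume old: "(S', P', Q') \<in> set ys"
            then show ?thesis using Ie[OF old e(2)] that by simp
          qed (use that in simp)
        qed
      qed
    qed
  qed
  define \<sigma> where "\<sigma> = fold (\<lambda>(S, P, Q) \<sigma>. fst (guarded_step lam S P Q \<sigma>)) xs \<sigma>1"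
  have rec: "recovered_set n k Lhat lam = accepted \<sigma>"
    unfolding recovered_set_eq \<sigma>_def \<sigma>1_def xs_def ..
  note inv' = inv[folded \<sigma>_def]
  show "recovered_set n k Lhat lam \<subseteq> pairs n k"
  proof clarify
    fix P Q assume "(P, Q) \<in> recovered_set n k Lhat lam"
    then have "(P, Q) \<in> {(P, Q). \<exists>S. (S, P, Q) \<in> set xs \<and> supp P \<union> supp Q = set S}"
      unfolding rec using inv'[THEN conjunct2, THEN conjunct1] by (rule subsetD[rotated])
    then obtain S where S: "(S, P, Q) \<in> set xs" "supp P \<union> supp Q = set S" by blast
    have "card (set S) \<le> k" using card_length[of S] S(1) vis by (meson order_trans)
    then show "(P, Q) \<in> pairs n k" using S vis by (auto simp: pairs_def strings_on_def)
  qed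
  assume P: "(P0, Q0) \<in> pairs0 n k"
  let ?S = "supp P0 \<union> supp Q0"
  have st: "P0 \<in> strings_on {..<n}" "Q0 \<in> strings_on {..<n}" "card ?S \<le> k" "(P0, Q0) \<noteq> (id_string, id_string)"
    using P by (auto simp: pairs0_def pairs_def)
  then have fS: "finite ?S" "?S \<subseteq> {..<n}" by (auto simp: strings_on_def intro: finite_subset)
  have "?S \<noteq> {}"
  proof
    assume "?S = {}"
    then have "P0 = id_string" "Q0 = id_string" by (auto simp: supp_def)
    then show False using st(4) by simp
  qed
  then have "1 \<le> card ?S" using fS(1) by (simp add: Suc_le_eq card_gt_0_iff)
  then have ev: "(sorted_list_of_set ?S, P0, Q0) \<in> set xs"
    unfolding vis using fS st by (auto simp: strict_sorted_iff strings_on_def)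
  have ss: "supp P0 \<union> supp Q0 = set (sorted_list_of_set ?S)" using fS(1) by simp
  note final = inv'[THEN conjunct2, THEN conjunct2, THEN conjunct2, THEN spec, THEN spec, THEN spec, THEN mp, OF ev, THEN mp, OF ss]
  have 1: "(P0, Q0) \<in> accepted \<sigma> \<Longrightarrow> lam - \<gamma> < cmod (chi P0 Q0)"
    and 2: "(P0, Q0) \<notin> accepted \<sigma> \<Longrightarrow> cmod (chi P0 Q0) \<le> lam + \<gamma>"
    using final by blast+
  show "(P0, Q0) \<in> recovered_set n k Lhat lam" if "cmod (chi P0 Q0) > lam + \<gamma>"
    using 2 that rec by fastforce
  show "(P0, Q0) \<notin> recovered_set n k Lhat lam" if "cmod (chi P0 Q0) < lam - \<gamma>"
    using 1 that rec by fastforce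
qed

section \<open>The distribution of a shot\<close>

lemma pauli_op_index:
  "i < 2 ^ n \<Longrightarrow> j < 2 ^ n \<Longrightarrow>
    pauli_op n P $$ (i, j) = (\<Prod>u<n. sigma (P u) $$ (i div 2 ^ u mod 2, j div 2 ^ u mod 2))"
  by (simp add: pauli_mat_def tensor_def)

text \<open>The eigenprojector of \<open>sigma a\<close>, with \<beta> marking the eigenvalue -1.
  For \<open>PI\<close> it is the identity or 0, so idempotence holds for every letter.\<close>

definition qubit_state :: "pauli \<Rightarrow> bool \<Rightarrow> complex mat" where
  "qubit_state a \<beta> = (1 / 2) \<cdot>\<^sub>m (sigma PI + (if \<beta> then - 1 else 1) \<cdot>\<^sub>m sigma a)"

lemma qubit_state_carrier [simp]: "qubit_state a \<beta> \<in> carrier_mat 2 2"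
  by (simp add: qubit_state_def)

lemma qubit_state_index:
  "i < 2 \<Longrightarrow> j < 2 \<Longrightarrow>
    qubit_state a \<beta> $$ (i, j) = (sigma PI $$ (i, j) + (if \<beta> then - 1 else 1) * sigma a $$ (i, j)) / 2"
  by (simp add: qubit_state_def)

lemma eigenstate_tensor: "eigenstate n W s = tensor [0..<n] (\<lambda>u. qubit_state (W u) (u \<in> s))"
  unfolding eigenstate_def qubit_state_def
  by (rule arg_cong[where f = "tensor _"]) (auto simp: pm_def fun_eq_iff)

lemma eigenstate_carrier [simp]: "eigenstate n W s \<in> carrier_mat (2 ^ n) (2 ^ n)"
  using tensor_carrier[of "[0..<n]"] by (simp add: eigenstate_tensor)

lemma eigenstate_adjoint: "mat_adjoint (eigenstate n W s) = eigenstate n W s"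
proof -
  have "mat_adjoint (qubit_state a \<beta>) = qubit_state a \<beta>" for a \<beta>
    by (simp add: qubit_state_def mat_adjoint_smult mat_adjoint_add[of _ 2] mat_adjoint_sigma)
  then show ?thesis by (simp add: eigenstate_tensor mat_adjoint_tensor)
qed

lemma eigenstate_idem: "eigenstate n W s * eigenstate n W s = eigenstate n W s"
proof -
  have "qubit_state a \<beta> * qubit_state a \<beta> = qubit_state a \<beta>" for a \<beta>
  proof -
    show ?thesis
    proof (rule mat2_eqI)
      show "qubit_state a \<beta> * qubit_state a \<beta> \<in> carrier_mat 2 2"
        by (rule mult_carrier_mat[OF qubit_state_carrier qubit_state_carrier])
    qed (cases a; cases \<beta>; simp add: mat2_mult_index[OF qubit_state_carrier qubit_state_carrier]
        qubit_state_index sigma_index del: index_mult_mat(1))+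
  qed
  then show ?thesis by (simp add: eigenstate_tensor tensor_mult)
qed

text \<open>The factor of a single qubit in a classical shadow: 3 compensates the probability 1/3 of
  the matching basis, and the sign is the recorded eigenvalue.\<close>

definition side_factor :: "pauli \<Rightarrow> pauli \<Rightarrow> bool \<Rightarrow> complex" where
  "side_factor p a \<beta> = (if p = PI then 1 else if a = p then (if \<beta> then - 3 else 3) else 0)"

lemma side_estimate_prod:
  assumes "P \<in> strings_on {..<n}"
  shows "complex_of_real (side_estimate P V b) = (\<Prod>u<n. side_factor (P u) (V u) (u \<in> b))"
proof -
  have fin: "finite (supp P)" "supp P \<subseteq> {..<n}" using assms by (auto simp: strings_on_def intro: finite_subset)
  have "(\<Prod>u<n. side_factor (P u) (V u) (u \<in> b)) = (\<Prod>u\<in>supp P. side_factor (P u) (V u) (u \<in> b))"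
    using fin by (intro prod.mono_neutral_right) (auto simp: side_factor_def supp_def)
  also have "\<dots> = complex_of_real (side_estimate P V b)"
  proof (cases "\<forall>u\<in>supp P. V u = P u")
    case True
    have "(\<Prod>u\<in>supp P. side_factor (P u) (V u) (u \<in> b)) = (\<Prod>u\<in>supp P. 3 * complex_of_real (pm b u))"
      using True by (intro prod.cong) (auto simp: side_factor_def pm_def supp_def)
    then show ?thesis using True by (simp add: side_estimate_def prod.distrib)
  next
    case False
    then obtain u where "u \<in> supp P" "V u \<noteq> P u" by blast
    then have "side_factor (P u) (V u) (u \<in> b) = 0" by (auto simp: side_factor_def supp_def)
    then show ?thesis using False \<open>u \<in> supp P\<close> fin(1) by (auto simp: side_estimate_def)
  qed
  finally show ?thesis ..
qed

lemma finite_bases [simp]: "finite (bases n)"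
  by (rule finite_subset[OF _ finite_strings_on[OF finite_lessThan[of n]]]) (auto simp: bases_def strings_on_def)

text \<open>Bases are the strings without trivial letter. Giving that letter weight 0 reduces the
  sum to one over all strings, which factors.\<close>

lemma sum_bases_prod:
  fixes h :: "nat \<Rightarrow> pauli \<Rightarrow> complex"
  shows "(\<Sum>V\<in>bases n. \<Prod>u<n. h u (V u)) = (\<Prod>u<n. h u PX + h u PY + h u PZ)"
proof -
  have "(\<Sum>V\<in>bases n. \<Prod>u<n. h u (V u)) = (\<Sum>V\<in>strings_on {..<n}. \<Prod>u<n. if V u = PI then 0 else h u (V u))"
  proof (rule sum.mono_neutral_cong_left)
    show "bases n \<subseteq> strings_on {..<n}" by (auto simp: bases_def strings_on_def)
    show "\<forall>V\<in>strings_on {..<n} - bases n. (\<Prod>u<n. if V u = PI then 0 else h u (V u)) = 0"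
    proof
      fix V assume "V \<in> strings_on {..<n} - bases n"
      then obtain u where "u < n" "V u = PI" by (auto simp: bases_def strings_on_def supp_def)
      then show "(\<Prod>u<n. if V u = PI then 0 else h u (V u)) = 0" by (intro prod_zero) auto
    qed
    show "(\<Prod>u<n. h u (V u)) = (\<Prod>u<n. if V u = PI then 0 else h u (V u))" if "V \<in> bases n" for V
      using that by (intro prod.cong) (auto simp: bases_def supp_def)
  qed simp
  also have "\<dots> = (\<Prod>u<n. \<Sum>a\<in>UNIV. if a = PI then 0 else h u a)" by (rule sum_strings_prod) simp
  finally show ?thesis by (simp add: sum_pauli)
qed

lemma sum_Pow_prod:
  fixes g :: "nat \<Rightarrow> bool \<Rightarrow> complex"
  shows "(\<Sum>b\<in>Pow {..<n}. \<Prod>u<n. g u (u \<in> b)) = (\<Prod>u<n. g u True + g u False)"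
proof -
  have "(\<Prod>u<n. g u (u \<in> b)) = (\<Prod>u\<in>b. g u True) * (\<Prod>u\<in>{..<n} - b. g u False)" if "b \<subseteq> {..<n}" for b
  proof -
    have "(\<Prod>u<n. g u (u \<in> b)) = (\<Prod>u\<in>{..<n} - b. g u (u \<in> b)) * (\<Prod>u\<in>b. g u (u \<in> b))"
      by (rule prod.subset_diff) (use that in auto)
    then show ?thesis by simp
  qed
  then show ?thesis unfolding prod_add[OF finite_lessThan] by (intro sum.cong refl) auto
qed

text \<open>Qubit by qubit: for a nontrivial letter only the matching basis counts, and 3 times the
  difference of its eigenprojectors is \<open>3 * sigma\<close>; for the trivial letter each of the
  three bases contributes a resolution of the identity.\<close>

lemma msum_side_estimate:
  assumes "P \<in> strings_on {..<n}"
  shows "msum (2 ^ n) (\<lambda>(V, b). complex_of_real (side_estimate P V b) \<cdot>\<^sub>m eigenstate n V b) (bases n \<times> Pow {..<n})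
    = 3 ^ n \<cdot>\<^sub>m pauli_op n P"
proof (rule eq_carrierI[of _ "2 ^ n"])
  fix i j :: nat assume ij: "i < 2 ^ n" "j < 2 ^ n"
  let ?e = "\<lambda>u a \<beta>. qubit_state a \<beta> $$ (i div 2 ^ u mod 2, j div 2 ^ u mod 2)"
  let ?g = "\<lambda>u a \<beta>. side_factor (P u) a \<beta> * ?e u a \<beta>"
  have "msum (2 ^ n) (\<lambda>(V, b). complex_of_real (side_estimate P V b) \<cdot>\<^sub>m eigenstate n V b) (bases n \<times> Pow {..<n}) $$ (i, j)
      = (\<Sum>(V, b)\<in>bases n \<times> Pow {..<n}. \<Prod>u<n. ?g u (V u) (u \<in> b))"
    unfolding msum_index[OF ij]
  proof (intro sum.cong refl, clarify)
    fix V b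
    have "eigenstate n V b $$ (i, j) = (\<Prod>u<n. ?e u (V u) (u \<in> b))"
      using ij by (simp add: eigenstate_tensor tensor_def)
    then show "(complex_of_real (side_estimate P V b) \<cdot>\<^sub>m eigenstate n V b) $$ (i, j) = (\<Prod>u<n. ?g u (V u) (u \<in> b))"
      unfolding carrier_index(3)[OF eigenstate_carrier ij] side_estimate_prod[OF assms] by (simp only: prod.distrib)
  qed
  also have "\<dots> = (\<Sum>V\<in>bases n. \<Sum>b\<in>Pow {..<n}. \<Prod>u<n. ?g u (V u) (u \<in> b))"
    by (simp add: sum.cartesian_product)
  also have "\<dots> = (\<Sum>V\<in>bases n. \<Prod>u<n. ?g u (V u) True + ?g u (V u) False)"
    by (intro sum.cong refl sum_Pow_prod)
  also have "\<dots> = (\<Prod>u<n. (?g u PX True + ?g u PX False) + (?g u PY True + ?g u PY False) + (?g u PZ True + ?g u PZ False))"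
    by (rule sum_bases_prod[of "\<lambda>u a. ?g u a True + ?g u a False"])
  also have "\<dots> = (\<Prod>u<n. 3 * sigma (P u) $$ (i div 2 ^ u mod 2, j div 2 ^ u mod 2))"
  proof (intro prod.cong refl)
    fix u
    show "(?g u PX True + ?g u PX False) + (?g u PY True + ?g u PY False) + (?g u PZ True + ?g u PZ False)
        = 3 * sigma (P u) $$ (i div 2 ^ u mod 2, j div 2 ^ u mod 2)"
      by (cases "P u") (simp_all add: side_factor_def qubit_state_index field_simps)
  qed
  also have "\<dots> = (3 ^ n \<cdot>\<^sub>m pauli_op n P) $$ (i, j)"
    unfolding carrier_index(3)[OF pauli_op_carrier ij] pauli_op_index[OF ij] by (simp add: prod.distrib)
  finally show "msum (2 ^ n) (\<lambda>(V, b). complex_of_real (side_estimate P V b) \<cdot>\<^sub>m eigenstate n V b) (bases n \<times> Pow {..<n}) $$ (i, j)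
    = (3 ^ n \<cdot>\<^sub>m pauli_op n P) $$ (i, j)" .
qed auto

lemma lin_exp_superop:
  assumes "lin d \<Phi>"
  shows "lin d (exp_superop d t \<Phi>)"
  unfolding lin_def
proof (intro conjI ballI allI)
  fix A B :: "complex mat" assume AB: "A \<in> carrier_mat d d" "B \<in> carrier_mat d d"
  note F = linD[OF lin_funpow[OF assms]]
  show "exp_superop d t \<Phi> (A + B) = exp_superop d t \<Phi> A + exp_superop d t \<Phi> B"
  proof (rule eq_carrierI[of _ d])
    fix i j assume ij: "i < d" "j < d"
    have "((\<Phi> ^^ m) (A + B)) $$ (i, j) = ((\<Phi> ^^ m) A) $$ (i, j) + ((\<Phi> ^^ m) B) $$ (i, j)" for m
      unfolding F(2)[OF AB] by (rule carrier_index(1)[OF F(1)[OF AB(1)] ij F(1)[OF AB(2)]])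
    then have s: "(\<lambda>m. complex_of_real (t ^ m / fact m) * ((\<Phi> ^^ m) (A + B)) $$ (i, j))
        sums (exp_superop d t \<Phi> A $$ (i, j) + exp_superop d t \<Phi> B $$ (i, j))"
      using sums_add[OF exp_superop_entry_sums[OF assms AB(1) ij, of t] exp_superop_entry_sums[OF assms AB(2) ij, of t]]
      by (simp only: distrib_left)
    show "exp_superop d t \<Phi> (A + B) $$ (i, j) = (exp_superop d t \<Phi> A + exp_superop d t \<Phi> B) $$ (i, j)"
      unfolding carrier_index(1)[OF exp_superop_carrier ij exp_superop_carrier]
      by (rule sums_unique2[OF exp_superop_entry_sums[OF assms add_carrier_mat[OF AB(2)] ij] s])
  qed auto
next
  fix c and A :: "complex mat" assume A: "A \<in> carrier_mat d d"
  note F = linD[OF lin_funpow[OF assms]]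
  show "exp_superop d t \<Phi> (c \<cdot>\<^sub>m A) = c \<cdot>\<^sub>m exp_superop d t \<Phi> A"
  proof (rule eq_carrierI[of _ d])
    fix i j assume ij: "i < d" "j < d"
    have "((\<Phi> ^^ m) (c \<cdot>\<^sub>m A)) $$ (i, j) = c * ((\<Phi> ^^ m) A) $$ (i, j)" for m
      unfolding F(3)[OF A] by (rule carrier_index(3)[OF F(1)[OF A] ij])
    then have s: "(\<lambda>m. complex_of_real (t ^ m / fact m) * ((\<Phi> ^^ m) (c \<cdot>\<^sub>m A)) $$ (i, j)) sums (c * exp_superop d t \<Phi> A $$ (i, j))"
      using sums_mult[OF exp_superop_entry_sums[OF assms A ij, of t], of c] by (simp only: mult.left_commute)
    show "exp_superop d t \<Phi> (c \<cdot>\<^sub>m A) $$ (i, j) = (c \<cdot>\<^sub>m exp_superop d t \<Phi> A) $$ (i, j)"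
      unfolding carrier_index(3)[OF exp_superop_carrier ij]
      by (rule sums_unique2[OF exp_superop_entry_sums[OF assms smult_carrier_mat[OF A] ij] s])
  qed auto
qed auto

lemma bilinear_msum:
  assumes "lin d \<Phi>" "finite X" "finite Y" "\<And>x. f x \<in> carrier_mat d d" "\<And>y. g y \<in> carrier_mat d d"
  shows "mtrace (msum d (\<lambda>x. \<alpha> x \<cdot>\<^sub>m f x) X * \<Phi> (msum d (\<lambda>y. \<beta> y \<cdot>\<^sub>m g y) Y))
    = (\<Sum>x\<in>X. \<Sum>y\<in>Y. \<alpha> x * \<beta> y * mtrace (f x * \<Phi> (g y)))"
proof -
  note c = assms(4,5) linD(1)[OF assms(1,5)]
  have "\<Phi> (msum d (\<lambda>y. \<beta> y \<cdot>\<^sub>m g y) Y) = msum d (\<lambda>y. \<beta> y \<cdot>\<^sub>m \<Phi> (g y)) Y"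
    unfolding lin_msum_arg[OF assms(1,3) smult_carrier_mat[OF c(2)]] linD(3)[OF assms(1) c(2)] ..
  note e = this
  have "mtrace (msum d (\<lambda>x. \<alpha> x \<cdot>\<^sub>m f x) X * \<Phi> (msum d (\<lambda>y. \<beta> y \<cdot>\<^sub>m g y) Y))
      = (\<Sum>x\<in>X. mtrace ((\<alpha> x \<cdot>\<^sub>m f x) * msum d (\<lambda>y. \<beta> y \<cdot>\<^sub>m \<Phi> (g y)) Y))"
    unfolding e msum_mult[OF msum_carrier smult_carrier_mat[OF c(1)]]
    by (rule mtrace_msum[OF mult_carrier_mat[OF smult_carrier_mat[OF c(1)] msum_carrier]])
  also have "\<dots> = (\<Sum>x\<in>X. \<Sum>y\<in>Y. mtrace ((\<alpha> x \<cdot>\<^sub>m f x) * (\<beta> y \<cdot>\<^sub>m \<Phi> (g y))))"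
    unfolding mult_msum[OF smult_carrier_mat[OF c(1)] smult_carrier_mat[OF c(3)]]
    by (simp only: mtrace_msum[OF mult_carrier_mat[OF smult_carrier_mat[OF c(1)] smult_carrier_mat[OF c(3)]]])
  also have "\<dots> = (\<Sum>x\<in>X. \<Sum>y\<in>Y. \<alpha> x * \<beta> y * mtrace (f x * \<Phi> (g y)))"
    unfolding mult_smult_distrib[OF smult_carrier_mat[OF c(1)] c(3)] mult_smult_assoc_mat[OF c(1) c(3)]
      mtrace_smult[OF smult_carrier_mat[OF mult_carrier_mat[OF c(1) c(3)]]]
      mtrace_smult[OF mult_carrier_mat[OF c(1) c(3)]] by (simp only: mult_ac)
  finally show ?thesis .
qed

definition shot_space :: "nat \<Rightarrow> shot set" where
  "shot_space n = bases n \<times> Pow {..<n} \<times> bases n \<times> Pow {..<n}"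

definition shot_weight :: "nat \<Rightarrow> superop \<Rightarrow> real \<Rightarrow> shot \<Rightarrow> real" where
  "shot_weight n \<Phi> t = (\<lambda>(W, s, V, b). 1 / (3 ^ n * 2 ^ n * 3 ^ n) *
        Re (mtrace (eigenstate n V b * exp_superop (2 ^ n) t \<Phi> (eigenstate n W s))))"

lemma shot_measure_alt: "shot_measure n \<Phi> t = point_measure (shot_space n) (\<lambda>x. ennreal (shot_weight n \<Phi> t x))"
  unfolding shot_measure_def shot_space_def shot_weight_def
  by (rule arg_cong[where f = "point_measure _"]) (auto simp: fun_eq_iff)

lemma finite_shot_space [simp]: "finite (shot_space n)"
  by (simp add: shot_space_def)

lemma space_shot_measure: "space (shot_measure n \<Phi> t) = shot_space n"
  by (simp add: shot_measure_alt space_point_measure)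

lemma sets_shot_measure: "sets (shot_measure n \<Phi> t) = Pow (shot_space n)"
  by (simp add: shot_measure_alt sets_point_measure)

text \<open>The Born weight is bilinear in state and effect, so the sums over both sides can be
  taken inside and yield \<open>3 ^ n\<close> times the Pauli operators. The factor
  \<open>9 ^ n\<close> cancels the probabilities of the two basis choices, and that of the signs
  leaves the normalisation of the overlap.\<close>

lemma sum_shot_weight:
  assumes "lin (2 ^ n) \<Phi>" "P \<in> strings_on {..<n}" "Q \<in> strings_on {..<n}"
  shows "(\<Sum>x\<in>shot_space n. shot_weight n \<Phi> t x * shot_estimate P Q x)
    = Re (mtrace (pauli_op n P * exp_superop (2 ^ n) t \<Phi> (pauli_op n Q))) / 2 ^ n"
proof -
  let ?N = "2 ^ n :: nat" and ?X = "bases n \<times> Pow {..<n}"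
  let ?F = "\<lambda>A B. mtrace (A * exp_superop ?N t \<Phi> B)"
  let ?E = "\<lambda>x. eigenstate n (fst x) (snd x)"
  let ?s = "\<lambda>P x. side_estimate P (fst x) (snd x)"
  have L: "lin ?N (exp_superop ?N t \<Phi>)" by (rule lin_exp_superop[OF assms(1)])
  have m: "msum ?N (\<lambda>x. complex_of_real (?s P x) \<cdot>\<^sub>m ?E x) ?X = 3 ^ n \<cdot>\<^sub>m pauli_op n P" if "P \<in> strings_on {..<n}" for P
    using msum_side_estimate[OF that] by (simp add: case_prod_unfold)
  have "(\<Sum>x\<in>?X. \<Sum>y\<in>?X. complex_of_real (?s P x) * complex_of_real (?s Q y) * ?F (?E x) (?E y))
      = ?F (3 ^ n \<cdot>\<^sub>m pauli_op n P) (3 ^ n \<cdot>\<^sub>m pauli_op n Q)"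
    using bilinear_msum[OF L, of ?X ?X ?E ?E "\<lambda>x. complex_of_real (?s P x)" "\<lambda>x. complex_of_real (?s Q x)"]
    by (simp add: m[OF assms(2)] m[OF assms(3)])
  also have "\<dots> = 9 ^ n * ?F (pauli_op n P) (pauli_op n Q)"
  proof -
    have c: "exp_superop ?N t \<Phi> (pauli_op n Q) \<in> carrier_mat ?N ?N" by simp
    have "?F (3 ^ n \<cdot>\<^sub>m pauli_op n P) (3 ^ n \<cdot>\<^sub>m pauli_op n Q) = 3 ^ n * (3 ^ n * ?F (pauli_op n P) (pauli_op n Q))"
      unfolding linD(3)[OF L pauli_op_carrier] mult_smult_distrib[OF smult_carrier_mat[OF pauli_op_carrier] c]
        mult_smult_assoc_mat[OF pauli_op_carrier c]
        mtrace_smult[OF smult_carrier_mat[OF mult_carrier_mat[OF pauli_op_carrier c]]]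
        mtrace_smult[OF mult_carrier_mat[OF pauli_op_carrier c]] ..
    also have "\<dots> = (3 ^ n * 3 ^ n) * ?F (pauli_op n P) (pauli_op n Q)" by (simp only: mult.assoc)
    also have "(3 :: complex) ^ n * 3 ^ n = 9 ^ n" by (simp flip: power_mult_distrib)
    finally show ?thesis .
  qed
  finally have "Re (\<Sum>x\<in>?X. \<Sum>y\<in>?X. complex_of_real (?s P x) * complex_of_real (?s Q y) * ?F (?E x) (?E y))
      = Re (complex_of_real (9 ^ n) * ?F (pauli_op n P) (pauli_op n Q))" by simp
  then have main: "(\<Sum>x\<in>?X. \<Sum>y\<in>?X. ?s P x * ?s Q y * Re (?F (?E x) (?E y)))
      = 9 ^ n * Re (?F (pauli_op n P) (pauli_op n Q))"
    by (simp only: Re_sum of_real_mult[symmetric] Re_complex_of_real times_complex.sel Im_complex_of_real mult_zero_left diff_zero)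
  have "(\<Sum>x\<in>shot_space n. shot_weight n \<Phi> t x * shot_estimate P Q x)
      = (\<Sum>z\<in>?X \<times> ?X. 1 / (3 ^ n * 2 ^ n * 3 ^ n) * (?s P (fst z) * ?s Q (snd z) * Re (?F (?E (fst z)) (?E (snd z)))))"
    by (rule sum.reindex_bij_witness[of _ "\<lambda>((V, b), (W, s)). (W, s, V, b)" "\<lambda>(W, s, V, b). ((V, b), (W, s))"])
      (auto simp: shot_space_def shot_weight_def shot_estimate_def)
  also have "\<dots> = 1 / (3 ^ n * 2 ^ n * 3 ^ n) * (\<Sum>x\<in>?X. \<Sum>y\<in>?X. ?s P x * ?s Q y * Re (?F (?E x) (?E y)))"
    unfolding sum_distrib_left[symmetric] sum.cartesian_product by (simp add: case_prod_unfold)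
  also have "\<dots> = 1 / (3 ^ n * 2 ^ n * 3 ^ n) * (9 ^ n * Re (?F (pauli_op n P) (pauli_op n Q)))"
    by (simp only: main)
  also have "\<dots> = Re (?F (pauli_op n P) (pauli_op n Q)) / 2 ^ n"
  proof -
    have "(9 :: real) ^ n = 3 ^ n * 3 ^ n" by (simp flip: power_mult_distrib)
    then show ?thesis by simp
  qed
  finally show ?thesis .
qed

lemma abs_side_estimate_le: "\<bar>side_estimate P V b\<bar> \<le> 3 ^ card (supp P)"
proof -
  have "\<bar>\<Prod>u\<in>supp P. pm b u\<bar> = (\<Prod>u\<in>supp P. 1)"
    unfolding abs_prod by (intro prod.cong) (auto simp: pm_def)
  then show ?thesis by (simp add: side_estimate_def abs_mult)
qed

lemma abs_shot_estimate_le: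
  assumes "card (supp P) \<le> k" "card (supp Q) \<le> k"
  shows "\<bar>shot_estimate P Q x\<bar> \<le> 9 ^ k"
proof -
  obtain W s V b where x: "x = (W, s, V, b)" by (cases x)
  have p: "(3 :: real) ^ card (supp P) \<le> 3 ^ k" "(3 :: real) ^ card (supp Q) \<le> 3 ^ k"
    using assms by (auto intro: power_increasing)
  have "\<bar>shot_estimate P Q x\<bar> = \<bar>side_estimate Q W s\<bar> * \<bar>side_estimate P V b\<bar>"
    by (simp add: x shot_estimate_def abs_mult)
  also have "\<dots> \<le> 3 ^ k * 3 ^ k"
    using abs_side_estimate_le[of Q W s] abs_side_estimate_le[of P V b] p by (intro mult_mono) linarith+
  also have "\<dots> = 9 ^ k" by (simp flip: power_mult_distrib)
  finally show ?thesis .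
qed

context local_generator begin

lemma shot_weight_nonneg: "0 \<le> t \<Longrightarrow> 0 \<le> shot_weight n (lindbladian n k G) t x"
  unfolding shot_weight_def
  by (cases x) (auto intro!: divide_nonneg_nonneg mtrace_exp_nonneg eigenstate_idem eigenstate_adjoint)

text \<open>The estimate for two identity strings is constantly 1, so the total mass is an instance
  of the sum formula, evaluated by trace preservation.\<close>

lemma prob_space_shot: "0 \<le> t \<Longrightarrow> prob_space (shot_measure n (lindbladian n k G) t)"
proof -
  assume t: "0 \<le> t"
  have id: "id_string \<in> strings_on {..<n}" by (simp add: strings_on_def supp_def)
  have "shot_estimate id_string id_string x = 1" for x
    by (cases x) (simp add: shot_estimate_def side_estimate_def supp_def)
  then have "(\<Sum>x\<in>shot_space n. shot_weight n (lindbladian n k G) t x)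
      = Re (mtrace (pauli_op n id_string * exp_superop N t (lindbladian n k G) (pauli_op n id_string))) / 2 ^ n"
    using sum_shot_weight[OF lin_lindbladian id id, of t] by simp
  also have "\<dots> = Re (mtrace (1\<^sub>m N)) / 2 ^ n"
    unfolding pauli_op_id left_mult_one_mat[OF exp_superop_carrier] by (simp add: mtrace_exp_superop)
  also have "\<dots> = 1" by (simp add: mtrace_def)
  finally have "(\<Sum>x\<in>shot_space n. ennreal (shot_weight n (lindbladian n k G) t x)) = 1"
    using shot_weight_nonneg[OF t] by (simp add: sum_ennreal)
  then show ?thesis unfolding shot_measure_alt by (intro prob_space_point_measure) auto
qed

lemma shot_expectation:
  fixes P Q :: pstring
  assumes "0 \<le> t" "P \<in> strings_on {..<n}" "Q \<in> strings_on {..<n}"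
  shows "integral\<^sup>L (shot_measure n (lindbladian n k G) t) (shot_estimate P Q)
    = Re (mtrace (pauli_op n P * exp_superop N t (lindbladian n k G) (pauli_op n Q))) / 2 ^ n"
proof -
  have "integral\<^sup>L (shot_measure n (lindbladian n k G) t) (shot_estimate P Q)
      = (\<Sum>x\<in>shot_space n. shot_weight n (lindbladian n k G) t x *\<^sub>R shot_estimate P Q x)"
    unfolding shot_measure_alt
    by (rule lebesgue_integral_point_measure_finite[OF finite_shot_space shot_weight_nonneg[OF assms(1)]])
  then show ?thesis by (simp only: real_scaleR_def sum_shot_weight[OF lin_lindbladian assms(2,3)])
qed

end

section \<open>Concentration\<close>

text \<open>Singletons are boxes of singletons, and the product space is finite. Every event is thus
  measurable, also those defined through \<open>arg_min\<close> and sorting.\<close>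

lemma sets_PiM_finite_space:
  assumes "finite I" "\<And>i. i \<in> I \<Longrightarrow> finite (space (M i))" "\<And>i. i \<in> I \<Longrightarrow> sets (M i) = Pow (space (M i))"
    and "A \<subseteq> space (PiM I M)"
  shows "A \<in> sets (PiM I M)"
proof -
  have fin: "finite (space (PiM I M))" unfolding space_PiM using assms(1,2) by (rule finite_PiE)
  have "{x} \<in> sets (PiM I M)" if x: "x \<in> space (PiM I M)" for x
  proof -
    have "PiE I (\<lambda>i. {x i}) \<in> sets (PiM I M)"
      using x assms(3) by (intro sets_PiM_I_finite assms(1)) (auto simp: space_PiM PiE_iff)
    moreover have "PiE I (\<lambda>i. {x i}) = {x}" by (rule PiE_singleton) (use x in \<open>simp add: space_PiM PiE_iff\<close>)
    ultimately show ?thesis by simp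
  qed
  then have "(\<Union>x\<in>A. {x}) \<in> sets (PiM I M)"
    using assms(4) finite_subset[OF assms(4) fin] by (intro sets.finite_UN) auto
  then show ?thesis by simp
qed

lemma indep_vars_PiM_coordinates:
  assumes "I \<noteq> {}" "\<And>i. i \<in> I \<Longrightarrow> prob_space (M i)"
  shows "prob_space.indep_vars (PiM I M) M (\<lambda>i x. x i) I"
proof -
  interpret P: prob_space "PiM I M" by (rule prob_space_PiM[OF assms(2)])
  have "distr (PiM I M) (PiM I M) (\<lambda>x. \<lambda>i\<in>I. x i) = distr (PiM I M) (PiM I M) (\<lambda>x. x)"
    by (rule distr_cong) (auto simp: space_PiM PiE_restrict)
  also have "\<dots> = PiM I M" by (rule distr_id)
  also have "\<dots> = PiM I (\<lambda>i. distr (PiM I M) (M i) (\<lambda>x. x i))"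
  proof (rule PiM_cong[OF refl])
    fix i assume "i \<in> I"
    from distr_PiM_component[of I M i, OF assms(2) this] show "M i = distr (PiM I M) (M i) (\<lambda>x. x i)" by simp
  qed
  finally show ?thesis
    by (subst P.indep_vars_iff_distr_eq_PiM'[OF assms(1)]) (auto intro: measurable_component_singleton)
qed

text \<open>Hoeffding's inequality for a subfamily of the coordinates; values between
  \<open>- c\<close> and \<open>c\<close> give the width \<open>2 * c\<close>.\<close>

lemma PiM_sum_deviation:
  fixes h :: "'b \<Rightarrow> real"
  assumes I: "finite I" "K \<subseteq> I" "K \<noteq> {}" and M: "\<And>i. i \<in> I \<Longrightarrow> prob_space (M i)"
    and h: "\<And>i. i \<in> I \<Longrightarrow> h \<in> borel_measurable (M i)" "\<And>x. \<bar>h x\<bar> \<le> c" and c: "0 < c" and e: "0 \<le> e"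
  shows "measure (PiM I M) {x \<in> space (PiM I M). e \<le> \<bar>(\<Sum>i\<in>K. h (x i)) - (\<Sum>i\<in>K. integral\<^sup>L (M i) h)\<bar>}
    \<le> 2 * exp (- 2 * e\<^sup>2 / (real (card K) * (2 * c)\<^sup>2))"
proof -
  interpret P: prob_space "PiM I M" by (rule prob_space_PiM[OF M])
  have finK: "finite K" using I finite_subset by blast
  have Ine: "I \<noteq> {}" using I by auto
  have "P.indep_vars M (\<lambda>i x. x i) K"
    by (rule P.indep_vars_subset[OF indep_vars_PiM_coordinates[OF Ine M] I(2)])
  from P.indep_vars_compose2[OF this, of "\<lambda>_. h" "\<lambda>_. borel"]
  have ind: "P.indep_vars (\<lambda>_. borel) (\<lambda>i x. h (x i)) K" using h(1) I(2) by auto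
  interpret H: indep_interval_bounded_random_variables "PiM I M" K "\<lambda>i x. h (x i)" "\<lambda>_. - c" "\<lambda>_. c"
    by unfold_locales (use finK ind h(2) in \<open>auto simp: abs_le_iff minus_le_iff\<close>)
  interpret Hoeffding_ineq "PiM I M" K "\<lambda>i x. h (x i)" "\<lambda>_. - c" "\<lambda>_. c" "\<Sum>i\<in>K. P.expectation (\<lambda>x. h (x i))"
    by unfold_locales simp
  have ex: "P.expectation (\<lambda>x. h (x i)) = integral\<^sup>L (M i) h" if "i \<in> K" for i
  proof -
    have i: "i \<in> I" using that I by auto
    have "integral\<^sup>L (distr (PiM I M) (M i) (\<lambda>x. x i)) h = P.expectation (\<lambda>x. h (x i))"
      using h(1)[OF i] i by (intro integral_distr) auto
    moreover have "distr (PiM I M) (M i) (\<lambda>x. x i) = M i" by (rule distr_PiM_component[of I M i, OF M i])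
    ultimately show ?thesis by (simp only:)
  qed
  have "0 < (\<Sum>i\<in>K. (c - - c)\<^sup>2)" using finK I(3) c by (simp add: card_gt_0_iff)
  from Hoeffding_ineq_abs_ge[OF e this] show ?thesis
    by (simp add: ex mult_2[symmetric] cong: sum.cong)
qed

section \<open>Parameters of the routine\<close>

lemma card_strings_on: "finite S \<Longrightarrow> card (strings_on S) = 4 ^ card S"
  using string_list_props[of "sorted_list_of_set S"] distinct_card[of "string_list (sorted_list_of_set S)"]
  by (simp add: length_string_list)

text \<open>The index pairs of all required entries, collected in one set over which the union bound
  is taken.\<close>

definition estimated_pairs :: "nat \<Rightarrow> nat \<Rightarrow> (pstring \<times> pstring) set" where
  "estimated_pairs n k = (\<Union>S\<in>regions n k - {{}}. strings_on S \<times> strings_on S)"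

lemma region_finite: "S \<in> regions n k \<Longrightarrow> finite S"
  by (auto simp: regions_def intro: finite_subset)

lemma finite_estimated_pairs: "finite (estimated_pairs n k)"
  unfolding estimated_pairs_def using finite_regions region_finite by (intro finite_UN_I) auto

lemma card_nonempty_regions: "card (regions n k - {{}}) \<le> n ^ k"
proof -
  let ?L = "{xs. set xs \<subseteq> {..<n} \<and> length xs = k}"
  have "regions n k - {{}} \<subseteq> set ` ?L"
  proof
    fix S assume S: "S \<in> regions n k - {{}}"
    then have fin: "finite S" and ne: "S \<noteq> {}" by (auto intro: region_finite)
    obtain u where u: "u \<in> S" using ne by blast
    \<comment> \<open>Padding with a repeated element makes the region the set of letters of a word
      of length exactly \<open>k\<close>; a nonempty region supplies the letter.\<close>
    let ?xs = "sorted_list_of_set S @ replicate (k - card S) u"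
    have "set ?xs = S" using fin u by auto
    moreover have "length ?xs = k" using S by (simp add: regions_def)
    ultimately show "S \<in> set ` ?L" using S by (intro image_eqI[of _ _ ?xs]) (auto simp: regions_def)
  qed
  then have "card (regions n k - {{}}) \<le> card (set ` ?L)"
    by (rule card_mono[rotated]) (simp add: finite_lists_length_eq)
  also have "\<dots> \<le> card ?L" by (rule card_image_le) (simp add: finite_lists_length_eq)
  finally show ?thesis by (simp add: card_lists_length_eq)
qed

lemma card_estimated_pairs: "card (estimated_pairs n k) \<le> n ^ k * 16 ^ k"
proof -
  have "card (estimated_pairs n k) \<le> (\<Sum>S\<in>regions n k - {{}}. card (strings_on S \<times> strings_on S))"
    unfolding estimated_pairs_def using finite_regions by (intro card_UN_le) auto
  also have "\<dots> \<le> (\<Sum>S\<in>regions n k - {{}}. 16 ^ k)"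
  proof (rule sum_mono)
    fix S assume S: "S \<in> regions n k - {{}}"
    then have "card S \<le> k" by (simp add: regions_def)
    have "finite S" using S by (auto intro: region_finite)
    have "card (strings_on S \<times> strings_on S) = 16 ^ card S"
      unfolding card_cartesian_product card_strings_on[OF \<open>finite S\<close>] by (simp flip: power_mult_distrib)
    also have "\<dots> \<le> 16 ^ k" using \<open>card S \<le> k\<close> by (intro power_increasing) auto
    finally show "card (strings_on S \<times> strings_on S) \<le> 16 ^ k" .
  qed
  also have "\<dots> \<le> n ^ k * 16 ^ k" using card_nonempty_regions[of n k] by simp
  finally show ?thesis .
qed

lemma estimated_pairs_supp:
  assumes "(A, B) \<in> estimated_pairs n k"
  shows "A \<in> strings_on {..<n}" "B \<in> strings_on {..<n}" "card (supp A) \<le> k" "card (supp B) \<le> k"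
proof -
  obtain S where S: "S \<subseteq> {..<n}" "card S \<le> k" "supp A \<subseteq> S" "supp B \<subseteq> S"
    using assms by (auto simp: estimated_pairs_def regions_def strings_on_def)
  have "finite S" using S(1) finite_subset by blast
  then show "A \<in> strings_on {..<n}" "B \<in> strings_on {..<n}" "card (supp A) \<le> k" "card (supp B) \<le> k"
    using S card_mono[of S "supp A"] card_mono[of S "supp B"] by (auto simp: strings_on_def)
qed

lemma ptm_accurate_iff:
  "ptm_accurate n k \<Phi> L \<epsilon> \<longleftrightarrow> (\<forall>(A, B)\<in>estimated_pairs n k. cmod (L A B - ptm n \<Phi> A B) \<le> \<epsilon>)"
  by (auto simp: ptm_accurate_def estimated_pairs_def)

section \<open>Taylor polynomials of the overlaps and the success probability\<close>

context local_generator begin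

text \<open>The \<open>m\<close>-th derivative of the overlap at time 0; the division by the
  factorial is left to \<open>taylor_poly\<close>.\<close>

definition taylor_coeff :: "pstring \<Rightarrow> pstring \<Rightarrow> nat \<Rightarrow> real" where
  "taylor_coeff P Q m = Re (mtrace (pauli_op n P * (lindbladian n k G ^^ m) (pauli_op n Q))) / 2 ^ n"

definition taylor_poly :: "pstring \<Rightarrow> pstring \<Rightarrow> nat \<Rightarrow> real poly" where
  "taylor_poly P Q d = (\<Sum>m\<le>d. Polynomial.monom (taylor_coeff P Q m / fact m) m)"

definition overlap :: "pstring \<Rightarrow> pstring \<Rightarrow> real \<Rightarrow> real" where
  "overlap P Q t = Re (mtrace (pauli_op n P * exp_superop N t (lindbladian n k G) (pauli_op n Q))) / 2 ^ n"

lemma ptm_taylor: "ptm n (lindbladian n k G) P Q = complex_of_real (taylor_coeff P Q 1)"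
proof -
  have "mtrace (pauli_op n P * lindbladian n k G (pauli_op n Q)) \<in> \<real>"
    using mtrace_funpow_real[of P 1 Q] by simp
  then show ?thesis by (simp add: ptm_def taylor_coeff_def)
qed

lemma degree_taylor_poly: "degree (taylor_poly P Q d) \<le> d"
  unfolding taylor_poly_def by (intro degree_sum_le) (auto intro: order_trans[OF degree_monom_le])

lemma pderiv_taylor_poly: "1 \<le> d \<Longrightarrow> poly (pderiv (taylor_poly P Q d)) 0 = taylor_coeff P Q 1"
  by (simp add: poly_0_coeff_0 coeff_pderiv taylor_poly_def coeff_sum)

lemma abs_taylor_coeff_le:
  assumes "interaction_strength n k G \<le> a" "0 \<le> a" "P \<in> strings_on {..<n}" "card (supp P) \<le> k"
  shows "\<bar>taylor_coeff P Q m\<bar> \<le> (real k * a) ^ m * fact m"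
proof -
  let ?z = "mtrace (pauli_op n P * (lindbladian n k G ^^ m) (pauli_op n Q))"
  have "\<bar>Re ?z\<bar> \<le> 2 ^ n * ((real k * a) ^ m * fact m)"
    using mtrace_funpow_bound[OF assms, of m Q] abs_Re_le_cmod[of ?z] by linarith
  then show ?thesis by (simp add: taylor_coeff_def field_simps)
qed

text \<open>The factorial in the derivative bound cancels that of the series, leaving powers of
  \<open>t * k * a\<close>, which is at most 1/4 in the time window. The geometric tail from index
  \<open>d + 1\<close> on is \<open>(1 / 4) ^ d / 3\<close>.\<close>

lemma taylor_remainder:
  assumes "interaction_strength n k G \<le> a" "0 < a" "1 \<le> k" "P \<in> strings_on {..<n}" "card (supp P) \<le> k"
    and t: "0 \<le> t" "t \<le> 1 / (4 * a * real k)"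
  shows "\<bar>overlap P Q t - poly (taylor_poly P Q d) t\<bar> \<le> (1 / 4) ^ d / 3"
proof -
  define h where "h m = t ^ m / fact m * taylor_coeff P Q m" for m
  have "(\<lambda>m. Re (complex_of_real (t ^ m / fact m) * mtrace (pauli_op n P * (lindbladian n k G ^^ m) (pauli_op n Q))) / 2 ^ n)
      sums overlap P Q t"
    unfolding overlap_def by (intro sums_divide sums_Re mtrace_exp_superop_sums lin_lindbladian pauli_op_carrier)
  then have sums: "h sums overlap P Q t"
    unfolding h_def taylor_coeff_def by (simp add: Re_complex_of_real del: of_real_divide of_real_power)
  have p: "poly (taylor_poly P Q d) t = (\<Sum>m<Suc d. h m)"
    by (simp add: taylor_poly_def poly_sum poly_monom h_def lessThan_Suc_atMost mult_ac del: sum.lessThan_Suc)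
  have ka: "0 \<le> t * (real k * a)" "t * (real k * a) \<le> 1 / 4"
  proof -
    have "t * (real k * a) \<le> 1 / (4 * a * real k) * (real k * a)"
      using t assms by (intro mult_right_mono) auto
    then show "t * (real k * a) \<le> 1 / 4" using assms by simp
  qed (use t assms in simp)
  have hb: "\<bar>h m\<bar> \<le> (1 / 4) ^ m" for m
  proof -
    have "\<bar>h m\<bar> \<le> t ^ m / fact m * ((real k * a) ^ m * fact m)"
      unfolding h_def abs_mult using t abs_taylor_coeff_le[of a P Q m] assms by (intro mult_mono) auto
    also have "\<dots> = (t * (real k * a)) ^ m" by (simp add: power_mult_distrib)
    also have "\<dots> \<le> (1 / 4) ^ m" using ka by (rule power_mono[rotated])
    finally show ?thesis .
  qed
  have tail: "(\<lambda>m. h (m + Suc d)) sums (overlap P Q t - poly (taylor_poly P Q d) t)"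
    unfolding p by (rule sums_split_initial_segment[OF sums])
  have geo: "(\<lambda>m. (1 / 4 :: real) ^ (m + Suc d)) sums ((1 / 4) ^ Suc d * (1 / (1 - 1 / 4)))"
    using sums_mult[OF geometric_sums[of "1 / 4 :: real"], of "(1 / 4) ^ Suc d"]
    by (simp add: power_add mult.commute)
  have "norm (\<Sum>m. h (m + Suc d)) \<le> (\<Sum>m. (1 / 4 :: real) ^ (m + Suc d))"
    by (rule norm_suminf_le[OF _ sums_summable[OF geo]]) (simp only: real_norm_def hb)
  then show ?thesis unfolding sums_unique[OF tail, symmetric] sums_unique[OF geo, symmetric] by simp
qed

text \<open>With one batch and one node per cell the estimator is the derivative of the polynomial
  interpolating the empirical means.\<close>

lemma success_prob_ge:
  assumes strength: "interaction_strength n k G \<le> a" "0 < a" "1 \<le> k" and d: "1 \<le> d" and s: "0 < s" "0 < B"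
    and R: "R = \<lparr>deg = d, cells = Suc d, per_cell = 1, batches = 1, batch_size = B\<rparr>"
    and err: "4 * real d ^ 3 * ((1 / 4) ^ d / 3 + s) * (4 * a * real k) \<le> \<epsilon>"
    and tail: "real (Suc d) * (real n ^ k * 16 ^ k) * (2 * exp (- (real B * s\<^sup>2 / (2 * 81 ^ k)))) \<le> \<delta>"
  shows "1 - \<delta> \<le> success_prob n k (lindbladian n k G) a R \<epsilon>"
proof -
  define T where "T = 1 / (4 * a * real k)"
  have T: "0 < T" using strength by (simp add: T_def)
  let ?t = "\<lambda>j. cheb_node T (Suc d) j"
  define I where "I = {..<Suc d} \<times> {..<B}"
  define M where "M = (\<lambda>(j, r :: nat). shot_measure n (lindbladian n k G) (?t j))"
  have data: "data_measure n (lindbladian n k G) T R = PiM I M"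
    by (simp add: data_measure_def I_def M_def R num_times_def)
  have node: "0 \<le> ?t j" "?t j \<le> T" for j using cheb_node_bounds[OF T] by auto
  have PS: "prob_space (M i)" for i by (cases i) (simp add: M_def prob_space_shot node)
  interpret P: prob_space "PiM I M" by (rule prob_space_PiM[OF PS])
  have finI: "finite I" by (simp add: I_def)
  have meas: "A \<in> sets (PiM I M)" if "A \<subseteq> space (PiM I M)" for A
    by (rule sets_PiM_finite_space[OF finI _ _ that])
      (auto simp: M_def space_shot_measure sets_shot_measure)
  have meas_est: "f \<in> borel_measurable (M i)" for f :: "shot \<Rightarrow> real" and i
    by (cases i) (simp add: M_def shot_measure_alt)
  \<comment> \<open>Deviation of the sum of \<open>B\<close> shots at node \<open>j\<close> by
    \<open>B * s\<close>, that is, of their mean by \<open>s\<close>.\<close>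
  define bad where "bad = (\<lambda>(j, A, C). {x \<in> space (PiM I M). real B * s \<le>
      \<bar>(\<Sum>i\<in>{j} \<times> {..<B}. shot_estimate A C (x i)) - (\<Sum>i\<in>{j} \<times> {..<B}. integral\<^sup>L (M i) (shot_estimate A C))\<bar>})"
  let ?Z = "{..<Suc d} \<times> estimated_pairs n k"
  have finZ: "finite ?Z" by (simp add: finite_estimated_pairs)
  have int: "(\<Sum>i\<in>{j} \<times> {..<B}. integral\<^sup>L (M i) (shot_estimate A C)) = real B * overlap A C (?t j)"
    if "(A, C) \<in> estimated_pairs n k" for A C j
  proof -
    have "integral\<^sup>L (M i) (shot_estimate A C) = overlap A C (?t j)" if "i \<in> {j} \<times> {..<B}" for i
      using that shot_expectation[OF node(1)] estimated_pairs_supp[OF \<open>(A, C) \<in> estimated_pairs n k\<close>]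
      by (auto simp: M_def overlap_def)
    then show ?thesis by (simp add: card_cartesian_product)
  qed
  have badp: "P.prob (bad z) \<le> 2 * exp (- (real B * s\<^sup>2 / (2 * 81 ^ k)))" if z: "z \<in> ?Z" for z
  proof -
    obtain j A C where z': "z = (j, A, C)" by (cases z)
    then have AC: "(A, C) \<in> estimated_pairs n k" and j: "j < Suc d" using z by auto
    have "P.prob (bad z) \<le> 2 * exp (- 2 * (real B * s)\<^sup>2 / (real (card ({j} \<times> {..<B})) * (2 * 9 ^ k)\<^sup>2))"
      unfolding bad_def z' prod.case
      using j s estimated_pairs_supp(3,4)[OF AC]
      by (intro PiM_sum_deviation finI PS meas_est abs_shot_estimate_le) (auto simp: I_def)
    \<comment> \<open>One factor \<open>B\<close> cancels and the squared width is
      \<open>4 * 81 ^ k\<close>, since estimates are bounded by \<open>9 ^ k\<close>.\<close>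
    also have "- 2 * (real B * s)\<^sup>2 / (real (card ({j} \<times> {..<B})) * (2 * 9 ^ k)\<^sup>2) = - (real B * s\<^sup>2 / (2 * 81 ^ k))"
    proof -
      have "(9 ^ k)\<^sup>2 = (81 :: real) ^ k" by (simp add: power2_eq_square flip: power_mult_distrib)
      then show ?thesis using s(2)
        by (simp add: card_cartesian_product power_mult_distrib power2_eq_square[of "real B"] field_simps)
    qed
    finally show ?thesis .
  qed
  define good where "good = {x \<in> space (PiM I M). ptm_accurate n k (lindbladian n k G)
     (\<lambda>A B. complex_of_real (derivative_estimate T R x A B)) \<epsilon>}"
  have sub: "space (PiM I M) - (\<Union>z\<in>?Z. bad z) \<subseteq> good"
  proof
    fix x assume x: "x \<in> space (PiM I M) - (\<Union>z\<in>?Z. bad z)"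
    have "cmod (complex_of_real (derivative_estimate T R x A C) - ptm n (lindbladian n k G) A C) \<le> \<epsilon>"
      if AC: "(A, C) \<in> estimated_pairs n k" for A C
    proof -
      note AC' = estimated_pairs_supp[OF AC]
      let ?y = "\<lambda>j. median_of_means 1 B (\<lambda>r. shot_estimate A C (x (j, r)))"
      have y: "\<bar>?y j - poly (taylor_poly A C d) (?t j)\<bar> \<le> (1 / 4) ^ d / 3 + s" if j: "j < Suc d" for j
      proof -
        have "x \<notin> bad (j, A, C)" using x AC j by auto
        then have "\<bar>(\<Sum>i\<in>{j} \<times> {..<B}. shot_estimate A C (x i)) - real B * overlap A C (?t j)\<bar> < real B * s"
          using x by (auto simp: bad_def int[OF AC])
        moreover have "(\<Sum>i\<in>{j} \<times> {..<B}. shot_estimate A C (x i)) = real B * ?y j"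
        proof -
          have "(\<Sum>i\<in>{j} \<times> {..<B}. shot_estimate A C (x i)) = (\<Sum>r<B. shot_estimate A C (x (j, r)))"
            by (rule sum.reindex_bij_witness[of _ "\<lambda>r. (j, r)" snd]) auto
          then show ?thesis using s(2) by (simp add: median_of_means_def median_def)
        qed
        ultimately have "\<bar>real B * (?y j - overlap A C (?t j))\<bar> < real B * s" by (simp add: right_diff_distrib)
        then have "\<bar>?y j - overlap A C (?t j)\<bar> < s" using s(2) by (simp add: abs_mult)
        moreover have "\<bar>overlap A C (?t j) - poly (taylor_poly A C d) (?t j)\<bar> \<le> (1 / 4) ^ d / 3"
          by (rule taylor_remainder[OF strength AC'(1,3) node(1)]) (use node(2)[of j] in \<open>simp only: T_def[symmetric]\<close>)
        ultimately show ?thesis by linarith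
      qed
      have "\<bar>poly (pderiv (robust_fit T d (Suc d) 1 ?y)) 0 - poly (pderiv (taylor_poly A C d)) 0\<bar>
          \<le> 4 * real d ^ 3 * ((1 / 4) ^ d / 3 + s) / T"
        by (rule robust_fit_pderiv_error[OF T degree_taylor_poly y])
      also have "\<dots> \<le> \<epsilon>" using err by (simp add: T_def)
      finally have "\<bar>derivative_estimate T R x A C - taylor_coeff A C 1\<bar> \<le> \<epsilon>"
        unfolding pderiv_taylor_poly[OF d] by (simp add: derivative_estimate_def R)
      then show ?thesis unfolding ptm_taylor by (metis norm_of_real of_real_diff)
    qed
    then show "x \<in> good" using x by (auto simp: good_def ptm_accurate_iff)
  qed
  have mb: "bad z \<in> P.events" for z by (rule meas) (auto simp: bad_def split: prod.splits)
  \<comment> \<open>Union bound over nodes and index pairs: the same shots serve all pairs, so no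
    independence between these events is available.\<close>
  have "P.prob (\<Union>z\<in>?Z. bad z) \<le> (\<Sum>z\<in>?Z. P.prob (bad z))"
    using finZ mb by (intro P.finite_measure_subadditive_finite) auto
  also have "\<dots> \<le> (\<Sum>z\<in>?Z. 2 * exp (- (real B * s\<^sup>2 / (2 * 81 ^ k))))"
    by (rule sum_mono[OF badp])
  also have "\<dots> = real (Suc d) * real (card (estimated_pairs n k)) * (2 * exp (- (real B * s\<^sup>2 / (2 * 81 ^ k))))"
    by (simp add: card_cartesian_product algebra_simps)
  also have "\<dots> \<le> real (Suc d) * (real n ^ k * 16 ^ k) * (2 * exp (- (real B * s\<^sup>2 / (2 * 81 ^ k))))"
  proof (intro mult_right_mono mult_left_mono)
    have "real (card (estimated_pairs n k)) \<le> real (n ^ k * 16 ^ k)"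
      using card_estimated_pairs[of n k] by (simp only: of_nat_le_iff)
    then show "real (card (estimated_pairs n k)) \<le> real n ^ k * 16 ^ k" by simp
  qed auto
  finally have "P.prob (\<Union>z\<in>?Z. bad z) \<le> \<delta>" using tail by linarith
  moreover have "P.prob (space (PiM I M) - (\<Union>z\<in>?Z. bad z)) = 1 - P.prob (\<Union>z\<in>?Z. bad z)"
    using finZ mb by (intro P.prob_compl) auto
  moreover have "P.prob (space (PiM I M) - (\<Union>z\<in>?Z. bad z)) \<le> P.prob good"
    using sub by (intro P.finite_measure_mono meas) (auto simp: good_def)
  ultimately have "1 - \<delta> \<le> P.prob good" by linarith
  then show ?thesis by (simp add: success_prob_def Let_def T_def[symmetric] data good_def)
qed

text \<open>A precision above \<open>a k\<close> needs no samples, since all entries are at most \<open>a k\<close>.\<close>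

lemma success_prob_trivial:
  assumes strength: "interaction_strength n k G \<le> a" "0 < a" "1 \<le> k" and "a * real k \<le> \<epsilon>"
    and R: "R = \<lparr>deg = d, cells = Suc d, per_cell = 1, batches = 1, batch_size = 0\<rparr>"
  shows "success_prob n k (lindbladian n k G) a R \<epsilon> = 1"
proof -
  define T where "T = 1 / (4 * a * real k)"
  have T: "0 < T" using strength by (simp add: T_def)
  define M where "M = data_measure n (lindbladian n k G) T R"
  have "prob_space M" unfolding M_def data_measure_def by (rule prob_space_PiM) (simp add: R)
  then interpret P: prob_space M .
  have "ptm_accurate n k (lindbladian n k G) (\<lambda>A B. complex_of_real (derivative_estimate T R x A B)) \<epsilon>" for x
    unfolding ptm_accurate_iff
  proof clarify
    fix A C assume AC: "(A, C) \<in> estimated_pairs n k"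
    \<comment> \<open>A batch of size 0 has mean \<open>0 / 0\<close>, which is 0, so the fit
      interpolates zero data.\<close>
    have "\<bar>poly (pderiv (robust_fit T d (Suc d) 1 (\<lambda>j. median_of_means 1 0 (\<lambda>r. shot_estimate A C (x (j, r)))))) 0
        - poly (pderiv 0) 0\<bar> \<le> 4 * real d ^ 3 * 0 / T"
      by (rule robust_fit_pderiv_error[OF T]) (simp_all add: median_of_means_def median_def)
    then have z: "derivative_estimate T R x A C = 0" by (simp add: derivative_estimate_def R)
    have "\<bar>taylor_coeff A C 1\<bar> \<le> \<epsilon>"
      using abs_taylor_coeff_le[OF strength(1) _ estimated_pairs_supp(1,3)[OF AC], of C 1] assms(2,4)
      by (simp add: mult.commute)
    then show "cmod (complex_of_real (derivative_estimate T R x A C) - ptm n (lindbladian n k G) A C) \<le> \<epsilon>"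
      unfolding ptm_taylor z by simp
  qed
  then show ?thesis by (simp add: success_prob_def Let_def T_def[symmetric] M_def[symmetric] P.prob_space)
qed

end

section \<open>Choice of degree, accuracy and number of shots\<close>

text \<open>From 4 on, passing to the successor at most doubles the cube; the first values are
  checked one by one.\<close>

lemma cube_le_exp: "real d ^ 3 \<le> 8 * 2 ^ d"
proof -
  have "d ^ 3 \<le> 8 * 2 ^ d"
  proof (induction d)
    case (Suc d)
    show ?case
    proof (cases "d < 4")
      case True
      then have "Suc d = 1 \<or> Suc d = 2 \<or> Suc d = 3 \<or> Suc d = 4" by auto
      then show ?thesis by (elim disjE; simp only:; simp)
    next
      case False
      then have "3 * d + 1 \<le> 4 * d" "4 * d \<le> d * d" by auto
      then have "3 * d + 1 \<le> d * d" by linarith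
      moreover have "4 * (d * d) \<le> d * (d * d)" using False by simp
      ultimately have "3 * (d * d) + 3 * d + 1 \<le> d * (d * d)" by linarith
      then have "Suc d ^ 3 \<le> 2 * d ^ 3" by (simp add: power3_eq_cube algebra_simps)
      then show ?thesis using Suc by simp
    qed
  qed simp
  then have "real (d ^ 3) \<le> real (8 * 2 ^ d)" by (simp only: of_nat_le_iff)
  then show ?thesis by simp
qed

text \<open>The summand 2 supplies a factor 4, so \<open>2 ^ d\<close> is at least
  \<open>512 * a * k / \<epsilon>\<close>. Together with \<open>d ^ 3 \<le> 8 * 2 ^ d\<close> this
  makes the truncation part of the derivative error at most \<open>\<epsilon> / 12\<close>.\<close>

definition fit_degree :: "nat \<Rightarrow> real \<Rightarrow> real \<Rightarrow> nat" where
  "fit_degree k a \<epsilon> = 2 + nat \<lceil>log 2 (128 * a * real k / \<epsilon>)\<rceil>"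

text \<open>The solution \<open>s\<close> of
  \<open>16 * (a * k) * d ^ 3 * s = \<epsilon> / 2\<close>: half of the error budget goes to
  sampling noise, amplified by interpolation.\<close>

definition mean_accuracy :: "nat \<Rightarrow> real \<Rightarrow> real \<Rightarrow> real" where
  "mean_accuracy k a \<epsilon> = \<epsilon> / (32 * a * real k * real (fit_degree k a \<epsilon>) ^ 3)"

text \<open>Number of nodes times the bound on the number of pairs times Hoeffding's factor 2, over
  \<delta>. A tail exponent equal to its logarithm makes the union bound at most \<delta>.\<close>

definition confidence :: "nat \<Rightarrow> nat \<Rightarrow> real \<Rightarrow> real \<Rightarrow> real \<Rightarrow> real" where
  "confidence k n a \<epsilon> \<delta> = 2 * real (Suc (fit_degree k a \<epsilon>)) * (real n ^ k * 16 ^ k) / \<delta>"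

text \<open>The case of no shots matters for large \<gamma>: a ceiling of a positive number is at
  least 1, which no constant multiple of \<open>D\<^sup>2 / \<gamma>\<^sup>2\<close> with the
  logarithms attached could bound.\<close>

definition shots_per_time :: "nat \<Rightarrow> nat \<Rightarrow> real \<Rightarrow> real \<Rightarrow> real \<Rightarrow> nat" where
  "shots_per_time k n a \<epsilon> \<delta> = (if a * real k \<le> \<epsilon> then 0
     else nat \<lceil>2 * 81 ^ k * ln (confidence k n a \<epsilon> \<delta>) / (mean_accuracy k a \<epsilon>)\<^sup>2\<rceil>)"

definition routine_design :: "nat \<Rightarrow> nat \<Rightarrow> real \<Rightarrow> real \<Rightarrow> nat \<Rightarrow> real \<Rightarrow> design" where
  "routine_design k n a \<gamma> D \<delta> = (let \<epsilon> = \<gamma> / (2 * real D) in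
     \<lparr>deg = fit_degree k a \<epsilon>, cells = Suc (fit_degree k a \<epsilon>), per_cell = 1, batches = 1,
      batch_size = shots_per_time k n a \<epsilon> \<delta>\<rparr>)"

lemma fit_degree_ge: "2 \<le> fit_degree k a \<epsilon>"
  by (simp add: fit_degree_def)

lemma two_power_fit_degree:
  assumes "0 < a" "1 \<le> k" "0 < \<epsilon>"
  shows "512 * a * real k / \<epsilon> \<le> 2 ^ fit_degree k a \<epsilon>"
proof -
  let ?x = "128 * a * real k / \<epsilon>"
  have x: "0 < ?x" using assms by simp
  have "?x = 2 powr log 2 ?x" using x by simp
  also have "\<dots> \<le> 2 powr real (nat \<lceil>log 2 ?x\<rceil>)" by (intro powr_mono real_nat_ceiling_ge) simp
  also have "\<dots> = 2 ^ nat \<lceil>log 2 ?x\<rceil>" by (simp add: powr_realpow)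
  finally show ?thesis by (simp add: fit_degree_def power_add)
qed

lemma mean_accuracy_pos: "0 < a \<Longrightarrow> 1 \<le> k \<Longrightarrow> 0 < \<epsilon> \<Longrightarrow> 0 < mean_accuracy k a \<epsilon>"
  using fit_degree_ge[of k a \<epsilon>] by (simp add: mean_accuracy_def)

lemma confidence_gt_1:
  assumes "1 \<le> n" "0 < \<delta>" "\<delta> < 1"
  shows "1 < confidence k n a \<epsilon> \<delta>"
proof -
  have "1 \<le> real n ^ k * 16 ^ k"
    using mult_mono[of 1 "real n ^ k" 1 "16 ^ k :: real"] assms(1) by simp
  then have "1 * 1 \<le> 2 * real (Suc (fit_degree k a \<epsilon>)) * (real n ^ k * 16 ^ k)"
    by (intro mult_mono) auto
  then show ?thesis using assms by (simp add: confidence_def field_simps)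
qed

lemma (in local_generator) routine_success:
  assumes strength: "interaction_strength n k G \<le> a" "0 < a" "1 \<le> k" and n: "1 \<le> n"
    and \<gamma>: "0 < \<gamma>" "1 \<le> D" and \<delta>: "0 < \<delta>" "\<delta> < 1"
  shows "1 - \<delta> \<le> success_prob n k (lindbladian n k G) a (routine_design k n a \<gamma> D \<delta>) (\<gamma> / (2 * real D))"
proof -
  define \<epsilon> where "\<epsilon> = \<gamma> / (2 * real D)"
  have \<epsilon>: "0 < \<epsilon>" using \<gamma> by (simp add: \<epsilon>_def)
  define d where "d = fit_degree k a \<epsilon>"
  define s where "s = mean_accuracy k a \<epsilon>"
  define B where "B = shots_per_time k n a \<epsilon> \<delta>"
  have R: "routine_design k n a \<gamma> D \<delta> = \<lparr>deg = d, cells = Suc d, per_cell = 1, batches = 1, batch_size = B\<rparr>"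
    by (simp add: routine_design_def Let_def d_def B_def \<epsilon>_def)
  have d2: "2 \<le> d" unfolding d_def by (rule fit_degree_ge)
  have s: "0 < s" unfolding s_def by (rule mean_accuracy_pos[OF strength(2,3) \<epsilon>])
  show ?thesis
  proof (cases "a * real k \<le> \<epsilon>")
    case True
    then have "B = 0" by (simp add: B_def shots_per_time_def)
    then show ?thesis
      using success_prob_trivial[OF strength True R[unfolded \<open>B = 0\<close>]] \<delta> by (simp add: \<epsilon>_def[symmetric])
  next
    case False
    define c where "c = confidence k n a \<epsilon> \<delta>"
    have c: "1 < c" unfolding c_def by (rule confidence_gt_1[OF n \<delta>])
    have B: "B = nat \<lceil>2 * 81 ^ k * ln c / s\<^sup>2\<rceil>" using False by (simp add: B_def shots_per_time_def c_def s_def)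
    have pos: "0 < 2 * 81 ^ k * ln c / s\<^sup>2" using c s by simp
    then have B0: "0 < B" unfolding B by simp
    have "2 * 81 ^ k * ln c / s\<^sup>2 \<le> real B" unfolding B by (rule real_nat_ceiling_ge)
    then have "ln c \<le> real B * s\<^sup>2 / (2 * 81 ^ k)" using s by (simp add: field_simps)
    then have "exp (- (real B * s\<^sup>2 / (2 * 81 ^ k))) \<le> exp (- ln c)" by simp
    also have "\<dots> = 1 / c" using c by (simp add: exp_minus field_simps)
    finally have "real (Suc d) * (real n ^ k * 16 ^ k) * (2 * exp (- (real B * s\<^sup>2 / (2 * 81 ^ k))))
        \<le> real (Suc d) * (real n ^ k * 16 ^ k) * (2 * (1 / c))" by (intro mult_left_mono) auto
    also have "\<dots> = \<delta>"
    proof -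
      have "c * \<delta> = 2 * real (Suc d) * (real n ^ k * 16 ^ k)" using \<delta> by (simp add: c_def confidence_def d_def)
      then show ?thesis using c by (simp add: field_simps)
    qed
    finally have tail: "real (Suc d) * (real n ^ k * 16 ^ k) * (2 * exp (- (real B * s\<^sup>2 / (2 * 81 ^ k)))) \<le> \<delta>" .
    have "real d ^ 3 * (1 / 4) ^ d \<le> 8 * 2 ^ d * (1 / 4) ^ d" by (intro mult_right_mono cube_le_exp) simp
    also have "\<dots> = 8 / 2 ^ d"
    proof -
      have "(4 :: real) ^ d = 2 ^ d * 2 ^ d" by (simp flip: power_mult_distrib)
      then show ?thesis by (simp add: power_one_over)
    qed
    finally have cube: "real d ^ 3 * (1 / 4) ^ d \<le> 8 / 2 ^ d" .
    have "512 * a * real k \<le> \<epsilon> * 2 ^ d"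
      using two_power_fit_degree[OF strength(2,3) \<epsilon>] \<epsilon> by (simp add: d_def field_simps)
    then have ak: "a * real k / 2 ^ d \<le> \<epsilon> / 512" by (simp add: field_simps)
    have "16 / 3 * (a * real k) * (real d ^ 3 * (1 / 4) ^ d) \<le> 16 / 3 * (a * real k) * (8 / 2 ^ d)"
      using cube strength by (intro mult_left_mono) auto
    also have "\<dots> = 128 / 3 * (a * real k / 2 ^ d)" by simp
    also have "\<dots> \<le> 128 / 3 * (\<epsilon> / 512)" using ak by (intro mult_left_mono) auto
    also have "\<dots> \<le> \<epsilon> / 2" using \<epsilon> by simp
    finally have e1: "16 / 3 * (a * real k) * (real d ^ 3 * (1 / 4) ^ d) \<le> \<epsilon> / 2" .
    have e2: "16 * (a * real k) * real d ^ 3 * s = \<epsilon> / 2"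
      using strength d2 by (simp add: s_def mean_accuracy_def d_def[symmetric])
    have "4 * real d ^ 3 * ((1 / 4) ^ d / 3 + s) * (4 * a * real k)
        = 16 / 3 * (a * real k) * (real d ^ 3 * (1 / 4) ^ d) + 16 * (a * real k) * real d ^ 3 * s"
      by (simp add: algebra_simps)
    also have "\<dots> \<le> \<epsilon>" using e1 e2 by simp
    finally show ?thesis
      using success_prob_ge[OF strength _ s B0 R _ tail, of \<epsilon>] d2 by (simp add: \<epsilon>_def[symmetric])
  qed
qed

lemma lg_ge_1: "1 \<le> lg x"
  by (simp add: lg_def)

text \<open>Replaces \<open>D\<close> by its bound at the price of a constant factor; that
  \<open>lg\<close> is at least 1 turns the additive \<open>ln D'\<close> into a multiplicative
  constant.\<close>

lemma lg_ratio_le: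
  assumes "1 \<le> D" "D \<le> D'" "0 < \<gamma>"
  shows "lg (D / \<gamma>) \<le> (1 + ln D') * lg (1 / \<gamma>)"
proof -
  have D': "0 \<le> ln D'" using assms by simp
  have "ln (D / \<gamma>) = ln D + ln (1 / \<gamma>)" using assms by (simp add: ln_div)
  also have "\<dots> \<le> ln D' * 1 + lg (1 / \<gamma>)" using assms by (intro add_mono) (auto simp: lg_def)
  also have "\<dots> \<le> ln D' * lg (1 / \<gamma>) + lg (1 / \<gamma>)"
    using D' lg_ge_1 by (intro add_mono mult_left_mono) auto
  finally have "ln (D / \<gamma>) \<le> (1 + ln D') * lg (1 / \<gamma>)" by (simp add: algebra_simps)
  moreover have "1 * 1 \<le> (1 + ln D') * lg (1 / \<gamma>)" using D' lg_ge_1 by (intro mult_mono) auto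
  ultimately show ?thesis by (simp add: lg_def[of "D / \<gamma>"])
qed

text \<open>The 5 is made of the offset 2, the 1 lost in the ceiling, and the 2 that bounds the
  change from base 2 to natural logarithms. The absolute value covers small
  \<open>amax * k\<close>.\<close>

lemma fit_degree_bound:
  assumes "0 < a" "a \<le> amax" "1 \<le> k" "0 < \<gamma>" "1 \<le> D"
  shows "real (fit_degree k a (\<gamma> / (2 * real D))) \<le> (5 + \<bar>log 2 (256 * amax * real k)\<bar>) * lg (real D / \<gamma>)"
proof -
  let ?y = "real D / \<gamma>" and ?c = "\<bar>log 2 (256 * amax * real k)\<bar>"
  have y: "0 < ?y" using assms by simp
  have "128 * a * real k / (\<gamma> / (2 * real D)) = (256 * a * real k) * ?y" by simp
  moreover have "log 2 ((256 * a * real k) * ?y) = log 2 (256 * a * real k) + log 2 ?y"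
    using assms y by (intro log_mult_pos) auto
  ultimately have "log 2 (128 * a * real k / (\<gamma> / (2 * real D))) = log 2 (256 * a * real k) + log 2 ?y"
    by (simp only:)
  moreover have "log 2 (256 * a * real k) \<le> log 2 (256 * amax * real k)"
    using assms by (subst log_le_cancel_iff) auto
  moreover have "log 2 ?y \<le> 2 * lg ?y"
  proof (cases "ln ?y \<le> 0")
    case True
    then have "log 2 ?y \<le> 0" by (simp add: log_def divide_nonpos_pos)
    then show ?thesis using lg_ge_1[of ?y] by linarith
  next
    case False
    have "log 2 ?y = ln ?y / ln 2" by (simp add: log_def)
    also have "\<dots> \<le> ln ?y / (1 / 2)" using ln2_ge_two_thirds False by (intro divide_left_mono) auto
    also have "\<dots> \<le> 2 * lg ?y" by (simp add: lg_def)
    finally show ?thesis .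
  qed
  ultimately have "log 2 (128 * a * real k / (\<gamma> / (2 * real D))) \<le> ?c + 2 * lg ?y" by linarith
  moreover have "real (nat \<lceil>z\<rceil>) \<le> w + 1" if "z \<le> w" "0 \<le> w" for z w :: real using that by linarith
  ultimately have "real (fit_degree k a (\<gamma> / (2 * real D))) \<le> 2 + (?c + 2 * lg ?y + 1)"
    unfolding fit_degree_def using lg_ge_1[of ?y] by (simp del: of_nat_nat) (smt (verit))
  also have "\<dots> \<le> (3 + ?c) * lg ?y + 2 * lg ?y"
    using mult_left_mono[OF lg_ge_1[of ?y], of "3 + ?c"] by simp
  finally show ?thesis by (simp add: algebra_simps)
qed

text \<open>The part of the confidence not involving \<open>n\<close> and \<delta> is simply bounded
  through \<open>ln x \<le> x\<close>, at the cost of a factor of the degree. For the rest,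
  \<open>\<delta> < 1\<close> makes \<open>ln (1 / \<delta>)\<close> nonnegative, so that
  \<open>ln (n ^ k / \<delta>)\<close> is at most \<open>k * ln (n / \<delta>)\<close>.\<close>

lemma ln_confidence_bound:
  assumes "1 \<le> n" "0 < \<delta>" "\<delta> < 1" "1 \<le> k"
  shows "ln (confidence k n a \<epsilon> \<delta>) \<le> (4 * 16 ^ k + real k) * real (fit_degree k a \<epsilon>) * lg (real n / \<delta>)"
proof -
  let ?d = "real (fit_degree k a \<epsilon>)" and ?L = "lg (real n / \<delta>)"
  have d: "2 \<le> ?d" using fit_degree_ge[of k a \<epsilon>] by simp
  have L: "1 \<le> ?L" by (rule lg_ge_1)
  have "confidence k n a \<epsilon> \<delta> = (2 * (?d + 1) * 16 ^ k) * (real n ^ k / \<delta>)"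
    by (simp add: confidence_def)
  moreover have "ln ((2 * (?d + 1) * 16 ^ k) * (real n ^ k / \<delta>)) = ln (2 * (?d + 1) * 16 ^ k) + ln (real n ^ k / \<delta>)"
    using assms d by (intro ln_mult_pos) auto
  moreover have "ln (2 * (?d + 1) * 16 ^ k) \<le> 2 * (?d + 1) * 16 ^ k"
    using d by (intro ln_bound) auto
  moreover have "2 * (?d + 1) * 16 ^ k \<le> 4 * 16 ^ k * ?d * ?L"
  proof -
    have "2 * (?d + 1) * 16 ^ k \<le> 4 * ?d * 16 ^ k * 1" using d by simp
    also have "\<dots> \<le> 4 * ?d * 16 ^ k * ?L" using L d by (intro mult_left_mono) auto
    finally show ?thesis by (simp add: mult_ac)
  qed
  moreover have "ln (real n ^ k / \<delta>) \<le> real k * ?d * ?L"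
  proof -
    have "0 \<le> ln (1 / \<delta>)" using assms by simp
    then have "1 * ln (1 / \<delta>) \<le> real k * ln (1 / \<delta>)" using assms by (intro mult_right_mono) auto
    then have "real k * ln (real n) + ln (1 / \<delta>) \<le> real k * (ln (real n) + ln (1 / \<delta>))"
      by (simp add: distrib_left)
    moreover have "ln (real n ^ k / \<delta>) = real k * ln (real n) + ln (1 / \<delta>)"
      using assms by (simp add: ln_div ln_realpow)
    moreover have "ln (real n) + ln (1 / \<delta>) = ln (real n / \<delta>)" using assms by (simp add: ln_div)
    ultimately have "ln (real n ^ k / \<delta>) \<le> real k * ln (real n / \<delta>)" by simp
    also have "\<dots> \<le> real k * ?L" by (intro mult_left_mono) (auto simp: lg_def)
    also have "\<dots> = real k * ?L * 1" by simp
    also have "\<dots> \<le> real k * ?L * ?d" using d L by (intro mult_left_mono) auto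
    finally show ?thesis by (simp only: mult_ac)
  qed
  ultimately show ?thesis by (simp add: algebra_simps)
qed

text \<open>The exponent 8 counts powers of the degree: one for the number of times, six from the
  squared mean accuracy, one from the logarithm of the confidence.\<close>

lemma routine_samples:
  assumes amax: "0 < amax" and k: "1 \<le> k"
  shows "\<exists>K\<ge>0. \<forall>n\<ge>1. \<forall>a \<gamma> \<delta>. \<forall>D\<ge>1. 0 < a \<and> a \<le> amax \<and> 0 < \<gamma> \<and> 0 < \<delta> \<and> \<delta> < 1 \<longrightarrow>
    real (num_samples (routine_design k n a \<gamma> D \<delta>))
      \<le> K * ((real D)\<^sup>2 / \<gamma>\<^sup>2) * lg (real D / \<gamma>) ^ 8 * lg (real n / \<delta>)"
proof -
  define A where "A = (amax * real k)\<^sup>2"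
  define C where "C = 5 + \<bar>log 2 (256 * amax * real k)\<bar>"
  define E where "E = 4 * 16 ^ k + real k"
  \<comment> \<open>The leading 2 comes from \<open>d + 1 \<le> 2 * d\<close>,
    \<open>2 * 81 ^ k\<close> from Hoeffding, 4096 from \<open>32\<^sup>2\<close> times the 4 in
    \<open>1 / \<epsilon>\<^sup>2\<close>, and the last 4 absorbs the ceiling.\<close>
  define K0 where "K0 = 2 * A * (2 * 81 ^ k * E * 4096 + 4)"
  have nonneg: "0 \<le> A" "0 \<le> E" "0 \<le> K0" "0 \<le> C" by (simp_all add: A_def E_def K0_def C_def)
  have "real (num_samples (routine_design k n a \<gamma> D \<delta>))
      \<le> K0 * C ^ 8 * ((real D)\<^sup>2 / \<gamma>\<^sup>2) * lg (real D / \<gamma>) ^ 8 * lg (real n / \<delta>)"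
    if h: "1 \<le> n" "1 \<le> D" "0 < a" "a \<le> amax" "0 < \<gamma>" "0 < \<delta>" "\<delta> < 1" for n a \<gamma> D \<delta>
  proof -
    define \<epsilon> where "\<epsilon> = \<gamma> / (2 * real D)"
    have \<epsilon>: "0 < \<epsilon>" using h by (simp add: \<epsilon>_def)
    define d where "d = real (fit_degree k a \<epsilon>)"
    define s where "s = mean_accuracy k a \<epsilon>"
    define q where "q = (real D)\<^sup>2 / \<gamma>\<^sup>2"
    define L where "L = lg (real n / \<delta>)"
    define c where "c = confidence k n a \<epsilon> \<delta>"
    have d2: "2 \<le> d" using fit_degree_ge[of k a \<epsilon>] by (simp add: d_def)
    have s: "0 < s" unfolding s_def by (rule mean_accuracy_pos[OF h(3) k \<epsilon>])
    have q: "0 \<le> q" by (simp add: q_def)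
    have L: "1 \<le> L" unfolding L_def by (rule lg_ge_1)
    have dC: "d \<le> C * lg (real D / \<gamma>)"
      unfolding d_def \<epsilon>_def C_def by (rule fit_degree_bound[OF h(3,4) k h(5,2)])
    have num: "real (num_samples (routine_design k n a \<gamma> D \<delta>)) = (d + 1) * real (shots_per_time k n a \<epsilon> \<delta>)"
      by (simp add: num_samples_def num_times_def routine_design_def Let_def d_def \<epsilon>_def algebra_simps)
    have aA: "(a * real k)\<^sup>2 \<le> A" unfolding A_def using h by (intro power_mono mult_right_mono) auto
    have e2: "1 / \<epsilon>\<^sup>2 = 4 * q" using h by (simp add: \<epsilon>_def q_def power_divide power_mult_distrib)
    have main: "(d + 1) * real (shots_per_time k n a \<epsilon> \<delta>) \<le> K0 * d ^ 8 * q * L"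
    proof (cases "a * real k \<le> \<epsilon>")
      case True
      then show ?thesis using nonneg d2 q L by (simp add: shots_per_time_def)
    next
      case False
      have lnc: "ln c \<le> E * d * L"
        unfolding c_def E_def d_def L_def by (rule ln_confidence_bound[OF h(1,6,7) k])
      have "0 < ln c" using confidence_gt_1[OF h(1,6,7), of k a \<epsilon>] by (simp add: c_def)
      then have x0: "0 \<le> 2 * 81 ^ k * ln c / s\<^sup>2" by simp
      have "real (shots_per_time k n a \<epsilon> \<delta>) = real (nat \<lceil>2 * 81 ^ k * ln c / s\<^sup>2\<rceil>)"
        using False by (simp add: shots_per_time_def c_def s_def)
      also have "\<dots> \<le> 2 * 81 ^ k * ln c / s\<^sup>2 + 1" using x0 by linarith
      finally have B: "real (shots_per_time k n a \<epsilon> \<delta>) \<le> 2 * 81 ^ k * ln c / s\<^sup>2 + 1" .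
      have "1 / s\<^sup>2 = 1024 * (a * real k)\<^sup>2 * d ^ 6 * (1 / \<epsilon>\<^sup>2)"
        using h k d2 \<epsilon> by (simp add: s_def mean_accuracy_def d_def[symmetric] power_divide power_mult_distrib flip: power_mult)
      also have "\<dots> \<le> 1024 * A * d ^ 6 * (4 * q)"
        unfolding e2 using aA d2 q by (intro mult_right_mono mult_left_mono) auto
      finally have s2: "1 / s\<^sup>2 \<le> 4096 * A * d ^ 6 * q" by simp
      have "2 * 81 ^ k * ln c / s\<^sup>2 = 2 * 81 ^ k * (ln c * (1 / s\<^sup>2))" by simp
      also have "\<dots> \<le> 2 * 81 ^ k * ((E * d * L) * (4096 * A * d ^ 6 * q))"
        using lnc s2 \<open>0 < ln c\<close> nonneg d2 L q by (intro mult_left_mono mult_mono) auto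
      also have "\<dots> = 2 * 81 ^ k * E * 4096 * (A * q * (d ^ 7 * L))"
        by (simp add: power_numeral_reduce mult_ac)
      finally have t1: "2 * 81 ^ k * ln c / s\<^sup>2 \<le> 2 * 81 ^ k * E * 4096 * (A * q * (d ^ 7 * L))" .
      \<comment> \<open>Outside the trivial case \<epsilon> is below \<open>a * k\<close>, so the 1
        lost in rounding up is itself bounded by a multiple of
        \<open>D\<^sup>2 / \<gamma>\<^sup>2\<close>.\<close>
      have "1 \<le> a * real k / \<epsilon>" using False \<epsilon> by (simp add: field_simps)
      then have "1 \<le> (a * real k / \<epsilon>)\<^sup>2" by (rule one_le_power)
      also have "\<dots> = (a * real k)\<^sup>2 * (1 / \<epsilon>\<^sup>2)" by (simp add: power_divide)
      also have "\<dots> \<le> A * (4 * q)" unfolding e2 using aA q by (intro mult_right_mono) auto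
      also have "\<dots> = 4 * (A * q * 1)" by simp
      also have "\<dots> \<le> 4 * (A * q * (d ^ 7 * L))"
      proof (intro mult_left_mono)
        have "1 \<le> d ^ 7" using d2 by (intro one_le_power) simp
        then show "1 \<le> d ^ 7 * L" using L d2 mult_mono[of 1 "d ^ 7" 1 L] by simp
      qed (use nonneg q in auto)
      finally have t2: "1 \<le> 4 * (A * q * (d ^ 7 * L))" .
      have "real (shots_per_time k n a \<epsilon> \<delta>) \<le> (2 * 81 ^ k * E * 4096 + 4) * (A * q * (d ^ 7 * L))"
        using B t1 t2 by (simp add: distrib_right)
      then have "(d + 1) * real (shots_per_time k n a \<epsilon> \<delta>) \<le> (2 * d) * ((2 * 81 ^ k * E * 4096 + 4) * (A * q * (d ^ 7 * L)))"
        using d2 by (intro mult_mono) auto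
      also have "\<dots> = K0 * d ^ 8 * q * L"
        by (simp add: K0_def power_numeral_reduce mult_ac)
      finally show ?thesis .
    qed
    also have "\<dots> \<le> K0 * (C * lg (real D / \<gamma>)) ^ 8 * q * L"
      using dC d2 nonneg q L by (intro mult_right_mono mult_left_mono power_mono) auto
    finally show ?thesis unfolding num by (simp add: q_def L_def power_mult_distrib mult_ac)
  qed
  then show ?thesis using nonneg by (intro exI[of _ "K0 * C ^ 8"]) auto
qed

theorem corollary3p7:
  fixes k :: nat
  assumes "1 \<le> k"
  shows
    "(\<forall>n G chi lam \<gamma> \<epsilon>L Lhat.
        generator_setting n k G chi lam \<gamma> \<and> margin_condition n k chi lam \<gamma> \<and>
        \<epsilon>L \<le> \<gamma> / (2 * real (diag_D n k chi (lam - \<gamma>))) \<and>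
        ptm_accurate n k (lindbladian n k G) Lhat \<epsilon>L \<longrightarrow>
          recovered_set n k Lhat lam \<subseteq> pairs n k \<and>
          (\<forall>(P, Q)\<in>pairs0 n k.
             (cmod (chi P Q) > lam + \<gamma> \<longrightarrow> (P, Q) \<in> recovered_set n k Lhat lam) \<and>
             (cmod (chi P Q) < lam - \<gamma> \<longrightarrow> (P, Q) \<notin> recovered_set n k Lhat lam)))
     \<and>
     (\<exists>C::real. \<forall>n\<ge>1. \<forall>Lhat. \<forall>lam>0. real (recovery_time n k Lhat lam) \<le> C * real n ^ k)
     \<and>
     (\<forall>amax>0. \<exists>R :: nat \<Rightarrow> real \<Rightarrow> real \<Rightarrow> nat \<Rightarrow> real \<Rightarrow> design.
        (\<exists>C::real. \<forall>n\<ge>1. \<forall>a \<gamma> \<delta>. \<forall>D\<ge>1.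
           0 < a \<and> a \<le> amax \<and> 0 < \<gamma> \<and> 0 < \<delta> \<and> \<delta> < 1 \<longrightarrow>
             real (deg (R n a \<gamma> D \<delta>)) \<le> C * lg (real D / \<gamma>) \<and>
             real (num_times (R n a \<gamma> D \<delta>))
               \<le> C * real (deg (R n a \<gamma> D \<delta>)) * lg (real (deg (R n a \<gamma> D \<delta>))))
        \<and>
        (\<forall>n G chi lam \<gamma> a \<delta>.
           generator_setting n k G chi lam \<gamma> \<and> margin_condition n k chi lam \<gamma> \<and>
           routine_setting n k G a amax \<delta> \<longrightarrow>
             success_prob n k (lindbladian n k G) a (R n a \<gamma> (diag_D n k chi (lam - \<gamma>)) \<delta>)
               (\<gamma> / (2 * real (diag_D n k chi (lam - \<gamma>)))) \<ge> 1 - \<delta>)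
        \<and>
        (\<exists>(C::real) p. \<forall>n G chi lam \<gamma> a \<delta>.
           generator_setting n k G chi lam \<gamma> \<and> margin_condition n k chi lam \<gamma> \<and>
           routine_setting n k G a amax \<delta> \<longrightarrow>
             real (num_samples (R n a \<gamma> (diag_D n k chi (lam - \<gamma>)) \<delta>))
               \<le> C * ((real (diag_D n k chi (lam - \<gamma>)))\<^sup>2 / \<gamma>\<^sup>2)
                   * lg (real (diag_D n k chi (lam - \<gamma>)) / \<gamma>) ^ p * lg (real n) ^ p
                   * lg (real n / \<delta>))
        \<and>
        (\<forall>Dmax. \<exists>(C::real) p. \<forall>n G chi lam \<gamma> a \<delta>.
           generator_setting n k G chi lam \<gamma> \<and> exact_threshold n k chi (lam + \<gamma>) \<and>
           diag_D n k chi (lam - \<gamma>) \<le> Dmax \<and> routine_setting n k G a amax \<delta> \<longrightarrow>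
             real (num_samples (R n a \<gamma> (diag_D n k chi (lam - \<gamma>)) \<delta>))
               \<le> C * (1 / \<gamma>\<^sup>2) * lg (1 / \<gamma>) ^ p * lg (real n) ^ p * lg (real n / \<delta>)))
     \<and>
     (\<forall>n G chi lam \<gamma>.
        generator_setting n k G chi lam \<gamma> \<and> exact_threshold n k chi (lam + \<gamma>) \<longrightarrow>
          diag_rho n k chi (lam + \<gamma>) = 0 \<and> margin_condition n k chi lam \<gamma>)"
proof -
  \<comment> \<open>Matching the goal names its clauses with \<open>amax\<close>, \<open>R\<close>
    and \<open>Dmax\<close> as arguments, so that those about the design can be stated before a
    design is chosen.\<close>
  let "?correct \<and> ?time \<and>
    (\<forall>amax>0. \<exists>R. ?degrees amax R \<and> ?success amax R \<and> ?samples amax R \<and> (\<forall>Dmax. ?bounded amax R Dmax)) \<and>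
    ?exact" = ?thesis
  have correct: ?correct
  proof (intro allI impI, elim conjE)
    fix n G chi lam \<gamma> \<epsilon>L Lhat
    assume a: "generator_setting n k G chi lam \<gamma>" "margin_condition n k chi lam \<gamma>"
      "\<epsilon>L \<le> \<gamma> / (2 * real (diag_D n k chi (lam - \<gamma>)))"
      "ptm_accurate n k (lindbladian n k G) Lhat \<epsilon>L"
    note rc = recovery_correct[OF a assms]
    show "recovered_set n k Lhat lam \<subseteq> pairs n k \<and>
          (\<forall>(P, Q)\<in>pairs0 n k.
             (cmod (chi P Q) > lam + \<gamma> \<longrightarrow> (P, Q) \<in> recovered_set n k Lhat lam) \<and>
             (cmod (chi P Q) < lam - \<gamma> \<longrightarrow> (P, Q) \<notin> recovered_set n k Lhat lam))"
      using rc(1) rc(2) rc(3) by fast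
  qed
  have time: ?time by (rule recovery_time_bound)
  have exact: ?exact using exact_threshold_rho by blast
  have routine: "\<exists>R. ?degrees amax R \<and> ?success amax R \<and> ?samples amax R \<and> (\<forall>Dmax. ?bounded amax R Dmax)"
    if amax: "0 < amax" for amax
  proof -
    obtain K where K0: "0 \<le> K" and K: "\<And>n a \<gamma> \<delta> D. 1 \<le> n \<Longrightarrow> 1 \<le> D \<Longrightarrow>
        0 < a \<and> a \<le> amax \<and> 0 < \<gamma> \<and> 0 < \<delta> \<and> \<delta> < 1 \<Longrightarrow>
        real (num_samples (routine_design k n a \<gamma> D \<delta>))
          \<le> K * ((real D)\<^sup>2 / \<gamma>\<^sup>2) * lg (real D / \<gamma>) ^ 8 * lg (real n / \<delta>)"
      using routine_samples[OF amax assms] by blast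
    have setting: "1 \<le> n \<and> 0 < \<gamma> \<and> interaction_strength n k G \<le> a \<and> 0 < a \<and> a \<le> amax \<and> 0 < \<delta> \<and> \<delta> < 1
        \<and> local_generator n k G"
      if "generator_setting n k G chi lam \<gamma>" "routine_setting n k G a amax \<delta>" for n G chi lam \<gamma> a \<delta>
      using that by (simp add: generator_setting_def routine_setting_def local_generator_def)
    \<comment> \<open>The bound obtained depends on \<open>n\<close> through
      \<open>lg (n / \<delta>)\<close> alone; a power of \<open>lg n\<close>, which is at least 1,
      is inserted to reach the claimed shape with equal exponents.\<close>
    have lgn: "x \<le> x * lg (real n) ^ 8" if "0 \<le> x" for x n
      using mult_left_mono[OF one_le_power[OF lg_ge_1[of "real n"]] that, of 8] by simp
    show ?thesis
    \<comment> \<open>One design serves all clauses; it depends on the instance only through its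
      explicit arguments, so the constants are uniform over generators.\<close>
    proof (rule exI[of _ "routine_design k"], intro conjI)
      let ?C = "5 + \<bar>log 2 (256 * amax * real k)\<bar>"
      show "?degrees amax (routine_design k)"
      proof (rule exI[of _ ?C], intro allI impI conjI)
        fix n D :: nat and a \<gamma> \<delta> :: real
        assume "1 \<le> D" "0 < a \<and> a \<le> amax \<and> 0 < \<gamma> \<and> 0 < \<delta> \<and> \<delta> < 1"
        then show "real (deg (routine_design k n a \<gamma> D \<delta>)) \<le> ?C * lg (real D / \<gamma>)"
          using fit_degree_bound[of a amax k \<gamma> D] assms by (simp add: routine_design_def Let_def)
        let ?d = "fit_degree k a (\<gamma> / (2 * real D))"
        have d: "2 \<le> real ?d" using fit_degree_ge[of k a "\<gamma> / (2 * real D)"] by simp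
        have "real (num_times (routine_design k n a \<gamma> D \<delta>)) = real ?d + 1"
          by (simp add: num_times_def routine_design_def Let_def)
        also have "\<dots> \<le> 2 * real ?d * 1" using d by simp
        also have "\<dots> \<le> ?C * real ?d * lg (real ?d)" using lg_ge_1[of "real ?d"] d by (intro mult_mono) auto
        finally show "real (num_times (routine_design k n a \<gamma> D \<delta>))
            \<le> ?C * real (deg (routine_design k n a \<gamma> D \<delta>)) * lg (real (deg (routine_design k n a \<gamma> D \<delta>)))"
          by (simp add: routine_design_def Let_def)
      qed
      show "?success amax (routine_design k)"
      proof (intro allI impI, elim conjE)
        fix n G chi lam \<gamma> a \<delta>
        assume "generator_setting n k G chi lam \<gamma>" "routine_setting n k G a amax \<delta>"
        from setting[OF this] show "success_prob n k (lindbladian n k G) a (routine_design k n a \<gamma> (diag_D n k chi (lam - \<gamma>)) \<delta>)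
               (\<gamma> / (2 * real (diag_D n k chi (lam - \<gamma>)))) \<ge> 1 - \<delta>"
          using assms diag_D_ge_1 by (intro local_generator.routine_success) auto
      qed
      show "?samples amax (routine_design k)"
      proof (rule exI[of _ K], rule exI[of _ 8], intro allI impI, elim conjE)
        fix n G chi lam \<gamma> a \<delta>
        assume s: "generator_setting n k G chi lam \<gamma>" "routine_setting n k G a amax \<delta>"
        let ?D = "diag_D n k chi (lam - \<gamma>)"
        have L: "0 \<le> lg (real n / \<delta>)" "0 \<le> lg (real ?D / \<gamma>)" using lg_ge_1 order_trans zero_le_one by metis+
        have "real (num_samples (routine_design k n a \<gamma> ?D \<delta>))
            \<le> K * ((real ?D)\<^sup>2 / \<gamma>\<^sup>2) * lg (real ?D / \<gamma>) ^ 8 * lg (real n / \<delta>)"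
          by (rule K[OF _ diag_D_ge_1]) (use setting[OF s] in simp_all)
        also have "\<dots> \<le> (K * ((real ?D)\<^sup>2 / \<gamma>\<^sup>2) * lg (real ?D / \<gamma>) ^ 8 * lg (real n / \<delta>)) * lg (real n) ^ 8"
          using K0 L by (intro lgn mult_nonneg_nonneg zero_le_power) auto
        finally show "real (num_samples (routine_design k n a \<gamma> ?D \<delta>))
            \<le> K * ((real ?D)\<^sup>2 / \<gamma>\<^sup>2) * lg (real ?D / \<gamma>) ^ 8 * lg (real n) ^ 8 * lg (real n / \<delta>)"
          by (simp only: mult_ac)
      qed
      show "\<forall>Dmax. ?bounded amax (routine_design k) Dmax"
      proof
        fix Dmax :: nat
        let ?C = "K * (real Dmax)\<^sup>2 * (1 + ln (real Dmax)) ^ 8"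
        show "?bounded amax (routine_design k) Dmax"
        proof (rule exI[of _ ?C], rule exI[of _ 8], intro allI impI, elim conjE)
          fix n G chi lam \<gamma> a \<delta>
          let ?D = "diag_D n k chi (lam - \<gamma>)"
          assume s: "generator_setting n k G chi lam \<gamma>" "routine_setting n k G a amax \<delta>" and D: "?D \<le> Dmax"
          have D1: "1 \<le> ?D" by (rule diag_D_ge_1)
          have \<gamma>: "0 < \<gamma>" using setting[OF s] by simp
          have L: "0 \<le> lg (real n / \<delta>)" "0 \<le> lg (real ?D / \<gamma>)" "0 \<le> lg (1 / \<gamma>)"
            using lg_ge_1 order_trans zero_le_one by metis+
          have Dm: "0 \<le> ln (real Dmax)" using D D1 by simp
          have ratio: "lg (real ?D / \<gamma>) \<le> (1 + ln (real Dmax)) * lg (1 / \<gamma>)"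
            by (rule lg_ratio_le) (use D D1 \<gamma> in auto)
          have "real (num_samples (routine_design k n a \<gamma> ?D \<delta>))
              \<le> K * ((real ?D)\<^sup>2 / \<gamma>\<^sup>2) * lg (real ?D / \<gamma>) ^ 8 * lg (real n / \<delta>)"
            by (rule K[OF _ diag_D_ge_1]) (use setting[OF s] in simp_all)
          also have "\<dots> \<le> K * ((real Dmax)\<^sup>2 / \<gamma>\<^sup>2) * ((1 + ln (real Dmax)) * lg (1 / \<gamma>)) ^ 8 * lg (real n / \<delta>)"
            using K0 L D ratio Dm \<gamma>
            by (intro mult_mono mult_left_mono divide_right_mono power_mono mult_nonneg_nonneg zero_le_power) auto
          also have "\<dots> \<le> (K * ((real Dmax)\<^sup>2 / \<gamma>\<^sup>2) * ((1 + ln (real Dmax)) * lg (1 / \<gamma>)) ^ 8 * lg (real n / \<delta>)) * lg (real n) ^ 8"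
            using K0 L Dm by (intro lgn mult_nonneg_nonneg zero_le_power) auto
          finally show "real (num_samples (routine_design k n a \<gamma> ?D \<delta>))
              \<le> ?C * (1 / \<gamma>\<^sup>2) * lg (1 / \<gamma>) ^ 8 * lg (real n) ^ 8 * lg (real n / \<delta>)"
            by (simp add: power_mult_distrib mult_ac)
        qed
      qed
    qed
  qed
  show ?thesis
    by (rule conjI[OF correct conjI[OF time conjI[OF _ exact]]]) (intro allI impI routine)
qed

end
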